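(* Assume the standing setting in the context and Assumptions (A3) and (A2). Let $v:]0,\infty[\to[0,\infty[$ be such that $v\in C^1(]0,\infty[)$, $v'$ is absolutely continuous on $]0,\infty[$, and $v$ solves the HJB equation $$\min\{-\mathcal L v(x)-\Pi(x),\ v(x)\}=0$$ (for almost every $x>0$, $v''$ denoting the a.e. derivative of $v'$), where $\mathcal L v(x)=-rv(x)+\alpha x v'(x)+\frac{\sigma^2}{2}x^2v''(x)$. If moreover $$\lim_{t\to\infty}e^{-rt}E_x\left[v(X(t))\mathbf 1_{\{\tau_0>t\}}\right]=0,\quad\text{where }\tau_0=\inf\{t>0:v(X(t))=0\},$$ then (i) $V(x)=v(x)$ for all $x>0$, where $V(x)=\sup_{\tau\in\mathcal S}E_x\left[\int_0^\tau e^{-rs}\Pi(X(s))ds\right]$; (ii) $\tau^*=\tau_0$ is an optimal stopping time; (iii) the stopping and continuation regions are $D=\{x>0:V(x)=0\}$ and $D^c=\{x>0:V(x)>0\}$, respectively.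
   Context: Let $(\Omega,\mathcal F,P)$ be a complete probability space carrying a standard Brownian motion $W$, with the filtration $(\mathcal F_t)_{t\ge0}$ generated by $W$; $\mathcal S$ denotes the set of all $(\mathcal F_t)$-stopping times. Fix $r,\alpha\in\mathbb R$, $\sigma\in\mathbb R\setminus\{0\}$. $X$ is the geometric Brownian motion $dX(t)=\alpha X(t)dt+\sigma X(t)dW(t)$ started at $X(0)=x>0$; $E_x$ denotes expectation given $X(0)=x$. For a function $f$, $f^+=\max(f,0)$. Assumption (A3): $\Pi:]0,\infty[\to\mathbb R$ is Borel measurable and locally integrable on $]0,\infty[$. Assumption (A2): $E_x\left[\int_0^\infty e^{-rs}\Pi^+(X(s))ds\right]<\infty$ for all $x>0$. *)

theory Defs
  imports "HOL-Probability.Probability"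
begin

definition std_brownian_motion :: "'a measure \<Rightarrow> (real \<Rightarrow> 'a \<Rightarrow> real) \<Rightarrow> bool" where
  "std_brownian_motion M W \<longleftrightarrow>
     prob_space M \<and>
     (\<forall>t\<ge>0. W t \<in> borel_measurable M) \<and>
     (\<forall>\<omega>\<in>space M. W 0 \<omega> = 0 \<and> continuous_on {0..} (\<lambda>t. W t \<omega>)) \<and>
     (\<forall>s t. 0 \<le> s \<and> s < t \<longrightarrow>
        distributed M lborel (\<lambda>\<omega>. W t \<omega> - W s \<omega>) (\<lambda>y. ennreal (normal_density 0 (sqrt (t - s)) y))) \<and>
     (\<forall>ts :: real list. sorted ts \<and> (\<forall>t\<in>set ts. 0 \<le> t) \<longrightarrow>
        prob_space.indep_vars M (\<lambda>_. borel) (\<lambda>i \<omega>. W (ts ! Suc i) \<omega> - W (ts ! i) \<omega>) {..<length ts - 1})"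

definition complete_space_measure :: "'a measure \<Rightarrow> bool" where
  "complete_space_measure M \<longleftrightarrow> (\<forall>N\<in>null_sets M. \<forall>A. A \<subseteq> N \<longrightarrow> A \<in> sets M)"

definition bm_filtration :: "'a measure \<Rightarrow> (real \<Rightarrow> 'a \<Rightarrow> real) \<Rightarrow> real \<Rightarrow> 'a measure" where
  "bm_filtration M W t = sigma (space M)
     ((\<Union>s\<in>{0..t}. {W s -` B \<inter> space M | B. B \<in> sets borel}) \<union> null_sets M)"

definition is_stopping_time :: "'a measure \<Rightarrow> (real \<Rightarrow> 'a \<Rightarrow> real) \<Rightarrow> ('a \<Rightarrow> ennreal) \<Rightarrow> bool" where
  "is_stopping_time M W \<tau> \<longleftrightarrow>
     (\<forall>t\<ge>0. {\<omega>\<in>space M. \<tau> \<omega> \<le> ennreal t} \<in> sets (bm_filtration M W t))"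

text \<open>Geometric Brownian motion dX = \<alpha> X dt + \<sigma> X dW, X(0) = x (explicit strong solution).\<close>
definition gbm :: "real \<Rightarrow> real \<Rightarrow> (real \<Rightarrow> 'a \<Rightarrow> real) \<Rightarrow> real \<Rightarrow> real \<Rightarrow> 'a \<Rightarrow> real" where
  "gbm \<alpha> \<sigma> W x t \<omega> = x * exp ((\<alpha> - \<sigma>\<^sup>2 / 2) * t + \<sigma> * W t \<omega>)"

definition disc_nn :: "'a measure \<Rightarrow> (real \<Rightarrow> 'a \<Rightarrow> real) \<Rightarrow> real \<Rightarrow> real \<Rightarrow> real
     \<Rightarrow> (real \<Rightarrow> real) \<Rightarrow> real \<Rightarrow> ('a \<Rightarrow> ennreal) \<Rightarrow> ennreal" where
  "disc_nn M W r \<alpha> \<sigma> f x \<tau> =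
     (\<integral>\<^sup>+ \<omega>. (\<integral>\<^sup>+ s. ennreal (exp (- r * s) * f (gbm \<alpha> \<sigma> W x s \<omega>))
                    * indicator {s. 0 \<le> s \<and> ennreal s < \<tau> \<omega>} s \<partial>lborel) \<partial>M)"

definition payoff :: "'a measure \<Rightarrow> (real \<Rightarrow> 'a \<Rightarrow> real) \<Rightarrow> real \<Rightarrow> real \<Rightarrow> real
     \<Rightarrow> (real \<Rightarrow> real) \<Rightarrow> real \<Rightarrow> ('a \<Rightarrow> ennreal) \<Rightarrow> ereal" where
  "payoff M W r \<alpha> \<sigma> Prof x \<tau> =
     enn2ereal (disc_nn M W r \<alpha> \<sigma> (\<lambda>y. max (Prof y) 0) x \<tau>)
     - enn2ereal (disc_nn M W r \<alpha> \<sigma> (\<lambda>y. max (- Prof y) 0) x \<tau>)"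

definition value_fun :: "'a measure \<Rightarrow> (real \<Rightarrow> 'a \<Rightarrow> real) \<Rightarrow> real \<Rightarrow> real \<Rightarrow> real
     \<Rightarrow> (real \<Rightarrow> real) \<Rightarrow> real \<Rightarrow> ereal" where
  "value_fun M W r \<alpha> \<sigma> Prof x =
     (SUP \<tau>\<in>{\<tau>. is_stopping_time M W \<tau>}. payoff M W r \<alpha> \<sigma> Prof x \<tau>)"

definition abs_continuous_on :: "real set \<Rightarrow> (real \<Rightarrow> real) \<Rightarrow> bool" where
  "abs_continuous_on I f \<longleftrightarrow>
     (\<forall>\<epsilon>>0. \<exists>\<delta>>0. \<forall>(n::nat) a b.
        (\<forall>k<n. a k \<le> b k \<and> {a k..b k} \<subseteq> I) \<and>
        (\<forall>j<n. \<forall>k<n. j \<noteq> k \<longrightarrow> {a j<..<b j} \<inter> {a k<..<b k} = {}) \<and>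
        (\<Sum>k<n. b k - a k) < \<delta> \<longrightarrow>
        (\<Sum>k<n. \<bar>f (b k) - f (a k)\<bar>) < \<epsilon>)"

end

theory Submission imports Defs
begin

text \<open>Write the geometric Brownian motion as \<open>X = x e\<^sup>Y\<close> with \<open>Y\<close> a Brownian motion with drift, so that \<open>f y = v (x e\<^sup>y)\<close> has an
  absolutely continuous derivative and solves the variational inequality \<open>min {-Lf - P, f} = 0\<close> for an operator \<open>L\<close>
  with constant coefficients. Dynkin's formula for such \<open>f\<close> follows from the smooth case by approximating the second
  derivative in \<open>L\<^sup>1\<close>, because the occupation measure of \<open>Y\<close> up to a fixed time has a bounded density. Stopped on leaving a bounded interval,
  it gives \<open>f 0 \<ge> J(\<tau>)\<close> for every stopping time \<open>\<tau>\<close>, as \<open>Lf \<le> -P\<close> and \<open>f \<ge> 0\<close>.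

  For equality at \<open>\<tau>\<^sub>0\<close> one has to control \<open>f\<close> on leaving a large interval. If the characteristic roots of \<open>L\<close> are real, let
  \<open>D \<ge> 0\<close> solve \<open>LD = P\<^sup>-\<close> outside \<open>[-m, m]\<close>, with zero data at \<open>0\<close>. Then \<open>u = f - D\<close> satisfies \<open>Lu \<le> 0\<close> outside \<open>[-m, m]\<close>, hence
  grows at most exponentially, whereas the probability that \<open>Y\<close> leaves \<open>[-N, N]\<close> before time \<open>m\<close> decays faster than any
  exponential in \<open>N\<close>. Only the contribution of \<open>{\<tau>\<^sub>0 > m}\<close> survives, and transversality removes it. If the roots are
  complex, finiteness of the expected discounted positive profit forces \<open>P \<le> 0\<close>, so \<open>Lf \<ge> 0\<close>, and \<open>f\<close> dominates an \<open>L\<close>-harmonic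
  function \<open>e\<^sup>a\<^sup>y R cos(wy - \<theta>)\<close> with the same value at \<open>0\<close>; the discounted surviving mass of \<open>f\<close> is then at least \<open>f 0\<close> at all
  times, so transversality gives \<open>f 0 = 0\<close>.\<close>

text \<open>Two gaps in the hypotheses shape the proof. First, \<open>v'\<close> is only absolutely
  continuous and the HJB relation is given only where \<open>v'\<close> is differentiable. So
  differentiability almost everywhere and the fundamental theorem come first; the one-sided bound
  read off from the relation then yields local Lebesgue integrability of the second derivative.
  Secondly, nothing bounds the growth of \<open>v\<close> or the size of the negative part of the
  profit, and the latter can make \<open>v\<close> grow arbitrarily fast. \<open>D\<close> absorbs
  precisely that growth. It is nonnegative because the operator with real roots splits into two
  first-order factors that can be inverted one after the other without losing the sign; with complex
  roots the kernel oscillates, hence the separate argument. Since the discounted loss may be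
  infinite, gains and losses are kept as two \<open>ennreal\<close> integrals, compared in the
  additive form gain versus \<open>f 0\<close> plus loss; they are subtracted only in
  \<open>payoff\<close>, where the gain is finite. Dynkin's formula uses no stochastic integral,
  only Taylor expansion along a time grid and Gaussian moments.\<close>

section \<open>Absolutely continuous functions\<close>

lemma abs_continuous_onE:
  assumes "abs_continuous_on I f" "e > 0"
  obtains d where "d > 0" "\<And>(n::nat) s t.
        (\<forall>k<n. s k \<le> t k \<and> {s k..t k} \<subseteq> I) \<Longrightarrow>
        (\<forall>j<n. \<forall>k<n. j \<noteq> k \<longrightarrow> {s j<..<t j} \<inter> {s k<..<t k} = {}) \<Longrightarrow>
        (\<Sum>k<n. t k - s k) < d \<Longrightarrow> (\<Sum>k<n. \<bar>f (t k) - f (s k)\<bar>) < e"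
proof -
  from assms(1)[unfolded abs_continuous_on_def, rule_format, OF assms(2)]
  show ?thesis by (elim exE conjE) (rule that, assumption, simp)
qed

text \<open>Members of a division may share endpoints but not interior points, which is exactly what
  the open intervals in \<open>abs_continuous_on\<close> permit. In this form the estimate applies
  directly to the partial divisions that arise from gauges and from gaps between covering
  intervals.\<close>

lemma abs_continuous_on_division:
  assumes "abs_continuous_on {a..b} f" "e > 0"
  obtains d where "d > 0"
    "\<And>p. p division_of \<Union>p \<Longrightarrow> \<Union>p \<subseteq> {a..b::real} \<Longrightarrow> sum (measure lborel) p < d
        \<Longrightarrow> (\<Sum>k\<in>p. \<bar>f (Sup k) - f (Inf k)\<bar>) < e"
proof -
  obtain d where d: "d > 0" and D: "\<And>(n::nat) s t.
        (\<forall>k<n. s k \<le> t k \<and> {s k..t k} \<subseteq> {a..b}) \<Longrightarrow>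
        (\<forall>j<n. \<forall>k<n. j \<noteq> k \<longrightarrow> {s j<..<t j} \<inter> {s k<..<t k} = {}) \<Longrightarrow>
        (\<Sum>k<n. t k - s k) < d \<Longrightarrow> (\<Sum>k<n. \<bar>f (t k) - f (s k)\<bar>) < e"
    using abs_continuous_onE[OF assms] by blast
  show ?thesis
  proof (rule that[OF d])
    fix p assume p: "p division_of \<Union>p" and sub: "\<Union>p \<subseteq> {a..b}" and c: "sum (measure lborel) p < d"
    note pD = division_ofD[OF p]
    obtain h where h: "bij_betw h {0..<card p} p"
      using ex_bij_betw_nat_finite[OF pD(1)] by blast
    define n where "n = card p"
    have h': "bij_betw h {..<n} p" using h by (simp add: n_def atLeast0LessThan)
    have hp: "h i \<in> p" if "i < n" for i using h' that by (auto simp: bij_betw_def)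
    have iv: "Inf (h i) \<le> Sup (h i) \<and> h i = {Inf (h i)..Sup (h i)} \<and> measure lborel (h i) = Sup (h i) - Inf (h i)"
      if i: "i < n" for i
    proof -
      obtain u v where uv: "h i = cbox u v" using pD(4)[OF hp[OF i]] by blast
      have "h i \<noteq> {}" using pD(3)[OF hp[OF i]] .
      then have "u \<le> v" using uv by auto
      then show ?thesis using uv by simp
    qed
    have "(\<Sum>k<n. \<bar>f (Sup (h k)) - f (Inf (h k))\<bar>) < e"
    proof (rule D)
      show "\<forall>k<n. Inf (h k) \<le> Sup (h k) \<and> {Inf (h k)..Sup (h k)} \<subseteq> {a..b}"
        using iv hp sub by (metis Sup_upper subset_trans)
      show "\<forall>j<n. \<forall>k<n. j \<noteq> k \<longrightarrow> {Inf (h j)<..<Sup (h j)} \<inter> {Inf (h k)<..<Sup (h k)} = {}"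
      proof (intro allI impI)
        fix j k assume jk: "j < n" "k < n" "j \<noteq> k"
        then have "h j \<noteq> h k" using h' by (auto simp: bij_betw_def inj_on_def)
        then have "interior (h j) \<inter> interior (h k) = {}" using pD(5) hp jk by blast
        moreover have "interior (h i) = {Inf (h i)<..<Sup (h i)}" if "i < n" for i
          using iv[OF that] by (metis interior_atLeastAtMost_real)
        ultimately show "{Inf (h j)<..<Sup (h j)} \<inter> {Inf (h k)<..<Sup (h k)} = {}" using jk by simp
      qed
      have "(\<Sum>k<n. Sup (h k) - Inf (h k)) = (\<Sum>k<n. measure lborel (h k))" using iv by (intro sum.cong) auto
      also have "\<dots> = sum (measure lborel) p" by (rule sum.reindex_bij_betw[OF h'])
      finally show "(\<Sum>k<n. Sup (h k) - Inf (h k)) < d" using c by simp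
    qed
    also have "(\<Sum>k<n. \<bar>f (Sup (h k)) - f (Inf (h k))\<bar>) = (\<Sum>k\<in>p. \<bar>f (Sup k) - f (Inf k)\<bar>)"
      by (rule sum.reindex_bij_betw[OF h'])
    finally show "(\<Sum>k\<in>p. \<bar>f (Sup k) - f (Inf k)\<bar>) < e" .
  qed
qed

lemma abs_continuous_on_uminus: "abs_continuous_on I f \<Longrightarrow> abs_continuous_on I (\<lambda>x. - f x)"
  unfolding abs_continuous_on_def by (simp add: abs_minus_commute)

lemma abs_continuous_on_imp_continuous_on:
  assumes "abs_continuous_on {a..b} f" shows "continuous_on {a..b} f"
  unfolding continuous_on_iff
proof (intro ballI allI impI)
  fix x e :: real assume x: "x \<in> {a..b}" and e: "e > 0"
  obtain d where d: "d > 0" and D: "\<And>(n::nat) s t.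
        (\<forall>k<n. s k \<le> t k \<and> {s k..t k} \<subseteq> {a..b}) \<Longrightarrow>
        (\<forall>j<n. \<forall>k<n. j \<noteq> k \<longrightarrow> {s j<..<t j} \<inter> {s k<..<t k} = {}) \<Longrightarrow>
        (\<Sum>k<n. t k - s k) < d \<Longrightarrow> (\<Sum>k<n. \<bar>f (t k) - f (s k)\<bar>) < e"
    using abs_continuous_onE[OF assms e] by blast
  show "\<exists>d>0. \<forall>x'\<in>{a..b}. dist x' x < d \<longrightarrow> dist (f x') (f x) < e"
  proof (intro exI[of _ d] conjI ballI impI d)
    fix y assume y: "y \<in> {a..b}" "dist y x < d"
    show "dist (f y) (f x) < e"
      using D[of 1 "\<lambda>_. min x y" "\<lambda>_. max x y"] x y
      by (cases "x \<le> y") (auto simp: dist_real_def min_def max_def abs_minus_commute)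
  qed
qed

text \<open>Any choice of tags turns the division into a tagged one, and the telescoping result for
  tagged divisions ignores the tags; left endpoints are used.\<close>

lemma division_sum_increments:
  fixes f :: "real \<Rightarrow> real"
  assumes "q division_of {s..t}" "s \<le> t"
  shows "(\<Sum>k\<in>q. f (Sup k) - f (Inf k)) = f t - f s"
proof -
  note qD = division_ofD[OF assms(1)]
  have "(\<lambda>k. (Inf k, k)) ` q tagged_division_of {s..t}"
  proof (rule tagged_division_ofI)
    show "finite ((\<lambda>k. (Inf k, k)) ` q)" using qD(1) by simp
    fix x K assume xK: "(x, K) \<in> (\<lambda>k. (Inf k, k)) ` q"
    then have K: "K \<in> q" "x = Inf K" by auto
    obtain u v where uv: "K = cbox u v" using qD(4)[OF K(1)] by blast
    moreover have "K \<noteq> {}" using qD(3)[OF K(1)] .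
    ultimately show "x \<in> K" using K by auto
    show "K \<subseteq> {s..t}" using qD(2)[OF K(1)] .
    show "\<exists>a b. K = cbox a b" using uv by blast
  next
    fix x1 K1 x2 K2 assume "(x1, K1) \<in> (\<lambda>k. (Inf k, k)) ` q" "(x2, K2) \<in> (\<lambda>k. (Inf k, k)) ` q" "(x1, K1) \<noteq> (x2, K2)"
    then show "interior K1 \<inter> interior K2 = {}" using qD(5) by blast
  next
    show "\<Union>{K. \<exists>x. (x, K) \<in> (\<lambda>k. (Inf k, k)) ` q} = {s..t}"
      unfolding qD(6)[symmetric] by (auto simp: image_iff)
  qed
  from additive_tagged_division_1[OF assms(2) this, of f]
  show ?thesis by (subst (asm) sum.reindex) (auto simp: inj_on_def)
qed

text \<open>Vitali's theorem yields countably many disjoint intervals covering \<open>S\<close> up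
  to a null set. The measure of \<open>S\<close> is finite, so by continuity from above finitely
  many of them already leave less than \<open>e\<close> uncovered. Restricting \<open>K\<close> to
  intervals inside \<open>U\<close> costs nothing because arbitrarily short ones are available at
  each point.\<close>

lemma vitali_finite_intervals:
  fixes S U :: "real set" and K :: "(real \<times> real) set"
  assumes S: "S \<in> lmeasurable" and U: "open U" "S \<subseteq> U"
    and K: "\<And>s t. (s, t) \<in> K \<Longrightarrow> s < t"
    and cov: "\<And>x d. x \<in> S \<Longrightarrow> d > 0 \<Longrightarrow> \<exists>(s, t)\<in>K. s \<le> x \<and> x \<le> t \<and> t - s < d"
    and e: "e > 0"
  obtains B where "finite B" "B \<subseteq> K" "\<And>s t. (s,t) \<in> B \<Longrightarrow> {s..t} \<subseteq> U"
    "\<And>i j. i \<in> B \<Longrightarrow> j \<in> B \<Longrightarrow> i \<noteq> j \<Longrightarrow> {fst i..snd i} \<inter> {fst j..snd j} = {}"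
    "measure lebesgue (S - (\<Union>i\<in>B. {fst i..snd i})) < e"
proof -
  define K' where "K' = {i \<in> K. {fst i..snd i} \<subseteq> U}"
  let ?a = "\<lambda>i::real\<times>real. (fst i + snd i) / 2" and ?r = "\<lambda>i::real\<times>real. (snd i - fst i) / 2"
  have cb: "cball (?a i) (?r i) = {fst i..snd i}" for i
  proof -
    have "?a i - ?r i = fst i" "?a i + ?r i = snd i" by (auto simp: field_simps)
    then show ?thesis by (simp only: cball_eq_atLeastAtMost)
  qed
  obtain C where C: "countable C" "C \<subseteq> K'"
     "pairwise (\<lambda>i j. disjnt (cball (?a i) (?r i)) (cball (?a j) (?r j))) C"
     "negligible (S - (\<Union>i \<in> C. cball (?a i) (?r i)))"
  proof (rule Vitali_covering_theorem_cballs[of K' ?r S ?a])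
    show "0 < ?r i" if "i \<in> K'" for i using that K[of "fst i" "snd i"] by (auto simp: K'_def)
    fix x d :: real assume x: "x \<in> S" "d > 0"
    obtain d' where d': "d' > 0" "ball x d' \<subseteq> U" using U x by (meson openE subsetD)
    obtain s t where st: "(s, t) \<in> K" "s \<le> x" "x \<le> t" "t - s < min d d'"
      using cov[OF x(1), of "min d d'"] x(2) d'(1) by auto
    have "{s..t} \<subseteq> ball x d'" using st by (auto simp: dist_real_def)
    then have "(s, t) \<in> K'" using st d' by (auto simp: K'_def)
    then show "\<exists>i. i \<in> K' \<and> x \<in> cball (?a i) (?r i) \<and> ?r i < d"
      using st K[OF st(1)] unfolding cb by (intro exI[of _ "(s,t)"]) auto
  qed
  show ?thesis
  \<comment> \<open>\<open>from_nat_into\<close> enumerates nonempty sets only. For finite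
    \<open>C\<close> the enumeration repeats elements, which is harmless as only images of initial
    segments are taken.\<close>
  proof (cases "C = {}")
    case True
    then have "measure lebesgue S = 0" using C(4) by (simp add: negligible_imp_measure0)
    then show ?thesis using e by (intro that[of "{}"]) auto
  next
    case False
    let ?I = "\<lambda>i::real\<times>real. {fst i..snd i}"
    let ?A = "\<lambda>n. S - (\<Union>i\<in>from_nat_into C ` {..<n}. ?I i)"
    have r: "range (from_nat_into C) = C" by (rule range_from_nat_into[OF False C(1)])
    have Int: "(\<Inter>n. ?A n) = S - (\<Union>i\<in>C. ?I i)" (is "?L = ?R")
    proof
      show "?L \<subseteq> ?R"
      proof
        fix x assume x: "x \<in> ?L"
        show "x \<in> ?R"
        proof
          show "x \<in> S" using x by auto
          show "x \<notin> (\<Union>i\<in>C. ?I i)"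
          proof
            assume "x \<in> (\<Union>i\<in>C. ?I i)"
            then obtain i where i: "i \<in> C" "x \<in> ?I i" by blast
            then have "i \<in> range (from_nat_into C)" using r by blast
            then obtain n where n: "x \<in> ?I (from_nat_into C n)" using i(2) by blast
            have "x \<in> ?A (Suc n)" using x by blast
            then show False using n by auto
          qed
        qed
      qed
      show "?R \<subseteq> ?L" using r by blast
    qed
    have Sl: "S \<in> sets lebesgue" using S by auto
    have "(\<lambda>n. measure lebesgue (?A n)) \<longlonglongrightarrow> measure lebesgue (\<Inter>n. ?A n)"
    proof (rule Lim_measure_decseq)
      show "range ?A \<subseteq> sets lebesgue" using Sl by auto
      show "decseq ?A" by (auto simp: decseq_def)
      show "emeasure lebesgue (?A i) \<noteq> \<infinity>" for i
      proof -
        have "?A i \<in> lmeasurable" by (rule fmeasurable_Diff[OF S]) auto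
        then show ?thesis by (auto simp: fmeasurable_def)
      qed
    qed
    moreover have "measure lebesgue (\<Inter>n. ?A n) = 0"
      unfolding Int using C(4) unfolding cb by (rule negligible_imp_measure0)
    ultimately have "\<forall>\<^sub>F n in sequentially. measure lebesgue (?A n) < e"
      using e by (simp add: order_tendstoD(2))
    then obtain n where n: "measure lebesgue (?A n) < e" by (auto simp: eventually_sequentially)
    let ?B = "from_nat_into C ` {..<n}"
    have BC: "?B \<subseteq> C" using r by auto
    show ?thesis
    proof (rule that[of ?B])
      show "finite ?B" by simp
      have BK': "?B \<subseteq> K'" using BC C(2) by (rule subset_trans)
      then show "?B \<subseteq> K" unfolding K'_def by blast
      show "{s..t} \<subseteq> U" if "(s,t) \<in> ?B" for s t
        using subsetD[OF BK' that] unfolding K'_def by simp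
      show "measure lebesgue (S - (\<Union>i\<in>?B. ?I i)) < e" by (rule n)
      fix i j assume "i \<in> ?B" "j \<in> ?B" and ij: "i \<noteq> j"
      then have "i \<in> C" "j \<in> C" using BC by (meson subsetD)+
      then show "?I i \<inter> ?I j = {}"
        using C(3) ij unfolding cb pairwise_def disjnt_def by meson
    qed
  qed
qed

lemma division_of_disjoint_intervals:
  fixes B :: "(real \<times> real) set"
  assumes "finite B" "\<And>i. i \<in> B \<Longrightarrow> fst i < snd i"
    "\<And>i j. i \<in> B \<Longrightarrow> j \<in> B \<Longrightarrow> i \<noteq> j \<Longrightarrow> {fst i..snd i} \<inter> {fst j..snd j} = {}"
  defines "p \<equiv> (\<lambda>i. {fst i..snd i}) ` B"
  shows "p division_of \<Union>p" "inj_on (\<lambda>i. {fst i..snd i}) B"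
    "sum (measure lborel) p = (\<Sum>i\<in>B. snd i - fst i)"
    "measure lebesgue (\<Union>p) = (\<Sum>i\<in>B. snd i - fst i)"
    "(\<Sum>k\<in>p. (f (Sup k) - f (Inf k) :: real)) = (\<Sum>i\<in>B. f (snd i) - f (fst i))"
proof -
  show inj: "inj_on (\<lambda>i. {fst i..snd i}) B"
    using assms(2,3) by (intro inj_onI) (metis Int_absorb atLeastatMost_empty_iff2 less_le_not_le)
  show div: "p division_of \<Union>p"
  proof (rule division_ofI)
    show "finite p" using assms(1) p_def by simp
    fix k assume k: "k \<in> p"
    then obtain i where i: "i \<in> B" "k = {fst i..snd i}" unfolding p_def by auto
    show "k \<subseteq> \<Union>p" using k by auto
    show "k \<noteq> {}" using i assms(2)[OF i(1)] by auto
    show "\<exists>a b. k = cbox a b" using i by (auto simp: cbox_interval)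
    fix k' assume k': "k' \<in> p" "k \<noteq> k'"
    then obtain j where j: "j \<in> B" "k' = {fst j..snd j}" unfolding p_def by auto
    have "k \<inter> k' = {}" using assms(3)[OF i(1) j(1)] i j k' by auto
    then show "interior k \<inter> interior k' = {}" using interior_subset by blast
  qed simp
  show 1: "sum (measure lborel) p = (\<Sum>i\<in>B. snd i - fst i)"
    unfolding p_def using assms(2) by (subst sum.reindex[OF inj]) (auto intro!: sum.cong simp: less_imp_le)
  show "(\<Sum>k\<in>p. (f (Sup k) - f (Inf k))) = (\<Sum>i\<in>B. f (snd i) - f (fst i))"
    unfolding p_def using assms(2) by (subst sum.reindex[OF inj]) (auto intro!: sum.cong simp: less_imp_le)
  have "measure lebesgue (\<Union>p) = sum (measure lebesgue) p"
    using content_division[OF div] by simp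
  also have "\<dots> = sum (measure lborel) p"
    using division_ofD(4)[OF div] by (intro sum.cong refl measure_completion) fastforce
  finally show "measure lebesgue (\<Union>p) = (\<Sum>i\<in>B. snd i - fst i)" using 1 by simp
qed

text \<open>The division \<open>r\<close> consists of the gaps that the intervals of
  \<open>C\<close> leave inside those of \<open>B\<close>. Increments over \<open>B\<close> and over
  \<open>C\<close> thus differ by an increment over gaps, which is small by absolute continuity once
  the gaps are short. The length identity is the increment identity for the function
  \<open>\<lambda>x. x\<close>.\<close>

lemma refine_disjoint_intervals:
  fixes B C :: "(real \<times> real) set"
  assumes B: "finite B" "\<And>i. i \<in> B \<Longrightarrow> fst i < snd i"
    "\<And>i j. i \<in> B \<Longrightarrow> j \<in> B \<Longrightarrow> i \<noteq> j \<Longrightarrow> {fst i..snd i} \<inter> {fst j..snd j} = {}"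
  and C: "finite C" "\<And>i. i \<in> C \<Longrightarrow> fst i < snd i"
    "\<And>i j. i \<in> C \<Longrightarrow> j \<in> C \<Longrightarrow> i \<noteq> j \<Longrightarrow> {fst i..snd i} \<inter> {fst j..snd j} = {}"
  and CB: "\<And>c. c \<in> C \<Longrightarrow> \<exists>b\<in>B. {fst c..snd c} \<subseteq> {fst b..snd b}"
  obtains r where "r division_of \<Union>r" "\<Union>r \<subseteq> (\<Union>i\<in>B. {fst i..snd i})"
    "sum (measure lborel) r = (\<Sum>i\<in>B. snd i - fst i) - (\<Sum>i\<in>C. snd i - fst i)"
    "\<And>g::real \<Rightarrow> real. (\<Sum>i\<in>B. g (snd i) - g (fst i)) = (\<Sum>i\<in>C. g (snd i) - g (fst i)) + (\<Sum>k\<in>r. g (Sup k) - g (Inf k))"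
proof -
  let ?I = "\<lambda>i::real\<times>real. {fst i..snd i}"
  define Cb where "Cb b = {c\<in>C. ?I c \<subseteq> ?I b}" for b
  have Cb: "finite (Cb b)" "Cb b \<subseteq> C" for b using C(1) by (auto simp: Cb_def)
  have Cb2: "fst i < snd i" if "i \<in> Cb b" for i b
    using that C(2) by (simp add: Cb_def)
  have Cb3: "?I i \<inter> ?I j = {}" if "i \<in> Cb b" "j \<in> Cb b" "i \<noteq> j" for i j b
    by (rule C(3)) (use that in \<open>simp_all add: Cb_def\<close>)
  have "\<exists>q. ?I ` Cb b \<subseteq> q \<and> q division_of {fst b..snd b}" for b
  proof -
    have 1: "?I ` Cb b division_of \<Union>(?I ` Cb b)"
      by (rule division_of_disjoint_intervals(1)[OF Cb(1)[of b] Cb2 Cb3])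
    have 2: "\<Union>(?I ` Cb b) \<subseteq> cbox (fst b) (snd b)" by (auto simp: Cb_def)
    show ?thesis
      by (rule partial_division_extend_interval[OF 1 2]) (auto simp: cbox_interval)
  qed
  then obtain q where q: "\<And>b. ?I ` Cb b \<subseteq> q b" "\<And>b. q b division_of {fst b..snd b}" by metis
  define r where "r b = q b - ?I ` Cb b" for b
  have rk: "k \<subseteq> ?I b \<and> k \<noteq> {} \<and> (\<exists>u v. k = cbox u v)" if "k \<in> r b" for k b
    using that division_ofD(2,3,4)[OF q(2)[of b]] by (auto simp: r_def)
  have fr: "finite (r b)" for b using division_ofD(1)[OF q(2)[of b]] by (simp add: r_def)
  have rdisj: "r b \<inter> r b' = {}" if "b \<in> B" "b' \<in> B" "b \<noteq> b'" for b b'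
  proof (rule ccontr)
    assume "r b \<inter> r b' \<noteq> {}"
    then obtain k where "k \<in> r b" "k \<in> r b'" by blast
    then have "k \<subseteq> ?I b \<inter> ?I b'" "k \<noteq> {}" using rk by blast+
    then show False using B(3)[OF that] by simp
  qed
  have inc: "(\<Sum>i\<in>B. g (snd i) - g (fst i)) = (\<Sum>i\<in>C. g (snd i) - g (fst i)) + (\<Sum>k\<in>(\<Union>b\<in>B. r b). g (Sup k) - g (Inf k))"
    for g :: "real \<Rightarrow> real"
  proof -
    have "g (snd b) - g (fst b) = (\<Sum>k\<in>r b. g (Sup k) - g (Inf k)) + (\<Sum>i\<in>Cb b. g (snd i) - g (fst i))"
      if b: "b \<in> B" for b
    proof -
      have "g (snd b) - g (fst b) = (\<Sum>k\<in>q b. g (Sup k) - g (Inf k))"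
        using division_sum_increments[OF q(2)[of b], of g] B(2)[OF b] by simp
      also have "\<dots> = (\<Sum>k\<in>r b. g (Sup k) - g (Inf k)) + (\<Sum>k\<in>?I ` Cb b. g (Sup k) - g (Inf k))"
        unfolding r_def by (rule sum.subset_diff[OF q(1)]) (rule division_ofD(1)[OF q(2)])
      also have "(\<Sum>k\<in>?I ` Cb b. g (Sup k) - g (Inf k)) = (\<Sum>i\<in>Cb b. g (snd i) - g (fst i))"
        by (rule division_of_disjoint_intervals(5)[OF Cb(1)[of b] Cb2 Cb3])
      finally show ?thesis .
    qed
    then have "(\<Sum>i\<in>B. g (snd i) - g (fst i)) =
       (\<Sum>b\<in>B. \<Sum>k\<in>r b. g (Sup k) - g (Inf k)) + (\<Sum>b\<in>B. \<Sum>i\<in>Cb b. g (snd i) - g (fst i))"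
      by (simp add: sum.distrib)
    also have "(\<Sum>b\<in>B. \<Sum>k\<in>r b. g (Sup k) - g (Inf k)) = (\<Sum>k\<in>(\<Union>b\<in>B. r b). g (Sup k) - g (Inf k))"
      using rdisj fr by (subst sum.UNION_disjoint[OF B(1)]) auto
    also have "(\<Sum>b\<in>B. \<Sum>i\<in>Cb b. g (snd i) - g (fst i)) = (\<Sum>i\<in>(\<Union>b\<in>B. Cb b). g (snd i) - g (fst i))"
    proof (subst sum.UNION_disjoint[OF B(1)])
      show "\<forall>i\<in>B. \<forall>j\<in>B. i \<noteq> j \<longrightarrow> Cb i \<inter> Cb j = {}"
      proof (intro ballI impI)
        fix i j assume ij: "i \<in> B" "j \<in> B" "i \<noteq> j"
        show "Cb i \<inter> Cb j = {}"
        proof (rule ccontr)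
          assume "Cb i \<inter> Cb j \<noteq> {}"
          then obtain c where "c \<in> C" "?I c \<subseteq> ?I i" "?I c \<subseteq> ?I j" by (auto simp: Cb_def)
          then have "fst c \<in> ?I i \<inter> ?I j" using C(2)[of c] by auto
          then show False using B(3)[OF ij] by blast
        qed
      qed
    qed (use Cb in auto)
    also have "(\<Union>b\<in>B. Cb b) = C" using CB by (auto simp: Cb_def)
    finally show ?thesis by simp
  qed
  have div: "(\<Union>b\<in>B. r b) division_of \<Union>(\<Union>b\<in>B. r b)"
  proof (rule division_ofI)
    show "finite (\<Union>b\<in>B. r b)" using B(1) fr by auto
    fix k assume k: "k \<in> (\<Union>b\<in>B. r b)"
    then obtain b where b: "b \<in> B" "k \<in> r b" by auto
    show "k \<subseteq> \<Union>(\<Union>b\<in>B. r b)" using k by blast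
    show "k \<noteq> {}" "\<exists>a b. k = cbox a b" using rk[OF b(2)] by auto
    fix k' assume k': "k' \<in> (\<Union>b\<in>B. r b)" "k \<noteq> k'"
    then obtain b' where b': "b' \<in> B" "k' \<in> r b'" by auto
    show "interior k \<inter> interior k' = {}"
    proof (cases "b = b'")
      case True
      then show ?thesis using division_ofD(5)[OF q(2)[of b]] b(2) b'(2) k'(2) by (auto simp: r_def)
    next
      case False
      have "k \<inter> k' = {}" using rk[OF b(2)] rk[OF b'(2)] B(3)[OF b(1) b'(1) False] by blast
      then show ?thesis using interior_subset by blast
    qed
  qed simp
  show ?thesis
  proof (rule that[OF div _ _ inc])
    show "\<Union>(\<Union>b\<in>B. r b) \<subseteq> (\<Union>i\<in>B. ?I i)" using rk by fast
    have "sum (measure lborel) (\<Union>b\<in>B. r b) = (\<Sum>k\<in>(\<Union>b\<in>B. r b). Sup k - Inf k)"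
    proof (rule sum.cong[OF refl])
      fix k assume "k \<in> (\<Union>b\<in>B. r b)"
      then obtain u v where "k = cbox u v" "k \<noteq> {}" using rk by blast
      then show "measure lborel k = Sup k - Inf k" by auto
    qed
    then show "sum (measure lborel) (\<Union>b\<in>B. r b) = (\<Sum>i\<in>B. snd i - fst i) - (\<Sum>i\<in>C. snd i - fst i)"
      using inc[of "\<lambda>x. x"] by simp
  qed
qed

section \<open>Almost everywhere differentiability of absolutely continuous functions\<close>

lemma lebesgue_outer_open_within:
  fixes S :: "real set"
  assumes "S \<in> sets lebesgue" "S \<subseteq> {a<..<b}" "e > 0"
  obtains U where "open U" "S \<subseteq> U" "U \<subseteq> {a<..<b}" "U \<in> lmeasurable" "measure lebesgue (U - S) < e" "S \<in> lmeasurable"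
proof -
  obtain T where T: "open T" "S \<subseteq> T" "T - S \<in> lmeasurable" "emeasure lebesgue (T - S) < ennreal e"
    using sets_lebesgue_outer_open[OF assms(1) assms(3)] by blast
  have Sm: "S \<in> lmeasurable"
    by (rule fmeasurableI2[OF _ assms(2) assms(1)]) auto
  let ?U = "T \<inter> {a<..<b}"
  have Um: "?U \<in> lmeasurable"
    by (rule fmeasurableI2[of "{a<..<b}"]) (use T(1) in auto)
  have "measure lebesgue (?U - S) \<le> measure lebesgue (T - S)"
    by (rule measure_mono_fmeasurable) (use T(3) Um Sm in auto)
  also have "\<dots> < e" using T(3,4) assms(3) by (simp add: emeasure_eq_measure2 ennreal_less_iff)
  finally show ?thesis using T(1,2) assms(2) Um Sm by (intro that[of ?U]) auto
qed

text \<open>Derivatives are tested on intervals containing \<open>x\<close> in their interior, so that Vitali coverings by intervals apply directly.\<close>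

definition slope_set :: "(real \<Rightarrow> real \<Rightarrow> bool) \<Rightarrow> real set" where
  "slope_set P = {x. \<forall>d>0. \<exists>s t. s < x \<and> x < t \<and> t - s < d \<and> P s t}"

lemma slope_setE:
  assumes "x \<in> slope_set P" "d > 0"
  obtains s t where "s < x" "x < t" "t - s < d" "P s t"
  using assms unfolding slope_set_def by auto

text \<open>For each bound \<open>1 / Suc n\<close> on the length, the points enclosed by a suitable
  interval form a union of open intervals. The set is therefore a countable intersection of open
  sets, whatever \<open>P\<close> is.\<close>

lemma slope_set_measurable: "slope_set P \<in> sets lebesgue"
proof -
  have eq: "slope_set P = (\<Inter>n::nat. \<Union>{{s<..<t} |s t. t - s < 1 / Suc n \<and> P s t})" (is "?L = ?R")
  proof (intro set_eqI iffI)
    fix x assume "x \<in> ?L"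
    have "x \<in> \<Union>{{s<..<t} |s t. t - s < 1 / Suc n \<and> P s t}" for n::nat
    proof -
      obtain s t where st: "s < x" "x < t" "t - s < 1 / Suc n" "P s t"
        using slope_setE[OF \<open>x \<in> ?L\<close>, of "1 / Suc n"] by auto
      then have "{s<..<t} \<in> {{s<..<t} |s t. t - s < 1 / Suc n \<and> P s t}" by blast
      then show ?thesis using st by (intro UnionI[of "{s<..<t}"]) auto
    qed
    then show "x \<in> ?R" by blast
  next
    fix x assume x: "x \<in> ?R"
    show "x \<in> ?L" unfolding slope_set_def
    proof (intro CollectI allI impI)
      fix d :: real assume "d > 0"
      then obtain n where n: "1 / Suc n < d" using nat_approx_posE by blast
      have "x \<in> \<Union>{{s<..<t} |s t. t - s < 1 / Suc n \<and> P s t}" using x by blast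
      then obtain s t where "x \<in> {s<..<t}" "t - s < 1 / Suc n" "P s t" by blast
      then show "\<exists>s t. s < x \<and> x < t \<and> t - s < d \<and> P s t" using n
        by (intro exI[of _ s] exI[of _ t]) auto
    qed
  qed
  have "(\<Union>{{s<..<t} |s t. t - s < 1 / Suc n \<and> P s t}) \<in> sets lebesgue" for n::nat
  proof -
    have "open (\<Union>{{s<..<t} |s t. t - s < 1 / Suc n \<and> P s t})" by (intro open_Union) auto
    then show ?thesis by (meson borel_open lborelD sets_completionI_sets sets_lborel)
  qed
  then show ?thesis unfolding eq by (intro sets.countable_INT') auto
qed

text \<open>\<open>U\<close> is an outer approximation of \<open>S\<close>, and \<open>V\<close>
  covers \<open>S\<close> up to a small remainder inside \<open>U\<close>; hence \<open>S\<close>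
  and \<open>V\<close> have almost the same measure although neither need contain the other.\<close>

lemma measure_sandwich:
  fixes S U V :: "real set"
  assumes "S \<in> lmeasurable" "U \<in> lmeasurable" "S \<subseteq> U" "V \<in> lmeasurable" "V \<subseteq> U"
    "measure lebesgue (U - S) < e" "measure lebesgue (S - V) < e'"
  shows "measure lebesgue V \<le> measure lebesgue S + e" "measure lebesgue S \<le> measure lebesgue V + e'"
proof -
  have "measure lebesgue V \<le> measure lebesgue U" by (rule measure_mono_fmeasurable) (use assms in auto)
  also have "measure lebesgue U = measure lebesgue (U - S) + measure lebesgue S"
    using measurable_measure_Diff[of U lebesgue S] assms by auto
  finally show "measure lebesgue V \<le> measure lebesgue S + e" using assms(6) by simp
  have "measure lebesgue S \<le> measure lebesgue ((S - V) \<union> V)"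
    by (rule measure_mono_fmeasurable) (use assms in \<open>auto intro: fmeasurable_Diff\<close>)
  also have "\<dots> \<le> measure lebesgue (S - V) + measure lebesgue V"
    by (rule measure_Un_le) (use assms(1,4) in \<open>auto\<close>)
  finally show "measure lebesgue S \<le> measure lebesgue V + e'" using assms(7) by simp
qed

text \<open>A point with both large and small slopes is covered, by Vitali, by short disjoint intervals of slope above \<open>q\<close> and, again, by
  such intervals of slope below \<open>p\<close>; the increments over both families differ little by absolute continuity.\<close>

lemma slope_gap_negligible:
  assumes ac: "abs_continuous_on {a..b} f" and pq: "p < q"
  shows "negligible ({a<..<b} \<inter> slope_set (\<lambda>s t. f t - f s > q * (t - s))
     \<inter> slope_set (\<lambda>s t. f t - f s < p * (t - s)))" (is "negligible ?S")
proof -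
  have Ss: "?S \<in> sets lebesgue" by (intro sets.Int slope_set_measurable) auto
  have "measure lebesgue ?S \<le> 3 * e / (q - p)" if e: "e > 0" for e
  proof -
    obtain d where d: "d > 0" and D: "\<And>p. p division_of \<Union>p \<Longrightarrow> \<Union>p \<subseteq> {a..b} \<Longrightarrow>
      sum (measure lborel) p < d \<Longrightarrow> (\<Sum>k\<in>p. \<bar>f (Sup k) - f (Inf k)\<bar>) < e"
      using abs_continuous_on_division[OF ac e] by blast
    \<comment> \<open>The gaps between the two families have total length at most
      \<open>3 * h\<close>, and \<open>d / 4\<close> keeps this below \<open>d\<close>. The second
      term makes the errors from replacing \<open>\<beta>\<close> and \<open>\<gamma>\<close> by the
      measure of the set, each weighted with a slope, at most \<open>2 * e\<close> in total.\<close>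
    define h where "h = min (d / 4) (e / (1 + \<bar>p\<bar> + \<bar>q\<bar>))"
    have h: "h > 0" "h \<le> d / 4" "h * (1 + \<bar>p\<bar> + \<bar>q\<bar>) \<le> e"
    proof -
      have pos: "1 + \<bar>p\<bar> + \<bar>q\<bar> > 0" by linarith
      show "h > 0" using d divide_pos_pos[OF e pos] by (simp add: h_def)
      show "h \<le> d / 4" unfolding h_def by (rule min.cobounded1)
      have "h \<le> e / (1 + \<bar>p\<bar> + \<bar>q\<bar>)" by (simp add: h_def)
      then show "h * (1 + \<bar>p\<bar> + \<bar>q\<bar>) \<le> e" using pos_le_divide_eq[OF pos, of h e] by blast
    qed
    obtain U where U: "open U" "?S \<subseteq> U" "U \<subseteq> {a<..<b}" "U \<in> lmeasurable"
       "measure lebesgue (U - ?S) < h" "?S \<in> lmeasurable"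
      by (rule lebesgue_outer_open_within[OF Ss _ h(1)]) auto
    obtain B where B: "finite B" "B \<subseteq> {(s,t). s < t \<and> f t - f s > q * (t - s)}"
        "\<And>s t. (s,t) \<in> B \<Longrightarrow> {s..t} \<subseteq> U"
        "\<And>i j. i \<in> B \<Longrightarrow> j \<in> B \<Longrightarrow> i \<noteq> j \<Longrightarrow> {fst i..snd i} \<inter> {fst j..snd j} = {}"
        "measure lebesgue (?S - (\<Union>i\<in>B. {fst i..snd i})) < h"
    proof (rule vitali_finite_intervals[OF U(6,1,2), of "{(s,t). s < t \<and> f t - f s > q * (t - s)}" h])
      fix x r :: real assume x: "x \<in> ?S" "r > 0"
      then obtain s t where "s < x" "x < t" "t - s < r" "f t - f s > q * (t - s)"
        unfolding slope_set_def by blast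
      then show "\<exists>(s, t)\<in>{(s, t). s < t \<and> q * (t - s) < f t - f s}. s \<le> x \<and> x \<le> t \<and> t - s < r"
        by (intro bexI[of _ "(s,t)"]) auto
    qed (use h in auto)
    have B2: "\<And>i. i \<in> B \<Longrightarrow> fst i < snd i" "\<And>i. i \<in> B \<Longrightarrow> f (snd i) - f (fst i) > q * (snd i - fst i)"
      using B(2) by auto
    \<comment> \<open>The second family has to lie inside the first, so Vitali is applied again
      within the interiors of the intervals of \<open>B\<close>. Only their finitely many endpoints
      are lost.\<close>
    define U2 where "U2 = (\<Union>i\<in>B. {fst i<..<snd i})"
    define S2 where "S2 = ?S \<inter> U2"
    have U2: "open U2" "S2 \<subseteq> U2" "U2 \<subseteq> U" "S2 \<in> lmeasurable"
    proof -
      show "open U2" "S2 \<subseteq> U2" by (auto simp: U2_def S2_def)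
      show "U2 \<subseteq> U" unfolding U2_def using B(3) by fastforce
      show "S2 \<in> lmeasurable" unfolding S2_def U2_def
        by (rule fmeasurable_Int_fmeasurable[OF U(6)]) (intro sets.finite_UN B(1), auto)
    qed
    have neg: "negligible ((\<Union>i\<in>B. {fst i..snd i}) - U2)" (is "negligible (?UB0 - U2)")
    proof (rule negligible_subset[of "(\<Union>i\<in>B. {fst i, snd i})"])
      show "negligible (\<Union>i\<in>B. {fst i, snd i})" using B(1) by (intro negligible_finite) auto
      show "?UB0 - U2 \<subseteq> (\<Union>i\<in>B. {fst i, snd i})"
      proof
        fix x assume x: "x \<in> ?UB0 - U2"
        then obtain i where i: "i \<in> B" "fst i \<le> x" "x \<le> snd i" by force
        moreover have "\<not> (fst i < x \<and> x < snd i)" using x i(1) unfolding U2_def by force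
        ultimately show "x \<in> (\<Union>i\<in>B. {fst i, snd i})" by (intro UN_I[of i]) auto
      qed
    qed
    let ?K2 = "{(s,t). s < t \<and> f t - f s < p * (t - s) \<and> (\<exists>i\<in>B. {s..t} \<subseteq> {fst i..snd i})}"
    obtain C where C: "finite C" "C \<subseteq> ?K2"
        "\<And>s t. (s,t) \<in> C \<Longrightarrow> {s..t} \<subseteq> U2"
        "\<And>i j. i \<in> C \<Longrightarrow> j \<in> C \<Longrightarrow> i \<noteq> j \<Longrightarrow> {fst i..snd i} \<inter> {fst j..snd j} = {}"
        "measure lebesgue (S2 - (\<Union>i\<in>C. {fst i..snd i})) < h"
    proof (rule vitali_finite_intervals[OF U2(4,1,2), of ?K2 h])
      fix x r :: real assume x: "x \<in> S2" "r > 0"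
      then obtain i where i: "i \<in> B" "fst i < x" "x < snd i" by (auto simp: S2_def U2_def)
      define r' where "r' = min r (min (x - fst i) (snd i - x))"
      have "r' > 0" using x i by (auto simp: r'_def)
      then obtain s t where st: "s < x" "x < t" "t - s < r'" "f t - f s < p * (t - s)"
        using x unfolding slope_set_def S2_def by blast
      then have "{s..t} \<subseteq> {fst i..snd i}" "t - s < r" by (auto simp: r'_def)
      then show "\<exists>(s, t)\<in>?K2. s \<le> x \<and> x \<le> t \<and> t - s < r"
        using st i by (intro bexI[of _ "(s,t)"]) auto
    qed (use h in auto)
    have C2: "fst i < snd i" "f (snd i) - f (fst i) < p * (snd i - fst i)"
       "\<exists>b\<in>B. {fst i..snd i} \<subseteq> {fst b..snd b}" if "i \<in> C" for i
      using subsetD[OF C(2) that] by (auto intro!: rev_bexI)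
    obtain r where r: "r division_of \<Union>r" "\<Union>r \<subseteq> (\<Union>i\<in>B. {fst i..snd i})"
      "sum (measure lborel) r = (\<Sum>i\<in>B. snd i - fst i) - (\<Sum>i\<in>C. snd i - fst i)"
      "(\<Sum>i\<in>B. f (snd i) - f (fst i)) = (\<Sum>i\<in>C. f (snd i) - f (fst i)) + (\<Sum>k\<in>r. f (Sup k) - f (Inf k))"
      by (rule refine_disjoint_intervals[OF B(1) B2(1) B(4) C(1) C2(1) C(4) C2(3)]) blast+
    let ?m = "measure lebesgue ?S"
    let ?UB = "\<Union>i\<in>B. {fst i..snd i}" and ?UC = "\<Union>i\<in>C. {fst i..snd i}"
    define \<beta> where "\<beta> = (\<Sum>i\<in>B. snd i - fst i)"
    define \<gamma> where "\<gamma> = (\<Sum>i\<in>C. snd i - fst i)"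
    have mB: "measure lebesgue ?UB = \<beta>" unfolding \<beta>_def
      using division_of_disjoint_intervals(4)[OF B(1) B2(1) B(4)] by simp
    have mC: "measure lebesgue ?UC = \<gamma>" unfolding \<gamma>_def
      using division_of_disjoint_intervals(4)[OF C(1) C2(1) C(4)] by simp
    have UBm: "?UB \<in> lmeasurable" "?UC \<in> lmeasurable" using B(1) C(1) by (auto intro!: fmeasurable.finite_UN)
    have UBU: "?UB \<subseteq> U" using B(3) by force
    have UCU: "?UC \<subseteq> U" using C(3) U2(3) by force
    note sB = measure_sandwich[OF U(6,4,2) UBm(1) UBU U(5) B(5)]
    have "measure lebesgue (?S - ?UC) < 2 * h"
    proof -
      have mm: "S2 - ?UC \<in> lmeasurable" "?S - ?UB \<in> lmeasurable" "?UB - U2 \<in> lmeasurable"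
        using fmeasurable_Diff[OF U2(4) fmeasurableD[OF UBm(2)]] fmeasurable_Diff[OF U(6) fmeasurableD[OF UBm(1)]]
          negligible_imp_measurable[OF neg] by blast+
      have "?S - ?UC \<subseteq> (S2 - ?UC) \<union> ((?S - ?UB) \<union> (?UB - U2))" by (auto simp: S2_def)
      then have "measure lebesgue (?S - ?UC) \<le> measure lebesgue ((S2 - ?UC) \<union> ((?S - ?UB) \<union> (?UB - U2)))"
        by (rule measure_mono_fmeasurable)
           (use mm fmeasurableD[OF fmeasurable_Diff[OF U(6) fmeasurableD[OF UBm(2)]]] in \<open>auto intro!: fmeasurable.Un\<close>)
      also have "\<dots> \<le> measure lebesgue (S2 - ?UC) + measure lebesgue ((?S - ?UB) \<union> (?UB - U2))"
        by (rule measure_Un_le) (use mm in \<open>auto dest: fmeasurableD\<close>)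
      also have "measure lebesgue ((?S - ?UB) \<union> (?UB - U2)) \<le> measure lebesgue (?S - ?UB) + measure lebesgue (?UB - U2)"
        by (rule measure_Un_le) (use mm in \<open>auto dest: fmeasurableD\<close>)
      also have "measure lebesgue (?UB - U2) = 0" using neg by (rule negligible_imp_measure0)
      finally show ?thesis using B(5) C(5) by simp
    qed
    note sC = measure_sandwich[OF U(6,4,2) UBm(2) UCU U(5) this]
    have rs: "\<Union>r \<subseteq> {a..b}" using r(2) UBU U(3) greaterThanLessThan_subseteq_atLeastAtMost_iff[of a b a b] by fast
    have rd: "sum (measure lborel) r < d"
      using r(3) sB sC h(1,2) unfolding mB mC \<beta>_def[symmetric] \<gamma>_def[symmetric] by linarith
    have "(\<Sum>k\<in>r. f (Sup k) - f (Inf k)) \<le> (\<Sum>k\<in>r. \<bar>f (Sup k) - f (Inf k)\<bar>)" by (intro sum_mono) auto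
    also have "\<dots> < e" by (rule D[OF r(1) rs rd])
    finally have re: "(\<Sum>k\<in>r. f (Sup k) - f (Inf k)) < e" .
    have "q * \<beta> \<le> (\<Sum>i\<in>B. f (snd i) - f (fst i))" unfolding \<beta>_def sum_distrib_left
      by (intro sum_mono less_imp_le B2(2))
    also have "\<dots> \<le> p * \<gamma> + e"
    proof -
      have "(\<Sum>i\<in>C. f (snd i) - f (fst i)) \<le> p * \<gamma>" unfolding \<gamma>_def sum_distrib_left
        by (intro sum_mono less_imp_le C2(2))
      then show ?thesis using r(4) re by linarith
    qed
    finally have 1: "q * \<beta> \<le> p * \<gamma> + e" .
    have b1: "\<bar>\<beta> - ?m\<bar> \<le> 2 * h" "\<bar>\<gamma> - ?m\<bar> \<le> 2 * h"
      using sB sC h(1) unfolding mB mC by linarith+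
    have "q * ?m \<le> q * \<beta> + \<bar>q\<bar> * (2 * h)"
    proof -
      have "q * (?m - \<beta>) \<le> \<bar>q\<bar> * \<bar>?m - \<beta>\<bar>" using abs_ge_self[of "q * (?m - \<beta>)"] by (simp only: abs_mult)
      also have "\<dots> \<le> \<bar>q\<bar> * (2 * h)" using b1(1) by (intro mult_left_mono) auto
      finally show ?thesis by (simp add: algebra_simps)
    qed
    moreover have "p * \<gamma> \<le> p * ?m + \<bar>p\<bar> * (2 * h)"
    proof -
      have "p * (\<gamma> - ?m) \<le> \<bar>p\<bar> * \<bar>\<gamma> - ?m\<bar>" using abs_ge_self[of "p * (\<gamma> - ?m)"] by (simp only: abs_mult)
      also have "\<dots> \<le> \<bar>p\<bar> * (2 * h)" using b1(2) by (intro mult_left_mono) auto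
      finally show ?thesis by (simp add: algebra_simps)
    qed
    ultimately have "(q - p) * ?m \<le> e + 2 * (h * (1 + \<bar>p\<bar> + \<bar>q\<bar>))"
      using 1 h(1) by (simp add: algebra_simps)
    also have "\<dots> \<le> 3 * e" using h(3) by simp
    finally show ?thesis using pq by (simp add: field_simps)
  qed
  note le = this
  have "measure lebesgue ?S \<le> 0"
  proof (rule field_le_epsilon)
    fix e :: real assume "e > 0"
    then show "measure lebesgue ?S \<le> 0 + e"
      using le[of "e * (q - p) / 3"] pq by simp
  qed
  then have "measure lebesgue ?S = 0" using measure_nonneg[of lebesgue "?S"] by linarith
  moreover have "?S \<in> lmeasurable"
    using lebesgue_outer_open_within[OF Ss _ zero_less_one, of a b] by blast
  ultimately show ?thesis by (simp only: negligible_iff_measure)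
qed

text \<open>On an interval shorter than \<open>d\<close> the increments over disjoint subintervals
  sum to less than \<open>1\<close>. Disjoint intervals of slope above \<open>K\<close> covering all
  but \<open>e\<close> of the set have increments of at least \<open>K\<close> times its measure
  minus \<open>K * e\<close>; letting \<open>K\<close> grow forces measure zero. Countably many such
  short intervals with rational centres cover the whole set.\<close>

lemma steep_negligible:
  assumes ac: "abs_continuous_on {a..b} f"
  shows "negligible {x \<in> {a<..<b}. \<forall>K. x \<in> slope_set (\<lambda>s t. f t - f s > K * (t - s))}" (is "negligible ?S")
proof -
  obtain d where d: "d > 0" and D: "\<And>p. p division_of \<Union>p \<Longrightarrow> \<Union>p \<subseteq> {a..b} \<Longrightarrow>
      sum (measure lborel) p < d \<Longrightarrow> (\<Sum>k\<in>p. \<bar>f (Sup k) - f (Inf k)\<bar>) < 1"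
    using abs_continuous_on_division[OF ac zero_less_one] by blast
  let ?SS = "\<lambda>K. slope_set (\<lambda>s t. f t - f s > K * (t - s))"
  \<comment> \<open>Slope sets shrink as the bound grows, so integer bounds suffice and the
    intersection becomes countable.\<close>
  have Seq: "?S = {a<..<b} \<inter> (\<Inter>n::nat. ?SS n)"
  proof (intro equalityI subsetI)
    fix x assume x: "x \<in> {a<..<b} \<inter> (\<Inter>n::nat. ?SS n)"
    have "x \<in> ?SS K" for K
    proof -
      obtain n::nat where n: "K \<le> real n" using real_arch_simple by blast
      have "x \<in> ?SS n" using x by blast
      show ?thesis unfolding slope_set_def
      proof (intro CollectI allI impI)
        fix d :: real assume "d > 0"
        then obtain s t :: real where st: "s < x" "x < t" "t - s < d" "f t - f s > real n * (t - s)"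
          by (rule slope_setE[OF \<open>x \<in> ?SS n\<close>])
        then have "K * (t - s) \<le> real n * (t - s)" using n by (intro mult_right_mono) auto
        then show "\<exists>s t. s < x \<and> x < t \<and> t - s < d \<and> K * (t - s) < f t - f s" using st by (intro exI[of _ s] exI[of _ t]) linarith
      qed
    qed
    then show "x \<in> ?S" using x by auto
  qed auto
  have Ss: "?S \<in> sets lebesgue" unfolding Seq using slope_set_measurable by (intro sets.Int sets.countable_INT') auto
  have neg: "negligible (?S \<inter> {c<..<c'})" (is "negligible ?T") if cc: "c' - c < d" "c < c'" for c c'
  proof -
    have Ts: "?T \<in> sets lebesgue" using Ss by auto
    have "K * measure lebesgue ?T \<le> 1 + K * e" if K: "K \<ge> 0" and e: "e > 0" for K e
    proof -
      obtain U where U: "open U" "?T \<subseteq> U" "U \<subseteq> {max a c<..<min b c'}" "U \<in> lmeasurable"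
        "measure lebesgue (U - ?T) < e" "?T \<in> lmeasurable"
        by (rule lebesgue_outer_open_within[OF Ts _ e, of "max a c" "min b c'"]) auto
      obtain B where B: "finite B" "B \<subseteq> {(s,t). s < t \<and> f t - f s > K * (t - s)}"
        "\<And>s t. (s,t) \<in> B \<Longrightarrow> {s..t} \<subseteq> U"
        "\<And>i j. i \<in> B \<Longrightarrow> j \<in> B \<Longrightarrow> i \<noteq> j \<Longrightarrow> {fst i..snd i} \<inter> {fst j..snd j} = {}"
        "measure lebesgue (?T - (\<Union>i\<in>B. {fst i..snd i})) < e"
      proof (rule vitali_finite_intervals[OF U(6,1,2), of "{(s,t). s < t \<and> f t - f s > K * (t - s)}" e])
        fix x r :: real assume x: "x \<in> ?T" "r > 0"
        then obtain s t where "s < x" "x < t" "t - s < r" "f t - f s > K * (t - s)"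
          unfolding slope_set_def by blast
        then show "\<exists>(s, t)\<in>{(s, t). s < t \<and> K * (t - s) < f t - f s}. s \<le> x \<and> x \<le> t \<and> t - s < r"
          by (intro bexI[of _ "(s,t)"]) auto
      qed (use e in auto)
      have B2: "\<And>i. i \<in> B \<Longrightarrow> fst i < snd i" "\<And>i. i \<in> B \<Longrightarrow> f (snd i) - f (fst i) > K * (snd i - fst i)"
        using B(2) by auto
      let ?p = "(\<lambda>i. {fst i..snd i}) ` B"
      let ?UB = "\<Union>i\<in>B. {fst i..snd i}"
      have UB: "?UB \<subseteq> U" using B(3) by force
      have UBm: "?UB \<in> lmeasurable" using B(1) by (auto intro!: fmeasurable.finite_UN)
      note sB = measure_sandwich[OF U(6,4,2) UBm UB U(5) B(5)]
      have mB: "measure lebesgue ?UB = (\<Sum>i\<in>B. snd i - fst i)"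
        using division_of_disjoint_intervals(4)[OF B(1) B2(1) B(4)] by simp
      have "measure lebesgue ?UB \<le> measure lebesgue {c<..<c'}"
      proof (rule measure_mono_fmeasurable)
        have "U \<subseteq> {c<..<c'}" using U(3) by auto
        then show "?UB \<subseteq> {c<..<c'}" using UB by (rule subset_trans[rotated])
      qed (use fmeasurableD[OF UBm] in auto)
      then have lt: "(\<Sum>i\<in>B. snd i - fst i) < d" using cc mB by simp
      have "(\<Sum>i\<in>B. f (snd i) - f (fst i)) = (\<Sum>k\<in>?p. f (Sup k) - f (Inf k))"
        using division_of_disjoint_intervals(5)[OF B(1) B2(1) B(4), of f] by simp
      also have "\<dots> \<le> (\<Sum>k\<in>?p. \<bar>f (Sup k) - f (Inf k)\<bar>)" by (intro sum_mono) auto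
      also have "\<dots> < 1"
      proof (rule D)
        show "?p division_of \<Union>?p" by (rule division_of_disjoint_intervals(1)[OF B(1) B2(1) B(4)])
        have "U \<subseteq> {a..b}" using U(3) by auto
        then show "\<Union>?p \<subseteq> {a..b}" using UB by blast
        show "sum (measure lborel) ?p < d"
          using division_of_disjoint_intervals(3)[OF B(1) B2(1) B(4)] lt by simp
      qed
      finally have "(\<Sum>i\<in>B. f (snd i) - f (fst i)) < 1" .
      moreover have "K * (\<Sum>i\<in>B. snd i - fst i) \<le> (\<Sum>i\<in>B. f (snd i) - f (fst i))"
        unfolding sum_distrib_left by (intro sum_mono less_imp_le B2(2))
      moreover have "K * measure lebesgue ?T \<le> K * ((\<Sum>i\<in>B. snd i - fst i) + e)"
        using sB(2) K unfolding mB by (intro mult_left_mono) auto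
      ultimately show ?thesis by (simp add: algebra_simps)
    qed
    note le = this
    have "measure lebesgue ?T \<le> 0"
    proof (rule field_le_epsilon)
      fix e :: real assume e: "e > 0"
      have "2 / e * measure lebesgue ?T \<le> 1 + 2 / e * (e / 2)" by (rule le) (use e in auto)
      then show "measure lebesgue ?T \<le> 0 + e" using e by (simp add: field_simps)
    qed
    then have "measure lebesgue ?T = 0" using measure_nonneg[of lebesgue "?T"] by linarith
    moreover have "?T \<in> lmeasurable"
      using lebesgue_outer_open_within[OF Ts _ zero_less_one, of a b] by blast
    ultimately show ?thesis by (simp only: negligible_iff_measure)
  qed
  have "?S \<subseteq> (\<Union>q\<in>\<rat>. ?S \<inter> {q - d/3<..<q + d/3})"
  proof
    fix x assume x: "x \<in> ?S"
    obtain q where "q \<in> \<rat>" "x - d/3 < q" "q < x" using Rats_dense_in_real[of "x - d/3" x] d by auto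
    then show "x \<in> (\<Union>q\<in>\<rat>. ?S \<inter> {q - d/3<..<q + d/3})" using x d by (intro UN_I[of q]) auto
  qed
  moreover have "negligible (\<Union>q\<in>\<rat>. ?S \<inter> {q - d/3<..<q + d/3})"
  proof (rule negligible_countable_Union)
    show "countable ((\<lambda>q. ?S \<inter> {q - d/3<..<q + d/3}) ` \<rat>)" by (intro countable_image countable_rat)
    fix T assume "T \<in> (\<lambda>q. ?S \<inter> {q - d/3<..<q + d/3}) ` \<rat>"
    then obtain q where T: "T = ?S \<inter> {q - d/3<..<q + d/3}" by blast
    show "negligible T" unfolding T by (rule neg) (use d in linarith)+
  qed
  ultimately show ?thesis by (rule negligible_subset[rotated])
qed

text \<open>The slopes are taken over intervals with \<open>x\<close> strictly inside. By continuity
  one endpoint can be moved to \<open>x\<close>, which turns the estimate into one for the usual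
  difference quotients on either side.\<close>

lemma has_real_derivative_from_slopes:
  fixes f :: "real \<Rightarrow> real"
  assumes cont: "continuous_on {a..b} f" and x: "x \<in> {a<..<b}"
  and sl: "\<And>e. e > 0 \<Longrightarrow> \<exists>d>0. \<forall>s t. s < x \<and> x < t \<and> t - s < d \<longrightarrow> \<bar>f t - f s - L * (t - s)\<bar> \<le> e * (t - s)"
  shows "(f has_real_derivative L) (at x)"
  unfolding has_field_derivative_def has_derivative_at_within
proof (intro conjI bounded_linear_mult_right)
  have cx: "isCont f x" using cont x continuous_on_interior[of "{a..b}" f x] by (simp add: interior_atLeastAtMost_real)
  show "((\<lambda>y. (f y - f x - L * (y - x)) /\<^sub>R norm (y - x)) \<longlongrightarrow> 0) (at x)"
  proof (rule tendstoI)
    fix e :: real assume e: "e > 0"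
    obtain d where d: "d > 0" and D: "\<And>s t. s < x \<Longrightarrow> x < t \<Longrightarrow> t - s < d \<Longrightarrow> \<bar>f t - f s - L * (t - s)\<bar> \<le> e/2 * (t - s)"
      using sl[of "e/2"] e by auto
    have right: "\<bar>f t - f x - L * (t - x)\<bar> \<le> e/2 * (t - x)" if t: "x < t" "t - x < d" for t
    proof -
      have *: "(f \<longlongrightarrow> f x) (at_left x)" "((\<lambda>s. s) \<longlongrightarrow> x) (at_left x)"
        using cx by (auto simp: isCont_def intro: tendsto_mono[OF at_le])
      have "0 \<le> e/2 * (t - x) - \<bar>f t - f x - L * (t - x)\<bar>"
      proof (rule tendsto_lowerbound)
        show "((\<lambda>s. e/2 * (t - s) - \<bar>f t - f s - L * (t - s)\<bar>) \<longlongrightarrow> e/2 * (t - x) - \<bar>f t - f x - L * (t - x)\<bar>) (at_left x)"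
          by (intro tendsto_intros *)
        show "\<forall>\<^sub>F s in at_left x. 0 \<le> e/2 * (t - s) - \<bar>f t - f s - L * (t - s)\<bar>"
        proof (rule eventually_mono[OF eventually_at_left_real[of "x - (d - (t - x))" x]])
          show "x - (d - (t - x)) < x" using t by simp
          fix s assume "s \<in> {x - (d - (t - x))<..<x}"
          then show "0 \<le> e/2 * (t - s) - \<bar>f t - f s - L * (t - s)\<bar>" using D[of s t] t by auto
        qed
      qed simp
      then show ?thesis by simp
    qed
    have left: "\<bar>f x - f s - L * (x - s)\<bar> \<le> e/2 * (x - s)" if s: "s < x" "x - s < d" for s
    proof -
      have *: "(f \<longlongrightarrow> f x) (at_right x)" "((\<lambda>t. t) \<longlongrightarrow> x) (at_right x)"
        using cx by (auto simp: isCont_def intro: tendsto_mono[OF at_le])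
      have "0 \<le> e/2 * (x - s) - \<bar>f x - f s - L * (x - s)\<bar>"
      proof (rule tendsto_lowerbound)
        show "((\<lambda>t. e/2 * (t - s) - \<bar>f t - f s - L * (t - s)\<bar>) \<longlongrightarrow> e/2 * (x - s) - \<bar>f x - f s - L * (x - s)\<bar>) (at_right x)"
          by (intro tendsto_intros *)
        show "\<forall>\<^sub>F t in at_right x. 0 \<le> e/2 * (t - s) - \<bar>f t - f s - L * (t - s)\<bar>"
        proof (rule eventually_mono[OF eventually_at_right_real[of x "x + (d - (x - s))"]])
          show "x < x + (d - (x - s))" using s by simp
          fix t assume "t \<in> {x<..<x + (d - (x - s))}"
          then show "0 \<le> e/2 * (t - s) - \<bar>f t - f s - L * (t - s)\<bar>" using D[of s t] s by auto
        qed
      qed simp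
      then show ?thesis by simp
    qed
    show "\<forall>\<^sub>F y in at x. dist ((f y - f x - L * (y - x)) /\<^sub>R norm (y - x)) 0 < e"
      unfolding eventually_at
    proof (intro exI[of _ d] conjI d ballI impI)
      fix y assume y: "y \<noteq> x \<and> dist y x < d"
      have "\<bar>f y - f x - L * (y - x)\<bar> \<le> e/2 * \<bar>y - x\<bar>"
        using right[of y] left[of y] y by (cases "y > x") (auto simp: dist_real_def algebra_simps abs_if split: if_splits)
      also have "\<dots> < e * \<bar>y - x\<bar>" using e y by simp
      finally show "dist ((f y - f x - L * (y - x)) /\<^sub>R norm (y - x)) 0 < e"
        using y by (simp add: field_simps abs_mult)
    qed
  qed
qed

text \<open>Outside the three exceptional sets, slopes near \<open>x\<close> are bounded on both
  sides, and no rational gap separates slopes that occur arbitrarily close to \<open>x\<close>. Then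
  the supremum \<open>L\<close> of all bounds exceeded arbitrarily close to \<open>x\<close> is the
  derivative: \<open>L + e\<close> is not exceeded near \<open>x\<close>, and since some bound above
  \<open>L - e / 2\<close> is, slopes below \<open>L - e\<close> cannot recur.\<close>

lemma abs_continuous_on_differentiable_AE:
  assumes ac: "abs_continuous_on {a..b} f"
  shows "negligible {x \<in> {a<..<b}. \<not> f differentiable at x}"
proof -
  let ?up = "\<lambda>q. slope_set (\<lambda>s t. f t - f s > q * (t - s))"
  let ?dn = "\<lambda>q. slope_set (\<lambda>s t. f t - f s < q * (t - s))"
  let ?N1 = "{x \<in> {a<..<b}. \<forall>K. x \<in> ?up K}"
  let ?N2 = "{x \<in> {a<..<b}. \<forall>K. x \<in> slope_set (\<lambda>s t. - f t - (- f s) > K * (t - s))}"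
  let ?N3 = "\<Union>(p,q)\<in>{(p,q)\<in>\<rat>\<times>\<rat>. p < q}. {a<..<b} \<inter> ?up q \<inter> ?dn p"
  have "negligible ?N3"
  proof (rule negligible_countable_Union)
    have "countable {(p,q). p \<in> \<rat> \<and> q \<in> \<rat> \<and> p < (q::real)}"
      by (rule countable_subset[of _ "\<rat> \<times> \<rat>"]) (auto simp: countable_rat)
    then show "countable ((\<lambda>(p,q). {a<..<b} \<inter> ?up q \<inter> ?dn p) ` {(p,q)\<in>\<rat>\<times>\<rat>. p < q})"
      by (intro countable_image) (auto elim!: countable_subset[rotated])
  qed (auto intro!: slope_gap_negligible[OF ac])
  then have "negligible (?N1 \<union> ?N2 \<union> ?N3)"
    using steep_negligible[OF ac] steep_negligible[OF abs_continuous_on_uminus[OF ac]] by (intro negligible_Un)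
  moreover have "{x \<in> {a<..<b}. \<not> f differentiable at x} \<subseteq> ?N1 \<union> ?N2 \<union> ?N3"
  proof (rule subsetI, rule ccontr)
    fix x assume x: "x \<in> {x \<in> {a<..<b}. \<not> f differentiable at x}" and n: "x \<notin> ?N1 \<union> ?N2 \<union> ?N3"
    have xab: "x \<in> {a<..<b}" using x by auto
    obtain K1 where K1: "x \<notin> ?up K1" using n xab by auto
    obtain K2 where K2: "x \<notin> slope_set (\<lambda>s t. - f t - (- f s) > K2 * (t - s))" using n xab by auto
    have gap: "x \<notin> ?up q \<or> x \<notin> ?dn p" if "p \<in> \<rat>" "q \<in> \<rat>" "p < q" for p q
      using n xab that by auto
    define A where "A = {q. x \<in> ?up q}"
    have mono: "q' \<in> A" if "q \<in> A" "q' \<le> q" for q q'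
    proof -
      have "x \<in> ?up q" using that by (simp add: A_def)
      have "\<exists>s t. s < x \<and> x < t \<and> t - s < d \<and> f t - f s > q' * (t - s)" if d: "d > 0" for d
      proof -
        obtain s t where st: "s < x" "x < t" "t - s < d" "f t - f s > q * (t - s)"
          by (rule slope_setE[OF \<open>x \<in> ?up q\<close> d])
        moreover have "q' * (t - s) \<le> q * (t - s)" using \<open>q' \<le> q\<close> st by (intro mult_right_mono) auto
        ultimately show ?thesis by (intro exI[of _ s] exI[of _ t]) linarith
      qed
      then show ?thesis by (simp add: A_def slope_set_def)
    qed
    have bdd: "bdd_above A" 
    proof (rule bdd_aboveI[of _ K1])
      fix q assume q: "q \<in> A"
      show "q \<le> K1"
      proof (rule ccontr)
        assume "\<not> q \<le> K1"
        then have "K1 \<in> A" using mono[OF q, of K1] by simp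
        then show False using K1 by (simp add: A_def)
      qed
    qed
    \<comment> \<open>Near \<open>x\<close> the slopes of \<open>-f\<close> do not exceed
      \<open>K2\<close>, so those of \<open>f\<close> are at least \<open>- K2\<close>, strictly
      above \<open>- K2 - 1\<close>.\<close>
    have ne: "- K2 - 1 \<in> A"
    proof -
      obtain d0 where d0: "d0 > 0" "\<And>s t. s < x \<Longrightarrow> x < t \<Longrightarrow> t - s < d0 \<Longrightarrow> \<not> (- f t - (- f s) > K2 * (t - s))"
        using K2 unfolding slope_set_def by blast
      have "\<exists>s t. s < x \<and> x < t \<and> t - s < d \<and> f t - f s > (- K2 - 1) * (t - s)" if d: "d > 0" for d
      proof -
        define s where "s = x - min d d0 / 3"
        define t where "t = x + min d d0 / 3"
        have st: "s < x" "x < t" "t - s < d" "t - s < d0" using d d0(1) by (auto simp: min_def s_def t_def)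
        have "\<not> (- f t - (- f s) > K2 * (t - s))" by (rule d0(2)[OF st(1,2,4)])
        moreover have "(- K2 - 1) * (t - s) = - (K2 * (t - s)) - (t - s)" by (simp add: algebra_simps)
        ultimately have "f t - f s > (- K2 - 1) * (t - s)" using st(1,2) by linarith
        then show ?thesis using st by blast
      qed
      then show ?thesis by (simp add: A_def slope_set_def)
    qed
    define L where "L = Sup A"
    have "(f has_real_derivative L) (at x)"
    proof (rule has_real_derivative_from_slopes[OF abs_continuous_on_imp_continuous_on[OF ac] xab])
      fix e :: real assume e: "e > 0"
      have "L + e \<notin> A" using cSup_upper[OF _ bdd, of "L + e"] e by (auto simp: L_def)
      then obtain d1 where d1: "d1 > 0" "\<And>s t. s < x \<Longrightarrow> x < t \<Longrightarrow> t - s < d1 \<Longrightarrow> \<not> (f t - f s > (L + e) * (t - s))"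
        unfolding A_def slope_set_def by blast
      obtain q0 where q0: "q0 \<in> A" "L - e / 2 < q0"
        using less_cSup_iff[of A "L - e/2"] bdd ne e by (auto simp: L_def)
      obtain q where q: "q \<in> \<rat>" "L - e / 2 < q" "q < q0" using Rats_dense_in_real[OF q0(2)] by blast
      obtain p where p: "p \<in> \<rat>" "L - e < p" "p < L - e / 2" using Rats_dense_in_real[of "L - e" "L - e/2"] e by auto
      have "q \<in> A" using mono[OF q0(1)] q by simp
      then have "x \<notin> ?dn p" using gap[OF p(1) q(1)] p q by (auto simp: A_def)
      then obtain d2 where d2: "d2 > 0" "\<And>s t. s < x \<Longrightarrow> x < t \<Longrightarrow> t - s < d2 \<Longrightarrow> \<not> (f t - f s < p * (t - s))"
        unfolding slope_set_def by blast
      show "\<exists>d>0. \<forall>s t. s < x \<and> x < t \<and> t - s < d \<longrightarrow> \<bar>f t - f s - L * (t - s)\<bar> \<le> e * (t - s)"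
      proof (intro exI[of _ "min d1 d2"] conjI allI impI)
        show "min d1 d2 > 0" using d1(1) d2(1) by simp
        fix s t assume st: "s < x \<and> x < t \<and> t - s < min d1 d2"
        have 1: "f t - f s \<le> (L + e) * (t - s)" using d1(2)[of s t] st by simp
        have 2: "f t - f s \<ge> p * (t - s)" using d2(2)[of s t] st by simp
        have "(L - e) * (t - s) \<le> p * (t - s)" using p st by (intro mult_right_mono) auto
        then show "\<bar>f t - f s - L * (t - s)\<bar> \<le> e * (t - s)" using 1 2 by (simp add: algebra_simps abs_le_iff)
      qed
    qed
    then have "f differentiable at x" by (meson real_differentiable_def)
    then show False using x by auto
  qed
  ultimately show ?thesis by (rule negligible_subset)
qed

text \<open>A Henstock-Kurzweil argument with a gauge of two kinds. At a tag outside
  \<open>N\<close> the ball is so small that the linear approximation is accurate; at a tag in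
  \<open>N\<close> the ball lies in an open set \<open>U\<close> of small measure, where absolute
  continuity bounds the increments. Putting \<open>g0 = 0\<close> on \<open>N\<close> leaves only
  these increments there.\<close>

lemma has_integral_abs_continuous:
  fixes f g :: "real \<Rightarrow> real"
  assumes ac: "abs_continuous_on {a..b} f" and ab: "a \<le> b"
    and N: "negligible N" "\<And>x. x \<in> {a..b} - N \<Longrightarrow> (f has_real_derivative g x) (at x within {a..b})"
  shows "(g has_integral f b - f a) {a..b}"
proof -
  define g0 where "g0 x = (if x \<in> N then 0 else g x)" for x
  have "(g0 has_integral f b - f a) {a..b}"
    unfolding has_integral_real
  proof (intro allI impI)
    fix e :: real assume e: "e > 0"
    \<comment> \<open>The approximation errors sum to at most \<open>e' * (b - a)\<close>; adding
      \<open>1\<close> in the denominator covers the case \<open>a = b\<close>.\<close>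
    define e' where "e' = e / (2 * (b - a + 1))"
    have e': "e' > 0" using e ab by (simp add: e'_def)
    obtain d where d: "d > 0" and D: "\<And>p. p division_of \<Union>p \<Longrightarrow> \<Union>p \<subseteq> {a..b} \<Longrightarrow>
      sum (measure lborel) p < d \<Longrightarrow> (\<Sum>k\<in>p. \<bar>f (Sup k) - f (Inf k)\<bar>) < e/2"
      using abs_continuous_on_division[OF ac half_gt_zero[OF e]] by blast
    have Ns: "N \<in> sets lebesgue" using N(1) by (rule negligible_imp_sets)
    obtain U where U: "open U" "N \<subseteq> U" "U \<in> lmeasurable" "measure lebesgue U < d"
    proof -
      obtain T where T: "open T" "N \<subseteq> T" "T - N \<in> lmeasurable" "emeasure lebesgue (T - N) < ennreal d"
        using sets_lebesgue_outer_open[OF Ns d] by blast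
      have Nn: "N \<in> null_sets lebesgue" using N(1) by (simp add: negligible_iff_null_sets)
      have Ts: "T \<in> sets lebesgue" using T(1) by auto
      have em: "emeasure lebesgue (T - N) = emeasure lebesgue T"
        by (rule emeasure_Diff_null_set[OF Nn Ts])
      then have "T \<in> lmeasurable" using T(4) Ts by (auto simp: fmeasurable_def less_top[symmetric] dest: order_less_le_trans)
      moreover have "measure lebesgue T < d" using T(4) d \<open>T \<in> lmeasurable\<close> unfolding em
        by (simp add: emeasure_eq_measure2 ennreal_less_iff)
      ultimately show ?thesis using T by (intro that[of T])
    qed
    have "\<exists>r>0. (x \<in> N \<longrightarrow> ball x r \<subseteq> U) \<and>
       (x \<in> {a..b} - N \<longrightarrow> (\<forall>y\<in>{a..b}. \<bar>y - x\<bar> < r \<longrightarrow> \<bar>f y - f x - g x * (y - x)\<bar> \<le> e' * \<bar>y - x\<bar>))" for x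
    proof (cases "x \<in> N")
      case True
      then show ?thesis using U(1,2) by (meson DiffD2 openE subsetD)
    next
      case False
      show ?thesis
      proof (cases "x \<in> {a..b}")
        case True
        then have "(f has_derivative (*) (g x)) (at x within {a..b})"
          using N(2)[of x] False by (simp add: has_field_derivative_def)
        then obtain r where "r > 0" "\<forall>y\<in>{a..b}. norm (y - x) < r \<longrightarrow> norm (f y - f x - g x * (y - x)) \<le> e' * norm (y - x)"
          using e' unfolding has_derivative_within_alt by meson
        then show ?thesis using False by (intro exI[of _ r]) auto
      next
        case False': False
        then show ?thesis using False by (intro exI[of _ 1]) auto
      qed
    qed
    then obtain r where r: "\<And>x. r x > 0" "\<And>x. x \<in> N \<Longrightarrow> ball x (r x) \<subseteq> U"
      "\<And>x y. x \<in> {a..b} - N \<Longrightarrow> y \<in> {a..b} \<Longrightarrow> \<bar>y - x\<bar> < r x \<Longrightarrow> \<bar>f y - f x - g x * (y - x)\<bar> \<le> e' * \<bar>y - x\<bar>"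
      by metis
    show "\<exists>\<gamma>. gauge \<gamma> \<and> (\<forall>\<D>. \<D> tagged_division_of {a..b} \<and> \<gamma> fine \<D> \<longrightarrow>
        norm ((\<Sum>(x, k)\<in>\<D>. measure lborel k *\<^sub>R g0 x) - (f b - f a)) < e)"
    proof (intro exI[of _ "\<lambda>x. ball x (r x)"] conjI allI impI)
      show "gauge (\<lambda>x. ball x (r x))" using r(1) by (intro gauge_ball_dependent) auto
      fix D assume "D tagged_division_of {a..b} \<and> (\<lambda>x. ball x (r x)) fine D"
      then have tag: "D tagged_division_of {a..b}" and fine: "(\<lambda>x. ball x (r x)) fine D" by auto
      note tD = tagged_division_ofD[OF tag]
      define D1 where "D1 = {(x,k) \<in> D. x \<in> N}"
      define D2 where "D2 = {(x,k) \<in> D. x \<notin> N}"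
      have DD: "D = D1 \<union> D2" "D1 \<inter> D2 = {}" "finite D1" "finite D2" using tD(1) 
        by (auto simp: D1_def D2_def elim!: finite_subset[rotated])
      have iv: "k = {Inf k..Sup k}" "Inf k \<le> x" "x \<le> Sup k" "a \<le> Inf k" "Sup k \<le> b" "measure lborel k = Sup k - Inf k"
        "Inf k \<in> ball x (r x)" "Sup k \<in> ball x (r x)"
        if k: "(x,k) \<in> D" for x k
      proof -
        obtain u v where uv: "k = cbox u v" using tD(4)[OF k] by blast
        have uv': "k = {u..v}" "u \<le> v" using uv tD(2)[OF k] by auto
        have e: "Inf k = u" "Sup k = v" using uv' by auto
        have m: "u \<in> k" "v \<in> k" using uv' by auto
        have kb: "k \<subseteq> ball x (r x)" using fine k by (auto simp: fine_def)
        show "Inf k \<in> ball x (r x)" "Sup k \<in> ball x (r x)"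
          unfolding e by (rule subsetD[OF kb m(1)], rule subsetD[OF kb m(2)])
        show "k = {Inf k..Sup k}" "measure lborel k = Sup k - Inf k" unfolding e using uv' by auto
        show "Inf k \<le> x" "x \<le> Sup k" unfolding e using uv' tD(2)[OF k] by auto
        show "a \<le> Inf k" "Sup k \<le> b" unfolding e using m tD(3)[OF k] by auto
      qed
      have D1p: "D1 tagged_partial_division_of {a..b}"
        by (rule tagged_partial_division_subset[of D]) (use tag in \<open>auto simp: D1_def tagged_division_of_def\<close>)
      have D1div: "snd ` D1 division_of \<Union>(snd ` D1)" by (rule partial_division_of_tagged_division[OF D1p])
      let ?dl = "\<lambda>(x,k). measure lborel k *\<^sub>R g0 x - (f (Sup k) - f (Inf k))"
      have eq: "(\<Sum>(x, k)\<in>D. measure lborel k *\<^sub>R g0 x) - (f b - f a) = (\<Sum>z\<in>D. ?dl z)"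
        unfolding additive_tagged_division_1[OF ab tag, of f, symmetric] by (simp add: case_prod_unfold sum_subtractf)
      have "norm (\<Sum>z\<in>D2. ?dl z) \<le> (\<Sum>(x,k)\<in>D2. e' * measure lborel k)"
      proof (rule sum_norm_le)
        fix z assume z: "z \<in> D2"
        obtain x k where zk: "z = (x,k)" by (cases z)
        have k: "(x,k) \<in> D" "x \<notin> N" using z zk by (auto simp: D2_def)
        note i = iv[OF k(1)]
        have xab: "x \<in> {a..b} - N" using i k by auto
        have 1: "\<bar>f (Sup k) - f x - g x * (Sup k - x)\<bar> \<le> e' * \<bar>Sup k - x\<bar>"
        proof (rule r(3)[OF xab])
          show "Sup k \<in> {a..b}" using i by auto
          show "\<bar>Sup k - x\<bar> < r x" using i(8) by (simp add: dist_real_def abs_minus_commute)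
        qed
        have 2: "\<bar>f (Inf k) - f x - g x * (Inf k - x)\<bar> \<le> e' * \<bar>Inf k - x\<bar>"
        proof (rule r(3)[OF xab])
          show "Inf k \<in> {a..b}" using i by auto
          show "\<bar>Inf k - x\<bar> < r x" using i(7) by (simp add: dist_real_def abs_minus_commute)
        qed
        have "\<bar>(Sup k - Inf k) * g x - (f (Sup k) - f (Inf k))\<bar>
          = \<bar>(f (Inf k) - f x - g x * (Inf k - x)) - (f (Sup k) - f x - g x * (Sup k - x))\<bar>"
          by (simp add: algebra_simps)
        also have "\<dots> \<le> e' * \<bar>Inf k - x\<bar> + e' * \<bar>Sup k - x\<bar>" using 1 2 by linarith
        also have "\<dots> = e' * (Sup k - Inf k)" using i by (simp add: algebra_simps)
        finally show "norm (?dl z) \<le> (case z of (x,k) \<Rightarrow> e' * measure lborel k)"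
          using k i by (simp add: zk g0_def)
      qed
      also have "\<dots> \<le> (\<Sum>(x,k)\<in>D. e' * measure lborel k)"
        by (rule sum_mono2[OF tD(1)]) (use e' in \<open>auto simp: D2_def\<close>)
      also have "\<dots> = e' * (b - a)"
        using additive_content_tagged_division[of D a b] tag ab
        by (simp add: case_prod_unfold sum_distrib_left[symmetric])
      also have "\<dots> < e/2" using e ab by (simp add: e'_def field_simps)
      finally have A: "\<bar>\<Sum>z\<in>D2. ?dl z\<bar> < e/2" by simp
      have "\<bar>\<Sum>z\<in>D1. ?dl z\<bar> = \<bar>\<Sum>(x,k)\<in>D1. f (Sup k) - f (Inf k)\<bar>"
        by (subst (2) abs_minus_cancel[symmetric], subst sum_negf[symmetric])
           (intro arg_cong[of _ _ abs] sum.cong, auto simp: D1_def g0_def)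
      also have "\<dots> \<le> (\<Sum>(x,k)\<in>D1. \<bar>f (Sup k) - f (Inf k)\<bar>)"
        by (rule order_trans[OF sum_abs]) (auto simp: case_prod_unfold)
      \<comment> \<open>Passing from tagged to plain intervals needs a function that vanishes on
        intervals with empty interior; for the empty set \<open>Sup\<close> and \<open>Inf\<close>
        give no usable value, hence the explicit case.\<close>
      also have "\<dots> = (\<Sum>(x,k)\<in>D1. if k = {} then 0 else \<bar>f (Sup k) - f (Inf k)\<bar>)"
        by (intro sum.cong) (auto simp: D1_def dest: tD(2))
      also have "\<dots> = (\<Sum>k\<in>snd ` D1. if k = {} then 0 else \<bar>f (Sup k) - f (Inf k)\<bar>)"
        by (rule sum.over_tagged_division_lemma[OF tagged_partial_division_of_Union_self[OF D1p]])
           (auto simp: not_less box_real)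
      also have "\<dots> = (\<Sum>k\<in>snd ` D1. \<bar>f (Sup k) - f (Inf k)\<bar>)"
        by (intro sum.cong) (auto simp: D1_def dest: tD(2))
      also have "\<dots> < e/2"
      proof (rule D[OF D1div])
        show "\<Union>(snd ` D1) \<subseteq> {a..b}" using tD(3) by (fastforce simp: D1_def)
        have sub: "\<Union>(snd ` D1) \<subseteq> U"
        proof
          fix y assume "y \<in> \<Union>(snd ` D1)"
          then obtain x k where xk: "(x,k) \<in> D" "x \<in> N" "y \<in> k" by (auto simp: D1_def)
          then have "k \<subseteq> ball x (r x)" using fine unfolding fine_def by blast
          then show "y \<in> U" using r(2)[OF xk(2)] xk(3) by blast
        qed
        have "sum (measure lborel) (snd ` D1) = sum (measure lebesgue) (snd ` D1)"
          using division_ofD(4)[OF D1div] by (intro sum.cong refl measure_completion[symmetric]) fastforce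
        also have "\<dots> = measure lebesgue (\<Union>(snd ` D1))" using content_division[OF D1div] by simp
        also have "\<dots> \<le> measure lebesgue U"
          by (rule measure_mono_fmeasurable[OF sub _ U(3)]) (use lmeasurable_division[OF D1div] in auto)
        finally show "sum (measure lborel) (snd ` D1) < d" using U(4) by simp
      qed
      finally have B: "\<bar>\<Sum>z\<in>D1. ?dl z\<bar> < e/2" .
      have "(\<Sum>z\<in>D. ?dl z) = (\<Sum>z\<in>D1. ?dl z) + (\<Sum>z\<in>D2. ?dl z)"
        unfolding DD(1) by (rule sum.union_disjoint[OF DD(3,4,2)])
      then show "norm ((\<Sum>(x, k)\<in>D. measure lborel k *\<^sub>R g0 x) - (f b - f a)) < e"
        unfolding eq using A B by simp
    qed
  qed
  then show ?thesis
    by (rule has_integral_spike[OF N(1), rotated]) (auto simp: g0_def)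
qed

section \<open>Functions with a locally integrable density\<close>

text \<open>Local absolute continuity in integrated form. The density is a fixed Borel function
  defined everywhere, so that it can be composed with the paths of the process.\<close>

definition has_density :: "(real \<Rightarrow> real) \<Rightarrow> (real \<Rightarrow> real) \<Rightarrow> bool" where
  "has_density f g \<longleftrightarrow> g \<in> borel_measurable borel \<and>
     (\<forall>a b. a \<le> b \<longrightarrow> set_integrable lborel {a..b} g \<and> f b - f a = (LINT x:{a..b}|lborel. g x))"

lemma has_densityD:
  assumes "has_density f g"
  shows "g \<in> borel_measurable borel" "set_integrable lborel {a..b} g"
    "a \<le> b \<Longrightarrow> f b - f a = (LINT x:{a..b}|lborel. g x)"
proof -
  show "set_integrable lborel {a..b} g"
    using assms by (cases "a \<le> b") (auto simp: has_density_def set_integrable_def)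
qed (use assms in \<open>auto simp: has_density_def\<close>)

lemma set_integrable_continuous_mult:
  fixes f g :: "real \<Rightarrow> real"
  assumes "set_integrable lborel {a..b} g" "continuous_on {a..b} f" "g \<in> borel_measurable borel" "f \<in> borel_measurable borel"
  shows "set_integrable lborel {a..b} (\<lambda>x. f x * g x)"
proof -
  have "bounded (f ` {a..b})" by (rule compact_imp_bounded[OF compact_continuous_image[OF assms(2) compact_Icc]])
  then obtain B where B: "\<And>x. x \<in> {a..b} \<Longrightarrow> \<bar>f x\<bar> \<le> B" unfolding bounded_iff real_norm_def by blast
  show ?thesis
  proof (rule set_integrable_bound[where f="\<lambda>x. B * g x"])
    show "set_integrable lborel {a..b} (\<lambda>x. B * g x)" using assms(1) by simp
    show "set_borel_measurable lborel {a..b} (\<lambda>x. f x * g x)"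
      unfolding set_borel_measurable_def using assms(3,4) by measurable
    show "AE x in lborel. x \<in> {a..b} \<longrightarrow> norm (f x * g x) \<le> norm (B * g x)"
      using B by (intro AE_I2) (auto simp: abs_mult intro!: mult_right_mono order_trans[OF B abs_ge_self])
  qed
qed

lemma has_density_C1:
  assumes "\<And>x. (f has_real_derivative f' x) (at x)" "continuous_on UNIV f'"
  shows "has_density f f'"
  unfolding has_density_def
proof (intro conjI allI impI)
  show m: "f' \<in> borel_measurable borel" by (rule borel_measurable_continuous_onI[OF assms(2)])
  fix a b :: real assume ab: "a \<le> b"
  have c: "continuous_on {a..b} f'" using assms(2) continuous_on_subset by blast
  show "set_integrable lborel {a..b} f'" by (rule borel_integrable_atLeastAtMost'[OF c])
  have "(f' has_integral (f b - f a)) {a..b}"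
    by (rule fundamental_theorem_of_calculus[OF ab])
       (use assms(1) in \<open>auto simp: has_real_derivative_iff_has_vector_derivative[symmetric] intro: has_field_derivative_at_within\<close>)
  moreover have "(LINT x:{a..b}|lborel. f' x) = integral {a..b} f'"
    by (rule set_borel_integral_eq_integral[OF borel_integrable_atLeastAtMost'[OF c]])
  ultimately show "f b - f a = (LINT x:{a..b}|lborel. f' x)" by (simp add: integral_unique)
qed

lemma has_density_add:
  assumes "has_density f f'" "has_density g g'"
  shows "has_density (\<lambda>x. f x + g x) (\<lambda>x. f' x + g' x)"
  unfolding has_density_def
proof (intro conjI allI impI)
  show "(\<lambda>x. f' x + g' x) \<in> borel_measurable borel" using has_densityD(1)[OF assms(1)] has_densityD(1)[OF assms(2)] by simp
  fix a b :: real assume ab: "a \<le> b"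
  note i = has_densityD(2)[OF assms(1), of a b] has_densityD(2)[OF assms(2), of a b]
  show "set_integrable lborel {a..b} (\<lambda>x. f' x + g' x)" by (rule set_integral_add(1)[OF i])
  show "f b + g b - (f a + g a) = (LINT x:{a..b}|lborel. f' x + g' x)"
    using set_integral_add(2)[OF i] has_densityD(3)[OF assms(1) ab] has_densityD(3)[OF assms(2) ab] by simp
qed

lemma has_density_cmult:
  assumes "has_density f f'"
  shows "has_density (\<lambda>x. c * f x) (\<lambda>x. c * f' x)"
  using has_densityD[OF assms] unfolding has_density_def
  by (auto simp: right_diff_distrib[symmetric])

lemma has_density_continuous:
  assumes "has_density f g" shows "continuous_on UNIV f"
proof -
  have "continuous_on {a<..<b} f" for a b
  proof (cases "a < b")
    case True
    have "continuous_on {a..b} (\<lambda>x. f a + integral {a..x} g)"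
      by (intro continuous_intros indefinite_integral_continuous_1 set_borel_integral_eq_integral has_densityD(2)[OF assms])
    moreover have "f a + integral {a..x} g = f x" if "x \<in> {a..b}" for x
      using has_densityD(3)[OF assms, of a x] that set_borel_integral_eq_integral(2)[OF has_densityD(2)[OF assms, of a x]] by simp
    ultimately have "continuous_on {a..b} f" using continuous_on_cong[OF refl, of "{a..b}"] by (metis (no_types, lifting))
    then show ?thesis by (rule continuous_on_subset) auto
  qed auto
  then have "continuous_on (\<Union>n::nat. {- real n<..<real n}) f" by (intro continuous_on_open_UN) auto
  moreover have "(\<Union>n::nat. {- real n<..<real n}) = UNIV"
  proof (intro equalityI subsetI UNIV_I)
    fix x :: real
    obtain n :: nat where "\<bar>x\<bar> < n" using reals_Archimedean2 by blast
    then show "x \<in> (\<Union>n::nat. {- real n<..<real n})" by (intro UN_I[of n]) auto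
  qed
  ultimately show ?thesis by simp
qed

text \<open>The product rule comes from Fubini: the kernel \<open>\<phi>' y * r z\<close> is
  integrated over the triangle \<open>z \<le> y\<close> in both orders, and equating the results is
  integration by parts. No pointwise derivative of \<open>R\<close> enters.\<close>

lemma has_density_mult_C1:
  assumes phi: "\<And>x. (\<phi> has_real_derivative \<phi>' x) (at x)" "continuous_on UNIV \<phi>'" and R: "has_density R r"
  shows "has_density (\<lambda>x. \<phi> x * R x) (\<lambda>x. \<phi>' x * R x + \<phi> x * r x)"
  unfolding has_density_def
proof (intro conjI allI impI)
  have cphi: "continuous_on UNIV \<phi>" using phi(1) DERIV_isCont continuous_at_imp_continuous_on by blast
  have cR: "continuous_on UNIV R" by (rule has_density_continuous[OF R])
  have [measurable]: "\<phi> \<in> borel_measurable borel" "\<phi>' \<in> borel_measurable borel" "R \<in> borel_measurable borel" "r \<in> borel_measurable borel"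
    using cphi phi(2) cR has_densityD(1)[OF R] by (auto intro: borel_measurable_continuous_onI)
  show "(\<lambda>x. \<phi>' x * R x + \<phi> x * r x) \<in> borel_measurable borel" by measurable
  fix a b :: real assume ab: "a \<le> b"
  have sub: "continuous_on {c..d} f" if "continuous_on UNIV f" for f :: "real \<Rightarrow> real" and c d using that continuous_on_subset by blast
  have i1: "set_integrable lborel {a..b} (\<lambda>x. \<phi>' x * R x)"
    by (intro borel_integrable_atLeastAtMost' continuous_on_mult sub phi cR)
  have i2: "set_integrable lborel {a..b} (\<lambda>x. \<phi> x * r x)"
    by (rule set_integrable_continuous_mult[OF has_densityD(2)[OF R] sub[OF cphi]]) auto
  have i3: "set_integrable lborel {a..b} \<phi>'" by (intro borel_integrable_atLeastAtMost' sub phi)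
  note ir = has_densityD(2)[OF R, of a b]
  show "set_integrable lborel {a..b} (\<lambda>x. \<phi>' x * R x + \<phi> x * r x)" by (rule set_integral_add(1)[OF i1 i2])
  define h where "h = (\<lambda>(y,z). if z \<le> y then (indicator {a..b} y * \<phi>' y) * (indicator {a..b} z * r z) else (0::real))"
  have [measurable]: "h \<in> borel_measurable (lborel \<Otimes>\<^sub>M lborel)" unfolding h_def by measurable
  have hi: "integrable (lborel \<Otimes>\<^sub>M lborel) h"
  proof (rule lborel_pair.Fubini_integrable)
    have nr: "integrable lborel (\<lambda>z. \<bar>indicator {a..b} z * r z\<bar>)" using ir by (simp add: set_integrable_def)
    have np: "integrable lborel (\<lambda>z. \<bar>indicator {a..b} z * \<phi>' z\<bar>)" using i3 by (simp add: set_integrable_def)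
    have hy: "integrable lborel (\<lambda>z. h (y, z))" for y
      by (rule Bochner_Integration.integrable_bound[where f="\<lambda>z. \<bar>indicator {a..b} y * \<phi>' y\<bar> * \<bar>indicator {a..b} z * r z\<bar>"])
         (use nr in \<open>auto simp: h_def abs_mult\<close>)
    show "AE x in lborel. integrable lborel (\<lambda>y. h (x, y))" using hy by simp
    show "integrable lborel (\<lambda>x. LINT y|lborel. norm (h (x, y)))"
    proof (rule Bochner_Integration.integrable_bound[where f="\<lambda>y. \<bar>indicator {a..b} y * \<phi>' y\<bar> * (LINT z|lborel. \<bar>indicator {a..b} z * r z\<bar>)"])
      show "AE x in lborel. norm (LINT y|lborel. norm (h (x, y))) \<le> norm (\<bar>indicat_real {a..b} x * \<phi>' x\<bar> * (LINT z|lborel. \<bar>indicat_real {a..b} z * r z\<bar>))"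
      proof (rule AE_I2)
        fix x
        have "(LINT y|lborel. norm (h (x, y))) \<le> (LINT z|lborel. \<bar>indicat_real {a..b} x * \<phi>' x\<bar> * \<bar>indicat_real {a..b} z * r z\<bar>)"
          by (rule integral_mono) (use hy nr in \<open>auto simp: h_def abs_mult\<close>)
        then show "norm (LINT y|lborel. norm (h (x, y))) \<le> norm (\<bar>indicat_real {a..b} x * \<phi>' x\<bar> * (LINT z|lborel. \<bar>indicat_real {a..b} z * r z\<bar>))"
          by simp
      qed
    qed (use np in auto)
  qed auto
  have inner1: "(LINT z|lborel. h (y,z)) = indicator {a..b} y * \<phi>' y * (R y - R a)" for y
  proof (cases "y \<in> {a..b}")
    case True
    have "(LINT z|lborel. h (y,z)) = (LINT z|lborel. \<phi>' y * (indicator {a..y} z * r z))"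
      by (intro Bochner_Integration.integral_cong refl) (use True in \<open>auto simp: h_def indicator_def\<close>)
    also have "\<dots> = \<phi>' y * (R y - R a)" using has_densityD(3)[OF R, of a y] True by (simp add: set_lebesgue_integral_def)
    finally show ?thesis using True by simp
  next
    case False
    then have "h (y,z) = 0" for z by (simp add: h_def)
    then show ?thesis using False by simp
  qed
  have dphi: "has_density \<phi> \<phi>'" by (rule has_density_C1[OF phi])
  have inner2: "(LINT y|lborel. h (y,z)) = indicator {a..b} z * r z * (\<phi> b - \<phi> z)" for z
  proof (cases "z \<in> {a..b}")
    case True
    have "(LINT y|lborel. h (y,z)) = (LINT y|lborel. (indicator {z..b} y * \<phi>' y) * r z)"
      by (intro Bochner_Integration.integral_cong refl) (use True in \<open>auto simp: h_def indicator_def\<close>)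
    also have "\<dots> = (\<phi> b - \<phi> z) * r z" using has_densityD(3)[OF dphi, of z b] True by (simp add: set_lebesgue_integral_def)
    finally show ?thesis using True by simp
  next
    case False
    then have "h (y,z) = 0" for y by (simp add: h_def)
    then show ?thesis using False by simp
  qed
  have "(LINT z|lborel. LINT y|lborel. h (y,z)) = (LINT y|lborel. LINT z|lborel. h (y,z))"
    using lborel_pair.Fubini_integral[of "\<lambda>y z. h (y,z)"] hi by simp
  then have "(LINT z|lborel. indicator {a..b} z * r z * (\<phi> b - \<phi> z)) = (LINT y|lborel. indicator {a..b} y * \<phi>' y * (R y - R a))"
    by (simp only: inner1 inner2)
  moreover have "(LINT z|lborel. indicator {a..b} z * r z * (\<phi> b - \<phi> z)) = \<phi> b * (R b - R a) - (LINT x:{a..b}|lborel. \<phi> x * r x)"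
  proof -
    have "(LINT z|lborel. indicator {a..b} z * r z * (\<phi> b - \<phi> z)) = (LINT z|lborel. \<phi> b * (indicator {a..b} z *\<^sub>R r z) - indicator {a..b} z *\<^sub>R (\<phi> z * r z))"
      by (intro Bochner_Integration.integral_cong refl) (simp add: algebra_simps)
    also have "\<dots> = \<phi> b * (R b - R a) - (LINT x:{a..b}|lborel. \<phi> x * r x)"
      using ir i2 has_densityD(3)[OF R ab] by (subst Bochner_Integration.integral_diff) (auto simp: set_integrable_def set_lebesgue_integral_def)
    finally show ?thesis .
  qed
  moreover have "(LINT y|lborel. indicator {a..b} y * \<phi>' y * (R y - R a)) = (LINT x:{a..b}|lborel. \<phi>' x * R x) - (\<phi> b - \<phi> a) * R a"
  proof -
    have "(LINT y|lborel. indicator {a..b} y * \<phi>' y * (R y - R a)) = (LINT y|lborel. indicator {a..b} y *\<^sub>R (\<phi>' y * R y) - (indicator {a..b} y *\<^sub>R \<phi>' y) * R a)"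
      by (intro Bochner_Integration.integral_cong refl) (simp add: algebra_simps)
    also have "\<dots> = (LINT x:{a..b}|lborel. \<phi>' x * R x) - (\<phi> b - \<phi> a) * R a"
      using i3 i1 has_densityD(3)[OF dphi ab] by (subst Bochner_Integration.integral_diff) (auto simp: set_integrable_def set_lebesgue_integral_def)
    finally show ?thesis .
  qed
  ultimately have "\<phi> b * R b - \<phi> a * R a = (LINT x:{a..b}|lborel. \<phi>' x * R x) + (LINT x:{a..b}|lborel. \<phi> x * r x)"
    by (simp add: algebra_simps)
  then show "\<phi> b * R b - \<phi> a * R a = (LINT x:{a..b}|lborel. \<phi>' x * R x + \<phi> x * r x)"
    using set_integral_add(2)[OF i1 i2] by simp
qed

text \<open>First \<open>f\<close> is truncated, with small error by dominated convergence. The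
  truncated function is almost everywhere a limit of continuous functions, and clipping those to the
  same bound supplies the dominating function for the second limit.\<close>

lemma L1_continuous_approximation:
  fixes f :: "real \<Rightarrow> real"
  assumes f: "set_integrable lborel {a..b} f" and [measurable]: "f \<in> borel_measurable borel" and e: "e > 0"
  obtains g where "continuous_on UNIV g" "(\<integral>\<^sup>+x. ennreal \<bar>f x - g x\<bar> * indicator {a..b} x \<partial>lborel) < ennreal e"
proof -
  have [simp]: "emeasure lborel {a..b} < \<top>" by (simp add: emeasure_lborel_Icc_eq)
  let ?clip = "\<lambda>B x. max (- B) (min B x) :: real"
  have fi: "integrable lborel (\<lambda>x. indicator {a..b} x * f x)" using f by (simp add: set_integrable_def)
  have "(\<lambda>n. LINT x|lborel. \<bar>f x - ?clip (real n) (f x)\<bar> * indicator {a..b} x) \<longlonglongrightarrow> (LINT x|(lborel::real measure). 0)"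
  proof (rule integral_dominated_convergence[where w="\<lambda>x. \<bar>indicator {a..b} x * f x\<bar>"])
    show "AE x in lborel. (\<lambda>n. \<bar>f x - ?clip (real n) (f x)\<bar> * indicator {a..b} x) \<longlonglongrightarrow> 0"
    proof (rule AE_I2)
      fix x
      obtain N :: nat where N: "\<bar>f x\<bar> \<le> N" using real_arch_simple by blast
      have "\<forall>\<^sub>F n in sequentially. 0 = \<bar>f x - ?clip (real n) (f x)\<bar> * indicator {a..b} x"
        using eventually_ge_at_top[of N] by eventually_elim (use N in auto)
      then show "(\<lambda>n. \<bar>f x - ?clip (real n) (f x)\<bar> * indicator {a..b} x) \<longlonglongrightarrow> 0"
        by (rule Lim_transform_eventually[OF tendsto_const])
    qed
    show "AE x in lborel. norm (\<bar>f x - ?clip (real n) (f x)\<bar> * indicator {a..b} x) \<le> \<bar>indicator {a..b} x * f x\<bar>" for n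
      by (intro AE_I2) (auto simp: indicator_def)
  qed (use fi in auto)
  then have "(\<lambda>n. LINT x|lborel. \<bar>f x - ?clip (real n) (f x)\<bar> * indicator {a..b} x) \<longlonglongrightarrow> 0" by simp
  then obtain n where n: "(LINT x|lborel. \<bar>f x - ?clip (real n) (f x)\<bar> * indicator {a..b} x) < e/2"
    using order_tendstoD(2)[of _ 0 sequentially "e/2"] e by (auto simp: eventually_sequentially)
  define B where "B = real n"
  define fB where "fB x = ?clip B (f x)" for x
  have [measurable]: "fB \<in> borel_measurable borel" unfolding fB_def by measurable
  have iB: "integrable lborel (\<lambda>x. \<bar>f x - fB x\<bar> * indicator {a..b} x)"
    by (rule Bochner_Integration.integrable_bound[OF fi]) (auto simp: fB_def B_def indicator_def)
  have "f \<in> borel_measurable lebesgue" by (rule measurable_completion) simp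
  have "fB measurable_on {a..b}"
    by (rule lebesgue_measurable_imp_measurable_on) (auto intro: measurable_completion)
  then obtain N g where N: "negligible N" and g: "\<And>n. continuous_on UNIV (g n)"
    "\<And>x. x \<notin> N \<Longrightarrow> (\<lambda>n. g n x) \<longlonglongrightarrow> (if x \<in> {a..b} then fB x else 0)"
    unfolding measurable_on_def by blast
  have cont: "continuous_on UNIV (\<lambda>x. ?clip B (g n x))" for n
    by (intro continuous_intros continuous_on_max continuous_on_min g)
  have [measurable]: "(\<lambda>x. ?clip B (g n x)) \<in> borel_measurable borel" for n
    by (rule borel_measurable_continuous_onI[OF cont])
  have AEN: "AE x in lborel. x \<notin> N"
  proof -
    have "AE x in lebesgue. x \<notin> N" using N by (intro AE_not_in) (simp add: negligible_iff_null_sets)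
    then show ?thesis by (simp add: AE_completion_iff)
  qed
  have "(\<lambda>n. LINT x|lborel. \<bar>fB x - ?clip B (g n x)\<bar> * indicator {a..b} x) \<longlonglongrightarrow> (LINT x|(lborel::real measure). 0)"
  proof (rule integral_dominated_convergence[where w="\<lambda>x. 2 * B * indicator {a..b} x"])
    show "AE x in lborel. (\<lambda>n. \<bar>fB x - ?clip B (g n x)\<bar> * indicator {a..b} x) \<longlonglongrightarrow> 0"
      using AEN
    proof eventually_elim
      case (elim x)
      show ?case
      proof (cases "x \<in> {a..b}")
        case True
        have "(\<lambda>n. g n x) \<longlonglongrightarrow> fB x" using g(2)[OF elim] True by simp
        then have "(\<lambda>n. \<bar>fB x - ?clip B (g n x)\<bar>) \<longlonglongrightarrow> \<bar>fB x - ?clip B (fB x)\<bar>" by (intro tendsto_intros)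
        then show ?thesis using True by (simp add: fB_def B_def)
      qed simp
    qed
    show "AE x in lborel. norm (\<bar>fB x - ?clip B (g n x)\<bar> * indicator {a..b} x) \<le> 2 * B * indicator {a..b} x" for n
      by (intro AE_I2) (auto simp: fB_def B_def indicator_def)
    show "integrable lborel (\<lambda>x. 2 * B * indicat_real {a..b} x)" by (intro integrable_mult_right integrable_real_indicator) auto
  qed auto
  then have "(\<lambda>n. LINT x|lborel. \<bar>fB x - ?clip B (g n x)\<bar> * indicator {a..b} x) \<longlonglongrightarrow> 0" by simp
  then obtain m where m: "(LINT x|lborel. \<bar>fB x - ?clip B (g m x)\<bar> * indicator {a..b} x) < e/2"
    using order_tendstoD(2)[of _ 0 sequentially "e/2"] e by (auto simp: eventually_sequentially)
  have im: "integrable lborel (\<lambda>x. \<bar>fB x - ?clip B (g m x)\<bar> * indicator {a..b} x)"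
  proof (rule Bochner_Integration.integrable_bound[where f="\<lambda>x. 2 * B * indicat_real {a..b} x"])
    show "integrable lborel (\<lambda>x. 2 * B * indicat_real {a..b} x)" by (intro integrable_mult_right integrable_real_indicator) auto
    show "AE x in lborel. norm (\<bar>fB x - ?clip B (g m x)\<bar> * indicator {a..b} x) \<le> norm (2 * B * indicat_real {a..b} x)"
      by (intro AE_I2) (auto simp: fB_def B_def indicator_def)
  qed measurable
  show ?thesis
  proof (rule that[OF cont[of m]])
    have "(\<integral>\<^sup>+x. ennreal \<bar>f x - ?clip B (g m x)\<bar> * indicator {a..b} x \<partial>lborel)
      \<le> (\<integral>\<^sup>+x. ennreal (\<bar>f x - fB x\<bar> * indicator {a..b} x + \<bar>fB x - ?clip B (g m x)\<bar> * indicator {a..b} x) \<partial>lborel)"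
      by (intro nn_integral_mono) (auto simp: indicator_def simp flip: ennreal_plus intro!: ennreal_leI)
    also have "\<dots> = ennreal ((LINT x|lborel. \<bar>f x - fB x\<bar> * indicator {a..b} x) + (LINT x|lborel. \<bar>fB x - ?clip B (g m x)\<bar> * indicator {a..b} x))"
      by (subst nn_integral_eq_integral) (use iB im in auto)
    also have "\<dots> < ennreal e" using n m e by (intro ennreal_lessI) (auto simp: fB_def B_def)
    finally show "(\<integral>\<^sup>+x. ennreal \<bar>f x - ?clip B (g m x)\<bar> * indicator {a..b} x \<partial>lborel) < ennreal e" .
  qed
qed

text \<open>The one-sided bound on the derivative comes from the variational inequality.\<close>

lemma has_density_abs_continuous:
  assumes ac: "\<And>a b. abs_continuous_on {a..b} f"
  and G: "\<And>a b. set_integrable lborel {a..b} G"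
  and le: "AE y in lborel. f differentiable (at y) \<longrightarrow> deriv f y \<le> G y"
  obtains g where "has_density f g" "AE y in lborel. (f has_real_derivative g y) (at y)"
proof -
  \<comment> \<open>\<open>lim\<close> along the fixed sequence \<open>1 / Suc n\<close> gives a
    Borel function on the whole line; where \<open>f\<close> is differentiable it is the
    derivative.\<close>
  define g where "g y = lim (\<lambda>n. (f (y + 1 / real (Suc n)) - f y) / (1 / real (Suc n)))" for y
  have cf: "continuous_on UNIV f"
  proof -
    have "isCont f x" for x
      using continuous_on_interior[OF abs_continuous_on_imp_continuous_on[OF ac[of "x - 1" "x + 1"]], of x]
      by (simp add: interior_atLeastAtMost_real)
    then show ?thesis by (simp add: continuous_at_imp_continuous_on)
  qed
  then have [measurable]: "f \<in> borel_measurable borel" by (rule borel_measurable_continuous_onI)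
  have gm [measurable]: "g \<in> borel_measurable borel"
    unfolding g_def by (rule borel_measurable_lim_metric) measurable
  have dg: "(f has_real_derivative g y) (at y)" if d: "f differentiable (at y)" for y
  proof -
    obtain D where D: "(f has_real_derivative D) (at y)" using d by (auto simp: real_differentiable_def)
    have "filterlim (\<lambda>n. 1 / real (Suc n)) (at 0) sequentially"
      unfolding filterlim_at using LIMSEQ_inverse_real_of_nat by (auto simp: inverse_eq_divide)
    then have "(\<lambda>n. (f (y + 1 / real (Suc n)) - f y) / (1 / real (Suc n))) \<longlonglongrightarrow> D"
      using D filterlim_compose[OF D[unfolded DERIV_def]] by blast
    then have "g y = D" unfolding g_def by (rule limI)
    then show ?thesis using D by simp
  qed
  let ?N = "{y. \<not> f differentiable (at y)}"
  have N: "negligible ?N"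
  proof -
    have "?N \<subseteq> (\<Union>n::nat. {y \<in> {- real n<..<real n}. \<not> f differentiable (at y)})"
    proof
      fix y assume y: "y \<in> ?N"
      obtain n :: nat where "\<bar>y\<bar> < n" using reals_Archimedean2 by blast
      then show "y \<in> (\<Union>n::nat. {y \<in> {- real n<..<real n}. \<not> f differentiable (at y)})" using y by (intro UN_I[of n]) auto
    qed
    moreover have "negligible (\<Union>n::nat. {y \<in> {- real n<..<real n}. \<not> f differentiable (at y)})"
      by (rule negligible_countable_Union) (auto intro: abs_continuous_on_differentiable_AE[OF ac, simplified])
    ultimately show ?thesis by (rule negligible_subset[rotated])
  qed
  have AEd: "AE y in lborel. f differentiable (at y)"
  proof -
    have "AE y in lebesgue. y \<notin> ?N" using N by (intro AE_not_in) (simp add: negligible_iff_null_sets)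
    then show ?thesis by (simp add: AE_completion_iff)
  qed
  have AEg: "AE y in lborel. g y \<le> G y"
    using AEd le
  proof eventually_elim
    case (elim y)
    then show ?case using DERIV_imp_deriv[OF dg[of y]] by simp
  qed
  have N2: "negligible {y. \<not> g y \<le> G y}"
    using AE_completion[OF AEg] by (simp add: negligible_iff_null_sets completion.AE_iff_null_sets)
  have "has_density f g" unfolding has_density_def
  proof (intro conjI allI impI gm)
    fix a b :: real assume ab: "a \<le> b"
    have hi: "(g has_integral f b - f a) {a..b}"
      by (rule has_integral_abs_continuous[OF ac ab N]) (auto intro: has_field_derivative_at_within dg)
    \<comment> \<open>\<open>min (g y) (G y)\<close> agrees with \<open>g\<close> almost everywhere
      and lies below \<open>G\<close> everywhere. A gauge-integrable function bounded above by an
      absolutely integrable one is absolutely integrable, which upgrades the integral of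
      \<open>g\<close> to a Lebesgue integral.\<close>
    have "((\<lambda>y. min (g y) (G y)) has_integral f b - f a) {a..b}"
      by (rule has_integral_spike[OF N2 _ hi]) auto
    then have "(\<lambda>y. min (g y) (G y)) integrable_on {a..b}" by blast
    moreover have "G absolutely_integrable_on {a..b}"
    proof -
      have "integrable lborel (\<lambda>x. indicat_real {a..b} x *\<^sub>R G x)" using G by (simp add: set_integrable_def)
      then show ?thesis unfolding set_integrable_def
        using integrable_completion[of "\<lambda>x. indicat_real {a..b} x *\<^sub>R G x" lborel] borel_measurable_integrable by blast
    qed
    ultimately have "(\<lambda>y. min (g y) (G y)) absolutely_integrable_on {a..b}"
      by (rule absolutely_integrable_absolutely_integrable_ubound) auto
    then have "g absolutely_integrable_on {a..b}"
      by (rule absolutely_integrable_spike[OF _ N2]) auto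
    then show si: "set_integrable lborel {a..b} g"
      unfolding set_integrable_def using integrable_completion[of "\<lambda>x. indicat_real {a..b} x *\<^sub>R g x" lborel] by simp
    show "f b - f a = (LINT x:{a..b}|lborel. g x)"
      using set_borel_integral_eq_integral(2)[OF si] hi by (simp add: integral_unique)
  qed
  moreover have "AE y in lborel. (f has_real_derivative g y) (at y)"
    using AEd by eventually_elim (rule dg)
  ultimately show ?thesis by (rule that)
qed

section \<open>Passage to logarithmic coordinates\<close>

lemma AE_exp_scale:
  assumes x: "(x::real) > 0" and Q: "AE z in lborel. 0 < z \<longrightarrow> Q z"
  shows "AE y in lborel. Q (x * exp y)"
proof -
  obtain N where N: "{z \<in> space lborel. \<not> (0 < z \<longrightarrow> Q z)} \<subseteq> N" "N \<in> null_sets lborel"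
    using Q by (auto simp: eventually_ae_filter)
  have [measurable]: "N \<in> sets borel" using N(2) by (auto simp: null_sets_def)
  \<comment> \<open>Substitution on a bounded interval: the weighted integral of the indicator of
    the preimage equals an integral over the null set, and the weight \<open>x * exp y\<close> is
    positive.\<close>
  have "AE y in lborel. y \<in> {- real n..real n} \<longrightarrow> x * exp y \<notin> N" for n :: nat
  proof -
    have "(\<integral>\<^sup>+y. ennreal (indicator N (x * exp y) * (x * exp y) * indicator {- real n..real n} y) \<partial>lborel)
      = (\<integral>\<^sup>+z. ennreal (indicator N z * indicator {x * exp (- real n)..x * exp (real n)} z) \<partial>lborel)"
      by (rule nn_integral_substitution[symmetric, where g="\<lambda>y. x * exp y" and g'="\<lambda>y. x * exp y"])
         (use x in \<open>auto intro!: derivative_eq_intros continuous_intros simp: set_borel_measurable_def ennreal_mult'\<close>)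
    also have "\<dots> = 0"
    proof (subst nn_integral_0_iff_AE)
      show "AE z in lborel. ennreal (indicator N z * indicator {x * exp (- real n)..x * exp (real n)} z) = 0"
        using AE_not_in[OF N(2)] by eventually_elim auto
    qed measurable
    finally have "AE y in lborel. ennreal (indicator N (x * exp y) * (x * exp y) * indicator {- real n..real n} y) = 0"
      by (subst (asm) nn_integral_0_iff_AE) auto
    then show ?thesis by eventually_elim (use x in \<open>auto simp: indicator_def ennreal_eq_0_iff mult_le_0_iff split: if_splits\<close>)
  qed
  then have "AE y in lborel. \<forall>n::nat. y \<in> {- real n..real n} \<longrightarrow> x * exp y \<notin> N" by (subst AE_all_countable) blast
  then show ?thesis
  proof eventually_elim
    case (elim y)
    obtain n :: nat where "\<bar>y\<bar> < n" using reals_Archimedean2 by blast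
    then have nN: "x * exp y \<notin> N" using elim[rule_format, of n] by (auto simp: abs_less_iff)
    have "x * exp y \<notin> {z \<in> space lborel. \<not> (0 < z \<longrightarrow> Q z)}" using N(1) nN by blast
    then show ?case using x by simp
  qed
qed

lemma measurable_exp_scale:
  assumes "(x::real) > 0" "p \<in> borel_measurable (restrict_space borel {0<..})"
  shows "(\<lambda>y. p (x * exp y)) \<in> borel_measurable borel"
  by (rule measurable_compose[OF _ assms(2)]) (use assms(1) in \<open>auto intro!: measurable_restrict_space2\<close>)

lemma set_integrable_exp_scale:
  fixes p :: "real \<Rightarrow> real"
  assumes x: "x > 0" and m: "p \<in> borel_measurable (restrict_space borel {0<..})"
    and int: "\<And>a b. 0 < a \<Longrightarrow> set_integrable lborel {a..b} p"
  shows "set_integrable lborel {a..b} (\<lambda>y. p (x * exp y))"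
proof (cases "a \<le> b")
  case True
  have [measurable]: "(\<lambda>y. p (x * exp y)) \<in> borel_measurable borel" by (rule measurable_exp_scale[OF x m])
  have 1: "set_integrable lborel {a..b} (\<lambda>y. p (x * exp y) * (x * exp y))"
    by (rule integral_substitution(1)[where g="\<lambda>y. x * exp y" and f=p])
       (use x int True in \<open>auto intro!: derivative_eq_intros continuous_intros\<close>)
  \<comment> \<open>The substitution rule produces the factor \<open>x * exp y\<close>; its
    reciprocal is continuous and removes it again.\<close>
  have "set_integrable lborel {a..b} (\<lambda>y. (1 / (x * exp y)) * (p (x * exp y) * (x * exp y)))"
    by (rule set_integrable_continuous_mult[OF 1]) (use x in \<open>auto intro!: continuous_intros\<close>)
  then show ?thesis using x by simp
qed (simp add: set_integrable_def)

text \<open>With \<open>w = deriv v\<close> this is the derivative of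
  \<open>\<lambda>y. v (x * exp y)\<close>. The exponential is increasing and Lipschitz on a bounded
  interval, so disjoint intervals go to disjoint ones of comparable length; the factor
  \<open>x * exp y\<close> is treated as in a product of two absolutely continuous
  functions.\<close>

lemma abs_continuous_on_exp_scale:
  assumes x: "x > 0" and w: "\<And>a b. 0 < a \<Longrightarrow> abs_continuous_on {a..b} w"
  shows "abs_continuous_on {a..b} (\<lambda>y. x * exp y * w (x * exp y))"
  unfolding abs_continuous_on_def
proof (intro allI impI)
  fix e :: real assume e: "e > 0"
  define B where "B = x * exp b"
  have B: "B > 0" using x by (simp add: B_def)
  have A: "x * exp a > 0" using x by simp
  have "bounded (w ` {x * exp a..B})"
    by (rule compact_imp_bounded[OF compact_continuous_image[OF abs_continuous_on_imp_continuous_on[OF w[OF A]] compact_Icc]])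
  then obtain K where K: "K > 0" "\<And>z. z \<in> {x * exp a..B} \<Longrightarrow> \<bar>w z\<bar> \<le> K" unfolding bounded_pos real_norm_def by blast
  have e2: "e / (2 * B) > 0" using e B by simp
  obtain d1 where d1: "d1 > 0" and D1: "\<And>(n::nat) s t.
        (\<forall>k<n. s k \<le> t k \<and> {s k..t k} \<subseteq> {x * exp a..B}) \<Longrightarrow>
        (\<forall>j<n. \<forall>k<n. j \<noteq> k \<longrightarrow> {s j<..<t j} \<inter> {s k<..<t k} = {}) \<Longrightarrow>
        (\<Sum>k<n. t k - s k) < d1 \<Longrightarrow> (\<Sum>k<n. \<bar>w (t k) - w (s k)\<bar>) < e / (2 * B)"
    using abs_continuous_onE[OF w[OF A] e2] by blast
  \<comment> \<open>\<open>B\<close> bounds both \<open>x * exp y\<close> and its Lipschitz constant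
    on \<open>{a..b}\<close>. The first term keeps the image intervals shorter than
    \<open>d1\<close> in total; the second bounds the variation of \<open>x * exp y\<close>,
    weighted with the bound \<open>K\<close> of \<open>w\<close>, by \<open>e / 2\<close>.\<close>
  define d where "d = min (d1 / B) (e / (2 * K * B))"
  show "\<exists>\<delta>>0. \<forall>(n::nat) s t. (\<forall>k<n. s k \<le> t k \<and> {s k..t k} \<subseteq> {a..b}) \<and>
        (\<forall>j<n. \<forall>k<n. j \<noteq> k \<longrightarrow> {s j<..<t j} \<inter> {s k<..<t k} = {}) \<and> (\<Sum>k<n. t k - s k) < \<delta> \<longrightarrow>
        (\<Sum>k<n. \<bar>x * exp (t k) * w (x * exp (t k)) - x * exp (s k) * w (x * exp (s k))\<bar>) < e"
  proof (intro exI[of _ d] conjI allI impI)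
    show "d > 0" using d1 B e K(1) by (simp add: d_def)
    fix n :: nat and s t :: "nat \<Rightarrow> real"
    assume asm: "(\<forall>k<n. s k \<le> t k \<and> {s k..t k} \<subseteq> {a..b}) \<and>
        (\<forall>j<n. \<forall>k<n. j \<noteq> k \<longrightarrow> {s j<..<t j} \<inter> {s k<..<t k} = {}) \<and> (\<Sum>k<n. t k - s k) < d"
    have st: "s k \<le> t k" "a \<le> s k" "t k \<le> b" if "k < n" for k
      using asm that by (auto simp: atLeastatMost_subset_iff)
    let ?p = "\<lambda>y. x * exp y"
    have mono: "?p u \<le> ?p v" if "u \<le> v" for u v using that x by simp
    have lip: "?p v - ?p u \<le> B * (v - u)" if "u \<le> v" "v \<le> b" for u v
    proof -
      have "1 + (u - v) \<le> exp (u - v)" by (rule exp_ge_add_one_self)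
      then have "exp v * (1 + (u - v)) \<le> exp u" by (simp add: exp_diff field_simps)
      then have "exp v - exp u \<le> exp v * (v - u)" by (simp add: algebra_simps)
      also have "\<dots> \<le> exp b * (v - u)" using that by (intro mult_right_mono) auto
      finally have "x * (exp v - exp u) \<le> x * (exp b * (v - u))" using x by (intro mult_left_mono) auto
      then show ?thesis by (simp add: B_def algebra_simps)
    qed
    have sl: "(\<Sum>k<n. ?p (t k) - ?p (s k)) \<le> B * (\<Sum>k<n. t k - s k)"
      unfolding sum_distrib_left using st by (intro sum_mono lip) auto
    have Bd: "B * (\<Sum>k<n. t k - s k) < B * d" using asm B by simp
    also have "B * d \<le> d1" using B by (simp add: d_def min_def field_simps)
    finally have sd1: "(\<Sum>k<n. ?p (t k) - ?p (s k)) < d1" using sl by simp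
    have "(\<Sum>k<n. \<bar>w (?p (t k)) - w (?p (s k))\<bar>) < e / (2 * B)"
    proof (rule D1[OF _ _ sd1])
      show "\<forall>k<n. ?p (s k) \<le> ?p (t k) \<and> {?p (s k)..?p (t k)} \<subseteq> {x * exp a..B}"
        using st mono by (auto simp: B_def atLeastatMost_subset_iff)
      show "\<forall>j<n. \<forall>k<n. j \<noteq> k \<longrightarrow> {?p (s j)<..<?p (t j)} \<inter> {?p (s k)<..<?p (t k)} = {}"
      proof (intro allI impI)
        fix j k assume jk: "j < n" "k < n" "j \<noteq> k"
        then have "{s j<..<t j} \<inter> {s k<..<t k} = {}" using asm by blast
        then have "min (t j) (t k) \<le> max (s j) (s k)" by (simp add: greaterThanLessThan_eq_iff Int_greaterThanLessThan not_less)
        then have "min (?p (t j)) (?p (t k)) \<le> max (?p (s j)) (?p (s k))"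
          using x by (auto simp: min_def max_def split: if_splits)
        then show "{?p (s j)<..<?p (t j)} \<inter> {?p (s k)<..<?p (t k)} = {}" by auto
      qed
    qed
    then have 1: "B * (\<Sum>k<n. \<bar>w (?p (t k)) - w (?p (s k))\<bar>) < e / 2" using B by (simp add: field_simps)
    have "K * (\<Sum>k<n. ?p (t k) - ?p (s k)) \<le> K * (B * (\<Sum>k<n. t k - s k))" using sl K(1) by simp
    also have "\<dots> < K * (B * d)" using Bd K(1) by simp
    also have "\<dots> \<le> K * (B * (e / (2 * K * B)))" using K(1) B by (intro mult_left_mono) (auto simp: d_def)
    also have "\<dots> = e / 2" using K(1) B by simp
    finally have 2: "K * (\<Sum>k<n. ?p (t k) - ?p (s k)) < e / 2" .
    have "(\<Sum>k<n. \<bar>?p (t k) * w (?p (t k)) - ?p (s k) * w (?p (s k))\<bar>)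
      \<le> (\<Sum>k<n. B * \<bar>w (?p (t k)) - w (?p (s k))\<bar> + K * (?p (t k) - ?p (s k)))"
    proof (rule sum_mono)
      fix k assume "k \<in> {..<n}"
      then have k: "s k \<le> t k" "a \<le> s k" "t k \<le> b" using st by auto
      have "\<bar>?p (t k) * w (?p (t k)) - ?p (s k) * w (?p (s k))\<bar>
        = \<bar>?p (t k) * (w (?p (t k)) - w (?p (s k))) + w (?p (s k)) * (?p (t k) - ?p (s k))\<bar>"
        by (simp add: algebra_simps)
      also have "\<dots> \<le> ?p (t k) * \<bar>w (?p (t k)) - w (?p (s k))\<bar> + \<bar>w (?p (s k))\<bar> * (?p (t k) - ?p (s k))"
        using x mono[OF k(1)] by (intro order_trans[OF abs_triangle_ineq]) (simp add: abs_mult)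
      also have "\<dots> \<le> B * \<bar>w (?p (t k)) - w (?p (s k))\<bar> + K * (?p (t k) - ?p (s k))"
        using mono[OF k(1)] mono[OF k(2)] mono[OF k(3)] mono[of "s k" b] k K(2)[of "?p (s k)"]
        by (intro add_mono mult_right_mono) (auto simp: B_def)
      finally show "\<bar>?p (t k) * w (?p (t k)) - ?p (s k) * w (?p (s k))\<bar>
        \<le> B * \<bar>w (?p (t k)) - w (?p (s k))\<bar> + K * (?p (t k) - ?p (s k))" .
    qed
    also have "\<dots> = B * (\<Sum>k<n. \<bar>w (?p (t k)) - w (?p (s k))\<bar>) + K * (\<Sum>k<n. ?p (t k) - ?p (s k))"
      by (simp add: sum.distrib sum_distrib_left)
    also have "\<dots> < e" using 1 2 by simp
    finally show "(\<Sum>k<n. \<bar>?p (t k) * w (?p (t k)) - ?p (s k) * w (?p (s k))\<bar>) < e" .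
  qed
qed

section \<open>Brownian motion and its filtration\<close>

locale brownian_motion =
  fixes M :: "'a measure" and W :: "real \<Rightarrow> 'a \<Rightarrow> real"
  assumes BM: "std_brownian_motion M W"
begin

sublocale prob_space M using BM by (simp add: std_brownian_motion_def)

lemma W_measurable: "t \<ge> 0 \<Longrightarrow> W t \<in> borel_measurable M"
  using BM by (simp add: std_brownian_motion_def)

lemma W_0: "\<omega> \<in> space M \<Longrightarrow> W 0 \<omega> = 0"
  using BM by (simp add: std_brownian_motion_def)

lemma W_continuous: "\<omega> \<in> space M \<Longrightarrow> continuous_on {0..} (\<lambda>t. W t \<omega>)"
  using BM by (simp add: std_brownian_motion_def)

lemma W_increment_distributed:
  "0 \<le> s \<Longrightarrow> s < t \<Longrightarrow> distributed M lborel (\<lambda>\<omega>. W t \<omega> - W s \<omega>) (\<lambda>y. ennreal (normal_density 0 (sqrt (t - s)) y))"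
  using BM by (simp add: std_brownian_motion_def)

lemma W_increments_indep:
  "sorted ts \<Longrightarrow> (\<And>t. t \<in> set ts \<Longrightarrow> 0 \<le> t) \<Longrightarrow>
   indep_vars (\<lambda>_. borel) (\<lambda>i \<omega>. W (ts ! Suc i) \<omega> - W (ts ! i) \<omega>) {..<length ts - 1}"
  using BM by (simp add: std_brownian_motion_def)

lemma W_continuous_max: "\<omega> \<in> space M \<Longrightarrow> continuous_on UNIV (\<lambda>t. W (max 0 t) \<omega>)"
  by (rule continuous_on_compose2[OF W_continuous]) (auto intro!: continuous_intros)

text \<open>Sampling the path at the grid point to the left of \<open>s\<close> is jointly
  measurable, since the index takes countably many values; path continuity gives the limit.
  \<open>max 0\<close> is there because nothing is known of \<open>W\<close> at negative
  times.\<close>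

lemma W_joint_measurable: "(\<lambda>(\<omega>, s). W (max 0 s) \<omega>) \<in> borel_measurable (M \<Otimes>\<^sub>M borel)"
proof (rule borel_measurable_LIMSEQ_real)
  let ?g = "\<lambda>(n::nat) z. nat \<lfloor>max 0 (snd z) * real (Suc n)\<rfloor>"
  let ?f = "\<lambda>(n::nat) z. W (real (?g n z) / real (Suc n)) (fst z)"
  show "?f n \<in> borel_measurable (M \<Otimes>\<^sub>M borel)" for n
  proof (rule measurable_compose_countable[where f="\<lambda>i z. W (real i / real (Suc n)) (fst z)" and g="?g n"])
    show "(\<lambda>z. W (real i / real (Suc n)) (fst z)) \<in> borel_measurable (M \<Otimes>\<^sub>M borel)" for i
      by (rule measurable_compose[OF measurable_fst W_measurable]) simp
    show "?g n \<in> M \<Otimes>\<^sub>M borel \<rightarrow>\<^sub>M count_space UNIV" by measurable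
  qed
  fix z assume z: "z \<in> space (M \<Otimes>\<^sub>M (borel :: real measure))"
  obtain \<omega> s where zz: "z = (\<omega>, s)" by (cases z)
  have om: "\<omega> \<in> space M" using z zz by (auto simp: space_pair_measure)
  have lim: "(\<lambda>n. real (?g n z) / real (Suc n)) \<longlonglongrightarrow> max 0 s"
  proof (rule real_tendsto_sandwich)
    have b: "max 0 s * real (Suc n) - 1 \<le> real (?g n z) \<and> real (?g n z) \<le> max 0 s * real (Suc n)" for n
    proof -
      have "max 0 s * real (Suc n) \<ge> 0" by simp
      then show ?thesis unfolding zz snd_conv by linarith
    qed
    have N: "real (Suc n) > 0" for n by simp
    have "(max 0 s * real (Suc n) - 1) / real (Suc n) \<le> real (?g n z) / real (Suc n)" for n
      using b by (intro divide_right_mono) auto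
    moreover have "(max 0 s * real (Suc n) - 1) / real (Suc n) = max 0 s - 1 / real (Suc n)" for n
      using N[of n] by (simp add: diff_divide_distrib del: of_nat_Suc)
    ultimately show "\<forall>\<^sub>F n in sequentially. max 0 s - 1 / real (Suc n) \<le> real (?g n z) / real (Suc n)"
      by (intro always_eventually allI) metis
    have "real (?g n z) / real (Suc n) \<le> max 0 s" for n
      using b N[of n] by (subst pos_divide_le_eq) auto
    then show "\<forall>\<^sub>F n in sequentially. real (?g n z) / real (Suc n) \<le> max 0 s"
      by (intro always_eventually allI)
    have "(\<lambda>n. max 0 s - 1 / real (Suc n)) \<longlonglongrightarrow> max 0 s - 0"
      by (intro tendsto_diff tendsto_const) (use LIMSEQ_inverse_real_of_nat in \<open>simp add: inverse_eq_divide\<close>)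
    then show "(\<lambda>n. max 0 s - 1 / real (Suc n)) \<longlonglongrightarrow> max 0 s" by simp
  qed simp
  have "isCont (\<lambda>t. W (max 0 t) \<omega>) (max 0 s)"
    using W_continuous_max[OF om] by (simp add: continuous_on_eq_continuous_at)
  from isCont_tendsto_compose[OF this lim]
  show "(\<lambda>n. ?f n z) \<longlonglongrightarrow> (case z of (\<omega>, s) \<Rightarrow> W (max 0 s) \<omega>)" by (simp add: zz)
qed

abbreviation F where "F \<equiv> bm_filtration M W"

lemma filtration_generator:
  "(\<Union>s\<in>{0..t}. {W s -` B \<inter> space M | B. B \<in> sets borel}) \<union> null_sets M \<subseteq> sets M"
  using W_measurable by (auto intro: measurable_sets)

lemma sets_filtration: "sets (F t) = sigma_sets (space M)
     ((\<Union>s\<in>{0..t}. {W s -` B \<inter> space M | B. B \<in> sets borel}) \<union> null_sets M)"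
  unfolding bm_filtration_def
  by (rule sets_measure_of) (use filtration_generator sets.sets_into_space in blast)

lemma space_filtration [simp]: "space (F t) = space M"
  unfolding bm_filtration_def
  by (rule space_measure_of) (use filtration_generator sets.sets_into_space in blast)

lemma filtration_subset: "sets (F t) \<subseteq> sets M"
  unfolding sets_filtration by (rule sets.sigma_sets_subset[OF filtration_generator])

lemma null_sets_filtration: "N \<in> null_sets M \<Longrightarrow> N \<in> sets (F t)"
  unfolding sets_filtration by (intro sigma_sets.Basic) auto

lemma W_filtration_measurable: "0 \<le> s \<Longrightarrow> s \<le> t \<Longrightarrow> W s \<in> borel_measurable (F t)"
proof (rule measurableI)
  fix B assume "B \<in> sets (borel :: real measure)" "0 \<le> s" "s \<le> t"
  then show "W s -` B \<inter> space (F t) \<in> sets (F t)"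
    unfolding space_filtration unfolding sets_filtration by (intro sigma_sets.Basic) auto
qed simp

lemma filtration_measurable_M: "f \<in> F t \<rightarrow>\<^sub>M N \<Longrightarrow> f \<in> M \<rightarrow>\<^sub>M N"
  using filtration_subset[of t] by (auto simp: measurable_def)

section \<open>Independence of increments from the past\<close>

definition cylinders :: "real \<Rightarrow> 'a set set" where
  "cylinders t = {{\<omega>\<in>space M. \<forall>s\<in>J. W s \<omega> \<in> B s} |J B. finite J \<and> J \<subseteq> {0..t} \<and> (\<forall>s. B s \<in> sets borel)}"

lemma cylinder_events: "cylinders t \<subseteq> sets M"
proof
  fix C assume "C \<in> cylinders t"
  then obtain J B where C: "C = {\<omega>\<in>space M. \<forall>s\<in>J. W s \<omega> \<in> B s}" "finite J" "J \<subseteq> {0..t}" "\<forall>s. B s \<in> sets borel"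
    unfolding cylinders_def by auto
  have "{\<omega>\<in>space M. W s \<omega> \<in> B s} \<in> sets M" if "s \<in> J" for s
    using measurable_sets[OF W_measurable[of s], of "B s"] C that by (auto simp: vimage_def Int_def conj_commute)
  then show "C \<in> sets M" unfolding C(1) by (rule sets.sets_Collect_finite_All[OF _ C(2)])
qed

text \<open>Independence is checked on a generator stable under intersection. Null sets belong to
  the completed filtration and have to be carried along; intersecting with one gives a null set
  again.\<close>

lemma cylinders_Int_stable: "Int_stable (cylinders t \<union> null_sets M)"
proof (rule Int_stableI)
  fix a b assume ab: "a \<in> cylinders t \<union> null_sets M" "b \<in> cylinders t \<union> null_sets M"
  show "a \<inter> b \<in> cylinders t \<union> null_sets M"
  proof (cases "a \<in> null_sets M \<or> b \<in> null_sets M")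
    case True
    moreover have "a \<in> sets M" "b \<in> sets M" using ab cylinder_events[of t] by auto
    ultimately show ?thesis by (auto intro: null_set_Int1 null_set_Int2)
  next
    case False
    then obtain J B J' B' where a: "a = {\<omega>\<in>space M. \<forall>s\<in>J. W s \<omega> \<in> B s}" "finite J" "J \<subseteq> {0..t}" "\<forall>s. B s \<in> sets borel"
      and b: "b = {\<omega>\<in>space M. \<forall>s\<in>J'. W s \<omega> \<in> B' s}" "finite J'" "J' \<subseteq> {0..t}" "\<forall>s. B' s \<in> sets borel"
      using ab unfolding cylinders_def by auto
    define B'' where "B'' s = (if s \<in> J then B s else UNIV) \<inter> (if s \<in> J' then B' s else UNIV)" for s
    have "a \<inter> b = {\<omega>\<in>space M. \<forall>s\<in>J \<union> J'. W s \<omega> \<in> B'' s}"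
      unfolding a(1) b(1) B''_def by auto
    moreover have "\<forall>s. B'' s \<in> sets borel" using a(4) b(4) by (auto simp: B''_def)
    ultimately have "a \<inter> b \<in> cylinders t" unfolding cylinders_def
      using a(2,3) b(2,3) by (intro CollectI exI[of _ "J \<union> J'"] exI[of _ B'']) auto
    then show ?thesis by simp
  qed
qed

lemma sets_filtration_cylinders: "sets (F t) \<subseteq> sigma_sets (space M) (cylinders t \<union> null_sets M)"
  unfolding sets_filtration
proof (rule sigma_sets_mono', rule Un_least)
  show "(\<Union>s\<in>{0..t}. {W s -` B \<inter> space M |B. B \<in> sets borel}) \<subseteq> cylinders t \<union> null_sets M"
  proof clarsimp
    fix s and B :: "real set" assume s: "0 \<le> s" "s \<le> t" and B: "B \<in> sets borel"
    have "W s -` B \<inter> space M \<in> cylinders t"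
      unfolding cylinders_def by (intro CollectI exI[of _ "{s}"] exI[of _ "\<lambda>_. B"]) (use s B in auto)
    then show "W s -` B \<inter> space M \<notin> null_sets M \<Longrightarrow> W s -` B \<inter> space M \<in> cylinders t" by simp
  qed
qed auto

text \<open>The hypothesis on \<open>W\<close> speaks of increments along one finite list of times.
  The list is made of \<open>J\<close>, of \<open>0\<close> so that each \<open>W s\<close> is the
  sum of the preceding increments, and of \<open>t\<close> followed by \<open>t + h\<close> so that
  the last increment is the one in question.\<close>

lemma cylinder_increment_indep:
  assumes t: "0 \<le> t" "0 < h" and C: "C \<in> cylinders t" and E: "E \<in> sets borel"
  shows "prob (C \<inter> ((\<lambda>\<omega>. W (t + h) \<omega> - W t \<omega>) -` E \<inter> space M))
      = prob C * prob ((\<lambda>\<omega>. W (t + h) \<omega> - W t \<omega>) -` E \<inter> space M)"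
proof -
  obtain J B where Ceq: "C = {\<omega>\<in>space M. \<forall>s\<in>J. W s \<omega> \<in> B s}" and J: "finite J" "J \<subseteq> {0..t}" and B: "\<And>s. B s \<in> sets borel"
    using C unfolding cylinders_def by auto
  define L where "L = sorted_list_of_set (J \<union> {0, t})"
  have "finite (J \<union> {0, t})" using J by simp
  then have L: "sorted L" "set L = J \<union> {0,t}"
    unfolding L_def by (simp_all only: sorted_sorted_list_of_set set_sorted_list_of_set)
  define m where "m = length L - 1"
  have lenL: "length L = Suc m" using L(2) by (cases L) (auto simp: m_def)
  define ts where "ts = L @ [t + h]"
  have ts: "sorted ts" "\<And>s. s \<in> set ts \<Longrightarrow> 0 \<le> s" "length ts - 1 = Suc m"
    using L J t by (auto simp: ts_def sorted_append lenL)
  have L0: "L ! 0 = 0"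
  proof -
    obtain j where j: "j < length L" "L ! j = 0" using L(2) by (metis UnI2 in_set_conv_nth insertI1)
    have "L ! 0 \<le> L ! j" using sorted_nth_mono[OF L(1), of 0 j] j by simp
    moreover have "L ! 0 \<in> set L" using lenL by (intro nth_mem) simp
    ultimately show ?thesis using j L(2) J(2) t by auto
  qed
  have Lm: "L ! m = t"
  proof -
    obtain j where j: "j < length L" "L ! j = t" using L(2) by (metis UnI2 in_set_conv_nth insertI1 insertI2)
    have "L ! j \<le> L ! m" using sorted_nth_mono[OF L(1), of j m] j lenL by simp
    moreover have "L ! m \<in> set L" using lenL by (intro nth_mem) simp
    ultimately show ?thesis using j L(2) J(2) t by auto
  qed
  define X where "X i \<omega> = W (ts ! Suc i) \<omega> - W (ts ! i) \<omega>" for i \<omega>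
  have ind: "indep_vars (\<lambda>_. borel) X {..<Suc m}"
    using W_increments_indep[OF ts(1,2)] unfolding ts(3) X_def[abs_def] by simp
  have Xm: "X m \<omega> = W (t + h) \<omega> - W t \<omega>" for \<omega>
    using Lm lenL by (simp add: X_def ts_def nth_append)
  have tele: "(\<Sum>i<j. X i \<omega>) = W (L ! j) \<omega>" if "j \<le> m" "\<omega> \<in> space M" for j \<omega>
    using that(1)
  proof (induction j)
    case 0 then show ?case using L0 W_0[OF that(2)] by simp
  next
    case (Suc j) then show ?case using lenL by (simp add: X_def ts_def nth_append)
  qed
  have "\<forall>s\<in>J. \<exists>j\<le>m. L ! j = s"
  proof
    fix s assume "s \<in> J"
    then have "s \<in> set L" using L(2) by simp
    then obtain j where "j < length L" "L ! j = s" by (meson in_set_conv_nth)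
    then show "\<exists>j\<le>m. L ! j = s" using lenL by (intro exI[of _ j]) auto
  qed
  then obtain idx where idx: "\<And>s. s \<in> J \<Longrightarrow> idx s \<le> m \<and> L ! idx s = s" by metis
  have iv: "indep_var (PiM {..<m} (\<lambda>_. borel)) (\<lambda>\<omega>. restrict (\<lambda>i. X i \<omega>) {..<m}) (PiM {m} (\<lambda>_. borel)) (\<lambda>\<omega>. restrict (\<lambda>i. X i \<omega>) {m})"
    by (rule indep_var_restrict[OF ind]) auto
  define A1 where "A1 = {x \<in> space (PiM {..<m} (\<lambda>_. borel :: real measure)). \<forall>s\<in>J. (\<Sum>i<idx s. x i) \<in> B s}"
  define A2 where "A2 = {x \<in> space (PiM {m} (\<lambda>_. borel :: real measure)). x m \<in> E}"
  have A1: "A1 \<in> sets (PiM {..<m} (\<lambda>_. borel))"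
    unfolding A1_def
  proof (rule sets.sets_Collect_finite_All[OF _ J(1)])
    show "{x \<in> space (PiM {..<m} (\<lambda>_. borel :: real measure)). (\<Sum>i<idx s. x i) \<in> B s} \<in> sets (PiM {..<m} (\<lambda>_. borel))" if s: "s \<in> J" for s
    proof -
      have "(\<lambda>x. \<Sum>i<idx s. x i) \<in> borel_measurable (PiM {..<m} (\<lambda>_. borel :: real measure))"
        using idx[OF s] by (intro borel_measurable_sum measurable_component_singleton) auto
      from measurable_sets[OF this B[of s]] show ?thesis by (simp add: vimage_def Int_def conj_commute)
    qed
  qed
  have A2: "A2 \<in> sets (PiM {m} (\<lambda>_. borel))"
  proof -
    have "(\<lambda>x. x m) \<in> borel_measurable (PiM {m} (\<lambda>_. borel :: real measure))"
      by (intro measurable_component_singleton) auto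
    from measurable_sets[OF this E] show ?thesis by (simp add: A2_def vimage_def Int_def conj_commute)
  qed
  have e1: "(\<lambda>\<omega>. restrict (\<lambda>i. X i \<omega>) {..<m}) -` A1 \<inter> space M = C"
  proof (intro equalityI subsetI)
    fix \<omega> assume "\<omega> \<in> (\<lambda>\<omega>. restrict (\<lambda>i. X i \<omega>) {..<m}) -` A1 \<inter> space M"
    then have om: "\<omega> \<in> space M" "\<And>s. s \<in> J \<Longrightarrow> (\<Sum>i<idx s. restrict (\<lambda>i. X i \<omega>) {..<m} i) \<in> B s"
      by (auto simp: A1_def)
    have "W s \<omega> \<in> B s" if s: "s \<in> J" for s
      using om(2)[OF s] tele[of "idx s" \<omega>] idx[OF s] om(1) by simp
    then show "\<omega> \<in> C" using om Ceq by auto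
  next
    fix \<omega> assume "\<omega> \<in> C"
    then have om: "\<omega> \<in> space M" "\<And>s. s \<in> J \<Longrightarrow> W s \<omega> \<in> B s" using Ceq by auto
    have "(\<Sum>i<idx s. restrict (\<lambda>i. X i \<omega>) {..<m} i) \<in> B s" if s: "s \<in> J" for s
      using om(2)[OF s] tele[of "idx s" \<omega>] idx[OF s] om(1) by simp
    then show "\<omega> \<in> (\<lambda>\<omega>. restrict (\<lambda>i. X i \<omega>) {..<m}) -` A1 \<inter> space M"
      using om(1) by (auto simp: A1_def space_PiM)
  qed
  have e2: "(\<lambda>\<omega>. restrict (\<lambda>i. X i \<omega>) {m}) -` A2 \<inter> space M = (\<lambda>\<omega>. W (t + h) \<omega> - W t \<omega>) -` E \<inter> space M"
    by (auto simp: A2_def space_PiM Xm)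
  have "(\<lambda>x. (restrict (\<lambda>i. X i x) {..<m}, restrict (\<lambda>i. X i x) {m})) -` (A1 \<times> A2) \<inter> space M
     = C \<inter> ((\<lambda>\<omega>. W (t + h) \<omega> - W t \<omega>) -` E \<inter> space M)"
    unfolding e1[symmetric] e2[symmetric] by auto
  then show ?thesis using indep_varD[OF iv A1 A2] unfolding e1 e2 by simp
qed

text \<open>Null sets are independent of everything, so \<open>cylinder_increment_indep\<close>
  settles a whole generator of the filtration, and independence passes to the generated
  sigma-algebras.\<close>

lemma filtration_increment_indep:
  assumes t: "0 \<le> t" "0 < h" and xi: "\<xi> \<in> borel_measurable (F t)"
  shows "indep_var borel \<xi> borel (\<lambda>\<omega>. W (t + h) \<omega> - W t \<omega>)"
proof -
  let ?D = "\<lambda>\<omega>. W (t + h) \<omega> - W t \<omega>"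
  let ?DE = "{?D -` E \<inter> space M | E. E \<in> sets borel}"
  have Dm: "?D \<in> borel_measurable M" using t by (intro borel_measurable_diff W_measurable) auto
  have "indep_set (cylinders t \<union> null_sets M) ?DE"
  proof (rule indep_setI)
    show "cylinders t \<union> null_sets M \<subseteq> events" using cylinder_events by auto
    show "?DE \<subseteq> events" using measurable_sets[OF Dm] by auto
    fix a b assume a: "a \<in> cylinders t \<union> null_sets M" and b: "b \<in> ?DE"
    obtain E where E: "E \<in> sets borel" "b = ?D -` E \<inter> space M" using b by auto
    have bM: "b \<in> sets M" using E measurable_sets[OF Dm] by auto
    show "prob (a \<inter> b) = prob a * prob b"
    proof (cases "a \<in> null_sets M")
      case True
      then have "a \<inter> b \<in> null_sets M" using bM by (intro null_set_Int2)
      then show ?thesis using True by (simp add: measure_eq_0_null_sets)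
    next
      case False
      then show ?thesis using a E cylinder_increment_indep[OF t] by auto
    qed
  qed
  moreover have "Int_stable ?DE"
  proof (rule Int_stableI)
    fix a b assume "a \<in> ?DE" "b \<in> ?DE"
    then obtain E E' where "E \<in> sets borel" "E' \<in> sets borel" "a = ?D -` E \<inter> space M" "b = ?D -` E' \<inter> space M" by auto
    then show "a \<inter> b \<in> ?DE" by (intro CollectI exI[of _ "E \<inter> E'"]) auto
  qed
  ultimately have ind: "indep_set (sigma_sets (space M) (cylinders t \<union> null_sets M)) (sigma_sets (space M) ?DE)"
    by (rule indep_set_sigma_sets[OF _ cylinders_Int_stable])
  have sub: "sigma_sets (space M) {\<xi> -` A \<inter> space M |A. A \<in> sets borel} \<subseteq> sigma_sets (space M) (cylinders t \<union> null_sets M)"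
  proof (rule sigma_sets_mono)
    show "{\<xi> -` A \<inter> space M |A. A \<in> sets borel} \<subseteq> sigma_sets (space M) (cylinders t \<union> null_sets M)"
      using measurable_sets[OF xi] sets_filtration_cylinders[of t] by auto
  qed
  have "indep_set (sigma_sets (space M) {\<xi> -` A \<inter> space M |A. A \<in> sets borel}) (sigma_sets (space M) ?DE)"
    using ind sub unfolding indep_sets2_eq by blast
  then show ?thesis
    unfolding indep_var_eq using Dm filtration_measurable_M[OF xi] by simp
qed

lemma W_increment_moment_integrable:
  assumes "0 \<le> t" "0 < h"
  shows "integrable M (\<lambda>\<omega>. (W (t + h) \<omega> - W t \<omega>) ^ k)"
  using distributed_integrable[OF W_increment_distributed[of t "t + h"], of "\<lambda>x. x ^ k"] assms
    integrable_normal_moment[of "sqrt h" 0 k] by simp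

lemma W_increment_moments:
  assumes "0 \<le> t" "0 < h"
  shows "expectation (\<lambda>\<omega>. W (t + h) \<omega> - W t \<omega>) = 0"
    "expectation (\<lambda>\<omega>. (W (t + h) \<omega> - W t \<omega>)\<^sup>2) = h"
    "expectation (\<lambda>\<omega>. (W (t + h) \<omega> - W t \<omega>) ^ 4) = 3 * h\<^sup>2"
proof -
  have s: "0 < sqrt h" using assms by simp
  have m: "expectation (\<lambda>\<omega>. (W (t + h) \<omega> - W t \<omega>) ^ k) = (\<integral>x. normal_density 0 (sqrt h) x * x ^ k \<partial>lborel)" for k
    using distributed_integral[OF W_increment_distributed[of t "t + h"], of "\<lambda>x. x ^ k"] assms by simp
  show "expectation (\<lambda>\<omega>. W (t + h) \<omega> - W t \<omega>) = 0"
    using m[of 1] integral_normal_moment_odd[OF s, of 0 0] by simp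
  show "expectation (\<lambda>\<omega>. (W (t + h) \<omega> - W t \<omega>)\<^sup>2) = h"
    using m[of 2] integral_normal_moment_even[OF s, of 0 1] assms by (simp add: fact_numeral)
  show "expectation (\<lambda>\<omega>. (W (t + h) \<omega> - W t \<omega>) ^ 4) = 3 * h\<^sup>2"
    using m[of 4] integral_normal_moment_even[OF s, of 0 2] assms by (simp add: fact_numeral field_simps)
qed

lemma filtration_increment_expectation:
  assumes t: "0 \<le> t" "0 < h" and xi: "\<xi> \<in> borel_measurable (F t)" "integrable M \<xi>"
  shows "integrable M (\<lambda>\<omega>. \<xi> \<omega> * (W (t + h) \<omega> - W t \<omega>) ^ k)"
    "expectation (\<lambda>\<omega>. \<xi> \<omega> * (W (t + h) \<omega> - W t \<omega>) ^ k) = expectation \<xi> * expectation (\<lambda>\<omega>. (W (t + h) \<omega> - W t \<omega>) ^ k)"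
proof -
  have "indep_var borel ((\<lambda>x. x) \<circ> \<xi>) borel ((\<lambda>x. x ^ k) \<circ> (\<lambda>\<omega>. W (t + h) \<omega> - W t \<omega>))"
    by (rule indep_var_compose[OF filtration_increment_indep[OF t xi(1)]]) auto
  then have i: "indep_var borel \<xi> borel (\<lambda>\<omega>. (W (t + h) \<omega> - W t \<omega>) ^ k)" by (simp add: comp_def)
  show "integrable M (\<lambda>\<omega>. \<xi> \<omega> * (W (t + h) \<omega> - W t \<omega>) ^ k)"
    by (rule indep_var_integrable[OF i xi(2) W_increment_moment_integrable[OF t]])
  show "expectation (\<lambda>\<omega>. \<xi> \<omega> * (W (t + h) \<omega> - W t \<omega>) ^ k) = expectation \<xi> * expectation (\<lambda>\<omega>. (W (t + h) \<omega> - W t \<omega>) ^ k)"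
    by (rule indep_var_lebesgue_integral[OF i xi(2) W_increment_moment_integrable[OF t]])
qed

end

section \<open>Brownian motion with drift, hitting and occupation times\<close>

locale drifted_brownian = brownian_motion +
  fixes \<mu> \<sigma> :: real
  assumes sigma: "\<sigma> \<noteq> 0"
begin

definition Y :: "real \<Rightarrow> 'a \<Rightarrow> real" where
  "Y s \<omega> = \<mu> * s + \<sigma> * W s \<omega>"

lemma Y_0: "\<omega> \<in> space M \<Longrightarrow> Y 0 \<omega> = 0"
  by (simp add: Y_def W_0)

lemma Y_continuous: "\<omega> \<in> space M \<Longrightarrow> continuous_on {0..} (\<lambda>s. Y s \<omega>)"
  unfolding Y_def by (intro continuous_intros W_continuous)

lemma Y_filtration_measurable: "0 \<le> s \<Longrightarrow> s \<le> t \<Longrightarrow> Y s \<in> borel_measurable (F t)"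
  unfolding Y_def[abs_def] using W_filtration_measurable[of s t] by measurable

lemma Y_measurable: "0 \<le> s \<Longrightarrow> Y s \<in> borel_measurable M"
  using filtration_measurable_M[OF Y_filtration_measurable[of s s]] by simp

lemma Y_joint_measurable: "(\<lambda>(\<omega>, s). Y (max 0 s) \<omega>) \<in> borel_measurable (M \<Otimes>\<^sub>M borel)"
proof -
  have [measurable]: "(\<lambda>z. W (max 0 (snd z)) (fst z)) \<in> borel_measurable (M \<Otimes>\<^sub>M borel)"
    using W_joint_measurable by (simp add: case_prod_unfold)
  have "(\<lambda>z. \<mu> * max 0 (snd z) + \<sigma> * W (max 0 (snd z)) (fst z)) \<in> borel_measurable (M \<Otimes>\<^sub>M (borel :: real measure))"
    by measurable
  then show ?thesis by (simp add: Y_def case_prod_unfold)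
qed

section \<open>Hitting times of closed sets\<close>

lemma closed_hit_measurable:
  assumes C: "closed C" and t: "0 \<le> t"
  shows "{\<omega>\<in>space M. \<exists>s\<in>{0..t}. Y s \<omega> \<in> C} \<in> sets (F t)"
proof (cases "C = {}")
  case True
  then show ?thesis by simp
next
  case False
  let ?Q = "\<rat> \<inter> {0..t}"
  \<comment> \<open>The path meets \<open>C\<close> up to time \<open>t\<close> iff its distance to
    \<open>C\<close> gets arbitrarily small at rational times: continuity gives one direction, and
    for the other the minimum of the distance over the compact interval \<open>{0..t}\<close> is
    attained.\<close>
  have eq: "{\<omega>\<in>space M. \<exists>s\<in>{0..t}. Y s \<omega> \<in> C} = (\<Inter>n::nat. \<Union>q\<in>?Q. {\<omega>\<in>space M. infdist (Y q \<omega>) C < 1 / Suc n})" (is "?L = ?R")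
  proof (intro equalityI subsetI)
    fix \<omega> assume "\<omega> \<in> ?L"
    then obtain s where om: "\<omega> \<in> space M" and s: "0 \<le> s" "s \<le> t" "Y s \<omega> \<in> C" by auto
    have cont: "continuous_on {0..t} (\<lambda>q. infdist (Y q \<omega>) C)"
      by (intro continuous_on_infdist continuous_on_subset[OF Y_continuous[OF om]]) auto
    have "\<exists>q\<in>?Q. infdist (Y q \<omega>) C < 1 / Suc n" for n :: nat
    proof -
      have z: "infdist (Y s \<omega>) C = 0" using s(3) by simp
      obtain d where d0: "d > 0" "\<And>q. q \<in> {0..t} \<Longrightarrow> dist q s < d \<Longrightarrow> dist (infdist (Y q \<omega>) C) (infdist (Y s \<omega>) C) < 1 / Suc n"
        using cont[unfolded continuous_on_iff, rule_format, of s "1 / Suc n"] s by auto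
      have d: "d > 0" "\<And>q. q \<in> {0..t} \<Longrightarrow> \<bar>q - s\<bar> < d \<Longrightarrow> infdist (Y q \<omega>) C < 1 / Suc n"
        using d0 unfolding z dist_real_def by (auto simp: abs_less_iff)
      show ?thesis
      \<comment> \<open>The rational time is chosen to the left of \<open>s\<close> so as to stay
        within \<open>{0..t}\<close>; at \<open>s = 0\<close> there is no room and \<open>0\<close>
        itself serves.\<close>
      proof (cases "s = 0")
        case True
        then show ?thesis using d(2)[of 0] d(1) t by (intro bexI[of _ 0]) auto
      next
        case False
        then have "max 0 (s - d) < s" using s d(1) by simp
        then obtain q where "q \<in> \<rat>" "max 0 (s - d) < q" "q < s" using Rats_dense_in_real by blast
        then show ?thesis using d(2)[of q] s by (intro bexI[of _ q]) auto
      qed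
    qed
    then show "\<omega> \<in> ?R" using om by auto
  next
    fix \<omega> assume R: "\<omega> \<in> ?R"
    then have om: "\<omega> \<in> space M" by auto
    have cont: "continuous_on {0..t} (\<lambda>q. infdist (Y q \<omega>) C)"
      by (intro continuous_on_infdist continuous_on_subset[OF Y_continuous[OF om]]) auto
    obtain s where s: "s \<in> {0..t}" "\<And>q. q \<in> {0..t} \<Longrightarrow> infdist (Y s \<omega>) C \<le> infdist (Y q \<omega>) C"
      using continuous_attains_inf[OF compact_Icc _ cont] t by auto
    have "infdist (Y s \<omega>) C \<le> 0"
    proof (rule field_le_epsilon)
      fix e :: real assume "e > 0"
      then obtain n where n: "1 / Suc n < e" using nat_approx_posE by blast
      obtain q where "q \<in> ?Q" "infdist (Y q \<omega>) C < 1 / Suc n" using R by blast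
      then show "infdist (Y s \<omega>) C \<le> 0 + e" using s(2)[of q] n by auto
    qed
    then have "Y s \<omega> \<in> C" using in_closed_iff_infdist_zero[OF C False] infdist_nonneg[of "Y s \<omega>" C] by simp
    then show "\<omega> \<in> ?L" using om s by auto
  qed
  have "{\<omega>\<in>space M. infdist (Y q \<omega>) C < 1 / Suc n} \<in> sets (F t)" if "q \<in> ?Q" for q and n :: nat
  proof -
    have [measurable]: "Y q \<in> borel_measurable (F t)" using that by (intro Y_filtration_measurable) auto
    have "{\<omega>\<in>space (F t). infdist (Y q \<omega>) C < 1 / Suc n} \<in> sets (F t)"
      using borel_measurable_continuous_on[OF continuous_on_infdist[OF continuous_on_id] \<open>Y q \<in> borel_measurable (F t)\<close>, of C]
      by measurable
    then show ?thesis by simp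
  qed
  then have "(\<Union>q\<in>?Q. {\<omega>\<in>space M. infdist (Y q \<omega>) C < 1 / Suc n}) \<in> sets (F t)" for n :: nat
    by (intro sets.countable_UN'' countable_Int1 countable_rat) blast
  then show ?thesis unfolding eq by (intro sets.countable_INT') auto
qed

text \<open>Time \<open>0\<close> counts here, in contrast to the exit time of the theorem. For
  closed \<open>C\<close> the event \<open>hit C \<le> t\<close> then depends only on the path up to
  \<open>t\<close>, without any appeal to right-continuity of the filtration.\<close>

definition hit :: "real set \<Rightarrow> 'a \<Rightarrow> ennreal" where
  "hit C \<omega> = Inf {ennreal s | s. 0 \<le> s \<and> Y s \<omega> \<in> C}"

text \<open>An infimum of at most \<open>t\<close> yields hitting times just above \<open>t\<close>.
  By continuity the hitting times in \<open>{0..t+1}\<close> form a compact set, so there is a least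
  one, and it cannot exceed \<open>t\<close>.\<close>

lemma hit_le_iff:
  assumes C: "closed C" and t: "0 \<le> t" and om: "\<omega> \<in> space M"
  shows "hit C \<omega> \<le> ennreal t \<longleftrightarrow> (\<exists>s\<in>{0..t}. Y s \<omega> \<in> C)"
proof
  assume "\<exists>s\<in>{0..t}. Y s \<omega> \<in> C"
  then obtain s where "0 \<le> s" "s \<le> t" "Y s \<omega> \<in> C" by auto
  then have "hit C \<omega> \<le> ennreal s" "ennreal s \<le> ennreal t" unfolding hit_def by (auto intro!: Inf_lower)
  then show "hit C \<omega> \<le> ennreal t" by (rule order_trans)
next
  assume le: "hit C \<omega> \<le> ennreal t"
  have cl: "closed ({0..t+1} \<inter> (\<lambda>s. Y s \<omega>) -` C)"
    by (rule continuous_closed_preimage[OF continuous_on_subset[OF Y_continuous[OF om]] _ C]) auto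
  let ?S = "{0..t+1} \<inter> (\<lambda>s. Y s \<omega>) -` C"
  have near: "\<exists>s\<in>?S. s < t + e" if e: "0 < e" "e \<le> 1" for e
  proof -
    have "hit C \<omega> < ennreal (t + e)" using le e t by (intro le_less_trans[OF le]) (simp add: ennreal_less_iff)
    then obtain s where "0 \<le> s" "Y s \<omega> \<in> C" "ennreal s < ennreal (t + e)" unfolding hit_def Inf_less_iff by auto
    moreover from this have "s < t + e" using ennreal_less_iff[of s "t + e"] by blast
    ultimately show ?thesis using e t by (intro bexI[of _ s]) auto
  qed
  have ne: "?S \<noteq> {}" using near[of 1] by auto
  have "compact ?S" using cl by (intro compact_eq_bounded_closed[THEN iffD2] conjI bounded_Int) auto
  then obtain s0 where s0: "s0 \<in> ?S" "\<And>s. s \<in> ?S \<Longrightarrow> s0 \<le> s" using compact_attains_inf[OF _ ne] by blast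
  have "s0 \<le> t"
  proof (rule ccontr)
    assume "\<not> s0 \<le> t"
    then obtain s where "s \<in> ?S" "s < t + min 1 (s0 - t)" using near[of "min 1 (s0 - t)"] by auto
    then show False using s0(2)[of s] by auto
  qed
  then show "\<exists>s\<in>{0..t}. Y s \<omega> \<in> C" using s0(1) by auto
qed

lemma hit_greater_iff:
  assumes "closed C" "0 \<le> t" "\<omega> \<in> space M"
  shows "ennreal t < hit C \<omega> \<longleftrightarrow> (\<forall>s\<in>{0..t}. Y s \<omega> \<notin> C)"
  using hit_le_iff[OF assms] by (auto simp: not_le[symmetric])

lemma hit_stopping_time: "closed C \<Longrightarrow> is_stopping_time M W (hit C)"
  unfolding is_stopping_time_def
proof (intro allI impI)
  fix t :: real assume C: "closed C" and t: "0 \<le> t"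
  have "{\<omega>\<in>space M. hit C \<omega> \<le> ennreal t} = {\<omega>\<in>space M. \<exists>s\<in>{0..t}. Y s \<omega> \<in> C}"
    using hit_le_iff[OF C t] by auto
  then show "{\<omega>\<in>space M. hit C \<omega> \<le> ennreal t} \<in> sets (F t)" using closed_hit_measurable[OF C t] by simp
qed

section \<open>Bounds on the time spent in a set\<close>

lemma Y_distributed:
  assumes "0 < s" shows "distributed M lborel (Y s) (\<lambda>y. ennreal (normal_density (\<mu> * s) (\<bar>\<sigma>\<bar> * sqrt s) y))"
proof -
  have "distributed M lborel (\<lambda>\<omega>. W s \<omega> - W 0 \<omega>) (\<lambda>y. ennreal (normal_density 0 (sqrt s) y))"
    using W_increment_distributed[of 0 s] assms by simp
  from normal_density_affine[OF this _ sigma, of "\<mu> * s"]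
  have "distributed M lborel (\<lambda>\<omega>. \<mu> * s + \<sigma> * (W s \<omega> - W 0 \<omega>)) (\<lambda>y. ennreal (normal_density (\<mu> * s) (\<bar>\<sigma>\<bar> * sqrt s) y))"
    using assms by simp
  moreover have "Y s \<omega> = \<mu> * s + \<sigma> * (W s \<omega> - W 0 \<omega>)" if "\<omega> \<in> space M" for \<omega>
    using that by (simp add: Y_def W_0)
  then have "distr M lborel (Y s) = distr M lborel (\<lambda>\<omega>. \<mu> * s + \<sigma> * (W s \<omega> - W 0 \<omega>))" by (intro distr_cong) auto
  ultimately show ?thesis using Y_measurable[of s] assms unfolding distributed_def by simp
qed

lemma Y_expectation_bound:
  assumes s: "0 < s" and f[measurable]: "f \<in> borel_measurable borel"
  shows "(\<integral>\<^sup>+\<omega>. f (Y s \<omega>) \<partial>M) \<le> ennreal (s powr (-1/2) / (\<bar>\<sigma>\<bar> * sqrt (2 * pi))) * (\<integral>\<^sup>+y. f y \<partial>lborel)"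
proof -
  have "(\<integral>\<^sup>+\<omega>. f (Y s \<omega>) \<partial>M) = (\<integral>\<^sup>+y. ennreal (normal_density (\<mu> * s) (\<bar>\<sigma>\<bar> * sqrt s) y) * f y \<partial>lborel)"
    by (rule distributed_nn_integral[OF Y_distributed[OF s], symmetric]) simp
  also have "\<dots> \<le> (\<integral>\<^sup>+y. ennreal (s powr (-1/2) / (\<bar>\<sigma>\<bar> * sqrt (2 * pi))) * f y \<partial>lborel)"
  proof (intro nn_integral_mono mult_right_mono ennreal_leI)
    fix y
    have e: "sqrt (2 * pi * (\<bar>\<sigma>\<bar> * sqrt s)\<^sup>2) = sqrt s * (\<bar>\<sigma>\<bar> * sqrt (2 * pi))"
      using s by (simp add: real_sqrt_mult power_mult_distrib real_sqrt_abs[symmetric] del: real_sqrt_abs)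
    have "normal_density (\<mu> * s) (\<bar>\<sigma>\<bar> * sqrt s) y \<le> 1 / sqrt (2 * pi * (\<bar>\<sigma>\<bar> * sqrt s)\<^sup>2)"
      unfolding normal_density_def by (rule mult_left_le) auto
    also have "\<dots> = s powr (-1/2) / (\<bar>\<sigma>\<bar> * sqrt (2 * pi))"
      unfolding e using s by (simp add: powr_minus_divide powr_half_sqrt)
    finally show "normal_density (\<mu> * s) (\<bar>\<sigma>\<bar> * sqrt s) y \<le> s powr (-1/2) / (\<bar>\<sigma>\<bar> * sqrt (2 * pi))" .
  qed simp
  also have "\<dots> = ennreal (s powr (-1/2) / (\<bar>\<sigma>\<bar> * sqrt (2 * pi))) * (\<integral>\<^sup>+y. f y \<partial>lborel)"
    by (rule nn_integral_cmult) simp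
  finally show ?thesis .
qed

text \<open>The peak of the density of \<open>Y s\<close> is of order \<open>1 / sqrt s\<close>,
  which is integrable at \<open>0\<close>; integrating it over \<open>{0..T}\<close> gives the
  factor \<open>2 * sqrt T\<close>.\<close>

lemma occupation_bound:
  assumes f[measurable]: "f \<in> borel_measurable borel" and T: "0 \<le> T"
  shows "(\<integral>\<^sup>+\<omega>. \<integral>\<^sup>+s. f (Y s \<omega>) * indicator {0..T} s \<partial>lborel \<partial>M)
     \<le> ennreal (2 * sqrt T / (\<bar>\<sigma>\<bar> * sqrt (2 * pi))) * (\<integral>\<^sup>+y. f y \<partial>lborel)"
proof -
  interpret pair_sigma_finite M lborel by (rule pair_sigma_finite.intro) (auto intro: sigma_finite_measure_axioms sigma_finite_lborel)
  let ?c = "\<bar>\<sigma>\<bar> * sqrt (2 * pi)"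
  have c: "?c > 0" using sigma by simp
  have [measurable]: "(\<lambda>z. Y (max 0 (snd z)) (fst z)) \<in> borel_measurable (M \<Otimes>\<^sub>M lborel)"
    using Y_joint_measurable by (simp add: case_prod_unfold cong: measurable_cong_sets)
  have "(\<integral>\<^sup>+\<omega>. \<integral>\<^sup>+s. f (Y s \<omega>) * indicator {0..T} s \<partial>lborel \<partial>M)
      = (\<integral>\<^sup>+\<omega>. \<integral>\<^sup>+s. f (Y (max 0 s) \<omega>) * indicator {0..T} s \<partial>lborel \<partial>M)"
    by (intro nn_integral_cong) (auto simp: indicator_def)
  also have "\<dots> = (\<integral>\<^sup>+s. \<integral>\<^sup>+\<omega>. f (Y (max 0 s) \<omega>) * indicator {0..T} s \<partial>M \<partial>lborel)"
    by (rule Fubini'[symmetric]) (simp add: case_prod_unfold)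
  also have "\<dots> \<le> (\<integral>\<^sup>+s. ennreal (s powr (-1/2) / ?c) * (\<integral>\<^sup>+y. f y \<partial>lborel) * indicator {0..T} s \<partial>lborel)"
  proof (rule nn_integral_mono_AE)
    \<comment> \<open>Time \<open>0\<close> is left out: \<open>Y 0\<close> is constant and has no
      density.\<close>
    show "AE s in lborel. (\<integral>\<^sup>+\<omega>. f (Y (max 0 s) \<omega>) * indicator {0..T} s \<partial>M)
       \<le> ennreal (s powr (-1/2) / ?c) * (\<integral>\<^sup>+y. f y \<partial>lborel) * indicator {0..T} s"
      using AE_lborel_singleton[of 0]
    proof eventually_elim
      case (elim s)
      show ?case
      proof (cases "s \<in> {0..T}")
        case True
        then show ?thesis using Y_expectation_bound[OF _ f, of s] elim by simp
      qed simp
    qed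
  qed
  also have "\<dots> = (\<integral>\<^sup>+s. (ennreal (s powr (-1/2)) * indicator {0..T} s) * (ennreal (1 / ?c) * (\<integral>\<^sup>+y. f y \<partial>lborel)) \<partial>lborel)"
  proof (rule nn_integral_cong)
    fix s :: real
    have "ennreal (s powr (-1/2) / ?c) = ennreal (s powr (-1/2)) * ennreal (1 / ?c)"
      using c by (simp add: ennreal_mult'[symmetric])
    then show "ennreal (s powr (-1/2) / ?c) * (\<integral>\<^sup>+y. f y \<partial>lborel) * indicator {0..T} s
      = (ennreal (s powr (-1/2)) * indicator {0..T} s) * (ennreal (1 / ?c) * (\<integral>\<^sup>+y. f y \<partial>lborel))"
      by (simp only: mult_ac)
  qed
  also have "\<dots> = (\<integral>\<^sup>+s. ennreal (s powr (-1/2)) * indicator {0..T} s \<partial>lborel) * (ennreal (1 / ?c) * (\<integral>\<^sup>+y. f y \<partial>lborel))"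
    by (rule nn_integral_multc) simp
  also have "(\<integral>\<^sup>+s. ennreal (s powr (-1/2)) * indicator {0..T} s \<partial>lborel) = ennreal (2 * sqrt T)"
  proof -
    have "((\<lambda>s. s powr (-1/2)) has_integral (T powr (-1/2+1) / (-1/2+1))) {0..T}"
      using has_integral_powr_from_0[of "-1/2" T] T by simp
    then have "((\<lambda>s. s powr (-1/2)) has_integral (2 * sqrt T)) {0..T}" using T by (simp add: powr_half_sqrt mult.commute)
    from nn_integral_has_integral_lebesgue[OF _ this]
    have "(\<integral>\<^sup>+s. ennreal (indicator {0..T} s * s powr (-1/2)) \<partial>lborel) = ennreal (2 * sqrt T)"
      by simp
    then show ?thesis by (simp add: ennreal_mult'' ennreal_indicator mult.commute)
  qed
  also have "ennreal (2 * sqrt T) * (ennreal (1 / ?c) * (\<integral>\<^sup>+y. f y \<partial>lborel)) = ennreal (2 * sqrt T / ?c) * (\<integral>\<^sup>+y. f y \<partial>lborel)"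
  proof -
    have "ennreal (2 * sqrt T / ?c) = ennreal (2 * sqrt T) * ennreal (1 / ?c)"
      using c T by (subst ennreal_mult'[symmetric]) (auto simp: field_simps)
    then show ?thesis by (simp only: mult.assoc)
  qed
  finally show ?thesis .
qed

text \<open>A Lebesgue null set is almost surely visited for zero time, by the occupation bound
  applied to its indicator. This carries almost everywhere statements about \<open>y\<close> over to
  the paths.\<close>

lemma AE_occupation:
  assumes "AE y in lborel. Q y"
  shows "AE \<omega> in M. AE s in lborel. 0 \<le> s \<longrightarrow> Q (Y s \<omega>)"
proof -
  obtain N where N: "{y \<in> space lborel. \<not> Q y} \<subseteq> N" "N \<in> null_sets lborel" "N \<in> sets borel"
    using assms by (auto simp: eventually_ae_filter null_sets_def)
  note [measurable] = N(3)
  have [measurable]: "(\<lambda>z. Y (max 0 (snd z)) (fst z)) \<in> borel_measurable (M \<Otimes>\<^sub>M lborel)"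
    using Y_joint_measurable by (simp add: case_prod_unfold cong: measurable_cong_sets)
  have "AE \<omega> in M. AE s in lborel. 0 \<le> s \<and> s \<le> real n \<longrightarrow> Y s \<omega> \<notin> N" for n :: nat
  proof -
    have eq: "(\<integral>\<^sup>+s. indicator N (Y s \<omega>) * indicator {0..real n} s \<partial>lborel) = (\<integral>\<^sup>+s. indicator N (Y (max 0 s) \<omega>) * indicator {0..real n} s \<partial>lborel)" for \<omega>
      by (intro nn_integral_cong) (auto simp: indicator_def)
    have "(\<integral>\<^sup>+\<omega>. \<integral>\<^sup>+s. indicator N (Y s \<omega>) * indicator {0..real n} s \<partial>lborel \<partial>M) \<le> 0"
      using occupation_bound[of "indicator N" "real n"] N(2) by (simp add: null_sets_def)
    then have "AE \<omega> in M. (\<integral>\<^sup>+s. indicator N (Y (max 0 s) \<omega>) * indicator {0..real n} s \<partial>lborel) = 0"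
      unfolding eq by (subst (asm) le_zero_eq, subst (asm) nn_integral_0_iff_AE) measurable
    from this AE_space show ?thesis
    proof eventually_elim
      case (elim \<omega>)
      note z = elim(1) and om = elim(2)
      have [measurable]: "(\<lambda>s. Y (max 0 s) \<omega>) \<in> borel_measurable lborel"
      proof -
        have "continuous_on UNIV (\<lambda>s. Y (max 0 s) \<omega>)"
          by (rule continuous_on_compose2[OF Y_continuous[OF om]]) (auto intro!: continuous_intros)
        then show ?thesis by (simp add: borel_measurable_continuous_onI)
      qed
      have "(\<lambda>s. indicator N (Y (max 0 s) \<omega>) * indicator {0..real n} s :: ennreal) \<in> borel_measurable lborel" by measurable
      from z[unfolded nn_integral_0_iff_AE[OF this]] show ?case
        by eventually_elim (auto simp: indicator_def split: if_splits)
    qed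
  qed
  then have "AE \<omega> in M. \<forall>n::nat. AE s in lborel. 0 \<le> s \<and> s \<le> real n \<longrightarrow> Y s \<omega> \<notin> N" by (subst AE_all_countable) blast
  then show ?thesis
  proof eventually_elim
    case (elim \<omega>)
    have "AE s in lborel. \<forall>n::nat. 0 \<le> s \<and> s \<le> real n \<longrightarrow> Y s \<omega> \<notin> N" using elim by (subst AE_all_countable) blast
    then show ?case
    proof eventually_elim
      case (elim s)
      obtain n :: nat where "s \<le> n" using real_arch_simple by blast
      then have "0 \<le> s \<Longrightarrow> Y s \<omega> \<notin> N" using elim by blast
      then show ?case using N(1) by auto
    qed
  qed
qed

end

section \<open>Dynkin's formula\<close>

abbreviation clip :: "real \<Rightarrow> real \<Rightarrow> real" where
  "clip K y \<equiv> max (- K) (min K y)"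

lemma continuous_bounded_Icc:
  fixes f :: "real \<Rightarrow> real"
  assumes "continuous_on UNIV f"
  obtains B where "B > 0" "\<And>y. \<bar>y\<bar> \<le> K \<Longrightarrow> \<bar>f y\<bar> \<le> B"
proof -
  have "bounded (f ` {-K..K})"
    by (rule compact_imp_bounded[OF compact_continuous_image[OF continuous_on_subset[OF assms] compact_Icc]]) simp
  then obtain B where B: "B > 0" "\<And>y. y \<in> {-K..K} \<Longrightarrow> \<bar>f y\<bar> \<le> B" unfolding bounded_pos real_norm_def by blast
  show ?thesis
  proof (rule that[OF B(1)])
    fix y assume "\<bar>y\<bar> \<le> K"
    then have "y \<in> {-K..K}" by auto
    then show "\<bar>f y\<bar> \<le> B" by (rule B(2))
  qed
qed

text \<open>Near \<open>y\<close> the second-order Taylor error is controlled by the uniform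
  continuity of \<open>w''\<close>. For \<open>\<bar>d\<bar> \<ge> \<delta>\<close> all terms are
  dominated by a multiple of \<open>d ^ 4\<close>, because clipping keeps \<open>w\<close> bounded.
  The fourth power is chosen since its mean over a short time step \<open>h\<close> is of order
  \<open>h\<^sup>2\<close>, hence negligible.\<close>

lemma Taylor_clip_bound:
  fixes w w' w'' :: "real \<Rightarrow> real"
  assumes d1: "\<And>y. (w has_real_derivative w' y) (at y)" and d2: "\<And>y. (w' has_real_derivative w'' y) (at y)"
    and c2: "continuous_on UNIV w''" and N: "N \<ge> 0" and e: "e > 0"
  obtains C where "C \<ge> 0" "\<And>y d. \<bar>y\<bar> \<le> N \<Longrightarrow>
     \<bar>w (clip (N + 1) (y + d)) - w y - w' y * d - w'' y * d\<^sup>2 / 2\<bar> \<le> e * d\<^sup>2 + C * d ^ 4"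
proof -
  have c0: "continuous_on UNIV w" "continuous_on UNIV w'"
    using DERIV_continuous_on[of UNIV w w'] DERIV_continuous_on[of UNIV w' w''] d1 d2 by simp_all
  obtain B0 where B0: "B0 > 0" "\<And>y. \<bar>y\<bar> \<le> N + 1 \<Longrightarrow> \<bar>w y\<bar> \<le> B0" using continuous_bounded_Icc[OF c0(1)] by blast
  obtain B1 where B1: "B1 > 0" "\<And>y. \<bar>y\<bar> \<le> N + 1 \<Longrightarrow> \<bar>w' y\<bar> \<le> B1" using continuous_bounded_Icc[OF c0(2)] by blast
  obtain B2 where B2: "B2 > 0" "\<And>y. \<bar>y\<bar> \<le> N + 1 \<Longrightarrow> \<bar>w'' y\<bar> \<le> B2" using continuous_bounded_Icc[OF c2] by blast
  have "uniformly_continuous_on {-(N+1)..N+1} w''"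
    by (rule compact_uniformly_continuous[OF continuous_on_subset[OF c2] compact_Icc]) simp
  from this[unfolded uniformly_continuous_on_def, rule_format, of "2 * e"] e
  obtain \<delta>0 where \<delta>0': "\<delta>0 > 0" "\<forall>v\<in>{-(N+1)..N+1}. \<forall>u\<in>{-(N+1)..N+1}. dist u v < \<delta>0 \<longrightarrow> dist (w'' u) (w'' v) < 2 * e"
    by auto
  note \<delta>0 = \<delta>0'(1) \<delta>0'(2)[rule_format, rotated]
  define \<delta> where "\<delta> = min \<delta>0 1"
  have \<delta>: "0 < \<delta>" "\<delta> \<le> 1" "\<delta> \<le> \<delta>0" using \<delta>0 by (auto simp: \<delta>_def)
  \<comment> \<open>With \<open>q = \<bar>d\<bar> / \<delta> \<ge> 1\<close> and
    \<open>\<delta> \<le> 1\<close>, each of \<open>1\<close>, \<open>\<bar>d\<bar>\<close> and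
    \<open>d\<^sup>2\<close> is at most \<open>q ^ 4\<close>; the two values of \<open>w\<close>
    account for \<open>2 * B0\<close>.\<close>
  define C where "C = (2 * B0 + B1 + B2) / \<delta> ^ 4"
  have C: "C \<ge> 0" using B0(1) B1(1) B2(1) \<delta> by (simp add: C_def)
  show ?thesis
  proof (rule that[OF C])
    fix y d assume y: "\<bar>y\<bar> \<le> N"
    show "\<bar>w (clip (N + 1) (y + d)) - w y - w' y * d - w'' y * d\<^sup>2 / 2\<bar> \<le> e * d\<^sup>2 + C * d ^ 4"
    proof (cases "\<bar>d\<bar> < \<delta>")
      case True
      then have cl: "clip (N + 1) (y + d) = y + d" using y \<delta> by auto
      show ?thesis
      proof (cases "d = 0")
        case True then show ?thesis using cl by simp
      next
        case False
        let ?diff = "\<lambda>m::nat. if m = 0 then w else if m = 1 then w' else w''"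
        have "\<exists>t. (if y + d < y then y + d < t \<and> t < y else y < t \<and> t < y + d) \<and>
          w (y + d) = (\<Sum>m<2. ?diff m y / fact m * (y + d - y) ^ m) + ?diff 2 t / fact 2 * (y + d - y) ^ 2"
          by (rule Taylor[of 2 ?diff w "y - 1" "y + 1" y "y + d"])
             (use True \<delta> False d1 d2 in \<open>auto simp: less_2_cases_iff\<close>)
        then obtain t where t0: "if y + d < y then y + d < t \<and> t < y else y < t \<and> t < y + d"
          "w (y + d) = (\<Sum>m<2. ?diff m y / fact m * (y + d - y) ^ m) + ?diff 2 t / fact 2 * (y + d - y) ^ 2" by blast
        have t: "\<bar>t - y\<bar> < \<bar>d\<bar>" "w (y + d) = w y + w' y * d + w'' t / 2 * d\<^sup>2"
          using t0(1) t0(2) by (auto simp: lessThan_Suc numeral_2_eq_2 split: if_splits)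
        have "dist (w'' t) (w'' y) < 2 * e"
          by (rule \<delta>0(2)) (use t(1) True y \<delta> in \<open>auto simp: dist_real_def\<close>)
        then have "\<bar>w'' t - w'' y\<bar> / 2 \<le> e" by (simp add: dist_real_def)
        then have "\<bar>w'' t - w'' y\<bar> / 2 * d\<^sup>2 \<le> e * d\<^sup>2" by (intro mult_right_mono) auto
        moreover have "w (y + d) - w y - w' y * d - w'' y * d\<^sup>2 / 2 = (w'' t - w'' y) / 2 * d\<^sup>2"
          unfolding t(2) by (simp add: algebra_simps)
        moreover have "\<bar>(w'' t - w'' y) / 2 * d\<^sup>2\<bar> = \<bar>w'' t - w'' y\<bar> / 2 * d\<^sup>2" by (simp add: abs_mult)
        moreover have "0 \<le> C * d ^ 4" using C by simp
        ultimately show ?thesis unfolding cl by linarith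
      qed
    next
      case False
      define q where "q = \<bar>d\<bar> / \<delta>"
      have q: "1 \<le> q" using False \<delta> by (simp add: q_def)
      have qd: "\<bar>d\<bar> = \<delta> * q" using \<delta> by (simp add: q_def)
      have dq: "\<bar>d\<bar> \<le> q" using qd \<delta> q by (simp add: mult_left_le_one_le)
      have q4: "q \<le> q ^ 4" "q\<^sup>2 \<le> q ^ 4" "1 \<le> q ^ 4"
        using q power_increasing[of 1 4 q] power_increasing[of 2 4 q] by auto
      have dd: "\<bar>d\<bar> \<le> q ^ 4" "d\<^sup>2 \<le> q ^ 4"
      proof -
        show "\<bar>d\<bar> \<le> q ^ 4" using dq q4 by linarith
        have "d\<^sup>2 \<le> q\<^sup>2" using dq by (metis abs_ge_zero power2_abs power_mono)
        then show "d\<^sup>2 \<le> q ^ 4" using q4 by linarith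
      qed
      have b: "\<bar>w (clip (N + 1) (y + d))\<bar> \<le> B0" "\<bar>w y\<bar> \<le> B0" "\<bar>w' y\<bar> \<le> B1" "\<bar>w'' y\<bar> \<le> B2"
      proof -
        have "\<bar>clip (N + 1) z\<bar> \<le> N + 1" for z using N by (auto simp: abs_le_iff min_def max_def)
        then show "\<bar>w (clip (N + 1) (y + d))\<bar> \<le> B0" by (rule B0(2))
        have "\<bar>y\<bar> \<le> N + 1" using y by linarith
        then show "\<bar>w y\<bar> \<le> B0" "\<bar>w' y\<bar> \<le> B1" "\<bar>w'' y\<bar> \<le> B2" by (rule B0(2), rule B1(2), rule B2(2))
      qed
      have b1: "\<bar>w' y * d\<bar> \<le> B1 * q ^ 4" unfolding abs_mult using b(3) dd B1(1) by (intro mult_mono) auto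
      have "\<bar>w'' y\<bar> * d\<^sup>2 \<le> B2 * q ^ 4" using b(4) dd B2(1) by (intro mult_mono) auto
      moreover have "\<bar>w'' y * d\<^sup>2 / 2\<bar> \<le> \<bar>w'' y\<bar> * d\<^sup>2" by (simp add: abs_mult)
      ultimately have b2: "\<bar>w'' y * d\<^sup>2 / 2\<bar> \<le> B2 * q ^ 4" by (rule order_trans[rotated])
      have b0: "B0 \<le> B0 * q ^ 4" using mult_left_mono[OF q4(3), of B0] B0(1) by simp
      have tri: "\<bar>p1 - p2 - p3 - p4\<bar> \<le> \<bar>p1\<bar> + \<bar>p2\<bar> + \<bar>p3\<bar> + \<bar>p4\<bar>" for p1 p2 p3 p4 :: real by linarith
      have "\<bar>w (clip (N + 1) (y + d)) - w y - w' y * d - w'' y * d\<^sup>2 / 2\<bar> \<le> B0 * q ^ 4 + B0 * q ^ 4 + B1 * q ^ 4 + B2 * q ^ 4"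
        by (rule order_trans[OF tri], intro add_mono b1 b2 order_trans[OF b(1) b0] order_trans[OF b(2) b0])
      also have "\<dots> = (2 * B0 + B1 + B2) * q ^ 4" by (simp add: algebra_simps)
      also have "\<dots> = C * d ^ 4"
      proof -
        have "d ^ 4 = \<delta> ^ 4 * q ^ 4" using qd power_even_abs[of 4 d] by (simp add: power_mult_distrib)
        then show ?thesis using \<delta> by (simp add: C_def)
      qed
      finally show ?thesis using mult_nonneg_nonneg[OF less_imp_le[OF e] zero_le_power2[of d]] by linarith
    qed
  qed
qed

section \<open>Dynkin's formula for twice continuously differentiable functions\<close>

context drifted_brownian
begin

text \<open>The constant \<open>C\<close> does not depend on \<open>t\<close>, \<open>h\<close> and
  \<open>A\<close>, so the errors of all grid steps can be summed; over a fixed horizon an error of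
  \<open>e * h + C * h\<^sup>2\<close> per step is negligible.\<close>

lemma one_step_estimate:
  assumes d1: "\<And>y. (w has_real_derivative w' y) (at y)" and d2: "\<And>y. (w' has_real_derivative w'' y) (at y)"
    and c2: "continuous_on UNIV w''" and N: "N \<ge> 0" and e: "e > 0" and T: "T \<ge> 0"
  obtains C where "C \<ge> 0" "\<And>t h A. 0 \<le> t \<Longrightarrow> 0 < h \<Longrightarrow> h \<le> T \<Longrightarrow> A \<in> sets (F t) \<Longrightarrow> (\<And>\<omega>. \<omega> \<in> A \<Longrightarrow> \<bar>Y t \<omega>\<bar> \<le> N) \<Longrightarrow>
     \<bar>expectation (\<lambda>\<omega>. indicator A \<omega> * (w (clip (N + 1) (Y (t + h) \<omega>)) - w (Y t \<omega>)
        - h * (\<sigma>\<^sup>2 / 2 * w'' (Y t \<omega>) + \<mu> * w' (Y t \<omega>))))\<bar> \<le> e * h + C * h\<^sup>2"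
proof -
  \<comment> \<open>The squared increment has mean \<open>\<sigma>\<^sup>2 * h\<close> up to order
    \<open>h\<^sup>2\<close>, so this choice turns \<open>e' * d\<^sup>2\<close> into
    \<open>e * h\<close>.\<close>
  define e' where "e' = e / \<sigma>\<^sup>2"
  have e': "e' > 0" using e sigma by (simp add: e'_def)
  obtain C where C: "C \<ge> 0" "\<And>y d. \<bar>y\<bar> \<le> N \<Longrightarrow>
     \<bar>w (clip (N + 1) (y + d)) - w y - w' y * d - w'' y * d\<^sup>2 / 2\<bar> \<le> e' * d\<^sup>2 + C * d ^ 4"
    using Taylor_clip_bound[OF d1 d2 c2 N e'] by blast
  have c0: "continuous_on UNIV w" "continuous_on UNIV w'"
    using DERIV_continuous_on[of UNIV w w'] DERIV_continuous_on[of UNIV w' w''] d1 d2 by simp_all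
  have [measurable]: "w \<in> borel_measurable borel" "w' \<in> borel_measurable borel" "w'' \<in> borel_measurable borel"
    using c0 c2 by (simp_all add: borel_measurable_continuous_onI)
  obtain B0 where B0: "B0 > 0" "\<And>y. \<bar>y\<bar> \<le> N + 1 \<Longrightarrow> \<bar>w y\<bar> \<le> B0" using continuous_bounded_Icc[OF c0(1)] by blast
  obtain B1 where B1: "B1 > 0" "\<And>y. \<bar>y\<bar> \<le> N \<Longrightarrow> \<bar>w' y\<bar> \<le> B1" using continuous_bounded_Icc[OF c0(2)] by blast
  obtain B2 where B2: "B2 > 0" "\<And>y. \<bar>y\<bar> \<le> N \<Longrightarrow> \<bar>w'' y\<bar> \<le> B2" using continuous_bounded_Icc[OF c2] by blast
  define K where "K = (B2 / 2 + e') * \<mu>\<^sup>2 + C * (8 * (\<mu> ^ 4 * T\<^sup>2 + 3 * \<sigma> ^ 4))"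
  have K: "K \<ge> 0" using B2(1) e' C(1) by (simp add: K_def)
  show ?thesis
  proof (rule that[OF K])
    fix t h :: real and A
    assume t: "0 \<le> t" and h: "0 < h" "h \<le> T" and A: "A \<in> sets (F t)" and AN: "\<And>\<omega>. \<omega> \<in> A \<Longrightarrow> \<bar>Y t \<omega>\<bar> \<le> N"
    define D where "D \<omega> = W (t + h) \<omega> - W t \<omega>" for \<omega>
    have Yd: "Y (t + h) \<omega> = Y t \<omega> + (\<mu> * h + \<sigma> * D \<omega>)" for \<omega> by (simp add: Y_def D_def algebra_simps)
    have [measurable]: "A \<in> sets M" using A filtration_subset by blast
    have [measurable]: "Y t \<in> borel_measurable M" "Y (t + h) \<in> borel_measurable M" "D \<in> borel_measurable M"
      using t h Y_measurable W_measurable unfolding D_def by auto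
    define \<xi>1 where "\<xi>1 \<omega> = indicator A \<omega> * w' (Y t \<omega>)" for \<omega>
    define \<xi>2 where "\<xi>2 \<omega> = indicator A \<omega> * w'' (Y t \<omega>)" for \<omega>
    have YF: "Y t \<in> borel_measurable (F t)" using t by (intro Y_filtration_measurable) auto
    have xiF: "\<xi>1 \<in> borel_measurable (F t)" "\<xi>2 \<in> borel_measurable (F t)"
      unfolding \<xi>1_def[abs_def] \<xi>2_def[abs_def] using A YF by measurable
    have xiB: "\<bar>\<xi>1 \<omega>\<bar> \<le> B1" "\<bar>\<xi>2 \<omega>\<bar> \<le> B2" for \<omega>
      using AN[of \<omega>] B1 B2 by (auto simp: \<xi>1_def \<xi>2_def indicator_def less_imp_le)
    have xii: "integrable M \<xi>1" "integrable M \<xi>2"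
      by (rule integrable_const_bound[where B=B1], use xiB filtration_measurable_M[OF xiF(1)] in auto)
         (rule integrable_const_bound[where B=B2], use xiB filtration_measurable_M[OF xiF(2)] in auto)
    note E1 = filtration_increment_expectation[OF t h(1) xiF(1) xii(1), folded D_def]
    note E2 = filtration_increment_expectation[OF t h(1) xiF(2) xii(2), folded D_def]
    note mom = W_increment_moments[OF t h(1), folded D_def]
    note momi = W_increment_moment_integrable[OF t h(1), folded D_def]
    define d where "d \<omega> = \<mu> * h + \<sigma> * D \<omega>" for \<omega>
    define R where "R \<omega> = indicator A \<omega> * (w (clip (N + 1) (Y t \<omega> + d \<omega>)) - w (Y t \<omega>) - w' (Y t \<omega>) * d \<omega> - w'' (Y t \<omega>) * (d \<omega>)\<^sup>2 / 2)" for \<omega>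
    have d2e: "(d \<omega>)\<^sup>2 = \<mu>\<^sup>2 * h\<^sup>2 + 2 * \<mu> * h * \<sigma> * D \<omega> + \<sigma>\<^sup>2 * (D \<omega>)\<^sup>2" for \<omega>
      unfolding d_def by (simp add: power2_eq_square algebra_simps)
    have d4e: "(d \<omega>) ^ 4 \<le> 8 * (\<mu> ^ 4 * h ^ 4 + \<sigma> ^ 4 * (D \<omega>) ^ 4)" for \<omega>
    proof -
      have s2: "(a + b)\<^sup>2 \<le> 2 * (a\<^sup>2 + b\<^sup>2)" for a b :: real
        using zero_le_power2[of "a - b"] by (simp add: power2_eq_square algebra_simps)
      let ?a = "\<mu> * h" and ?b = "\<sigma> * D \<omega>"
      have "((?a + ?b)\<^sup>2)\<^sup>2 \<le> (2 * (?a\<^sup>2 + ?b\<^sup>2))\<^sup>2" by (intro power_mono s2) auto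
      also have "\<dots> = 4 * (?a\<^sup>2 + ?b\<^sup>2)\<^sup>2" by (subst power_mult_distrib) simp
      also have "\<dots> \<le> 4 * (2 * ((?a\<^sup>2)\<^sup>2 + (?b\<^sup>2)\<^sup>2))" using s2[of "?a\<^sup>2" "?b\<^sup>2"] by simp
      finally show ?thesis unfolding d_def by (simp add: power_mult_distrib flip: power_mult)
    qed
    have d2i: "integrable M (\<lambda>\<omega>. (d \<omega>)\<^sup>2)" "expectation (\<lambda>\<omega>. (d \<omega>)\<^sup>2) = \<mu>\<^sup>2 * h\<^sup>2 + \<sigma>\<^sup>2 * h"
      unfolding d2e using momi[of 1] momi[of 2] mom by (auto simp: prob_space)
    have d4i: "integrable M (\<lambda>\<omega>. 8 * (\<mu> ^ 4 * h ^ 4 + \<sigma> ^ 4 * (D \<omega>) ^ 4))"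
      "expectation (\<lambda>\<omega>. 8 * (\<mu> ^ 4 * h ^ 4 + \<sigma> ^ 4 * (D \<omega>) ^ 4)) = 8 * (\<mu> ^ 4 * h ^ 4 + 3 * \<sigma> ^ 4 * h\<^sup>2)"
      using momi[of 4] mom by (auto simp: prob_space)
    have [measurable]: "d \<in> borel_measurable M" unfolding d_def[abs_def] by measurable
    have RB: "\<bar>R \<omega>\<bar> \<le> e' * (d \<omega>)\<^sup>2 + C * (8 * (\<mu> ^ 4 * h ^ 4 + \<sigma> ^ 4 * (D \<omega>) ^ 4))" for \<omega>
    proof -
      have "\<bar>R \<omega>\<bar> \<le> e' * (d \<omega>)\<^sup>2 + C * (d \<omega>) ^ 4"
        using C(2)[OF AN[of \<omega>], of "d \<omega>"] e' C(1) by (cases "\<omega> \<in> A") (auto simp: R_def)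
      also have "\<dots> \<le> e' * (d \<omega>)\<^sup>2 + C * (8 * (\<mu> ^ 4 * h ^ 4 + \<sigma> ^ 4 * (D \<omega>) ^ 4))"
        using d4e C(1) by (intro add_left_mono mult_left_mono) auto
      finally show ?thesis .
    qed
    have Bi: "integrable M (\<lambda>\<omega>. e' * (d \<omega>)\<^sup>2 + C * (8 * (\<mu> ^ 4 * h ^ 4 + \<sigma> ^ 4 * (D \<omega>) ^ 4)))"
      using d2i d4i by auto
    have Ri: "integrable M R"
    proof (rule Bochner_Integration.integrable_bound[OF Bi])
      show "R \<in> borel_measurable M" unfolding R_def[abs_def] by measurable
      show "AE \<omega> in M. norm (R \<omega>) \<le> norm (e' * (d \<omega>)\<^sup>2 + C * (8 * (\<mu> ^ 4 * h ^ 4 + \<sigma> ^ 4 * (D \<omega>) ^ 4)))"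
        using RB by (intro AE_I2) (smt (verit) real_norm_def)
    qed
    have ER: "\<bar>expectation R\<bar> \<le> e' * (\<mu>\<^sup>2 * h\<^sup>2 + \<sigma>\<^sup>2 * h) + C * (8 * (\<mu> ^ 4 * h ^ 4 + 3 * \<sigma> ^ 4 * h\<^sup>2))"
    proof -
      have "\<bar>expectation R\<bar> \<le> expectation (\<lambda>\<omega>. \<bar>R \<omega>\<bar>)" by (rule integral_abs_bound)
      also have "\<dots> \<le> expectation (\<lambda>\<omega>. e' * (d \<omega>)\<^sup>2 + C * (8 * (\<mu> ^ 4 * h ^ 4 + \<sigma> ^ 4 * (D \<omega>) ^ 4)))"
        using Ri Bi RB by (intro integral_mono) auto
      also have "\<dots> = e' * (\<mu>\<^sup>2 * h\<^sup>2 + \<sigma>\<^sup>2 * h) + C * (8 * (\<mu> ^ 4 * h ^ 4 + 3 * \<sigma> ^ 4 * h\<^sup>2))"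
        using d2i d4i by simp
      finally show ?thesis .
    qed
    \<comment> \<open>All coefficients are known at time \<open>t\<close>, and the increment
      \<open>D\<close> is independent of them. The terms linear in \<open>D\<close> have mean zero,
      and the mean of the \<open>D\<^sup>2\<close> term cancels the part with
      \<open>\<sigma>\<^sup>2 * h\<close>, so that only the remainder \<open>R\<close> and a term of
      order \<open>h\<^sup>2\<close> survive.\<close>
    have eq: "indicator A \<omega> * (w (clip (N + 1) (Y (t + h) \<omega>)) - w (Y t \<omega>) - h * (\<sigma>\<^sup>2 / 2 * w'' (Y t \<omega>) + \<mu> * w' (Y t \<omega>)))
       = R \<omega> + \<sigma> * (\<xi>1 \<omega> * D \<omega> ^ 1) + (\<mu>\<^sup>2 * h\<^sup>2 - \<sigma>\<^sup>2 * h) / 2 * \<xi>2 \<omega> + \<mu> * h * \<sigma> * (\<xi>2 \<omega> * D \<omega> ^ 1) + \<sigma>\<^sup>2 / 2 * (\<xi>2 \<omega> * (D \<omega>)\<^sup>2)" for \<omega>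
      unfolding R_def \<xi>1_def \<xi>2_def Yd d2e d_def[symmetric] by (simp add: d_def field_simps)
    have "expectation (\<lambda>\<omega>. indicator A \<omega> * (w (clip (N + 1) (Y (t + h) \<omega>)) - w (Y t \<omega>) - h * (\<sigma>\<^sup>2 / 2 * w'' (Y t \<omega>) + \<mu> * w' (Y t \<omega>))))
      = expectation R + (\<mu>\<^sup>2 * h\<^sup>2 - \<sigma>\<^sup>2 * h) / 2 * expectation \<xi>2 + \<sigma>\<^sup>2 / 2 * (expectation \<xi>2 * h)"
      unfolding eq using Ri xii E1(1)[of 1] E2(1)[of 1] E2(1)[of 2] E1(2)[of 1] E2(2)[of 1] E2(2)[of 2] mom by simp
    also have "\<dots> = expectation R + \<mu>\<^sup>2 * h\<^sup>2 / 2 * expectation \<xi>2" by (simp add: field_simps)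
    finally have fin: "expectation (\<lambda>\<omega>. indicator A \<omega> * (w (clip (N + 1) (Y (t + h) \<omega>)) - w (Y t \<omega>) - h * (\<sigma>\<^sup>2 / 2 * w'' (Y t \<omega>) + \<mu> * w' (Y t \<omega>))))
      = expectation R + \<mu>\<^sup>2 * h\<^sup>2 / 2 * expectation \<xi>2" .
    have "\<bar>expectation \<xi>2\<bar> \<le> expectation (\<lambda>\<omega>. \<bar>\<xi>2 \<omega>\<bar>)" by (rule integral_abs_bound)
    also have "\<dots> \<le> expectation (\<lambda>\<omega>. B2)" using xii xiB by (intro integral_mono) auto
    finally have "\<bar>expectation \<xi>2\<bar> \<le> B2" by (simp add: prob_space)
    then have "\<bar>\<mu>\<^sup>2 * h\<^sup>2 / 2 * expectation \<xi>2\<bar> \<le> \<mu>\<^sup>2 * h\<^sup>2 / 2 * B2" unfolding abs_mult by (intro mult_mono) auto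
    moreover have "h ^ 4 \<le> T\<^sup>2 * h\<^sup>2"
    proof -
      have "h\<^sup>2 * h\<^sup>2 \<le> T\<^sup>2 * h\<^sup>2" using h by (intro mult_right_mono power_mono) auto
      then show ?thesis by (simp flip: power_add)
    qed
    then have "\<mu> ^ 4 * h ^ 4 \<le> \<mu> ^ 4 * (T\<^sup>2 * h\<^sup>2)" by (intro mult_left_mono) auto
    then have "C * (8 * (\<mu> ^ 4 * h ^ 4 + 3 * \<sigma> ^ 4 * h\<^sup>2)) \<le> C * (8 * (\<mu> ^ 4 * (T\<^sup>2 * h\<^sup>2) + 3 * \<sigma> ^ 4 * h\<^sup>2))"
      using C(1) by (intro mult_left_mono) auto
    moreover have "e' * (\<mu>\<^sup>2 * h\<^sup>2 + \<sigma>\<^sup>2 * h) + C * (8 * (\<mu> ^ 4 * (T\<^sup>2 * h\<^sup>2) + 3 * \<sigma> ^ 4 * h\<^sup>2)) + \<mu>\<^sup>2 * h\<^sup>2 / 2 * B2 = e * h + K * h\<^sup>2"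
      using sigma by (simp add: K_def e'_def field_simps)
    ultimately show "\<bar>expectation (\<lambda>\<omega>. indicator A \<omega> * (w (clip (N + 1) (Y (t + h) \<omega>)) - w (Y t \<omega>)
        - h * (\<sigma>\<^sup>2 / 2 * w'' (Y t \<omega>) + \<mu> * w' (Y t \<omega>))))\<bar> \<le> e * h + K * h\<^sup>2"
      unfolding fin using ER by linarith
  qed
qed

text \<open>\<open>\<rho>\<close> is rounded up to the grid: the index counts the \<open>k\<close>
  with \<open>real k * h < \<rho>\<close>. Whether step \<open>k\<close> is taken is thus decided at
  its left end, by an event of the past.\<close>

lemma grid_telescope:
  fixes Z :: "nat \<Rightarrow> real"
  assumes h: "h > 0" and rho: "0 \<le> \<rho>" "\<rho> \<le> real n * h"
  shows "Z (nat \<lceil>\<rho> / h\<rceil>) = Z 0 + (\<Sum>k<n. if real k * h < \<rho> then Z (Suc k) - Z k else 0)"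
proof -
  define J where "J = nat \<lceil>\<rho> / h\<rceil>"
  have iff: "real k * h < \<rho> \<longleftrightarrow> k < J" for k
  proof -
    have "real k * h < \<rho> \<longleftrightarrow> real k < \<rho> / h" using h by (simp add: field_simps)
    also have "\<dots> \<longleftrightarrow> int k < \<lceil>\<rho> / h\<rceil>" by (simp add: less_ceiling_iff)
    also have "\<dots> \<longleftrightarrow> k < J" unfolding J_def by linarith
    finally show ?thesis .
  qed
  have "\<rho> / h \<le> real n" using rho(2) h by (simp add: field_simps)
  then have Jn: "J \<le> n" unfolding J_def by (simp add: ceiling_le_iff nat_le_iff)
  have "{..<n} \<inter> {k. real k * h < \<rho>} = {..<J}" unfolding iff using Jn by auto
  then have "(\<Sum>k<n. if real k * h < \<rho> then Z (Suc k) - Z k else 0) = (\<Sum>k<J. Z (Suc k) - Z k)"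
    by (simp add: sum.If_cases)
  also have "\<dots> = Z J - Z 0" by (rule sum_lessThan_telescope)
  finally show ?thesis by (simp add: J_def)
qed

text \<open>The one-step estimate is summed over the grid of mesh \<open>h n\<close>, with
  \<open>\<rho>\<close> rounded up. The main terms are Riemann sums converging to \<open>U\<close>
  along each path; the errors sum to a multiple of the tolerance plus a multiple of the
  mesh.\<close>

lemma Dynkin_C2:
  fixes \<rho> :: "'a \<Rightarrow> real" and r :: real
  assumes rho: "\<And>s. 0 \<le> s \<Longrightarrow> {\<omega>\<in>space M. s < \<rho> \<omega>} \<in> sets (F s)"
    and rhoT: "\<And>\<omega>. \<omega> \<in> space M \<Longrightarrow> 0 \<le> \<rho> \<omega> \<and> \<rho> \<omega> \<le> T" and T: "T > 0"
    and inN: "\<And>\<omega> s. \<omega> \<in> space M \<Longrightarrow> 0 \<le> s \<Longrightarrow> s < \<rho> \<omega> \<Longrightarrow> \<bar>Y s \<omega>\<bar> \<le> N" and N: "N \<ge> 0"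
    and d1: "\<And>y. (w has_real_derivative w' y) (at y)" and d2: "\<And>y. (w' has_real_derivative w'' y) (at y)"
    and c2: "continuous_on UNIV w''"
  defines "U \<equiv> \<lambda>\<omega>. LINT s|lborel. indicator {0..<\<rho> \<omega>} s * (exp (- r * s) * (\<sigma>\<^sup>2 / 2 * w'' (Y s \<omega>) + \<mu> * w' (Y s \<omega>) - r * w (Y s \<omega>)))"
  shows "integrable M U" "expectation (\<lambda>\<omega>. exp (- r * \<rho> \<omega>) * w (Y (\<rho> \<omega>) \<omega>)) = w 0 + expectation U"
proof -
  have c0: "continuous_on UNIV w" "continuous_on UNIV w'"
    using DERIV_continuous_on[of UNIV w w'] DERIV_continuous_on[of UNIV w' w''] d1 d2 by simp_all
  have [measurable]: "w \<in> borel_measurable borel" "w' \<in> borel_measurable borel" "w'' \<in> borel_measurable borel"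
    using c0 c2 by (simp_all add: borel_measurable_continuous_onI)
  define L where "L y = \<sigma>\<^sup>2 / 2 * w'' y + \<mu> * w' y" for y
  have cL: "continuous_on UNIV L" unfolding L_def by (intro continuous_intros c0 c2)
  have [measurable]: "L \<in> borel_measurable borel" using cL by (rule borel_measurable_continuous_onI)
  obtain B0 where B0: "B0 > 0" "\<And>y. \<bar>y\<bar> \<le> N + 1 \<Longrightarrow> \<bar>w y\<bar> \<le> B0" using continuous_bounded_Icc[OF c0(1)] by blast
  obtain B1 where B1: "B1 > 0" "\<And>y. \<bar>y\<bar> \<le> N \<Longrightarrow> \<bar>L y\<bar> \<le> B1" using continuous_bounded_Icc[OF cL] by blast
  have clN: "\<bar>clip (N + 1) y\<bar> \<le> N + 1" for y using N by (auto simp: abs_le_iff min_def max_def)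
  \<comment> \<open>At the rounded time the path may already have left \<open>{-N..N}\<close>.
    Clipping keeps the values bounded and changes nothing up to \<open>N + 1\<close>, in particular
    not in the limit.\<close>
  define v where "v y = w (clip (N + 1) y)" for y
  have vw: "v y = w y" if "\<bar>y\<bar> \<le> N + 1" for y 
  proof -
    have "clip (N + 1) y = y" using that by (auto simp: min_def max_def)
    then show ?thesis by (simp only: v_def)
  qed
  have vB: "\<bar>v y\<bar> \<le> B0" for y unfolding v_def by (rule B0(2)[OF clN])
  have cv: "continuous_on UNIV v" unfolding v_def
    by (rule continuous_on_compose2[OF c0(1)]) (auto intro!: continuous_intros continuous_on_max continuous_on_min)
  have [measurable]: "v \<in> borel_measurable borel" using cv by (rule borel_measurable_continuous_onI)
  define E where "E = exp (\<bar>r\<bar> * T)"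
  have E: "E > 0" "\<And>s. 0 \<le> s \<Longrightarrow> s \<le> T \<Longrightarrow> exp (- r * s) \<le> E"
  proof -
    show "E > 0" by (simp add: E_def)
    fix s assume s: "0 \<le> s" "s \<le> T"
    have "- r * s \<le> \<bar>r\<bar> * s" using s by (intro mult_right_mono) auto
    also have "\<dots> \<le> \<bar>r\<bar> * T" using s by (intro mult_left_mono) auto
    finally show "exp (- r * s) \<le> E" by (simp add: E_def)
  qed
  define h where "h n = T / real (Suc n)" for n :: nat
  have h: "h n > 0" "h n \<le> T" "real (Suc n) * h n = T" for n using T by (auto simp: h_def field_simps)
  have hlim: "h \<longlonglongrightarrow> 0"
    unfolding h_def using tendsto_mult[OF tendsto_const LIMSEQ_inverse_real_of_nat, of T] by (simp add: divide_inverse)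
  have kh: "0 \<le> real k * h n" "real k * h n \<le> T" "0 \<le> real (Suc k) * h n" "real (Suc k) * h n \<le> T" if "k < Suc n" for k n
  proof -
    have "real (Suc k) * h n \<le> real (Suc n) * h n" using that h(1)[of n] by (intro mult_right_mono) auto
    then show "real (Suc k) * h n \<le> T" using h(3) by simp
    moreover have "real k * h n \<le> real (Suc k) * h n" using h(1)[of n] by (intro mult_right_mono) auto
    ultimately show "real k * h n \<le> T" by linarith
    show "0 \<le> real k * h n" "0 \<le> real (Suc k) * h n" using h(1)[of n] by simp_all
  qed
  define A where "A n k = {\<omega>\<in>space M. real k * h n < \<rho> \<omega>}" for n k
  have AF: "A n k \<in> sets (F (real k * h n))" for n k unfolding A_def using h(1)[of n] by (intro rho) simp
  have [measurable]: "A n k \<in> sets M" for n k using AF filtration_subset by blast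
  have AN: "\<bar>Y (real k * h n) \<omega>\<bar> \<le> N" if "\<omega> \<in> A n k" for n k \<omega>
    using that inN[of \<omega> "real k * h n"] h(1)[of n] by (simp add: A_def)
  have Ym: "Y (real k * h n) \<in> borel_measurable M" for n k using h(1)[of n] by (intro Y_measurable) simp
  note [measurable] = Ym
  define q where "q n = (exp (- r * h n) - 1) / h n" for n
  have qlim: "q \<longlonglongrightarrow> - r"
  proof -
    have "((\<lambda>x. exp (- r * x)) has_real_derivative - r) (at 0)" by (auto intro!: derivative_eq_intros)
    then have "((\<lambda>x. (exp (- r * (0 + x)) - exp (- r * 0)) / x) \<longlongrightarrow> - r) (at 0)" by (rule DERIV_D)
    moreover have "filterlim h (at 0) sequentially"
      unfolding filterlim_at using hlim h(1) by (auto simp: less_imp_neq[symmetric])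
    ultimately have "(\<lambda>n. (exp (- r * (0 + h n)) - exp (- r * 0)) / h n) \<longlonglongrightarrow> - r" by (rule filterlim_compose)
    then show ?thesis by (simp add: q_def[abs_def])
  qed
  then obtain Q where Q: "Q > 0" "\<And>n. \<bar>q n\<bar> \<le> Q" using Bseq_def convergentI[THEN convergent_imp_Bseq] by (metis real_norm_def)
  \<comment> \<open>The increment of a discounted value is split as the later discount factor times
    the increment of \<open>w\<close>, plus the increment of the discount factor times the earlier
    value of \<open>w\<close>. This accounts for the two different times in the exponents;
    \<open>q n\<close> is the difference quotient of the discount factor.\<close>
  define c where "c n k \<omega> = indicator (A n k) \<omega> * (exp (- r * (real (Suc k) * h n)) * L (Y (real k * h n) \<omega>)
     + q n * exp (- r * (real k * h n)) * w (Y (real k * h n) \<omega>))" for n k \<omega>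
  have [measurable]: "c n k \<in> borel_measurable M" for n k unfolding c_def[abs_def] by measurable
  define Bc where "Bc = E * B1 + Q * E * B0"
  have Bc: "Bc \<ge> 0" using E(1) B1(1) Q(1) B0(1) by (simp add: Bc_def)
  have cB: "\<bar>c n k \<omega>\<bar> \<le> Bc" if "k < Suc n" for n k \<omega>
  proof (cases "\<omega> \<in> A n k")
    case True
    note a = AN[OF True]
    have "\<bar>exp (- r * (real (Suc k) * h n)) * L (Y (real k * h n) \<omega>)\<bar> \<le> E * B1"
      unfolding abs_mult using E kh[OF that] B1(2)[OF a] by (intro mult_mono) auto
    moreover have "\<bar>q n * exp (- r * (real k * h n)) * w (Y (real k * h n) \<omega>)\<bar> \<le> Q * E * B0"
      unfolding abs_mult using E kh[OF that] B0(2)[of "Y (real k * h n) \<omega>"] a Q by (intro mult_mono) auto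
    ultimately have "\<bar>exp (- r * (real (Suc k) * h n)) * L (Y (real k * h n) \<omega>) + q n * exp (- r * (real k * h n)) * w (Y (real k * h n) \<omega>)\<bar> \<le> Bc"
      unfolding Bc_def by (intro order_trans[OF abs_triangle_ineq] add_mono)
    then show ?thesis using True by (simp add: c_def)
  qed (use Bc in \<open>simp add: c_def\<close>)
  define Uap where "Uap n \<omega> = (\<Sum>k<Suc n. h n * c n k \<omega>)" for n \<omega>
  have [measurable]: "Uap n \<in> borel_measurable M" for n unfolding Uap_def[abs_def] by measurable
  have UnB: "\<bar>Uap n \<omega>\<bar> \<le> T * Bc" for n \<omega>
  proof -
    have "\<bar>Uap n \<omega>\<bar> \<le> (\<Sum>k<Suc n. h n * Bc)" unfolding Uap_def
      using cB h(1)[of n] by (intro order_trans[OF sum_abs] sum_mono) (simp add: abs_mult mult_left_mono)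
    also have "\<dots> = T * Bc" using h(3)[of n] by (simp del: of_nat_Suc)
    finally show ?thesis .
  qed
  have Ulim: "(\<lambda>n. Uap n \<omega>) \<longlonglongrightarrow> U \<omega>" if om: "\<omega> \<in> space M" for \<omega>
  proof -
    define g where "g n s = (\<Sum>k<Suc n. indicator {real k * h n..<real (Suc k) * h n} s * c n k \<omega>)" for n s
    have gU: "(LINT s|lborel. g n s) = Uap n \<omega>" for n
    proof -
      have i: "integrable lborel (\<lambda>s. indicator {real k * h n..<real (Suc k) * h n} s * c n k \<omega>)" for k
      proof (intro integrable_mult_left integrable_real_indicator)
        have "real k * h n \<le> real (Suc k) * h n" using h(1)[of n] by (intro mult_right_mono) auto
        from emeasure_lborel_Ico[OF this]
        show "emeasure lborel {real k * h n..<real (Suc k) * h n} < \<infinity>" by simp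
      qed simp
      have "(LINT s|lborel. g n s) = (\<Sum>k<Suc n. LINT s|lborel. indicator {real k * h n..<real (Suc k) * h n} s * c n k \<omega>)"
        unfolding g_def by (intro Bochner_Integration.integral_sum i)
      also have "\<dots> = Uap n \<omega>" unfolding Uap_def
      proof (rule sum.cong[OF refl])
        fix k
        have "real k * h n \<le> real (Suc k) * h n" using h(1)[of n] by (intro mult_right_mono) auto
        then show "(LINT s|lborel. indicator {real k * h n..<real (Suc k) * h n} s * c n k \<omega>) = h n * c n k \<omega>"
          by (simp add: algebra_simps)
      qed
      finally show ?thesis .
    qed
    have gform: "g n s = c n (nat \<lfloor>s / h n\<rfloor>) \<omega> \<and> nat \<lfloor>s / h n\<rfloor> < Suc n" if s: "0 \<le> s" "s < T" for n s
    proof -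
      define j where "j = nat \<lfloor>s / h n\<rfloor>"
      have jj: "real j \<le> s / h n" "s / h n < real j + 1" using s h(1)[of n] by (auto simp: j_def)
      have j: "real j * h n \<le> s" "s < real (Suc j) * h n" using jj h(1)[of n] by (auto simp: field_simps)
      have "s / h n < real (Suc n)" using s(2) h(1,3)[of n] by (simp add: pos_divide_less_eq del: of_nat_Suc)
      then have jn: "j < Suc n" using jj by linarith
      have "indicator {real k * h n..<real (Suc k) * h n} s * c n k \<omega> = (if k = j then c n j \<omega> else 0)" for k
      proof (cases "k = j")
        case True then show ?thesis using j by simp
      next
        case False
        have "\<not> (real k * h n \<le> s \<and> s < real (Suc k) * h n)"
        proof
          assume a: "real k * h n \<le> s \<and> s < real (Suc k) * h n"
          then have "real k * h n < real (Suc j) * h n" "real j * h n < real (Suc k) * h n" using j by linarith+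
          then have "real k < real (Suc j)" "real j < real (Suc k)" using h(1)[of n] by (simp_all only: mult_less_cancel_right_pos)
          then show False using False by linarith
        qed
        then show ?thesis using False by auto
      qed
      then have "g n s = c n j \<omega>" unfolding g_def using jn by simp
      then show ?thesis using jn by (simp add: j_def)
    qed
    have gout: "g n s = 0" if s: "\<not> (0 \<le> s \<and> s < T)" for n s
      unfolding g_def
    proof (rule sum.neutral, rule ballI)
      fix k assume "k \<in> {..<Suc n}"
      then have "s \<notin> {real k * h n..<real (Suc k) * h n}" using kh[of k n] s by auto
      then show "indicator {real k * h n..<real (Suc k) * h n} s * c n k \<omega> = 0" by simp
    qed
    have "(\<lambda>n. LINT s|lborel. g n s) \<longlonglongrightarrow> U \<omega>"
      unfolding U_def
    proof (rule integral_dominated_convergence[where w="\<lambda>s. Bc * indicator {0..T} s"])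
      have Ycont: "continuous_on UNIV (\<lambda>s. Y (max 0 s) \<omega>)"
        by (rule continuous_on_compose2[OF Y_continuous[OF om]]) (auto intro!: continuous_intros)
      then have [measurable]: "(\<lambda>s. Y (max 0 s) \<omega>) \<in> borel_measurable borel" by (rule borel_measurable_continuous_onI)
      have "(\<lambda>s. indicator {0..<\<rho> \<omega>} s * (exp (- r * s) * (\<sigma>\<^sup>2 / 2 * w'' (Y (max 0 s) \<omega>) + \<mu> * w' (Y (max 0 s) \<omega>) - r * w (Y (max 0 s) \<omega>)))) \<in> borel_measurable lborel"
        by measurable
      then show "(\<lambda>s. indicator {0..<\<rho> \<omega>} s * (exp (- r * s) * (\<sigma>\<^sup>2 / 2 * w'' (Y s \<omega>) + \<mu> * w' (Y s \<omega>) - r * w (Y s \<omega>)))) \<in> borel_measurable lborel"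
        by (rule subst[OF _ , where P="\<lambda>f. f \<in> borel_measurable lborel", rotated]) (auto simp: indicator_def fun_eq_iff)
      show "g n \<in> borel_measurable lborel" for n unfolding g_def[abs_def] by measurable
      show "integrable lborel (\<lambda>s. Bc * indicat_real {0..T} s)"
        by (intro integrable_mult_right integrable_real_indicator) (auto simp: emeasure_lborel_Icc_eq)
      show "AE s in lborel. norm (g n s) \<le> Bc * indicator {0..T} s" for n
      proof (rule AE_I2)
        fix s
        show "norm (g n s) \<le> Bc * indicator {0..T} s"
          using gform[of s n] gout[of s n] cB Bc by (cases "0 \<le> s \<and> s < T") auto
      qed
      \<comment> \<open>At \<open>s = \<rho> \<omega>\<close> grid points to the left of
        \<open>s\<close> may still count as before \<open>\<rho> \<omega>\<close>, so the limit of
        the indicators is claimed only off this point.\<close>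
      show "AE s in lborel. (\<lambda>n. g n s) \<longlonglongrightarrow> indicator {0..<\<rho> \<omega>} s * (exp (- r * s) * (\<sigma>\<^sup>2 / 2 * w'' (Y s \<omega>) + \<mu> * w' (Y s \<omega>) - r * w (Y s \<omega>)))"
        using AE_lborel_singleton[of "\<rho> \<omega>"] AE_lborel_singleton[of T]
      proof eventually_elim
        case (elim s)
        show ?case
        proof (cases "0 \<le> s \<and> s < T")
          case False
          then have "\<not> (0 \<le> s \<and> s < \<rho> \<omega>)" using rhoT[OF om] elim by auto
          then show ?thesis using gout[OF False] by simp
        next
          case True
          define t where "t n = real (nat \<lfloor>s / h n\<rfloor>) * h n" for n
          have tb: "s - h n \<le> t n" "t n \<le> s" for n
          proof -
            have "real (nat \<lfloor>s / h n\<rfloor>) \<le> s / h n" "s / h n < real (nat \<lfloor>s / h n\<rfloor>) + 1"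
              using True h(1)[of n] by auto
            then show "s - h n \<le> t n" "t n \<le> s" using h(1)[of n] unfolding t_def by (auto simp: field_simps)
          qed
          have tlim: "t \<longlonglongrightarrow> s"
          proof (rule real_tendsto_sandwich)
            show "\<forall>\<^sub>F n in sequentially. s - h n \<le> t n" "\<forall>\<^sub>F n in sequentially. t n \<le> s" using tb by auto
            show "(\<lambda>n. s - h n) \<longlonglongrightarrow> s" using tendsto_diff[OF tendsto_const hlim, of s] by simp
          qed simp
          have t0: "0 \<le> t n" for n using h(1)[of n] by (simp add: t_def)
          have Yt: "(\<lambda>n. Y (t n) \<omega>) \<longlonglongrightarrow> Y s \<omega>"
          proof -
            have "isCont (\<lambda>s. Y (max 0 s) \<omega>) s" using Ycont by (simp add: continuous_on_eq_continuous_at)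
            from isCont_tendsto_compose[OF this tlim] show ?thesis using t0 True by simp
          qed
          have Lt: "(\<lambda>n. L (Y (t n) \<omega>)) \<longlonglongrightarrow> L (Y s \<omega>)" "(\<lambda>n. w (Y (t n) \<omega>)) \<longlonglongrightarrow> w (Y s \<omega>)"
          proof -
            have ic: "isCont L (Y s \<omega>)" "isCont w (Y s \<omega>)" using cL c0(1) by (simp_all add: continuous_on_eq_continuous_at)
            show "(\<lambda>n. L (Y (t n) \<omega>)) \<longlonglongrightarrow> L (Y s \<omega>)" by (rule isCont_tendsto_compose[OF ic(1) Yt])
            show "(\<lambda>n. w (Y (t n) \<omega>)) \<longlonglongrightarrow> w (Y s \<omega>)" by (rule isCont_tendsto_compose[OF ic(2) Yt])
          qed
          have ind: "(\<lambda>n. indicator (A n (nat \<lfloor>s / h n\<rfloor>)) \<omega>) \<longlonglongrightarrow> (indicator {0..<\<rho> \<omega>} s :: real)"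
          proof (cases "s < \<rho> \<omega>")
            case True
            have "indicator (A n (nat \<lfloor>s / h n\<rfloor>)) \<omega> = (1::real)" for n
              using tb(2)[of n] True om by (simp add: A_def t_def)
            then show ?thesis using True \<open>0 \<le> s \<and> s < T\<close> by simp
          next
            case False
            then have "\<rho> \<omega> < s" using elim by simp
            then have "\<forall>\<^sub>F n in sequentially. \<rho> \<omega> < t n" using order_tendstoD(1)[OF tlim] by blast
            then have "\<forall>\<^sub>F n in sequentially. (0::real) = indicator (A n (nat \<lfloor>s / h n\<rfloor>)) \<omega>"
              by eventually_elim (simp add: A_def t_def)
            then show ?thesis using False by (simp add: Lim_transform_eventually[OF tendsto_const])
          qed
          have "(\<lambda>n. c n (nat \<lfloor>s / h n\<rfloor>) \<omega>) \<longlonglongrightarrow> indicator {0..<\<rho> \<omega>} s * (exp (- r * (s + 0)) * L (Y s \<omega>) + (- r) * exp (- r * s) * w (Y s \<omega>))"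
          proof -
            have "c n (nat \<lfloor>s / h n\<rfloor>) \<omega> = indicator (A n (nat \<lfloor>s / h n\<rfloor>)) \<omega> * (exp (- r * (t n + h n)) * L (Y (t n) \<omega>) + q n * exp (- r * t n) * w (Y (t n) \<omega>))" for n
              unfolding c_def t_def by (simp add: algebra_simps)
            then show ?thesis by (simp only:) (intro tendsto_intros ind tlim hlim Lt qlim)
          qed
          moreover have "g n s = c n (nat \<lfloor>s / h n\<rfloor>) \<omega>" for n using gform[of s n] True by blast
          ultimately show ?thesis by (simp add: L_def algebra_simps)
        qed
      qed
    qed
    then show ?thesis by (simp add: gU)
  qed
  have Um [measurable]: "U \<in> borel_measurable M"
    by (rule borel_measurable_LIMSEQ_real[of M Uap]) (use Ulim in auto)
  have UB: "\<bar>U \<omega>\<bar> \<le> T * Bc" if "\<omega> \<in> space M" for \<omega>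
    by (rule tendsto_upperbound[OF tendsto_rabs[OF Ulim[OF that]]]) (use UnB in auto)
  show Ui: "integrable M U" by (rule integrable_const_bound[where B="T * Bc"]) (use UB in auto)
  have EU: "(\<lambda>n. expectation (Uap n)) \<longlonglongrightarrow> expectation U"
    by (rule integral_dominated_convergence[where w="\<lambda>_. T * Bc"]) (use Ulim UnB in auto)
  define Z where "Z n k \<omega> = exp (- r * (real k * h n)) * v (Y (real k * h n) \<omega>)" for n k \<omega>
  define J where "J n \<omega> = nat \<lceil>\<rho> \<omega> / h n\<rceil>" for n \<omega>
  have tele: "Z n (J n \<omega>) \<omega> = Z n 0 \<omega> + (\<Sum>k<Suc n. if real k * h n < \<rho> \<omega> then Z n (Suc k) \<omega> - Z n k \<omega> else 0)" if "\<omega> \<in> space M" for n \<omega>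
    unfolding J_def using rhoT[OF that] h(1,3)[of n] by (intro grid_telescope) auto
  have [measurable]: "Z n k \<in> borel_measurable M" for n k unfolding Z_def[abs_def] by measurable
  have Z0: "Z n 0 \<omega> = w 0" if "\<omega> \<in> space M" for n \<omega> using Y_0[OF that] vw[of 0] N by (simp add: Z_def)
  have step: "(if real k * h n < \<rho> \<omega> then Z n (Suc k) \<omega> - Z n k \<omega> else 0) =
     h n * c n k \<omega> + exp (- r * (real (Suc k) * h n)) * (indicator (A n k) \<omega> * (w (clip (N + 1) (Y (real k * h n + h n) \<omega>)) - w (Y (real k * h n) \<omega>) - h n * L (Y (real k * h n) \<omega>)))"
    if om: "\<omega> \<in> space M" for n k \<omega>
  proof (cases "\<omega> \<in> A n k")
    case True
    have e: "h n * q n * exp (- r * (real k * h n)) = exp (- r * (real (Suc k) * h n)) - exp (- r * (real k * h n))"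
    proof -
      have "h n * q n = exp (- r * h n) - 1" using h(1)[of n] by (simp add: q_def)
      moreover have "exp (- r * (real (Suc k) * h n)) = exp (- r * h n) * exp (- r * (real k * h n))"
        by (simp add: exp_add[symmetric] algebra_simps)
      ultimately show ?thesis by (simp only: left_diff_distrib mult_1_left)
    qed
    have "v (Y (real k * h n) \<omega>) = w (Y (real k * h n) \<omega>)" by (rule vw) (use AN[OF True] in simp)
    moreover have "real (Suc k) * h n = real k * h n + h n" by (simp add: algebra_simps)
    moreover have "h n * c n k \<omega> = exp (- r * (real (Suc k) * h n)) * (h n * L (Y (real k * h n) \<omega>)) + (exp (- r * (real (Suc k) * h n)) - exp (- r * (real k * h n))) * w (Y (real k * h n) \<omega>)"
      unfolding e[symmetric] using True by (simp add: c_def algebra_simps)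
    ultimately show ?thesis using True om by (simp add: A_def Z_def v_def right_diff_distrib left_diff_distrib)
  next
    case False
    then show ?thesis using om by (simp add: A_def c_def)
  qed
  define err where "err n k \<omega> = indicator (A n k) \<omega> * (w (clip (N + 1) (Y (real k * h n + h n) \<omega>)) - w (Y (real k * h n) \<omega>) - h n * L (Y (real k * h n) \<omega>))" for n k \<omega>
  have Ym2 [measurable]: "Y (real k * h n + h n) \<in> borel_measurable M" for k n using h(1)[of n] by (intro Y_measurable) simp
  have [measurable]: "err n k \<in> borel_measurable M" for n k unfolding err_def[abs_def] by measurable
  have erri: "integrable M (err n k)" for n k
  proof (rule integrable_const_bound[where B="B0 + B0 + h n * B1"])
    show "AE \<omega> in M. norm (err n k \<omega>) \<le> B0 + B0 + h n * B1"
    proof (rule AE_I2)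
      fix \<omega>
      have tri: "\<bar>p1 - p2 - p3\<bar> \<le> \<bar>p1\<bar> + \<bar>p2\<bar> + \<bar>p3\<bar>" for p1 p2 p3 :: real by linarith
      show "norm (err n k \<omega>) \<le> B0 + B0 + h n * B1"
      proof (cases "\<omega> \<in> A n k")
        case True
        have t1: "\<bar>h n * L (Y (real k * h n) \<omega>)\<bar> \<le> h n * B1"
          using B1(2)[OF AN[OF True]] h(1)[of n] by (simp add: abs_mult mult_left_mono)
        have t2: "\<bar>w (Y (real k * h n) \<omega>)\<bar> \<le> B0" using AN[OF True] by (intro B0(2)) simp
        have "err n k \<omega> = w (clip (N + 1) (Y (real k * h n + h n) \<omega>)) - w (Y (real k * h n) \<omega>) - h n * L (Y (real k * h n) \<omega>)"
          unfolding err_def indicator_simps(1)[OF True] by (rule mult_1_left)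
        then show ?thesis unfolding real_norm_def
          by (simp only:) (rule order_trans[OF tri add_mono[OF add_mono[OF B0(2)[OF clN] t2] t1]])
      qed (use B0(1) B1(1) h(1)[of n] in \<open>simp add: err_def\<close>)
    qed
  qed measurable
  have ci: "integrable M (c n k)" if "k < Suc n" for n k
    by (rule integrable_const_bound[where B=Bc]) (use cB[OF that] in auto)
  have EZ: "expectation (\<lambda>\<omega>. Z n (J n \<omega>) \<omega>) = w 0 + expectation (Uap n) + (\<Sum>k<Suc n. exp (- r * (real (Suc k) * h n)) * expectation (err n k))" for n
  proof -
    have "expectation (\<lambda>\<omega>. Z n (J n \<omega>) \<omega>) = expectation (\<lambda>\<omega>. w 0 + (\<Sum>k<Suc n. h n * c n k \<omega> + exp (- r * (real (Suc k) * h n)) * err n k \<omega>))"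
      by (intro Bochner_Integration.integral_cong refl) (simp only: tele Z0 step err_def)
    also have "\<dots> = expectation (\<lambda>\<omega>. w 0 + Uap n \<omega> + (\<Sum>k<Suc n. exp (- r * (real (Suc k) * h n)) * err n k \<omega>))"
      by (simp only: Uap_def sum.distrib add.assoc)
    also have "\<dots> = expectation (\<lambda>\<omega>. w 0 + Uap n \<omega>) + expectation (\<lambda>\<omega>. \<Sum>k<Suc n. exp (- r * (real (Suc k) * h n)) * err n k \<omega>)"
      by (rule Bochner_Integration.integral_add)
         (intro Bochner_Integration.integrable_add Bochner_Integration.integrable_sum integrable_mult_right erri integrable_const, rule integrable_const_bound[where B="T * Bc"], use UnB in \<open>auto intro!: Bochner_Integration.integrable_sum integrable_mult_right erri\<close>)
    also have "expectation (\<lambda>\<omega>. w 0 + Uap n \<omega>) = w 0 + expectation (Uap n)"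
      by (subst Bochner_Integration.integral_add) (use UnB in \<open>auto simp: prob_space intro!: integrable_const_bound[where B="T * Bc"]\<close>)
    also have "expectation (\<lambda>\<omega>. \<Sum>k<Suc n. exp (- r * (real (Suc k) * h n)) * err n k \<omega>) = (\<Sum>k<Suc n. exp (- r * (real (Suc k) * h n)) * expectation (err n k))"
      by (subst Bochner_Integration.integral_sum) (auto intro!: integrable_mult_right erri)
    finally show ?thesis .
  qed
  have errlim: "(\<lambda>n. \<Sum>k<Suc n. exp (- r * (real (Suc k) * h n)) * expectation (err n k)) \<longlonglongrightarrow> 0"
  proof (rule LIMSEQ_I)
    fix e :: real assume e: "e > 0"
    \<comment> \<open>The errors are weighted with discount factors of at most \<open>E\<close> over
      total time \<open>T\<close>; this makes their leading part \<open>e / 2\<close>.\<close>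
    define e1 where "e1 = e / (2 * E * T)"
    have e1: "e1 > 0" using e E(1) T by (simp add: e1_def)
    obtain C where C: "C \<ge> 0" "\<And>t h A. 0 \<le> t \<Longrightarrow> 0 < h \<Longrightarrow> h \<le> T \<Longrightarrow> A \<in> sets (F t) \<Longrightarrow> (\<And>\<omega>. \<omega> \<in> A \<Longrightarrow> \<bar>Y t \<omega>\<bar> \<le> N) \<Longrightarrow>
     \<bar>expectation (\<lambda>\<omega>. indicator A \<omega> * (w (clip (N + 1) (Y (t + h) \<omega>)) - w (Y t \<omega>)
        - h * (\<sigma>\<^sup>2 / 2 * w'' (Y t \<omega>) + \<mu> * w' (Y t \<omega>))))\<bar> \<le> e1 * h + C * h\<^sup>2"
      using one_step_estimate[OF d1 d2 c2 N e1 less_imp_le[OF T]] by blast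
    have eb: "\<bar>expectation (err n k)\<bar> \<le> e1 * h n + C * (h n)\<^sup>2" for n k
      unfolding err_def L_def by (rule C(2)) (use h[of n] AF AN in auto)
    have sb: "\<bar>\<Sum>k<Suc n. exp (- r * (real (Suc k) * h n)) * expectation (err n k)\<bar> \<le> E * (e1 * T) + E * C * T * h n" for n
    proof -
      have "\<bar>\<Sum>k<Suc n. exp (- r * (real (Suc k) * h n)) * expectation (err n k)\<bar> \<le> (\<Sum>k<Suc n. E * (e1 * h n + C * (h n)\<^sup>2))"
        using kh E eb by (intro order_trans[OF sum_abs] sum_mono) (auto simp: abs_mult intro!: mult_mono simp del: of_nat_Suc)
      also have "\<dots> = E * (e1 * (real (Suc n) * h n)) + E * C * (real (Suc n) * h n) * h n"
        by (simp add: algebra_simps power2_eq_square)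
      finally show ?thesis unfolding h(3) .
    qed
    have "(\<lambda>n. E * C * T * h n) \<longlonglongrightarrow> E * C * T * 0" by (intro tendsto_intros hlim)
    then have "\<forall>\<^sub>F n in sequentially. E * C * T * h n < e / 2" using e by (intro order_tendstoD(2)) auto
    then obtain n0 where n0: "\<And>n. n \<ge> n0 \<Longrightarrow> E * C * T * h n < e / 2" by (auto simp: eventually_sequentially)
    have "E * (e1 * T) = e / 2" using E(1) T by (simp add: e1_def)
    then show "\<exists>n0. \<forall>n\<ge>n0. norm ((\<Sum>k<Suc n. exp (- r * (real (Suc k) * h n)) * expectation (err n k)) - 0) < e"
      using sb n0 by (intro exI[of _ n0] allI impI) (smt (verit) real_norm_def field_sum_of_halves)
  qed
  have Zlim: "(\<lambda>n. Z n (J n \<omega>) \<omega>) \<longlonglongrightarrow> exp (- r * \<rho> \<omega>) * w (Y (\<rho> \<omega>) \<omega>)" if om: "\<omega> \<in> space M" for \<omega>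
  proof -
    define t where "t n = real (J n \<omega>) * h n" for n
    have tb: "\<rho> \<omega> \<le> t n" "t n \<le> \<rho> \<omega> + h n" for n
    proof -
      have "\<rho> \<omega> / h n \<le> real (J n \<omega>)" unfolding J_def by linarith
      moreover have "real (J n \<omega>) \<le> \<rho> \<omega> / h n + 1"
      proof -
        have "0 \<le> \<rho> \<omega> / h n" using rhoT[OF om] h(1)[of n] by simp
        then show ?thesis unfolding J_def by linarith
      qed
      ultimately show "\<rho> \<omega> \<le> t n" "t n \<le> \<rho> \<omega> + h n" using h(1)[of n] unfolding t_def by (auto simp: field_simps)
    qed
    have tlim: "t \<longlonglongrightarrow> \<rho> \<omega>"
    proof (rule real_tendsto_sandwich)
      show "\<forall>\<^sub>F n in sequentially. \<rho> \<omega> \<le> t n" "\<forall>\<^sub>F n in sequentially. t n \<le> \<rho> \<omega> + h n" using tb by auto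
      show "(\<lambda>n. \<rho> \<omega> + h n) \<longlonglongrightarrow> \<rho> \<omega>" using tendsto_add[OF tendsto_const hlim, of "\<rho> \<omega>"] by simp
    qed simp
    have Ycont: "continuous_on UNIV (\<lambda>s. Y (max 0 s) \<omega>)"
      by (rule continuous_on_compose2[OF Y_continuous[OF om]]) (auto intro!: continuous_intros)
    then have "isCont (\<lambda>s. Y (max 0 s) \<omega>) (\<rho> \<omega>)" by (simp add: continuous_on_eq_continuous_at)
    from isCont_tendsto_compose[OF this tlim] have Yt: "(\<lambda>n. Y (t n) \<omega>) \<longlonglongrightarrow> Y (\<rho> \<omega>) \<omega>"
      using rhoT[OF om] tb(1) by (simp add: max_absorb2 order_trans[of 0 "\<rho> \<omega>"])
    have "(\<lambda>n. exp (- r * t n) * v (Y (t n) \<omega>)) \<longlonglongrightarrow> exp (- r * \<rho> \<omega>) * v (Y (\<rho> \<omega>) \<omega>)"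
      using cv isCont_tendsto_compose[OF _ Yt, of v] by (intro tendsto_intros tlim) (simp add: continuous_on_eq_continuous_at)
    moreover have "v (Y (\<rho> \<omega>) \<omega>) = w (Y (\<rho> \<omega>) \<omega>)"
    proof (rule vw)
      show "\<bar>Y (\<rho> \<omega>) \<omega>\<bar> \<le> N + 1"
      proof (cases "\<rho> \<omega> = 0")
        case True then show ?thesis using Y_0[OF om] N by simp
      next
        case False
        then have pos: "0 < \<rho> \<omega>" using rhoT[OF om] by simp
        have "((\<lambda>s. \<bar>Y (max 0 s) \<omega>\<bar>) \<longlongrightarrow> \<bar>Y (max 0 (\<rho> \<omega>)) \<omega>\<bar>) (at_left (\<rho> \<omega>))"
          using \<open>isCont (\<lambda>s. Y (max 0 s) \<omega>) (\<rho> \<omega>)\<close> unfolding isCont_def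
          by (intro tendsto_rabs) (rule tendsto_mono[OF at_le], auto)
        moreover have "\<forall>\<^sub>F s in at_left (\<rho> \<omega>). \<bar>Y (max 0 s) \<omega>\<bar> \<le> N"
          using eventually_at_left_real[OF pos] by eventually_elim (use inN[OF om] in auto)
        ultimately have "\<bar>Y (max 0 (\<rho> \<omega>)) \<omega>\<bar> \<le> N" by (rule tendsto_upperbound) simp
        then show ?thesis using pos by simp
      qed
    qed
    ultimately show ?thesis by (simp add: Z_def t_def)
  qed
  have "(\<lambda>n. expectation (\<lambda>\<omega>. Z n (J n \<omega>) \<omega>)) \<longlonglongrightarrow> expectation (\<lambda>\<omega>. exp (- r * \<rho> \<omega>) * w (Y (\<rho> \<omega>) \<omega>))"
  proof (rule integral_dominated_convergence[where w="\<lambda>_. E * B0"])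
    have Zm: "(\<lambda>\<omega>. Z n (J n \<omega>) \<omega>) \<in> borel_measurable M" for n
    proof -
      have "(\<lambda>\<omega>. w 0 + (\<Sum>k<Suc n. h n * c n k \<omega> + exp (- r * (real (Suc k) * h n)) * err n k \<omega>)) \<in> borel_measurable M" by measurable
      then show ?thesis by (rule measurable_cong[THEN iffD1, rotated]) (simp only: tele Z0 step err_def)
    qed
    then show "\<And>n. (\<lambda>\<omega>. Z n (J n \<omega>) \<omega>) \<in> borel_measurable M" .
    show "(\<lambda>\<omega>. exp (- r * \<rho> \<omega>) * w (Y (\<rho> \<omega>) \<omega>)) \<in> borel_measurable M"
      by (rule borel_measurable_LIMSEQ_real[OF Zlim Zm])
    show "AE \<omega> in M. (\<lambda>n. Z n (J n \<omega>) \<omega>) \<longlonglongrightarrow> exp (- r * \<rho> \<omega>) * w (Y (\<rho> \<omega>) \<omega>)" using Zlim by auto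
    show "AE \<omega> in M. norm (Z n (J n \<omega>) \<omega>) \<le> E * B0" for n
    proof (rule AE_I2)
      fix \<omega> assume om: "\<omega> \<in> space M"
      have "J n \<omega> \<le> Suc n"
      proof -
        have "\<rho> \<omega> / h n \<le> real (Suc n)" using rhoT[OF om] h(1,3)[of n] by (simp add: pos_divide_le_eq del: of_nat_Suc)
        then show ?thesis unfolding J_def by (simp add: ceiling_le_iff nat_le_iff del: of_nat_Suc)
      qed
      then have "real (J n \<omega>) * h n \<le> T" using h(1,3)[of n] mult_right_mono[of "real (J n \<omega>)" "real (Suc n)" "h n"] by simp
      then have "exp (- r * (real (J n \<omega>) * h n)) \<le> E" using h(1)[of n] by (intro E(2)) auto
      then show "norm (Z n (J n \<omega>) \<omega>) \<le> E * B0" unfolding Z_def real_norm_def abs_mult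
        using vB E(1) by (intro mult_mono) (auto simp: less_imp_le)
    qed
  qed auto
  moreover have "(\<lambda>n. expectation (\<lambda>\<omega>. Z n (J n \<omega>) \<omega>)) \<longlonglongrightarrow> w 0 + expectation U + 0"
    unfolding EZ by (intro tendsto_intros EU errlim)
  ultimately show "expectation (\<lambda>\<omega>. exp (- r * \<rho> \<omega>) * w (Y (\<rho> \<omega>) \<omega>)) = w 0 + expectation U"
    using LIMSEQ_unique by fastforce
qed

text \<open>Bounded stopping times up to which the path stays in a compact interval, so that
  Dynkin's formula needs no growth condition on \<open>w\<close>. Events \<open>s < \<rho>\<close>
  rather than \<open>\<rho> \<le> s\<close> are listed because a grid step is taken exactly on
  them.\<close>

definition stops :: "('a \<Rightarrow> real) \<Rightarrow> real \<Rightarrow> real \<Rightarrow> bool" where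
  "stops \<rho> T N \<longleftrightarrow> (\<forall>s\<ge>0. {\<omega>\<in>space M. s < \<rho> \<omega>} \<in> sets (F s)) \<and>
     (\<forall>\<omega>\<in>space M. 0 \<le> \<rho> \<omega> \<and> \<rho> \<omega> \<le> T) \<and>
     (\<forall>\<omega>\<in>space M. \<forall>s. 0 \<le> s \<and> s < \<rho> \<omega> \<longrightarrow> \<bar>Y s \<omega>\<bar> \<le> N)"

lemma stopsD:
  assumes "stops \<rho> T N"
  shows "0 \<le> s \<Longrightarrow> {\<omega>\<in>space M. s < \<rho> \<omega>} \<in> sets (F s)"
    "\<omega> \<in> space M \<Longrightarrow> 0 \<le> \<rho> \<omega> \<and> \<rho> \<omega> \<le> T"
    "\<omega> \<in> space M \<Longrightarrow> 0 \<le> s \<Longrightarrow> s < \<rho> \<omega> \<Longrightarrow> \<bar>Y s \<omega>\<bar> \<le> N"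
  using assms unfolding stops_def by auto

lemma stops_measurable:
  assumes "stops \<rho> T N" shows "\<rho> \<in> borel_measurable M"
  unfolding borel_measurable_iff_greater
proof
  fix a :: real
  show "{\<omega> \<in> space M. a < \<rho> \<omega>} \<in> sets M"
  proof (cases "0 \<le> a")
    case True
    then show ?thesis using stopsD(1)[OF assms] filtration_subset by blast
  next
    case False
    then have "{\<omega> \<in> space M. a < \<rho> \<omega>} = space M" using stopsD(2)[OF assms] by force
    then show ?thesis by simp
  qed
qed

lemma Y_path_isCont: "\<omega> \<in> space M \<Longrightarrow> isCont (\<lambda>s. Y (max 0 s) \<omega>) t"
proof -
  assume om: "\<omega> \<in> space M"
  have "continuous_on UNIV (\<lambda>s. Y (max 0 s) \<omega>)"
    by (rule continuous_on_compose2[OF Y_continuous[OF om]]) (auto intro!: continuous_intros)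
  then show ?thesis by (simp add: continuous_on_eq_continuous_at)
qed

lemma stops_value_bound:
  assumes st: "stops \<rho> T N" and N: "N \<ge> 0" and om: "\<omega> \<in> space M"
  shows "\<bar>Y (\<rho> \<omega>) \<omega>\<bar> \<le> N"
proof (cases "\<rho> \<omega> = 0")
  case True then show ?thesis using Y_0[OF om] N by simp
next
  case False
  then have pos: "0 < \<rho> \<omega>" using stopsD(2)[OF st om] by simp
  have "((\<lambda>s. \<bar>Y (max 0 s) \<omega>\<bar>) \<longlongrightarrow> \<bar>Y (max 0 (\<rho> \<omega>)) \<omega>\<bar>) (at_left (\<rho> \<omega>))"
  proof (rule tendsto_rabs)
    have "((\<lambda>s. Y (max 0 s) \<omega>) \<longlongrightarrow> Y (max 0 (\<rho> \<omega>)) \<omega>) (at (\<rho> \<omega>))"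
      using Y_path_isCont[OF om, of "\<rho> \<omega>"] unfolding isCont_def .
    then show "((\<lambda>s. Y (max 0 s) \<omega>) \<longlongrightarrow> Y (max 0 (\<rho> \<omega>)) \<omega>) (at_left (\<rho> \<omega>))"
      by (rule tendsto_mono[OF at_le[OF subset_UNIV]])
  qed
  moreover have "\<forall>\<^sub>F s in at_left (\<rho> \<omega>). \<bar>Y (max 0 s) \<omega>\<bar> \<le> N"
    using eventually_at_left_real[OF pos] by eventually_elim (use stopsD(3)[OF st om] in auto)
  ultimately have "\<bar>Y (max 0 (\<rho> \<omega>)) \<omega>\<bar> \<le> N" by (rule tendsto_upperbound) simp
  then show ?thesis using pos by simp
qed

section \<open>Discounted occupation integrals\<close>

lemma Y_max_measurable: "(\<lambda>z. Y (max 0 (snd z)) (fst z)) \<in> borel_measurable (M \<Otimes>\<^sub>M lborel)"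
  using Y_joint_measurable by (simp add: case_prod_unfold cong: measurable_cong_sets)

lemma stopped_measurable:
  assumes st: "stops \<rho> T N" and [measurable]: "w \<in> borel_measurable borel"
  shows "(\<lambda>\<omega>. exp (- r * \<rho> \<omega>) * w (Y (\<rho> \<omega>) \<omega>)) \<in> borel_measurable M"
proof -
  note [measurable] = stops_measurable[OF st] Y_max_measurable
  have "(\<lambda>\<omega>. (\<omega>, \<rho> \<omega>)) \<in> M \<rightarrow>\<^sub>M M \<Otimes>\<^sub>M lborel" by measurable
  from measurable_compose[OF this Y_max_measurable]
  have [measurable]: "(\<lambda>\<omega>. Y (max 0 (\<rho> \<omega>)) \<omega>) \<in> borel_measurable M" by simp
  have "(\<lambda>\<omega>. exp (- r * \<rho> \<omega>) * w (Y (max 0 (\<rho> \<omega>)) \<omega>)) \<in> borel_measurable M" by measurable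
  then show ?thesis
    by (rule measurable_cong[THEN iffD1, rotated]) (use stopsD(2)[OF st] in \<open>simp add: max_absorb2\<close>)
qed

text \<open>Expected path integrals are written on the product of \<open>M\<close> and the time
  axis, so that linearity, monotonicity and norm bounds are those of a single integral.
  \<open>max 0\<close> serves joint measurability and is invisible under the indicator.\<close>

definition occ_kernel :: "real \<Rightarrow> ('a \<Rightarrow> real) \<Rightarrow> (real \<Rightarrow> real) \<Rightarrow> 'a \<times> real \<Rightarrow> real" where
  "occ_kernel r \<rho> \<phi> z = indicator {0..<\<rho> (fst z)} (snd z) * (exp (- r * snd z) * \<phi> (Y (max 0 (snd z)) (fst z)))"

definition occ :: "real \<Rightarrow> ('a \<Rightarrow> real) \<Rightarrow> (real \<Rightarrow> real) \<Rightarrow> real" where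
  "occ r \<rho> \<phi> = (LINT z|(M \<Otimes>\<^sub>M lborel). occ_kernel r \<rho> \<phi> z)"

sublocale paths: pair_sigma_finite M lborel
  by (rule pair_sigma_finite.intro) (auto intro: sigma_finite_measure_axioms sigma_finite_lborel)

text \<open>The first factor bounds the discount up to time \<open>T\<close>, whatever the sign of
  \<open>r\<close>; the second is the constant of \<open>occupation_bound\<close>.\<close>

definition occ_const :: "real \<Rightarrow> real \<Rightarrow> real" where
  "occ_const r T = exp (\<bar>r\<bar> * T) * (2 * sqrt T / (\<bar>\<sigma>\<bar> * sqrt (2 * pi)))"

lemma occ_const_nonneg: "0 \<le> T \<Longrightarrow> 0 \<le> occ_const r T"
  by (simp add: occ_const_def)

lemma discount_bound: "0 \<le> s \<Longrightarrow> s \<le> T \<Longrightarrow> exp (- r * s) \<le> exp (\<bar>r\<bar> * T)" for r s T :: real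
proof -
  assume s: "0 \<le> s" "s \<le> T"
  have "- r * s \<le> \<bar>r\<bar> * s" using s by (intro mult_right_mono) auto
  also have "\<dots> \<le> \<bar>r\<bar> * T" using s by (intro mult_left_mono) auto
  finally show ?thesis by simp
qed

lemma occ_kernel_measurable:
  assumes st: "stops \<rho> T N" and [measurable]: "\<phi> \<in> borel_measurable borel"
  shows "occ_kernel r \<rho> \<phi> \<in> borel_measurable (M \<Otimes>\<^sub>M lborel)"
proof -
  note [measurable] = stops_measurable[OF st] Y_max_measurable
  have "(\<lambda>z. (if 0 \<le> snd z \<and> snd z < \<rho> (fst z) then 1 else 0) * (exp (- r * snd z) * \<phi> (Y (max 0 (snd z)) (fst z)))) \<in> borel_measurable (M \<Otimes>\<^sub>M lborel)"
    by measurable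
  moreover have "occ_kernel r \<rho> \<phi> = (\<lambda>z. (if 0 \<le> snd z \<and> snd z < \<rho> (fst z) then 1 else 0) * (exp (- r * snd z) * \<phi> (Y (max 0 (snd z)) (fst z))))"
    by (auto simp: occ_kernel_def indicator_def fun_eq_iff)
  ultimately show ?thesis by simp
qed

lemma occ_kernel_nn_bound:
  assumes st: "stops \<rho> T N" and [measurable]: "\<phi> \<in> borel_measurable borel" and T: "T \<ge> 0"
  shows "(\<integral>\<^sup>+z. ennreal \<bar>occ_kernel r \<rho> \<phi> z\<bar> \<partial>(M \<Otimes>\<^sub>M lborel)) \<le> ennreal (occ_const r T) * (\<integral>\<^sup>+y. ennreal \<bar>\<phi> y\<bar> * indicator {-N..N} y \<partial>lborel)"
proof -
  note [measurable] = occ_kernel_measurable[OF st assms(2)]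
  define f where "f y = ennreal (exp (\<bar>r\<bar> * T)) * (ennreal \<bar>\<phi> y\<bar> * indicator {-N..N} y)" for y
  have fm: "f \<in> borel_measurable borel" unfolding f_def[abs_def] by measurable
  have "(\<integral>\<^sup>+z. ennreal \<bar>occ_kernel r \<rho> \<phi> z\<bar> \<partial>(M \<Otimes>\<^sub>M lborel)) = (\<integral>\<^sup>+\<omega>. \<integral>\<^sup>+s. ennreal \<bar>occ_kernel r \<rho> \<phi> (\<omega>, s)\<bar> \<partial>lborel \<partial>M)"
    by (rule lborel.nn_integral_fst[symmetric]) measurable
  also have "\<dots> \<le> (\<integral>\<^sup>+\<omega>. \<integral>\<^sup>+s. f (Y s \<omega>) * indicator {0..T} s \<partial>lborel \<partial>M)"
  proof (intro nn_integral_mono)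
    fix \<omega> s assume om: "\<omega> \<in> space M"
    show "ennreal \<bar>occ_kernel r \<rho> \<phi> (\<omega>, s)\<bar> \<le> f (Y s \<omega>) * indicator {0..T} s"
    proof (cases "0 \<le> s \<and> s < \<rho> \<omega>")
      case True
      then have "\<bar>Y s \<omega>\<bar> \<le> N" "s \<le> T" using stopsD(2)[OF st om] stopsD(3)[OF st om, of s] by auto
      moreover have "exp (- r * s) * \<bar>\<phi> (Y s \<omega>)\<bar> \<le> exp (\<bar>r\<bar> * T) * \<bar>\<phi> (Y s \<omega>)\<bar>"
        using True \<open>s \<le> T\<close> discount_bound[of s T r] by (intro mult_right_mono) auto
      then have "ennreal (exp (- r * s) * \<bar>\<phi> (Y s \<omega>)\<bar>) \<le> ennreal (exp (\<bar>r\<bar> * T)) * ennreal \<bar>\<phi> (Y s \<omega>)\<bar>"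
        by (simp add: ennreal_mult'[symmetric] ennreal_leI)
      ultimately show ?thesis using True by (simp add: f_def occ_kernel_def abs_mult abs_le_iff)
    qed (auto simp: occ_kernel_def)
  qed
  also have "\<dots> \<le> ennreal (2 * sqrt T / (\<bar>\<sigma>\<bar> * sqrt (2 * pi))) * (\<integral>\<^sup>+y. f y \<partial>lborel)"
    by (rule occupation_bound[OF fm T])
  also have "\<dots> = ennreal (2 * sqrt T / (\<bar>\<sigma>\<bar> * sqrt (2 * pi))) * (ennreal (exp (\<bar>r\<bar> * T)) * (\<integral>\<^sup>+y. ennreal \<bar>\<phi> y\<bar> * indicator {-N..N} y \<partial>lborel))"
    unfolding f_def by (subst nn_integral_cmult) auto
  also have "\<dots> = ennreal (occ_const r T) * (\<integral>\<^sup>+y. ennreal \<bar>\<phi> y\<bar> * indicator {-N..N} y \<partial>lborel)"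
  proof -
    have "ennreal (2 * sqrt T / (\<bar>\<sigma>\<bar> * sqrt (2 * pi))) * ennreal (exp (\<bar>r\<bar> * T)) = ennreal (occ_const r T)"
      unfolding occ_const_def using T by (subst ennreal_mult[symmetric]) (auto simp: mult.commute)
    then show ?thesis by (simp only: mult.assoc[symmetric])
  qed
  finally show ?thesis .
qed

lemma set_integrable_nn:
  fixes \<phi> :: "real \<Rightarrow> real"
  assumes "set_integrable lborel A \<phi>"
  shows "(\<integral>\<^sup>+y. ennreal \<bar>\<phi> y\<bar> * indicator A y \<partial>lborel) = ennreal (LINT y:A|lborel. \<bar>\<phi> y\<bar>)"
proof -
  have "integrable lborel (\<lambda>y. \<bar>indicator A y * \<phi> y\<bar>)" using assms by (simp add: set_integrable_def)
  then have "(\<integral>\<^sup>+y. ennreal \<bar>indicator A y * \<phi> y\<bar> \<partial>lborel) = ennreal (LINT y|lborel. \<bar>indicator A y * \<phi> y\<bar>)"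
    by (rule nn_integral_eq_integral) simp
  moreover have "ennreal \<bar>indicator A y * \<phi> y\<bar> = ennreal \<bar>\<phi> y\<bar> * indicator A y" for y by (simp add: indicator_def)
  moreover have "\<bar>indicator A y * \<phi> y\<bar> = indicator A y *\<^sub>R \<bar>\<phi> y\<bar>" for y by (simp add: indicator_def)
  ultimately show ?thesis by (simp only: set_lebesgue_integral_def)
qed

lemma occ_integrable:
  assumes st: "stops \<rho> T N" and m: "\<phi> \<in> borel_measurable borel" and T: "T \<ge> 0" and i: "set_integrable lborel {-N..N} \<phi>"
  shows "integrable (M \<Otimes>\<^sub>M lborel) (occ_kernel r \<rho> \<phi>)"
    "\<bar>occ r \<rho> \<phi>\<bar> \<le> occ_const r T * (LINT y:{-N..N}|lborel. \<bar>\<phi> y\<bar>)"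
proof -
  have b: "(\<integral>\<^sup>+z. ennreal \<bar>occ_kernel r \<rho> \<phi> z\<bar> \<partial>(M \<Otimes>\<^sub>M lborel)) \<le> ennreal (occ_const r T * (LINT y:{-N..N}|lborel. \<bar>\<phi> y\<bar>))"
    using occ_kernel_nn_bound[OF st m T, where r=r] occ_const_nonneg[OF T, of r] unfolding set_integrable_nn[OF i]
    by (simp add: ennreal_mult')
  show I: "integrable (M \<Otimes>\<^sub>M lborel) (occ_kernel r \<rho> \<phi>)"
  proof (rule integrableI_bounded[OF occ_kernel_measurable[OF st m]])
    show "(\<integral>\<^sup>+z. ennreal (norm (occ_kernel r \<rho> \<phi> z)) \<partial>(M \<Otimes>\<^sub>M lborel)) < \<infinity>"
      using b by (simp add: order_le_less_trans)
  qed
  have nn: "0 \<le> (LINT y:{-N..N}|lborel. \<bar>\<phi> y\<bar>)"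
    unfolding set_lebesgue_integral_def by (rule Bochner_Integration.integral_nonneg) simp
  have "\<bar>occ r \<rho> \<phi>\<bar> \<le> (LINT z|(M \<Otimes>\<^sub>M lborel). \<bar>occ_kernel r \<rho> \<phi> z\<bar>)" unfolding occ_def by (rule integral_abs_bound)
  also have "\<dots> \<le> occ_const r T * (LINT y:{-N..N}|lborel. \<bar>\<phi> y\<bar>)"
    using b nn_integral_eq_integral[OF integrable_abs[OF I]] mult_nonneg_nonneg[OF occ_const_nonneg[OF T] nn]
    by (simp add: ennreal_le_iff)
  finally show "\<bar>occ r \<rho> \<phi>\<bar> \<le> occ_const r T * (LINT y:{-N..N}|lborel. \<bar>\<phi> y\<bar>)" .
qed

lemma occ_add:
  assumes "integrable (M \<Otimes>\<^sub>M lborel) (occ_kernel r \<rho> \<phi>)" "integrable (M \<Otimes>\<^sub>M lborel) (occ_kernel r \<rho> \<psi>)"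
  shows "occ r \<rho> (\<lambda>y. \<phi> y + \<psi> y) = occ r \<rho> \<phi> + occ r \<rho> \<psi>"
proof -
  have "occ_kernel r \<rho> (\<lambda>y. \<phi> y + \<psi> y) = (\<lambda>z. occ_kernel r \<rho> \<phi> z + occ_kernel r \<rho> \<psi> z)"
    by (rule ext) (simp add: occ_kernel_def algebra_simps)
  then show ?thesis unfolding occ_def using Bochner_Integration.integral_add[OF assms] by (simp only:)
qed

lemma occ_C2:
  assumes st: "stops \<rho> T N" and T: "T > 0" and N: "N \<ge> 0"
    and d1: "\<And>y. (w has_real_derivative w' y) (at y)" and d2: "\<And>y. (w' has_real_derivative w'' y) (at y)"
    and c2: "continuous_on UNIV w''"
  shows "expectation (\<lambda>\<omega>. exp (- r * \<rho> \<omega>) * w (Y (\<rho> \<omega>) \<omega>)) = w 0 + occ r \<rho> (\<lambda>y. \<sigma>\<^sup>2 / 2 * w'' y + \<mu> * w' y - r * w y)"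
proof -
  let ?L = "\<lambda>y. \<sigma>\<^sup>2 / 2 * w'' y + \<mu> * w' y - r * w y"
  have c0: "continuous_on UNIV w" "continuous_on UNIV w'"
    using DERIV_continuous_on[of UNIV w w'] DERIV_continuous_on[of UNIV w' w''] d1 d2 by simp_all
  have cL: "continuous_on UNIV ?L" by (intro continuous_intros c0 c2)
  have "integrable (M \<Otimes>\<^sub>M lborel) (occ_kernel r \<rho> ?L)"
    by (rule occ_integrable[OF st borel_measurable_continuous_onI[OF cL] less_imp_le[OF T]])
       (rule borel_integrable_atLeastAtMost'[OF continuous_on_subset[OF cL subset_UNIV]])
  then have "occ r \<rho> ?L = expectation (\<lambda>\<omega>. LINT s|lborel. occ_kernel r \<rho> ?L (\<omega>, s))"
    unfolding occ_def by (rule paths.integral_fst'[symmetric])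
  also have "\<dots> = expectation (\<lambda>\<omega>. LINT s|lborel. indicator {0..<\<rho> \<omega>} s * (exp (- r * s) * ?L (Y s \<omega>)))"
    by (intro Bochner_Integration.integral_cong refl) (auto simp: occ_kernel_def indicator_def)
  finally show ?thesis
    using Dynkin_C2(2)[of \<rho> T N w w' w'' r, OF stopsD(1)[OF st] stopsD(2)[OF st] T stopsD(3)[OF st] N d1 d2 c2] by simp
qed

text \<open>\<open>g\<close> is replaced by a continuous \<open>h\<close> that is close in
  \<open>L1\<close> on \<open>{-N..N}\<close>, and \<open>h\<close> is integrated twice with the
  values of \<open>w'\<close> and \<open>w\<close> at \<open>0\<close>. The resulting
  \<open>u'\<close> and \<open>u\<close> are uniformly close to \<open>w'\<close> and
  \<open>w\<close>, while the second-order error enters the occupation integral only through the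
  \<open>L1\<close> norm of \<open>g - h\<close>.\<close>

lemma Dynkin_density:
  assumes st: "stops \<rho> T N" and T: "T > 0" and N: "N \<ge> 0"
    and d1: "\<And>y. (w has_real_derivative w' y) (at y)" and d2: "has_density w' g"
  shows "expectation (\<lambda>\<omega>. exp (- r * \<rho> \<omega>) * w (Y (\<rho> \<omega>) \<omega>)) = w 0 + occ r \<rho> (\<lambda>y. \<sigma>\<^sup>2 / 2 * g y + \<mu> * w' y - r * w y)"
proof -
  let ?L = "\<lambda>y. \<sigma>\<^sup>2 / 2 * g y + \<mu> * w' y - r * w y"
  note gm [measurable] = has_densityD(1)[OF d2]
  have cw: "continuous_on UNIV w" "continuous_on UNIV w'"
    using DERIV_continuous_on[of UNIV w w'] d1 has_density_continuous[OF d2] by simp_all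
  note [measurable] = borel_measurable_continuous_onI[OF cw(1)] borel_measurable_continuous_onI[OF cw(2)]
  have iL: "set_integrable lborel {-N..N} ?L"
    by (intro set_integral_add(1) set_integral_diff(1) set_integrable_mult_right has_densityD(2)[OF d2]
        borel_integrable_atLeastAtMost' continuous_on_subset[OF cw(1)] continuous_on_subset[OF cw(2)]) auto
  have mL: "?L \<in> borel_measurable borel" by measurable
  define E where "E = exp (\<bar>r\<bar> * T)"
  obtain B0 where B0: "B0 > 0" "\<And>y. \<bar>y\<bar> \<le> N \<Longrightarrow> \<bar>w y\<bar> \<le> B0" using continuous_bounded_Icc[OF cw(1)] by blast
  \<comment> \<open>The first summand is the error in the stopped value, the second that in the
    generator; \<open>2 * N\<close> is the length of the interval over which the errors in
    \<open>w'\<close> and \<open>w\<close> are integrated.\<close>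
  define K where "K = E * N + occ_const r T * (\<sigma>\<^sup>2 / 2 + \<bar>\<mu>\<bar> * (2 * N) + \<bar>r\<bar> * N * (2 * N))"
  have K: "K \<ge> 0" using occ_const_nonneg[of T r] T N by (simp add: K_def E_def)
  have le: "\<bar>expectation (\<lambda>\<omega>. exp (- r * \<rho> \<omega>) * w (Y (\<rho> \<omega>) \<omega>)) - (w 0 + occ r \<rho> ?L)\<bar> \<le> K * e" if e: "e > 0" for e
  proof -
    obtain h where h: "continuous_on UNIV h" "(\<integral>\<^sup>+y. ennreal \<bar>g y - h y\<bar> * indicator {-N..N} y \<partial>lborel) < ennreal e"
      using L1_continuous_approximation[OF has_densityD(2)[OF d2] gm e] by blast
    have hi: "set_integrable lborel {a..b} h" for a b
      by (rule borel_integrable_atLeastAtMost'[OF continuous_on_subset[OF h(1)]]) simp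
    note [measurable] = borel_measurable_continuous_onI[OF h(1)]
    have anti: "\<exists>H. \<forall>y. (H has_real_derivative k y) (at y)" if "continuous_on UNIV k" for k :: "real \<Rightarrow> real"
      using einterval_antiderivative[of "-\<infinity>" "\<infinity>" k] that
      by (auto simp: continuous_on_eq_continuous_at has_real_derivative_iff_has_vector_derivative)
    obtain G where G: "\<And>y. (G has_real_derivative h y) (at y)" using anti[OF h(1)] by blast
    define u' where "u' y = w' 0 + (G y - G 0)" for y
    have u'd: "(u' has_real_derivative h y) (at y)" for y
      unfolding u'_def[abs_def] by (auto intro!: derivative_eq_intros G)
    have cu': "continuous_on UNIV u'" using DERIV_continuous_on[of UNIV u' h] u'd by simp
    obtain H where H: "\<And>y. (H has_real_derivative u' y) (at y)" using anti[OF cu'] by blast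
    define u where "u y = w 0 + (H y - H 0)" for y
    have ud: "(u has_real_derivative u' y) (at y)" for y
      unfolding u_def[abs_def] by (auto intro!: derivative_eq_intros H)
    have cu: "continuous_on UNIV u" using DERIV_continuous_on[of UNIV u u'] ud by simp
    note [measurable] = borel_measurable_continuous_onI[OF cu'] borel_measurable_continuous_onI[OF cu]
    have u'dens: "has_density u' h" by (rule has_density_C1[OF u'd h(1)])
    have gh: "set_integrable lborel {a..b} (\<lambda>y. g y - h y)" for a b
      by (rule set_integral_diff(1)[OF has_densityD(2)[OF d2] hi])
    have L1: "(LINT y:{-N..N}|lborel. \<bar>g y - h y\<bar>) \<le> e"
      using h(2) e unfolding set_integrable_nn[OF gh] by (simp add: ennreal_less_iff set_lebesgue_integral_def less_imp_le)
    have inc: "\<bar>(w' b - w' a) - (u' b - u' a)\<bar> \<le> e" if ab: "a \<le> b" "-N \<le> a" "b \<le> N" for a b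
    proof -
      have "(w' b - w' a) - (u' b - u' a) = (LINT y:{a..b}|lborel. g y - h y)"
        using has_densityD(3)[OF d2 ab(1)] has_densityD(3)[OF u'dens ab(1)] set_integral_diff(2)[OF has_densityD(2)[OF d2] hi] by simp
      also have "\<bar>\<dots>\<bar> \<le> (LINT y:{a..b}|lborel. \<bar>g y - h y\<bar>)"
        unfolding set_lebesgue_integral_def by (rule order_trans[OF integral_abs_bound]) (simp add: abs_mult)
      also have "\<dots> \<le> (LINT y:{-N..N}|lborel. \<bar>g y - h y\<bar>)"
        unfolding set_lebesgue_integral_def
        using set_integrable_abs[OF gh[of a b]] set_integrable_abs[OF gh[of "-N" N]] ab
        by (intro integral_mono) (auto simp: set_integrable_def indicator_def)
      finally show ?thesis using L1 by linarith
    qed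
    have du': "\<bar>u' y - w' y\<bar> \<le> e" if "\<bar>y\<bar> \<le> N" for y
    proof (cases "0 \<le> y")
      case True
      then show ?thesis using inc[of 0 y] that N by (simp add: u'_def abs_minus_commute)
    next
      case False
      have "\<bar>(w' 0 - w' y) - (u' 0 - u' y)\<bar> \<le> e" by (rule inc) (use False that N in auto)
      moreover have "u' 0 = w' 0" by (simp add: u'_def)
      ultimately show ?thesis by simp
    qed
    have du: "\<bar>u y - w y\<bar> \<le> N * e" if y: "\<bar>y\<bar> \<le> N" for y
    proof -
      have "norm ((u y - w y) - (u 0 - w 0)) \<le> e * norm (y - 0)"
      proof (rule field_differentiable_bound[where S="{-N..N}" and f'="\<lambda>y. u' y - w' y"])
        show "((\<lambda>y. u y - w y) has_field_derivative u' z - w' z) (at z within {-N..N})" for z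
          by (rule DERIV_subset[OF DERIV_diff[OF ud d1] subset_UNIV])
        show "norm (u' z - w' z) \<le> e" if "z \<in> {-N..N}" for z using du'[of z] that by (simp add: abs_le_iff)
      qed (use y N in \<open>auto simp: abs_le_iff\<close>)
      moreover have "u 0 = w 0" by (simp add: u_def)
      moreover have "e * \<bar>y\<bar> \<le> e * N" using y e by (intro mult_left_mono) auto
      ultimately show ?thesis by (simp add: mult.commute)
    qed
    let ?Lu = "\<lambda>y. \<sigma>\<^sup>2 / 2 * h y + \<mu> * u' y - r * u y"
    have cLu: "continuous_on UNIV ?Lu" by (intro continuous_intros h(1) cu cu')
    have iLu: "set_integrable lborel {-N..N} ?Lu"
      by (rule borel_integrable_atLeastAtMost'[OF continuous_on_subset[OF cLu subset_UNIV]])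
    have eu: "expectation (\<lambda>\<omega>. exp (- r * \<rho> \<omega>) * u (Y (\<rho> \<omega>) \<omega>)) = u 0 + occ r \<rho> ?Lu"
      by (rule occ_C2[OF st T N ud u'd h(1)])
    have si: "integrable M (\<lambda>\<omega>. exp (- r * \<rho> \<omega>) * f (Y (\<rho> \<omega>) \<omega>))" if f: "continuous_on UNIV f" for f
    proof -
      obtain B where B: "B > 0" "\<And>y. \<bar>y\<bar> \<le> N \<Longrightarrow> \<bar>f y\<bar> \<le> B" using continuous_bounded_Icc[OF f] by blast
      show ?thesis
      proof (rule integrable_const_bound[where B="E * B"])
        show "AE \<omega> in M. norm (exp (- r * \<rho> \<omega>) * f (Y (\<rho> \<omega>) \<omega>)) \<le> E * B"
        proof (rule AE_I2)
          fix \<omega> assume om: "\<omega> \<in> space M"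
          show "norm (exp (- r * \<rho> \<omega>) * f (Y (\<rho> \<omega>) \<omega>)) \<le> E * B"
            unfolding real_norm_def abs_mult E_def
            using B(2)[OF stops_value_bound[OF st N om]] discount_bound[of "\<rho> \<omega>" T r] stopsD(2)[OF st om] by (intro mult_mono) auto
        qed
      qed (rule stopped_measurable[OF st borel_measurable_continuous_onI[OF f]])
    qed
    have 1: "\<bar>expectation (\<lambda>\<omega>. exp (- r * \<rho> \<omega>) * w (Y (\<rho> \<omega>) \<omega>)) - expectation (\<lambda>\<omega>. exp (- r * \<rho> \<omega>) * u (Y (\<rho> \<omega>) \<omega>))\<bar> \<le> E * (N * e)"
    proof -
      have "\<bar>expectation (\<lambda>\<omega>. exp (- r * \<rho> \<omega>) * w (Y (\<rho> \<omega>) \<omega>) - exp (- r * \<rho> \<omega>) * u (Y (\<rho> \<omega>) \<omega>))\<bar>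
        \<le> expectation (\<lambda>\<omega>. \<bar>exp (- r * \<rho> \<omega>) * w (Y (\<rho> \<omega>) \<omega>) - exp (- r * \<rho> \<omega>) * u (Y (\<rho> \<omega>) \<omega>)\<bar>)" by (rule integral_abs_bound)
      also have "\<dots> \<le> expectation (\<lambda>\<omega>. E * (N * e))"
      proof (rule integral_mono)
        fix \<omega> assume om: "\<omega> \<in> space M"
        have "\<bar>exp (- r * \<rho> \<omega>) * w (Y (\<rho> \<omega>) \<omega>) - exp (- r * \<rho> \<omega>) * u (Y (\<rho> \<omega>) \<omega>)\<bar> = exp (- r * \<rho> \<omega>) * \<bar>u (Y (\<rho> \<omega>) \<omega>) - w (Y (\<rho> \<omega>) \<omega>)\<bar>"
          by (simp add: abs_mult right_diff_distrib[symmetric] abs_minus_commute)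
        also have "\<dots> \<le> E * (N * e)" unfolding E_def
          using du[OF stops_value_bound[OF st N om]] discount_bound[of "\<rho> \<omega>" T r] stopsD(2)[OF st om] by (intro mult_mono) auto
        finally show "\<bar>exp (- r * \<rho> \<omega>) * w (Y (\<rho> \<omega>) \<omega>) - exp (- r * \<rho> \<omega>) * u (Y (\<rho> \<omega>) \<omega>)\<bar> \<le> E * (N * e)" .
      qed (intro integrable_abs Bochner_Integration.integrable_diff si cw(1) cu integrable_const)+
      finally show ?thesis using Bochner_Integration.integral_diff[OF si[OF cw(1)] si[OF cu]] by (simp add: prob_space)
    qed
    have 2: "\<bar>occ r \<rho> ?L - occ r \<rho> ?Lu\<bar> \<le> occ_const r T * ((\<sigma>\<^sup>2 / 2 + \<bar>\<mu>\<bar> * (2 * N) + \<bar>r\<bar> * N * (2 * N)) * e)"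
    proof -
      let ?D = "\<lambda>y. ?L y - ?Lu y"
      have iD: "set_integrable lborel {-N..N} ?D" by (rule set_integral_diff(1)[OF iL iLu])
      note mLu = borel_measurable_continuous_onI[OF cLu]
      note mD = borel_measurable_diff[OF mL mLu]
      have "occ r \<rho> (\<lambda>y. ?Lu y + ?D y) = occ r \<rho> ?Lu + occ r \<rho> ?D"
      proof (rule occ_add)
        show "integrable (M \<Otimes>\<^sub>M lborel) (occ_kernel r \<rho> ?Lu)" by (rule occ_integrable(1)[OF st mLu less_imp_le[OF T] iLu])
        show "integrable (M \<Otimes>\<^sub>M lborel) (occ_kernel r \<rho> ?D)" by (rule occ_integrable(1)[OF st mD less_imp_le[OF T] iD])
      qed
      moreover have "(\<lambda>y. ?Lu y + ?D y) = ?L" by (simp add: fun_eq_iff)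
      ultimately have "occ r \<rho> ?L = occ r \<rho> ?Lu + occ r \<rho> ?D" by (simp only:)
      then have "\<bar>occ r \<rho> ?L - occ r \<rho> ?Lu\<bar> = \<bar>occ r \<rho> ?D\<bar>" by (simp only: add_diff_cancel_left')
      also have "\<dots> \<le> occ_const r T * (LINT y:{-N..N}|lborel. \<bar>?D y\<bar>)"
        by (rule occ_integrable(2)[OF st mD less_imp_le[OF T] iD])
      finally have A: "\<bar>occ r \<rho> ?L - occ r \<rho> ?Lu\<bar> \<le> occ_const r T * (LINT y:{-N..N}|lborel. \<bar>?D y\<bar>)" .
      have "(LINT y:{-N..N}|lborel. \<bar>?D y\<bar>) \<le> (LINT y:{-N..N}|lborel. \<sigma>\<^sup>2 / 2 * \<bar>g y - h y\<bar> + (\<bar>\<mu>\<bar> * e + \<bar>r\<bar> * (N * e)))"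
      proof (rule set_integral_mono)
        show "set_integrable lborel {-N..N} (\<lambda>y. \<bar>?D y\<bar>)" by (rule set_integrable_abs[OF iD])
        show "set_integrable lborel {-N..N} (\<lambda>y. \<sigma>\<^sup>2 / 2 * \<bar>g y - h y\<bar> + (\<bar>\<mu>\<bar> * e + \<bar>r\<bar> * (N * e)))"
          by (intro set_integral_add(1) set_integrable_mult_right set_integrable_abs gh borel_integrable_atLeastAtMost' continuous_on_const)
        fix y assume "y \<in> {-N..N}"
        then have y: "\<bar>y\<bar> \<le> N" by (auto simp: abs_le_iff)
        have "?D y = \<sigma>\<^sup>2 / 2 * (g y - h y) - \<mu> * (u' y - w' y) + r * (u y - w y)" by (simp add: field_simps)
        moreover have "\<bar>\<sigma>\<^sup>2 / 2 * (g y - h y)\<bar> = \<sigma>\<^sup>2 / 2 * \<bar>g y - h y\<bar>" by (simp add: abs_mult)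
        moreover have "\<bar>\<mu> * (u' y - w' y)\<bar> \<le> \<bar>\<mu>\<bar> * e" unfolding abs_mult using du'[OF y] by (intro mult_left_mono) auto
        moreover have "\<bar>r * (u y - w y)\<bar> \<le> \<bar>r\<bar> * (N * e)" unfolding abs_mult using du[OF y] by (intro mult_left_mono) auto
        ultimately show "\<bar>?D y\<bar> \<le> \<sigma>\<^sup>2 / 2 * \<bar>g y - h y\<bar> + (\<bar>\<mu>\<bar> * e + \<bar>r\<bar> * (N * e))" by linarith
      qed
      also have "\<dots> = \<sigma>\<^sup>2 / 2 * (LINT y:{-N..N}|lborel. \<bar>g y - h y\<bar>) + (\<bar>\<mu>\<bar> * e + \<bar>r\<bar> * (N * e)) * (2 * N)"
      proof -
        have i1: "set_integrable lborel {-N..N} (\<lambda>y. \<sigma>\<^sup>2 / 2 * \<bar>g y - h y\<bar>)"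
          by (intro set_integrable_mult_right set_integrable_abs gh)
        have i2: "set_integrable lborel {-N..N} (\<lambda>y. \<bar>\<mu>\<bar> * e + \<bar>r\<bar> * (N * e))"
          by (intro borel_integrable_atLeastAtMost' continuous_on_const)
        have "(LINT y:{-N..N}|lborel. \<bar>\<mu>\<bar> * e + \<bar>r\<bar> * (N * e)) = (\<bar>\<mu>\<bar> * e + \<bar>r\<bar> * (N * e)) * (2 * N)"
          using N unfolding set_lebesgue_integral_def by simp
        then show ?thesis unfolding set_integral_add(2)[OF i1 i2] by simp
      qed
      also have "\<dots> \<le> \<sigma>\<^sup>2 / 2 * e + (\<bar>\<mu>\<bar> * e + \<bar>r\<bar> * (N * e)) * (2 * N)" using L1 by (intro add_right_mono mult_left_mono) auto
      also have "\<dots> = (\<sigma>\<^sup>2 / 2 + \<bar>\<mu>\<bar> * (2 * N) + \<bar>r\<bar> * N * (2 * N)) * e" by (simp add: algebra_simps)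
      finally have "occ_const r T * (LINT y:{-N..N}|lborel. \<bar>?D y\<bar>) \<le> occ_const r T * ((\<sigma>\<^sup>2 / 2 + \<bar>\<mu>\<bar> * (2 * N) + \<bar>r\<bar> * N * (2 * N)) * e)"
        using occ_const_nonneg[of T r] T by (intro mult_left_mono) auto
      with A show ?thesis by (rule order_trans)
    qed
    have "u 0 = w 0" by (simp add: u_def)
    then have "\<bar>expectation (\<lambda>\<omega>. exp (- r * \<rho> \<omega>) * w (Y (\<rho> \<omega>) \<omega>)) - (w 0 + occ r \<rho> ?L)\<bar>
      \<le> E * (N * e) + occ_const r T * ((\<sigma>\<^sup>2 / 2 + \<bar>\<mu>\<bar> * (2 * N) + \<bar>r\<bar> * N * (2 * N)) * e)"
      using 1 2 unfolding eu by linarith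
    then show ?thesis by (simp add: K_def algebra_simps)
  qed
  have "\<bar>expectation (\<lambda>\<omega>. exp (- r * \<rho> \<omega>) * w (Y (\<rho> \<omega>) \<omega>)) - (w 0 + occ r \<rho> ?L)\<bar> \<le> 0"
  proof (rule field_le_epsilon)
    fix e :: real assume e: "e > 0"
    have "K * (e / (K + 1)) \<le> e" using K e by (simp add: field_simps)
    then show "\<bar>expectation (\<lambda>\<omega>. exp (- r * \<rho> \<omega>) * w (Y (\<rho> \<omega>) \<omega>)) - (w 0 + occ r \<rho> ?L)\<bar> \<le> 0 + e"
      using le[of "e / (K + 1)"] K e by simp
  qed
  then show ?thesis by simp
qed

section \<open>Localisation and exit times\<close>

lemma stopped_in_closed:
  assumes K: "closed K" "0 \<in> K" and om: "\<omega> \<in> space M" and t: "0 \<le> t" and in_K: "\<And>s. 0 \<le> s \<Longrightarrow> s < t \<Longrightarrow> Y s \<omega> \<in> K"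
  shows "Y t \<omega> \<in> K"
proof (cases "t = 0")
  case True then show ?thesis using Y_0[OF om] K by simp
next
  case False
  then have pos: "0 < t" using t by simp
  have "((\<lambda>s. Y (max 0 s) \<omega>) \<longlongrightarrow> Y (max 0 t) \<omega>) (at_left t)"
    using Y_path_isCont[OF om] unfolding isCont_def by (rule tendsto_mono[OF at_le, rotated]) auto
  moreover have "\<forall>\<^sub>F s in at_left t. Y (max 0 s) \<omega> \<in> K"
    using eventually_at_left_real[OF pos] by eventually_elim (use in_K in auto)
  ultimately have "Y (max 0 t) \<omega> \<in> K" by (intro Lim_in_closed_set[OF K(1)]) auto
  then show ?thesis using pos by simp
qed

lemma hit_attained:
  assumes C: "closed C" and om: "\<omega> \<in> space M" and s: "0 \<le> s" "hit C \<omega> = ennreal s"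
  shows "Y s \<omega> \<in> C"
proof -
  obtain u where u: "0 \<le> u" "u \<le> s" "Y u \<omega> \<in> C" using hit_le_iff[OF C s(1) om] s(2) by auto
  have "hit C \<omega> \<le> ennreal u" using hit_le_iff[OF C u(1) om] u by auto
  then have "s \<le> u" using s u by simp
  then show ?thesis using u by simp
qed

text \<open>The minimum is at most \<open>ennreal T\<close>, so \<open>enn2real\<close> never meets
  infinity and merely changes the type to that of the real-valued times in
  \<open>stops\<close>.\<close>

definition stop_before :: "('a \<Rightarrow> ennreal) \<Rightarrow> real set \<Rightarrow> real \<Rightarrow> 'a \<Rightarrow> real" where
  "stop_before \<tau> C T \<omega> = enn2real (min (min (\<tau> \<omega>) (hit C \<omega>)) (ennreal T))"

lemma less_stop_before_iff:
  assumes "0 \<le> s" "0 \<le> T"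
  shows "s < stop_before \<tau> C T \<omega> \<longleftrightarrow> ennreal s < \<tau> \<omega> \<and> ennreal s < hit C \<omega> \<and> s < T"
proof -
  define m where "m = min (min (\<tau> \<omega>) (hit C \<omega>)) (ennreal T)"
  have "m \<le> ennreal T" by (simp add: m_def)
  then have fin: "m < \<top>" by (simp add: order_le_less_trans)
  have "s < enn2real m \<longleftrightarrow> ennreal s < ennreal (enn2real m)" using assms by (simp add: ennreal_less_iff)
  also have "\<dots> \<longleftrightarrow> ennreal s < m" using fin by simp
  also have "\<dots> \<longleftrightarrow> ennreal s < \<tau> \<omega> \<and> ennreal s < hit C \<omega> \<and> s < T"
    using assms by (simp add: m_def ennreal_less_iff)
  finally show ?thesis by (simp add: stop_before_def m_def)
qed

lemma stop_before_bounds: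
  assumes "0 \<le> T" shows "0 \<le> stop_before \<tau> C T \<omega>" "stop_before \<tau> C T \<omega> \<le> T"
proof -
  show "0 \<le> stop_before \<tau> C T \<omega>" by (simp add: stop_before_def)
  show "stop_before \<tau> C T \<omega> \<le> T" using less_stop_before_iff[OF assms assms, of \<tau> C \<omega>] by (simp add: not_less[symmetric])
qed

lemma stop_before_stops:
  assumes tau: "is_stopping_time M W \<tau>" and C: "closed C" "- C \<subseteq> {-N..N}" and T: "0 \<le> T"
  shows "stops (stop_before \<tau> C T) T N"
  unfolding stops_def
proof (intro conjI allI impI ballI)
  fix s :: real assume s: "0 \<le> s"
  have *: "{\<omega>\<in>space M. ennreal s < \<theta> \<omega>} \<in> sets (F s)" if "is_stopping_time M W \<theta>" for \<theta>
  proof -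
    have "{\<omega>\<in>space M. \<theta> \<omega> \<le> ennreal s} \<in> sets (F s)" using that s by (simp add: is_stopping_time_def)
    then have "space (F s) - {\<omega>\<in>space M. \<theta> \<omega> \<le> ennreal s} \<in> sets (F s)" by (rule sets.compl_sets)
    moreover have "space (F s) - {\<omega>\<in>space M. \<theta> \<omega> \<le> ennreal s} = {\<omega>\<in>space M. ennreal s < \<theta> \<omega>}" by auto
    ultimately show ?thesis by simp
  qed
  have "{\<omega>\<in>space M. s < stop_before \<tau> C T \<omega>} = (if s < T then {\<omega>\<in>space M. ennreal s < \<tau> \<omega>} \<inter> {\<omega>\<in>space M. ennreal s < hit C \<omega>} else {})"
    using less_stop_before_iff[OF s T] by auto
  then show "{\<omega>\<in>space M. s < stop_before \<tau> C T \<omega>} \<in> sets (F s)"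
    using *[OF tau] *[OF hit_stopping_time[OF C(1)]] by auto
next
  fix \<omega> s assume om: "\<omega> \<in> space M" and "0 \<le> s \<and> s < stop_before \<tau> C T \<omega>"
  then have "0 \<le> s" "ennreal s < hit C \<omega>" using less_stop_before_iff[OF _ T] by auto
  then have "Y s \<omega> \<notin> C" using hit_greater_iff[OF C(1) _ om, of s] by auto
  then show "\<bar>Y s \<omega>\<bar> \<le> N" using C(2) by (auto simp: abs_le_iff)
qed (use stop_before_bounds[OF T] in auto)

lemma never_stopping_time: "is_stopping_time M W (\<lambda>_. \<infinity>)"
  unfolding is_stopping_time_def
proof (intro allI impI)
  fix t :: real
  have "\<not> (\<infinity>::ennreal) \<le> ennreal t" unfolding not_le by simp
  then have "{\<omega>\<in>space M. (\<infinity>::ennreal) \<le> ennreal t} = {}" by blast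
  then show "{\<omega>\<in>space M. (\<infinity>::ennreal) \<le> ennreal t} \<in> sets (F t)" by (simp only: sets.empty_sets)
qed

definition outside :: "real \<Rightarrow> real set" where "outside N = {y. N \<le> \<bar>y\<bar>}"

lemma closed_outside: "closed (outside N)"
  unfolding outside_def by (intro closed_Collect_le continuous_intros)

lemma outside_compl: "- outside N \<subseteq> {-N..N}"
  by (auto simp: outside_def)

lemma outside_eventually:
  assumes om: "\<omega> \<in> space M" and t: "0 \<le> t"
  obtains N0 :: nat where "\<And>N. N \<ge> real N0 \<Longrightarrow> ennreal t < hit (outside N) \<omega>"
proof -
  have "bounded ((\<lambda>s. Y s \<omega>) ` {0..t})"
    by (intro compact_imp_bounded compact_continuous_image continuous_on_subset[OF Y_continuous[OF om]]) auto
  then obtain B where B: "\<And>s. s \<in> {0..t} \<Longrightarrow> \<bar>Y s \<omega>\<bar> \<le> B" unfolding bounded_iff real_norm_def by blast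
  obtain N0 :: nat where N0: "B < N0" using reals_Archimedean2 by blast
  show ?thesis
  proof (rule that[of N0])
    fix N assume N: "N \<ge> real N0"
    show "ennreal t < hit (outside N) \<omega>"
      using hit_greater_iff[OF closed_outside t om, of N] B N N0 by (force simp: outside_def)
  qed
qed

lemma occ_nonpos: "(\<And>y. \<phi> y \<le> 0) \<Longrightarrow> occ r \<rho> \<phi> \<le> 0"
proof -
  assume n: "\<And>y. \<phi> y \<le> 0"
  have "0 \<le> (LINT z|(M \<Otimes>\<^sub>M lborel). - occ_kernel r \<rho> \<phi> z)"
    by (rule Bochner_Integration.integral_nonneg) (simp add: occ_kernel_def mult_nonneg_nonpos n)
  then show ?thesis by (simp add: occ_def)
qed

lemma stopped_integrable:
  assumes st: "stops \<rho> T N" and N: "N \<ge> 0" and f: "continuous_on UNIV f"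
  shows "integrable M (\<lambda>\<omega>. exp (- r * \<rho> \<omega>) * f (Y (\<rho> \<omega>) \<omega>))"
proof -
  obtain B where B: "B > 0" "\<And>y. \<bar>y\<bar> \<le> N \<Longrightarrow> \<bar>f y\<bar> \<le> B" using continuous_bounded_Icc[OF f] by blast
  show ?thesis
  proof (rule integrable_const_bound[where B="exp (\<bar>r\<bar> * T) * B"])
    show "AE \<omega> in M. norm (exp (- r * \<rho> \<omega>) * f (Y (\<rho> \<omega>) \<omega>)) \<le> exp (\<bar>r\<bar> * T) * B"
    proof (rule AE_I2)
      fix \<omega> assume om: "\<omega> \<in> space M"
      show "norm (exp (- r * \<rho> \<omega>) * f (Y (\<rho> \<omega>) \<omega>)) \<le> exp (\<bar>r\<bar> * T) * B"
        unfolding real_norm_def abs_mult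
        using B(2)[OF stops_value_bound[OF st N om]] discount_bound[of "\<rho> \<omega>" T r] stopsD(2)[OF st om] by (intro mult_mono) auto
    qed
  qed (rule stopped_measurable[OF st borel_measurable_continuous_onI[OF f]])
qed

lemma stop_before_hit:
  assumes C: "closed C" and om: "\<omega> \<in> space M" and T: "0 \<le> T" and le: "hit C \<omega> \<le> ennreal T" "hit C \<omega> \<le> \<tau> \<omega>"
  shows "Y (stop_before \<tau> C T \<omega>) \<omega> \<in> C"
proof (rule hit_attained[OF C om])
  show "0 \<le> stop_before \<tau> C T \<omega>" by (rule stop_before_bounds[OF T])
  have "hit C \<omega> < \<top>" using le(1) by (simp add: order_le_less_trans)
  then show "hit C \<omega> = ennreal (stop_before \<tau> C T \<omega>)" using le by (simp add: stop_before_def min_absorb1 min_absorb2)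
qed

text \<open>Discounted at a suitable rate, \<open>cosh (c * Y)\<close> is a supermartingale, and it
  is at least the discounted \<open>cosh (c * N)\<close> when \<open>Y\<close> leaves the interval.
  That \<open>c\<close> is free is the source of the fast decay in \<open>N\<close>.\<close>

lemma escape_probability:
  assumes c: "0 \<le> c" and N: "0 \<le> N" and T: "0 < T"
  shows "prob {\<omega>\<in>space M. hit (outside N) \<omega> \<le> ennreal T} * cosh (c * N) \<le> exp ((\<sigma>\<^sup>2 * c\<^sup>2 / 2 + \<bar>\<mu>\<bar> * c) * T)"
proof -
  let ?\<rho> = "stop_before (\<lambda>_. \<infinity>) (outside N) T"
  \<comment> \<open>The rate is read off from the generator: since
    \<open>\<bar>sinh\<bar> \<le> cosh\<close>, applying it to \<open>cosh (c * y)\<close> gives at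
    most \<open>k * cosh (c * y)\<close>.\<close>
  define k where "k = \<sigma>\<^sup>2 * c\<^sup>2 / 2 + \<bar>\<mu>\<bar> * c"
  have k: "k \<ge> 0" using c by (simp add: k_def)
  have st: "stops ?\<rho> T N" by (rule stop_before_stops[OF never_stopping_time closed_outside outside_compl less_imp_le[OF T]])
  let ?w = "\<lambda>y. cosh (c * y)"
  have d1: "(?w has_real_derivative c * sinh (c * y)) (at y)" for y by (auto intro!: derivative_eq_intros)
  have d2: "((\<lambda>y. c * sinh (c * y)) has_real_derivative c * (c * cosh (c * y))) (at y)" for y by (auto intro!: derivative_eq_intros)
  have c2: "continuous_on UNIV (\<lambda>y. c * (c * cosh (c * y)))" by (intro continuous_intros)
  have cw: "continuous_on UNIV ?w" by (intro continuous_intros)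
  have "occ k ?\<rho> (\<lambda>y. \<sigma>\<^sup>2 / 2 * (c * (c * cosh (c * y))) + \<mu> * (c * sinh (c * y)) - k * cosh (c * y)) \<le> 0"
  proof (rule occ_nonpos)
    fix y
    have "\<bar>sinh (c * y)\<bar> \<le> cosh (c * y)" using sinh_le_cosh_real[of "c * y"] sinh_le_cosh_real[of "- (c * y)"] by (simp add: abs_le_iff)
    then have "\<mu> * (c * sinh (c * y)) \<le> \<bar>\<mu>\<bar> * c * cosh (c * y)"
    proof -
      assume a: "\<bar>sinh (c * y)\<bar> \<le> cosh (c * y)"
      have "\<mu> * (c * sinh (c * y)) \<le> \<bar>\<mu> * c\<bar> * \<bar>sinh (c * y)\<bar>" using abs_ge_self[of "\<mu> * (c * sinh (c * y))"] by (simp add: abs_mult mult.assoc)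
      also have "\<dots> \<le> \<bar>\<mu> * c\<bar> * cosh (c * y)" using a by (intro mult_left_mono) auto
      finally show ?thesis using c by (simp add: abs_mult)
    qed
    then show "\<sigma>\<^sup>2 / 2 * (c * (c * cosh (c * y))) + \<mu> * (c * sinh (c * y)) - k * cosh (c * y) \<le> 0"
      by (simp add: k_def algebra_simps power2_eq_square)
  qed
  then have le1: "expectation (\<lambda>\<omega>. exp (- k * ?\<rho> \<omega>) * cosh (c * Y (?\<rho> \<omega>) \<omega>)) \<le> 1"
    using occ_C2[OF st T N d1 d2 c2, of k] by simp
  let ?A = "{\<omega>\<in>space M. hit (outside N) \<omega> \<le> ennreal T}"
  have A: "?A \<in> sets M" using hit_stopping_time[OF closed_outside, of N] filtration_subset[of T] T by (auto simp: is_stopping_time_def)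
  have "prob ?A * (exp (- k * T) * cosh (c * N)) = expectation (\<lambda>\<omega>. indicator ?A \<omega> * (exp (- k * T) * cosh (c * N)))"
    using A by simp
  also have "\<dots> \<le> expectation (\<lambda>\<omega>. exp (- k * ?\<rho> \<omega>) * cosh (c * Y (?\<rho> \<omega>) \<omega>))"
  proof (rule integral_mono)
    show "integrable M (\<lambda>\<omega>. indicator ?A \<omega> * (exp (- k * T) * cosh (c * N)))"
      using A by (intro integrable_mult_left integrable_real_indicator) (auto simp: emeasure_eq_measure)
    show "integrable M (\<lambda>\<omega>. exp (- k * ?\<rho> \<omega>) * cosh (c * Y (?\<rho> \<omega>) \<omega>))" by (rule stopped_integrable[OF st N cw])
    fix \<omega> assume om: "\<omega> \<in> space M"
    show "indicator ?A \<omega> * (exp (- k * T) * cosh (c * N)) \<le> exp (- k * ?\<rho> \<omega>) * cosh (c * Y (?\<rho> \<omega>) \<omega>)"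
    proof (cases "\<omega> \<in> ?A")
      case True
      then have "Y (?\<rho> \<omega>) \<omega> \<in> outside N" using T by (intro stop_before_hit[OF closed_outside om]) auto
      then have "N \<le> \<bar>Y (?\<rho> \<omega>) \<omega>\<bar>" by (simp add: outside_def)
      then have "cosh (c * N) \<le> cosh \<bar>c * Y (?\<rho> \<omega>) \<omega>\<bar>" using c N
        by (subst cosh_real_nonneg_le_iff) (auto simp: abs_mult intro!: mult_left_mono)
      moreover have "exp (- k * T) \<le> exp (- k * ?\<rho> \<omega>)" using k stop_before_bounds(2)[of T] T by (simp add: mult_left_mono)
      ultimately have "exp (- k * T) * cosh (c * N) \<le> exp (- k * ?\<rho> \<omega>) * cosh \<bar>c * Y (?\<rho> \<omega>) \<omega>\<bar>" using cosh_real_pos[of "c * N"] by (intro mult_mono) auto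
      then show ?thesis using True by simp
    next
      case False
      then show ?thesis using cosh_real_pos[of "c * Y (?\<rho> \<omega>) \<omega>"] by (simp add: less_imp_le)
    qed
  qed
  also note le1
  finally have "prob ?A * cosh (c * N) * exp (- k * T) \<le> 1" by (simp add: mult_ac)
  then show ?thesis unfolding k_def[symmetric] by (simp add: exp_minus field_simps)
qed

text \<open>The function \<open>1 - exp (- \<kappa> y)\<close> is increasing and, for large \<open>\<kappa>\<close>, a supermartingale along \<open>Y\<close>, which is stopped on leaving \<open>]-a, 1[\<close>.
  As \<open>a \<rightarrow> 0\<close> this is incompatible with a positive probability of staying nonnegative.\<close>

lemma negative_immediately: "AE \<omega> in M. \<forall>n::nat. \<exists>s. 0 < s \<and> s < 1 / Suc n \<and> Y s \<omega> < 0"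
  unfolding AE_all_countable
proof
  fix n :: nat
  define \<epsilon> where "\<epsilon> = 1 / real (Suc n)"
  have eps: "\<epsilon> > 0" by (simp add: \<epsilon>_def)
  define T where "T = \<epsilon> / 2"
  have T: "T > 0" "T < \<epsilon>" using eps by (auto simp: T_def)
  \<comment> \<open>Paths that stay nonnegative up to time \<open>\<epsilon>\<close>, tested at
    rational times for measurability; continuity extends this to all times. It will be shown that
    \<open>E\<close> is null.\<close>
  define E where "E = {\<omega>\<in>space M. \<forall>q\<in>\<rat> \<inter> {0<..<\<epsilon>}. 0 \<le> Y q \<omega>}"
  have Em: "E \<in> sets M"
  proof -
    have "(\<Union>q\<in>\<rat> \<inter> {0<..<\<epsilon>}. {\<omega>\<in>space M. Y q \<omega> < 0}) \<in> sets M"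
    proof (rule sets.countable_UN'')
      show "countable (\<rat> \<inter> {0<..<\<epsilon>})" by (intro countable_Int1 countable_rat)
      fix q assume "q \<in> \<rat> \<inter> {0<..<\<epsilon>}"
      then have [measurable]: "Y q \<in> borel_measurable M" by (intro Y_measurable) auto
      show "{\<omega>\<in>space M. Y q \<omega> < 0} \<in> sets M" by measurable
    qed
    from sets.compl_sets[OF this] have "space M - (\<Union>q\<in>\<rat> \<inter> {0<..<\<epsilon>}. {\<omega>\<in>space M. Y q \<omega> < 0}) \<in> sets M" .
    moreover have "space M - (\<Union>q\<in>\<rat> \<inter> {0<..<\<epsilon>}. {\<omega>\<in>space M. Y q \<omega> < 0}) = E"
    proof (intro equalityI subsetI)
      fix \<omega> assume "\<omega> \<in> space M - (\<Union>q\<in>\<rat> \<inter> {0<..<\<epsilon>}. {\<omega>\<in>space M. Y q \<omega> < 0})"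
      then have "\<omega> \<in> space M" "\<forall>q\<in>\<rat> \<inter> {0<..<\<epsilon>}. \<not> Y q \<omega> < 0" by blast+
      then show "\<omega> \<in> E" unfolding E_def not_less by blast
    next
      fix \<omega> assume "\<omega> \<in> E"
      then have "\<omega> \<in> space M" "\<forall>q\<in>\<rat> \<inter> {0<..<\<epsilon>}. \<not> Y q \<omega> < 0" unfolding E_def not_less by blast+
      then show "\<omega> \<in> space M - (\<Union>q\<in>\<rat> \<inter> {0<..<\<epsilon>}. {\<omega>\<in>space M. Y q \<omega> < 0})" by blast
    qed
    ultimately show ?thesis by simp
  qed
  have Epos: "0 \<le> Y s \<omega>" if asm: "\<omega> \<in> E" "0 \<le> s" "s < \<epsilon>" for \<omega> s
  proof (rule ccontr)
    assume neg: "\<not> 0 \<le> Y s \<omega>"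
    have om: "\<omega> \<in> space M" using asm by (simp add: E_def)
    have "((\<lambda>u. Y (max 0 u) \<omega>) \<longlongrightarrow> Y (max 0 s) \<omega>) (at_right s)"
      using Y_path_isCont[OF om] unfolding isCont_def by (rule tendsto_mono[OF at_le, rotated]) auto
    then have "\<forall>\<^sub>F u in at_right s. Y (max 0 u) \<omega> < 0" using neg asm by (intro order_tendstoD(2)) (auto simp: max_absorb2)
    then obtain b where b: "b > s" "\<And>u. s < u \<Longrightarrow> u < b \<Longrightarrow> Y (max 0 u) \<omega> < 0" unfolding eventually_at_right_field by blast
    obtain q where q: "q \<in> \<rat>" "s < q" "q < min b \<epsilon>" using Rats_dense_in_real[of s "min b \<epsilon>"] b asm by auto
    then have "Y q \<omega> < 0" using b(2)[of q] asm by (simp add: max_absorb2)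
    moreover have "0 \<le> Y q \<omega>" using asm(1) q asm(2) by (simp add: E_def)
    ultimately show False by simp
  qed
  \<comment> \<open>Chosen so that \<open>\<mu> \<le> \<sigma>\<^sup>2 / 2 * \<kappa>\<close>, which
    makes the generator of \<open>w\<close> nonpositive; adding \<open>1\<close> ensures
    \<open>\<kappa> > 0\<close> when \<open>\<mu> = 0\<close>.\<close>
  define \<kappa> where "\<kappa> = 2 * \<bar>\<mu>\<bar> / \<sigma>\<^sup>2 + 1"
  have kap: "\<kappa> > 0" by (simp add: \<kappa>_def add_nonneg_pos)
  have kmu: "\<mu> \<le> \<sigma>\<^sup>2 / 2 * \<kappa>"
  proof -
    have "\<sigma>\<^sup>2 / 2 * \<kappa> = \<bar>\<mu>\<bar> + \<sigma>\<^sup>2 / 2" using sigma by (simp add: \<kappa>_def field_simps)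
    then show ?thesis using zero_le_power2[of \<sigma>] by linarith
  qed
  define w where "w y = 1 - exp (- \<kappa> * y)" for y
  have d1: "(w has_real_derivative \<kappa> * exp (- \<kappa> * y)) (at y)" for y
    unfolding w_def[abs_def] by (auto intro!: derivative_eq_intros)
  have d2: "((\<lambda>y. \<kappa> * exp (- \<kappa> * y)) has_real_derivative - (\<kappa> * (\<kappa> * exp (- \<kappa> * y)))) (at y)" for y
    by (auto intro!: derivative_eq_intros)
  have c2: "continuous_on UNIV (\<lambda>y. - (\<kappa> * (\<kappa> * exp (- \<kappa> * y))))" by (intro continuous_intros)
  have cw: "continuous_on UNIV w" unfolding w_def by (intro continuous_intros)
  define C where "C a = {y::real. y \<le> - a \<or> 1 \<le> y}" for a
  have Ccl: "closed (C a)" for a unfolding C_def by (intro closed_Collect_disj closed_Collect_le continuous_intros)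
  define \<rho> where "\<rho> a = stop_before (\<lambda>_. \<infinity>) (C a) T" for a
  have st: "stops (\<rho> a) T 1" if "0 < a" "a \<le> 1" for a
    unfolding \<rho>_def by (rule stop_before_stops[OF never_stopping_time Ccl]) (use that T in \<open>auto simp: C_def\<close>)
  have int: "integrable M (\<lambda>\<omega>. w (Y (\<rho> a \<omega>) \<omega>))" if "0 < a" "a \<le> 1" for a
    using stopped_integrable[OF st[OF that] _ cw, of 0] by simp
  have Ew: "expectation (\<lambda>\<omega>. w (Y (\<rho> a \<omega>) \<omega>)) \<le> 0" if a: "0 < a" "a \<le> 1" for a
  proof -
    have "occ 0 (\<rho> a) (\<lambda>y. \<sigma>\<^sup>2 / 2 * (- (\<kappa> * (\<kappa> * exp (- \<kappa> * y)))) + \<mu> * (\<kappa> * exp (- \<kappa> * y)) - 0 * w y) \<le> 0"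
    proof (rule occ_nonpos)
      fix y
      have "(\<mu> - \<sigma>\<^sup>2 / 2 * \<kappa>) * (\<kappa> * exp (- \<kappa> * y)) \<le> 0" using kmu kap by (intro mult_nonpos_nonneg) auto
      then show "\<sigma>\<^sup>2 / 2 * (- (\<kappa> * (\<kappa> * exp (- \<kappa> * y)))) + \<mu> * (\<kappa> * exp (- \<kappa> * y)) - 0 * w y \<le> 0" by (simp add: algebra_simps)
    qed
    then show ?thesis using occ_C2[OF st[OF a] T(1) _ d1 d2 c2, of 0] by (simp add: w_def)
  qed
  \<comment> \<open>On \<open>E\<close> the lower barrier is not reached up to time
    \<open>T\<close>, so the stopping time does not depend on \<open>a\<close> there and the limit
    \<open>a \<rightarrow> 0\<close> can be taken.\<close>
  have eqE: "\<rho> a \<omega> = \<rho> 1 \<omega>" if a: "0 < a" "a \<le> 1" and om: "\<omega> \<in> E" for a \<omega>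
  proof -
    have omM: "\<omega> \<in> space M" using om by (simp add: E_def)
    have iff: "s < \<rho> a \<omega> \<longleftrightarrow> s < \<rho> 1 \<omega>" if s: "0 \<le> s" for s
    proof (cases "s < T")
      case True
      have "Y u \<omega> \<notin> C a \<longleftrightarrow> Y u \<omega> \<notin> C 1" if "u \<in> {0..s}" for u
        using Epos[OF om, of u] that True T a by (auto simp: C_def)
      then show ?thesis unfolding \<rho>_def less_stop_before_iff[OF s less_imp_le[OF T(1)]] hit_greater_iff[OF Ccl s omM] by auto
    next
      case False
      then show ?thesis unfolding \<rho>_def using less_stop_before_iff[OF s less_imp_le[OF T(1)]] by auto
    qed
    have "0 \<le> \<rho> a \<omega>" "0 \<le> \<rho> 1 \<omega>" unfolding \<rho>_def using stop_before_bounds(1)[of T] T by auto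
    then show ?thesis using iff[of "\<rho> a \<omega>"] iff[of "\<rho> 1 \<omega>"] by linarith
  qed
  have low: "- a \<le> Y (\<rho> a \<omega>) \<omega>" if a: "0 < a" and om: "\<omega> \<in> space M" for a \<omega>
  proof -
    have "Y (\<rho> a \<omega>) \<omega> \<in> {-a..}"
    proof (rule stopped_in_closed[OF _ _ om])
      show "0 \<le> \<rho> a \<omega>" unfolding \<rho>_def using stop_before_bounds(1)[of T] T by auto
      fix s assume s: "0 \<le> s" "s < \<rho> a \<omega>"
      then have "ennreal s < hit (C a) \<omega>" unfolding \<rho>_def using less_stop_before_iff[OF s(1) less_imp_le[OF T(1)]] by auto
      then have "Y s \<omega> \<notin> C a" using hit_greater_iff[OF Ccl s(1) om] s by auto
      then show "Y s \<omega> \<in> {-a..}" by (auto simp: C_def)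
    qed (use a in auto)
    then show ?thesis by simp
  qed
  have wmono: "w x \<le> w y" if "x \<le> y" for x y using that kap by (simp add: w_def)
  have posE: "0 \<le> w (Y (\<rho> 1 \<omega>) \<omega>)" if "\<omega> \<in> E" for \<omega>
  proof -
    have "0 \<le> Y (\<rho> 1 \<omega>) \<omega>" using Epos[OF that] stop_before_bounds[of T] T unfolding \<rho>_def
      by (meson le_less_trans less_imp_le)
    then show ?thesis using wmono[of 0] by (simp add: w_def)
  qed
  have bnd: "expectation (\<lambda>\<omega>. indicator E \<omega> * w (Y (\<rho> 1 \<omega>) \<omega>)) \<le> - w (- a)" if a: "0 < a" "a \<le> 1" for a
  proof -
    have "expectation (\<lambda>\<omega>. w (- a) + indicator E \<omega> * w (Y (\<rho> 1 \<omega>) \<omega>)) \<le> expectation (\<lambda>\<omega>. w (Y (\<rho> a \<omega>) \<omega>))"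
    proof (rule integral_mono[OF _ int[OF a]])
      show "integrable M (\<lambda>\<omega>. w (- a) + indicator E \<omega> * w (Y (\<rho> 1 \<omega>) \<omega>))"
        using integrable_real_mult_indicator[OF Em int[of 1]] by (simp add: mult.commute)
      fix \<omega> assume om: "\<omega> \<in> space M"
      have n: "w (- a) \<le> 0" using wmono[of "-a" 0] a by (simp add: w_def)
      show "w (- a) + indicator E \<omega> * w (Y (\<rho> 1 \<omega>) \<omega>) \<le> w (Y (\<rho> a \<omega>) \<omega>)"
      proof (cases "\<omega> \<in> E")
        case True then show ?thesis using n eqE[OF a True] by simp
      next
        case False then show ?thesis using wmono[OF low[OF a(1) om]] by simp
      qed
    qed
    also have "\<dots> \<le> 0" by (rule Ew[OF a])
    finally show ?thesis using integrable_real_mult_indicator[OF Em int[of 1]] by (simp add: prob_space mult.commute)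
  qed
  have "expectation (\<lambda>\<omega>. indicator E \<omega> * w (Y (\<rho> 1 \<omega>) \<omega>)) \<le> 0"
  proof (rule tendsto_lowerbound)
    have "((\<lambda>a. - w (- a)) \<longlongrightarrow> - w (- 0)) (at_right 0)" unfolding w_def by (intro tendsto_intros)
    then show "((\<lambda>a. - w (- a)) \<longlongrightarrow> 0) (at_right 0)" by (simp add: w_def)
    show "\<forall>\<^sub>F a in at_right 0. expectation (\<lambda>\<omega>. indicator E \<omega> * w (Y (\<rho> 1 \<omega>) \<omega>)) \<le> - w (- a)"
      using eventually_at_right_real[of 0 1] by (auto elim!: eventually_mono intro!: bnd)
  qed simp
  moreover have nn: "0 \<le> indicator E \<omega> * w (Y (\<rho> 1 \<omega>) \<omega>)" for \<omega> using posE[of \<omega>] by (auto simp: indicator_def)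
  moreover have ii: "integrable M (\<lambda>\<omega>. indicator E \<omega> * w (Y (\<rho> 1 \<omega>) \<omega>))"
    using integrable_real_mult_indicator[OF Em int[of 1]] by (simp add: mult.commute)
  moreover have "0 \<le> expectation (\<lambda>\<omega>. indicator E \<omega> * w (Y (\<rho> 1 \<omega>) \<omega>))"
    by (rule Bochner_Integration.integral_nonneg) (rule nn)
  ultimately have "expectation (\<lambda>\<omega>. indicator E \<omega> * w (Y (\<rho> 1 \<omega>) \<omega>)) = 0"
    by linarith
  then have ae: "AE \<omega> in M. indicator E \<omega> * w (Y (\<rho> 1 \<omega>) \<omega>) = 0"
    using integral_nonneg_eq_0_iff_AE[OF ii] nn by simp
  \<comment> \<open>A vanishing stopped value of \<open>w\<close> means \<open>Y = 0\<close> at time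
    \<open>\<rho> 1\<close>. As \<open>0\<close> is not in \<open>C 1\<close>, the stop is then at
    the fixed time \<open>T\<close>, where \<open>Y\<close> has a density and is almost surely
    nonzero.\<close>
  have z: "(\<integral>\<^sup>+\<omega>. indicator {0} (Y T \<omega>) \<partial>M) = 0"
    using Y_expectation_bound[OF T(1), of "indicator {0}"] by simp
  have [measurable]: "Y T \<in> borel_measurable M" using T by (intro Y_measurable) simp
  have ae2: "AE \<omega> in M. Y T \<omega> \<noteq> 0"
    using z by (subst (asm) nn_integral_0_iff_AE) (auto simp: indicator_def elim!: eventually_mono)
  from ae ae2 AE_space show "AE \<omega> in M. \<exists>s. 0 < s \<and> s < 1 / Suc n \<and> Y s \<omega> < 0"
  proof eventually_elim
    case (elim \<omega>)
    have "\<omega> \<notin> E"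
    proof
      assume E: "\<omega> \<in> E"
      then have "w (Y (\<rho> 1 \<omega>) \<omega>) = 0" using elim(1) by simp
      then have Y0: "Y (\<rho> 1 \<omega>) \<omega> = 0" using kap by (simp add: w_def)
      have "\<not> hit (C 1) \<omega> \<le> ennreal T"
      proof
        assume "hit (C 1) \<omega> \<le> ennreal T"
        then have "Y (\<rho> 1 \<omega>) \<omega> \<in> C 1" unfolding \<rho>_def using T by (intro stop_before_hit[OF Ccl elim(3)]) auto
        then show False using Y0 by (simp add: C_def)
      qed
      then have "\<rho> 1 \<omega> = T" unfolding \<rho>_def stop_before_def using T by (simp add: min_absorb2)
      then show False using Y0 elim(2) by simp
    qed
    then obtain q where "q \<in> \<rat>" "0 < q" "q < \<epsilon>" "Y q \<omega> < 0" using elim(3) by (auto simp: E_def not_le)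
    then show ?case unfolding \<epsilon>_def by blast
  qed
qed

end

text \<open>\<open>- Y\<close> is again a drifted Brownian motion, with parameters
  \<open>- \<mu>\<close> and \<open>- \<sigma>\<close>. Hence both signs occur at arbitrarily small
  times, and a zero lies between them.\<close>

lemma (in drifted_brownian) return_immediately:
  "AE \<omega> in M. \<forall>n::nat. \<exists>s. 0 < s \<and> s < 1 / Suc n \<and> Y s \<omega> = 0"
proof -
  interpret N: drifted_brownian M W "- \<mu>" "- \<sigma>" by unfold_locales (use sigma in auto)
  have NY: "N.Y s \<omega> = - Y s \<omega>" for s \<omega> by (simp add: N.Y_def Y_def)
  from negative_immediately N.negative_immediately AE_space show ?thesis
  proof eventually_elim
    case (elim \<omega>)
    show ?case
    proof
      fix n :: nat
      obtain s where s: "0 < s" "s < 1 / Suc n" "Y s \<omega> < 0" using elim(1) by blast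
      obtain u where u: "0 < u" "u < 1 / Suc n" "Y u \<omega> > 0" using elim(2) unfolding NY by auto
      have cont: "continuous_on {a..b} (\<lambda>s. Y s \<omega>)" if "0 < a" for a b
        by (rule continuous_on_subset[OF Y_continuous[OF elim(3)]]) (use that in auto)
      show "\<exists>s. 0 < s \<and> s < 1 / Suc n \<and> Y s \<omega> = 0"
      proof (cases "s \<le> u")
        case True
        obtain x where "s \<le> x" "x \<le> u" "Y x \<omega> = 0" using IVT'[of "\<lambda>s. Y s \<omega>" s 0 u] s u True cont[OF s(1), of u] by auto
        then show ?thesis using s u by (intro exI[of _ x]) auto
      next
        case False
        obtain x where "u \<le> x" "x \<le> s" "Y x \<omega> = 0" using IVT2'[of "\<lambda>s. Y s \<omega>" s 0 u] s u False cont[OF u(1), of s] by auto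
        then show ?thesis using s u by (intro exI[of _ x]) auto
      qed
    qed
  qed
qed

context drifted_brownian
begin

section \<open>The variational inequality in logarithmic coordinates\<close>

text \<open>\<open>G\<close> holds along the path before \<open>\<rho>\<close>, so the comparison is
  required only on the set where the path lives. For the lower bound this set is the complement of
  the zeros of \<open>f\<close>, where the variational inequality becomes an equation.\<close>

lemma occ_mono:
  assumes st: "stops \<rho> T N" and T: "T \<ge> 0"
    and m: "\<phi> \<in> borel_measurable borel" "\<psi> \<in> borel_measurable borel"
    and i: "set_integrable lborel {-N..N} \<phi>" "set_integrable lborel {-N..N} \<psi>"
    and le: "AE y in lborel. G y \<longrightarrow> \<phi> y \<le> \<psi> y"
    and G: "\<And>\<omega> s. \<omega> \<in> space M \<Longrightarrow> 0 \<le> s \<Longrightarrow> s < \<rho> \<omega> \<Longrightarrow> G (Y s \<omega>)"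
  shows "occ r \<rho> \<phi> \<le> occ r \<rho> \<psi>"
  unfolding occ_def
proof (rule integral_mono_AE)
  note km = occ_kernel_measurable[OF st m(1), of r] occ_kernel_measurable[OF st m(2), of r]
  show "integrable (M \<Otimes>\<^sub>M lborel) (occ_kernel r \<rho> \<phi>)" "integrable (M \<Otimes>\<^sub>M lborel) (occ_kernel r \<rho> \<psi>)"
    by (rule occ_integrable(1)[OF st m(1) T i(1)], rule occ_integrable(1)[OF st m(2) T i(2)])
  show "AE z in M \<Otimes>\<^sub>M lborel. occ_kernel r \<rho> \<phi> z \<le> occ_kernel r \<rho> \<psi> z"
  proof (rule paths.AE_pair_measure)
    show "{z \<in> space (M \<Otimes>\<^sub>M lborel). occ_kernel r \<rho> \<phi> z \<le> occ_kernel r \<rho> \<psi> z} \<in> sets (M \<Otimes>\<^sub>M lborel)"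
      by (rule borel_measurable_le[OF km])
    from AE_occupation[OF le] AE_space
    show "AE \<omega> in M. AE s in lborel. occ_kernel r \<rho> \<phi> (\<omega>, s) \<le> occ_kernel r \<rho> \<psi> (\<omega>, s)"
    proof eventually_elim
      case (elim \<omega>)
      note om = elim(2)
      from elim(1) show ?case
      proof eventually_elim
        case (elim s)
        show ?case
        proof (cases "0 \<le> s \<and> s < \<rho> \<omega>")
          case True
          then have "\<phi> (Y s \<omega>) \<le> \<psi> (Y s \<omega>)" using elim G[OF om] by blast
          then show ?thesis using True by (simp add: occ_kernel_def)
        qed (auto simp: occ_kernel_def)
      qed
    qed
  qed
qed

text \<open>\<open>disc_nn\<close> in logarithmic coordinates, with the starting point
  \<open>x\<close> moved into \<open>\<phi>\<close>.\<close>

definition flow :: "real \<Rightarrow> ('a \<Rightarrow> ennreal) \<Rightarrow> (real \<Rightarrow> real) \<Rightarrow> ennreal" where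
  "flow r \<tau> \<phi> = (\<integral>\<^sup>+\<omega>. (\<integral>\<^sup>+s. ennreal (exp (- r * s) * \<phi> (Y s \<omega>)) * indicator {s. 0 \<le> s \<and> ennreal s < \<tau> \<omega>} s \<partial>lborel) \<partial>M)"

definition nn_occ :: "real \<Rightarrow> ('a \<Rightarrow> real) \<Rightarrow> (real \<Rightarrow> real) \<Rightarrow> ennreal" where
  "nn_occ r \<rho> \<phi> = (\<integral>\<^sup>+z. ennreal (occ_kernel r \<rho> \<phi> z) \<partial>(M \<Otimes>\<^sub>M lborel))"

lemma nn_occ_iterated:
  assumes st: "stops \<rho> T N" and m: "\<phi> \<in> borel_measurable borel"
  shows "nn_occ r \<rho> \<phi> = (\<integral>\<^sup>+\<omega>. (\<integral>\<^sup>+s. ennreal (exp (- r * s) * \<phi> (Y s \<omega>)) * indicator {0..<\<rho> \<omega>} s \<partial>lborel) \<partial>M)"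
proof -
  note [measurable] = occ_kernel_measurable[OF st m, of r]
  have "nn_occ r \<rho> \<phi> = (\<integral>\<^sup>+\<omega>. \<integral>\<^sup>+s. ennreal (occ_kernel r \<rho> \<phi> (\<omega>, s)) \<partial>lborel \<partial>M)"
    unfolding nn_occ_def by (rule lborel.nn_integral_fst[symmetric]) measurable
  also have "\<dots> = (\<integral>\<^sup>+\<omega>. (\<integral>\<^sup>+s. ennreal (exp (- r * s) * \<phi> (Y s \<omega>)) * indicator {0..<\<rho> \<omega>} s \<partial>lborel) \<partial>M)"
    by (intro nn_integral_cong) (auto simp: occ_kernel_def indicator_def)
  finally show ?thesis .
qed

lemma nn_occ_eq_occ:
  assumes st: "stops \<rho> T N" and m: "\<phi> \<in> borel_measurable borel" and T: "T \<ge> 0" and i: "set_integrable lborel {-N..N} \<phi>"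
    and nn: "\<And>y. 0 \<le> \<phi> y"
  shows "nn_occ r \<rho> \<phi> = ennreal (occ r \<rho> \<phi>)" "0 \<le> occ r \<rho> \<phi>"
proof -
  have k: "0 \<le> occ_kernel r \<rho> \<phi> z" for z using nn by (simp add: occ_kernel_def)
  show "nn_occ r \<rho> \<phi> = ennreal (occ r \<rho> \<phi>)" unfolding nn_occ_def occ_def
    by (rule nn_integral_eq_integral[OF occ_integrable(1)[OF st m T i]]) (simp add: k)
  show "0 \<le> occ r \<rho> \<phi>" unfolding occ_def by (rule Bochner_Integration.integral_nonneg) (rule k)
qed

lemma nn_occ_le_flow:
  assumes tau: "is_stopping_time M W \<tau>" and C: "closed C" "- C \<subseteq> {-N..N}" and T: "T \<ge> 0" and m: "\<phi> \<in> borel_measurable borel"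
  shows "nn_occ r (stop_before \<tau> C T) \<phi> \<le> flow r \<tau> \<phi>"
  unfolding nn_occ_iterated[OF stop_before_stops[OF tau C T] m] flow_def
  by (intro nn_integral_mono mult_left_mono) (auto simp: indicator_def less_stop_before_iff[OF _ T])

abbreviation loc :: "('a \<Rightarrow> ennreal) \<Rightarrow> nat \<Rightarrow> 'a \<Rightarrow> real" where
  "loc \<tau> n \<equiv> stop_before \<tau> (outside (real n)) (real n)"

lemma loc_stops: "is_stopping_time M W \<tau> \<Longrightarrow> stops (loc \<tau> n) (real n) (real n)"
  by (rule stop_before_stops[OF _ closed_outside outside_compl]) auto

lemma less_loc_iff:
  assumes "\<omega> \<in> space M" "0 \<le> s"
  shows "s < loc \<tau> n \<omega> \<longleftrightarrow> ennreal s < \<tau> \<omega> \<and> (\<forall>u\<in>{0..s}. \<bar>Y u \<omega>\<bar> < n) \<and> s < n"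
  using less_stop_before_iff[OF assms(2), of "real n" \<tau> "outside (real n)" \<omega>] hit_greater_iff[OF closed_outside assms(2,1), of "real n"]
  by (auto simp: outside_def not_le)

text \<open>Each path is bounded on \<open>{0..s}\<close>, so every \<open>s\<close> before
  \<open>\<tau>\<close> is also before \<open>loc \<tau> n\<close> for large \<open>n\<close>. The
  kernels increase with \<open>n\<close>, and monotone convergence applies.\<close>

lemma flow_SUP:
  assumes tau: "is_stopping_time M W \<tau>" and m: "\<phi> \<in> borel_measurable borel" and nn: "\<And>y. 0 \<le> \<phi> y"
  shows "flow r \<tau> \<phi> = (SUP n. nn_occ r (loc \<tau> n) \<phi>)"
proof -
  define k where "k n z = ennreal (occ_kernel r (loc \<tau> n) \<phi> z)" for n z
  have km [measurable]: "k n \<in> borel_measurable (M \<Otimes>\<^sub>M lborel)" for n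
    unfolding k_def[abs_def] using occ_kernel_measurable[OF loc_stops[OF tau] m] by measurable
  have kform: "k n (\<omega>, s) = ennreal (exp (- r * s) * \<phi> (Y s \<omega>)) * indicator {s. 0 \<le> s \<and> s < loc \<tau> n \<omega>} s" for n \<omega> s
    by (auto simp: k_def occ_kernel_def indicator_def)
  have mono: "k n (\<omega>, s) \<le> k (Suc n) (\<omega>, s)" if om: "\<omega> \<in> space M" for n \<omega> s
  proof -
    have "s < loc \<tau> n \<omega> \<Longrightarrow> 0 \<le> s \<Longrightarrow> s < loc \<tau> (Suc n) \<omega>"
      unfolding less_loc_iff[OF om] by (auto intro: less_trans)
    then show ?thesis unfolding kform by (auto simp: indicator_def)
  qed
  have sup: "(SUP n. k n (\<omega>, s)) = ennreal (exp (- r * s) * \<phi> (Y s \<omega>)) * indicator {s. 0 \<le> s \<and> ennreal s < \<tau> \<omega>} s"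
    if om: "\<omega> \<in> space M" for \<omega> s
  proof (cases "0 \<le> s \<and> ennreal s < \<tau> \<omega>")
    case True
    then have s0: "0 \<le> s" by simp
    obtain N0 :: nat where N0: "\<And>N. N \<ge> real N0 \<Longrightarrow> ennreal s < hit (outside N) \<omega>"
      using outside_eventually[OF om s0] by blast
    obtain N1 :: nat where N1: "s < N1" using reals_Archimedean2 by blast
    let ?n = "max N0 N1"
    have "s < loc \<tau> ?n \<omega>" using less_stop_before_iff[OF s0, of "real ?n"] True N0[of "real ?n"] N1 by auto
    then have eq: "k ?n (\<omega>, s) = ennreal (exp (- r * s) * \<phi> (Y s \<omega>))" using s0 by (simp add: kform)
    have "(SUP n. k n (\<omega>, s)) = ennreal (exp (- r * s) * \<phi> (Y s \<omega>))"
    proof (rule antisym)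
      show "(SUP n. k n (\<omega>, s)) \<le> ennreal (exp (- r * s) * \<phi> (Y s \<omega>))"
        by (rule SUP_least) (auto simp: kform indicator_def)
      show "ennreal (exp (- r * s) * \<phi> (Y s \<omega>)) \<le> (SUP n. k n (\<omega>, s))" unfolding eq[symmetric] by (rule SUP_upper) simp
    qed
    then show ?thesis using True by simp
  next
    case False
    then have "k n (\<omega>, s) = 0" for n using less_loc_iff[OF om, of s \<tau> n] by (auto simp: kform indicator_def)
    then show ?thesis using False by simp
  qed
  have "(SUP n. nn_occ r (loc \<tau> n) \<phi>) = (SUP n. \<integral>\<^sup>+z. k n z \<partial>(M \<Otimes>\<^sub>M lborel))"
    by (simp add: nn_occ_def k_def)
  also have "\<dots> = (\<integral>\<^sup>+z. (SUP n. k n z) \<partial>(M \<Otimes>\<^sub>M lborel))"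
  proof (rule nn_integral_monotone_convergence_SUP_AE[symmetric])
    show "AE z in M \<Otimes>\<^sub>M lborel. k n z \<le> k (Suc n) z" for n
      by (rule AE_I2) (auto simp: space_pair_measure mono)
  qed measurable
  also have "\<dots> = (\<integral>\<^sup>+\<omega>. \<integral>\<^sup>+s. (SUP n. k n (\<omega>, s)) \<partial>lborel \<partial>M)"
    by (rule lborel.nn_integral_fst[symmetric]) measurable
  also have "\<dots> = flow r \<tau> \<phi>" unfolding flow_def by (intro nn_integral_cong) (simp add: sup)
  finally show ?thesis by simp
qed

lemma SUP_add_const_le:
  fixes f g :: "nat \<Rightarrow> ennreal"
  assumes "\<And>n. f n \<le> a + g n" shows "(SUP n. f n) \<le> a + (SUP n. g n)"
  by (rule SUP_least) (use assms in \<open>meson SUP_upper UNIV_I add_left_mono order_trans\<close>)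

end

text \<open>The instance used is \<open>f y = v (x * exp y)\<close> and
  \<open>P y = Prof (x * exp y)\<close>, with drift
  \<open>\<mu> = \<alpha> - \<sigma>\<^sup>2 / 2\<close>; the process starts at \<open>0\<close>, so
  \<open>f 0\<close> is \<open>v x\<close>. The pointwise statement \<open>g_deriv\<close>
  supplements the integrated one at the zeros of \<open>f\<close>, where the sign of
  \<open>g\<close> has to be read off from a minimum.\<close>

locale log_hjb = drifted_brownian +
  fixes r :: real and f f' g P :: "real \<Rightarrow> real"
  assumes f': "\<And>y. (f has_real_derivative f' y) (at y)"
    and g: "has_density f' g"
    and g_deriv: "AE y in lborel. (f' has_real_derivative g y) (at y)"
    and f_nonneg: "\<And>y. 0 \<le> f y"
    and P_meas: "P \<in> borel_measurable borel"
    and P_int: "\<And>a b. set_integrable lborel {a..b} P"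
    and hjb: "AE y in lborel. min (- (\<sigma>\<^sup>2 / 2 * g y + \<mu> * f' y - r * f y) - P y) (f y) = 0"
begin

abbreviation "Lf y \<equiv> \<sigma>\<^sup>2 / 2 * g y + \<mu> * f' y - r * f y"
abbreviation "Pp y \<equiv> max (P y) 0"
abbreviation "Pm y \<equiv> max (- P y) 0"

lemma f_cont: "continuous_on UNIV f" "continuous_on UNIV f'"
  using DERIV_continuous_on[of UNIV f f'] f' has_density_continuous[OF g] by simp_all

lemma meas: "f \<in> borel_measurable borel" "f' \<in> borel_measurable borel" "g \<in> borel_measurable borel"
  "Lf \<in> borel_measurable borel" "Pp \<in> borel_measurable borel" "Pm \<in> borel_measurable borel"
proof -
  show [measurable]: "f \<in> borel_measurable borel" "f' \<in> borel_measurable borel" "g \<in> borel_measurable borel"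
    using f_cont has_densityD(1)[OF g] by (simp_all add: borel_measurable_continuous_onI)
  show "Lf \<in> borel_measurable borel" by measurable
  note [measurable] = P_meas
  show "Pp \<in> borel_measurable borel" "Pm \<in> borel_measurable borel" by measurable
qed

lemma Lf_int: "set_integrable lborel {a..b} Lf"
  by (intro set_integral_add(1) set_integral_diff(1) set_integrable_mult_right has_densityD(2)[OF g]
      borel_integrable_atLeastAtMost' continuous_on_subset[OF f_cont(1)] continuous_on_subset[OF f_cont(2)]) auto

lemma PP_int: "set_integrable lborel {a..b} Pp" "set_integrable lborel {a..b} Pm"
proof -
  show "set_integrable lborel {a..b} Pp"
    by (rule set_integrable_bound[OF P_int[of a b]]) (use meas in \<open>auto simp: set_borel_measurable_def\<close>)
  show "set_integrable lborel {a..b} Pm"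
    by (rule set_integrable_bound[OF P_int[of a b]]) (use meas in \<open>auto simp: set_borel_measurable_def\<close>)
qed

lemma Lf_le: "AE y in lborel. Lf y \<le> - P y"
  using hjb by eventually_elim (auto simp: min_def split: if_splits)

lemma Lf_eq: "AE y in lborel. f y \<noteq> 0 \<longrightarrow> Lf y = - P y"
  using hjb by eventually_elim (auto simp: min_def split: if_splits)

text \<open>Dynkin's formula at \<open>loc \<tau> n\<close>, with \<open>f \<ge> 0\<close> at the
  end and \<open>Lf \<le> Pm - Pp\<close> before. Writing the gain on one side and the loss on the
  other lets both pass to the limit by monotone convergence even if the loss is infinite.\<close>

lemma upper_bound:
  assumes tau: "is_stopping_time M W \<tau>"
  shows "flow r \<tau> Pp \<le> ennreal (f 0) + flow r \<tau> Pm"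
proof -
  have "nn_occ r (loc \<tau> n) Pp \<le> ennreal (f 0) + nn_occ r (loc \<tau> n) Pm" for n
  proof (cases "n = 0")
    case True
    have "occ_kernel r (loc \<tau> 0) Pp z = 0" for z
      using stop_before_bounds(2)[of 0 \<tau> "outside 0" "fst z"] by (auto simp: occ_kernel_def indicator_def)
    then show ?thesis using True by (simp add: nn_occ_def)
  next
    case False
    let ?\<rho> = "loc \<tau> n"
    have T: "real n > 0" "real n \<ge> 0" using False by auto
    note st = loc_stops[OF tau, of n]
    have "0 \<le> expectation (\<lambda>\<omega>. exp (- r * ?\<rho> \<omega>) * f (Y (?\<rho> \<omega>) \<omega>))"
      by (rule Bochner_Integration.integral_nonneg) (simp add: f_nonneg)
    also have "\<dots> = f 0 + occ r ?\<rho> Lf" by (rule Dynkin_density[OF st T f' g])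
    finally have 1: "0 \<le> f 0 + occ r ?\<rho> Lf" .
    have ia: "set_integrable lborel {- real n..real n} (\<lambda>y. Lf y + Pp y)" by (rule set_integral_add(1)[OF Lf_int PP_int(1)])
    have "occ r ?\<rho> (\<lambda>y. Lf y + Pp y) \<le> occ r ?\<rho> Pm"
    proof (rule occ_mono[OF st T(2) _ meas(6) ia PP_int(2), where G="\<lambda>_. True"])
      show "(\<lambda>y. Lf y + Pp y) \<in> borel_measurable borel" by (rule borel_measurable_add[OF meas(4,5)])
      show "AE y in lborel. True \<longrightarrow> Lf y + Pp y \<le> Pm y" using Lf_le by eventually_elim (auto simp: max_def)
    qed simp
    moreover have "occ r ?\<rho> (\<lambda>y. Lf y + Pp y) = occ r ?\<rho> Lf + occ r ?\<rho> Pp"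
      by (rule occ_add[OF occ_integrable(1)[OF st meas(4) T(2) Lf_int] occ_integrable(1)[OF st meas(5) T(2) PP_int(1)]])
    ultimately have "occ r ?\<rho> Pp \<le> f 0 + occ r ?\<rho> Pm" using 1 by linarith
    then have "ennreal (occ r ?\<rho> Pp) \<le> ennreal (f 0) + ennreal (occ r ?\<rho> Pm)"
      using nn_occ_eq_occ(2)[OF st meas(6) T(2) PP_int(2), of r] f_nonneg[of 0] by (simp add: ennreal_leI flip: ennreal_plus)
    then show ?thesis
      using nn_occ_eq_occ(1)[OF st meas(5) T(2) PP_int(1), of r] nn_occ_eq_occ(1)[OF st meas(6) T(2) PP_int(2), of r] by simp
  qed
  then show ?thesis
    unfolding flow_SUP[OF tau meas(5) max.cobounded2] flow_SUP[OF tau meas(6) max.cobounded2] by (rule SUP_add_const_le)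
qed

end

section \<open>Attainment when the characteristic roots are real\<close>

lemma has_density_antiderivative:
  assumes m: "\<phi> \<in> borel_measurable borel" and i: "\<And>a b. set_integrable lborel {a..b} \<phi>"
  obtains R where "R 0 = 0" "has_density R \<phi>"
proof -
  define R where "R y = (LBINT z=0..y. \<phi> z)" for y :: real
  have ii: "interval_lebesgue_integrable lborel (ereal a) (ereal b) \<phi>" for a b
  proof -
    have *: "set_integrable lborel (einterval (ereal (min a b)) (ereal (max a b))) \<phi>"
      by (rule set_integrable_subset[OF i[of "min a b" "max a b"]]) (auto simp: einterval_def simp del: ereal_min ereal_max)
    show ?thesis unfolding interval_lebesgue_integrable_def
      using * by (auto simp: min_def max_def split: if_splits)
  qed
  show ?thesis
  proof (rule that)
    show "R 0 = 0" by (simp add: R_def zero_ereal_def interval_integral_endpoints_same)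
    show "has_density R \<phi>" unfolding has_density_def
    proof (intro conjI allI impI m i)
      fix a b :: real assume ab: "a \<le> b"
      have "(LBINT z=ereal 0..ereal a. \<phi> z) + (LBINT z=ereal a..ereal b. \<phi> z) = (LBINT z=ereal 0..ereal b. \<phi> z)"
        by (rule interval_integral_sum) (simp add: ii del: ereal_min ereal_max flip: ereal_min ereal_max)
      then have "R b - R a = (LBINT z=ereal a..ereal b. \<phi> z)" by (simp add: R_def zero_ereal_def)
      also have "\<dots> = (LINT x:{a..b}|lborel. \<phi> x)" using ab by (rule interval_integral_Icc)
      finally show "R b - R a = (LINT x:{a..b}|lborel. \<phi> x)" .
    qed
  qed
qed

lemma has_density_mono:
  assumes R: "has_density R \<phi>" and nn: "AE y in lborel. a < y \<and> y < b \<longrightarrow> 0 \<le> \<phi> y" and ab: "a \<le> x" "x \<le> y" "y \<le> b"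
  shows "R x \<le> R y"
proof -
  have "0 \<le> (LINT z:{x..y}|lborel. \<phi> z)" unfolding set_lebesgue_integral_def
  proof (rule integral_nonneg_AE)
    show "AE z in lborel. 0 \<le> indicat_real {x..y} z *\<^sub>R \<phi> z"
      using nn AE_lborel_singleton[of a] AE_lborel_singleton[of b]
      by eventually_elim (use ab in \<open>auto simp: indicator_def\<close>)
  qed
  then show ?thesis using has_densityD(3)[OF R ab(2)] by simp
qed

lemma continuous_antiderivative:
  fixes k :: "real \<Rightarrow> real"
  assumes "continuous_on UNIV k"
  obtains H where "H 0 = 0" "\<And>y. (H has_real_derivative k y) (at y)"
proof -
  obtain H where H: "\<And>y. (H has_real_derivative k y) (at y)"
    using einterval_antiderivative[of "-\<infinity>" "\<infinity>" k] assms
    by (auto simp: continuous_on_eq_continuous_at has_real_derivative_iff_has_vector_derivative)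
  show ?thesis
  proof (rule that[of "\<lambda>y. H y - H 0"])
    show "((\<lambda>y. H y - H 0) has_real_derivative k y) (at y)" for y
      using DERIV_diff[OF H DERIV_const[of "H 0"], of y] by simp
  qed simp
qed

text \<open>Variation of constants for the operator \<open>(d/dy - m1)(d/dy - m2)\<close> with source \<open>\<rho> \<ge> 0\<close>.\<close>

lemma nonneg_source_solution:
  fixes m1 m2 :: real
  assumes m: "\<rho> \<in> borel_measurable borel" and i: "\<And>a b. set_integrable lborel {a..b} \<rho>" and nn: "\<And>y. 0 \<le> \<rho> y"
  obtains D D' where "D 0 = 0" "\<And>y. 0 \<le> D y" "\<And>y. (D has_real_derivative D' y) (at y)"
    "has_density D' (\<lambda>y. (m1 + m2) * D' y - m1 * m2 * D y + \<rho> y)"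
proof -
  have ce: "continuous_on UNIV (\<lambda>y::real. exp (c * y))" for c by (intro continuous_intros)
  have de: "((\<lambda>y. exp (c * y)) has_real_derivative c * exp (c * y)) (at y)" for c y :: real
    by (auto intro!: derivative_eq_intros)
  have ce': "continuous_on UNIV (\<lambda>y::real. c * exp (c * y))" for c by (intro continuous_intros)
  have em: "(\<lambda>y. exp (- m1 * y) * \<rho> y) \<in> borel_measurable borel" using m by measurable
  have ei: "set_integrable lborel {a..b} (\<lambda>y. exp (- m1 * y) * \<rho> y)" for a b
    by (rule set_integrable_continuous_mult[OF i continuous_on_subset[OF ce] m]) auto
  obtain R where R: "R 0 = 0" "has_density R (\<lambda>y. exp (- m1 * y) * \<rho> y)"
    using has_density_antiderivative[OF em ei] by blast
  have Rm: "R x \<le> R y" if "x \<le> y" for x y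
    by (rule has_density_mono[OF R(2) _ order_refl that order_refl]) (simp add: nn)
  have cR: "continuous_on UNIV R" by (rule has_density_continuous[OF R(2)])
  obtain S where S: "S 0 = 0" "\<And>y. (S has_real_derivative exp ((m1 - m2) * y) * R y) (at y)"
    using continuous_antiderivative[OF continuous_on_mult[OF ce[of "m1 - m2"] cR]] by blast
  \<comment> \<open>\<open>R\<close> is nondecreasing with \<open>R 0 = 0\<close>, so it has the
    sign of \<open>y\<close>, and its weighted antiderivative \<open>S\<close> from \<open>0\<close>
    is nonnegative on both sides.\<close>
  have Snn: "0 \<le> S y" for y
  proof (cases "0 \<le> y")
    case True
    have "S 0 \<le> S y"
      by (rule DERIV_nonneg_imp_nondecreasing[OF True]) (use S(2) Rm[of 0] R(1) in \<open>force intro!: mult_nonneg_nonneg\<close>)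
    then show ?thesis using S(1) by simp
  next
    case False
    have "S 0 \<le> S y"
      by (rule DERIV_nonpos_imp_nonincreasing[of y 0]) (use False S(2) Rm[of _ 0] R(1) in \<open>force intro!: mult_nonneg_nonpos\<close>)+
    then show ?thesis using S(1) by simp
  qed
  define D where "D y = exp (m2 * y) * S y" for y
  define p where "p y = exp (m1 * y) * R y" for y
  define D' where "D' y = m2 * D y + p y" for y
  have D: "(D has_real_derivative D' y) (at y)" for y
  proof -
    have "(D has_real_derivative m2 * exp (m2 * y) * S y + exp ((m1 - m2) * y) * R y * exp (m2 * y)) (at y)"
      unfolding D_def[abs_def] by (rule DERIV_mult[OF de S(2)])
    moreover have "exp ((m1 - m2) * y) * R y * exp (m2 * y) = p y"
      by (simp add: p_def algebra_simps flip: exp_add)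
    ultimately show ?thesis by (simp add: D'_def D_def mult.assoc)
  qed
  have pd: "has_density p (\<lambda>y. m1 * exp (m1 * y) * R y + exp (m1 * y) * (exp (- m1 * y) * \<rho> y))"
    unfolding p_def[abs_def] by (rule has_density_mult_C1[OF de ce' R(2)])
  have peq: "(\<lambda>y. m1 * exp (m1 * y) * R y + exp (m1 * y) * (exp (- m1 * y) * \<rho> y)) = (\<lambda>y. m1 * p y + \<rho> y)"
    by (rule ext) (simp add: p_def mult.assoc[symmetric] flip: exp_add)
  have cp: "continuous_on UNIV p" by (rule has_density_continuous[OF pd])
  have cD: "continuous_on UNIV D" using DERIV_continuous_on[of UNIV D D'] D by simp
  have cD': "continuous_on UNIV D'" unfolding D'_def by (intro continuous_intros cD cp)
  have "has_density D' (\<lambda>y. m2 * D' y + (m1 * p y + \<rho> y))"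
    using has_density_add[OF has_density_cmult[OF has_density_C1[OF D cD'], of m2] pd[unfolded peq]]
    by (simp add: D'_def[abs_def])
  moreover have "(\<lambda>y. m2 * D' y + (m1 * p y + \<rho> y)) = (\<lambda>y. (m1 + m2) * D' y - m1 * m2 * D y + \<rho> y)"
    by (rule ext) (simp add: D'_def algebra_simps)
  ultimately have "has_density D' (\<lambda>y. (m1 + m2) * D' y - m1 * m2 * D y + \<rho> y)" by simp
  then show ?thesis using D Snn S(1) by (intro that[of D D']) (auto simp: D_def)
qed

text \<open>The operator factorises, so \<open>q\<close>, a positive weight times one first-order
  factor applied to \<open>u\<close>, is nonincreasing on either side of \<open>{-k..k}\<close>:
  bounded above on the right and below on the left. Both facts point the right way, since
  integrating \<open>exp ((m1 - m2) * y) * q y\<close>, the derivative of \<open>z\<close>, outwards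
  bounds \<open>z\<close> from above in either direction.\<close>

lemma subsolution_growth:
  fixes m1 m2 :: real
  assumes u: "\<And>y. (u has_real_derivative u' y) (at y)" and u2: "has_density u' h"
    and sub: "AE y in lborel. \<bar>y\<bar> > k \<longrightarrow> h y - (m1 + m2) * u' y + m1 * m2 * u y \<le> 0" and k: "k \<ge> 0" and m12: "m2 \<le> m1"
  obtains C \<beta> where "C \<ge> 0" "\<beta> \<ge> 0" "\<And>y. \<bar>y\<bar> \<ge> k \<Longrightarrow> u y \<le> C * exp (\<beta> * \<bar>y\<bar>)"
proof -
  define q where "q y = exp (- m1 * y) * (u' y + - m2 * u y)" for y
  have cu: "continuous_on UNIV u" "continuous_on UNIV u'"
    using DERIV_continuous_on[of UNIV u u'] u has_density_continuous[OF u2] by simp_all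
  have de: "((\<lambda>y. exp (c * y)) has_real_derivative c * exp (c * y)) (at y)" for c y :: real
    by (auto intro!: derivative_eq_intros)
  have ce': "continuous_on UNIV (\<lambda>y::real. c * exp (c * y))" for c by (intro continuous_intros)
  have qd: "has_density q (\<lambda>y. - m1 * exp (- m1 * y) * (u' y + - m2 * u y) + exp (- m1 * y) * (h y + - m2 * u' y))"
    unfolding q_def[abs_def]
    by (rule has_density_mult_C1[OF de ce' has_density_add[OF u2 has_density_cmult[OF has_density_C1[OF u cu(2)]]]])
  let ?d = "\<lambda>y. -1 * (- m1 * exp (- m1 * y) * (u' y + - m2 * u y) + exp (- m1 * y) * (h y + - m2 * u' y))"
  have nq: "has_density (\<lambda>y. -1 * q y) ?d" by (rule has_density_cmult[OF qd])
  have dsign: "AE y in lborel. \<bar>y\<bar> > k \<longrightarrow> 0 \<le> ?d y"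
    using sub
  proof eventually_elim
    case (elim y)
    have "?d y = - (exp (- m1 * y) * (h y - (m1 + m2) * u' y + m1 * m2 * u y))" by (simp add: algebra_simps)
    moreover have "\<bar>y\<bar> > k \<Longrightarrow> exp (- m1 * y) * (h y - (m1 + m2) * u' y + m1 * m2 * u y) \<le> 0"
      using elim by (intro mult_nonneg_nonpos) auto
    ultimately show ?case by linarith
  qed
  have q_right: "q y \<le> q k" if "k \<le> y" for y
  proof -
    have "AE z in lborel. k < z \<and> z < y \<longrightarrow> 0 \<le> ?d z" using dsign by eventually_elim auto
    from has_density_mono[OF nq this order_refl that order_refl] show ?thesis by simp
  qed
  have q_left: "q (- k) \<le> q y" if "y \<le> - k" for y
  proof -
    have "AE z in lborel. y < z \<and> z < - k \<longrightarrow> 0 \<le> ?d z" using dsign by eventually_elim auto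
    from has_density_mono[OF nq this order_refl that order_refl] show ?thesis by simp
  qed
  define z where "z y = exp (- m2 * y) * u y" for y
  have zd: "(z has_real_derivative exp ((m1 - m2) * y) * q y) (at y)" for y
  proof -
    have d: "(z has_real_derivative - m2 * exp (- m2 * y) * u y + u' y * exp (- m2 * y)) (at y)"
      unfolding z_def[abs_def] by (rule DERIV_mult[OF de u])
    have "exp ((m1 - m2) * y) * q y = exp (- m2 * y) * (u' y + - m2 * u y)"
    proof -
      have "exp ((m1 - m2) * y) * exp (- m1 * y) = exp (- m2 * y)" unfolding exp_add[symmetric] by (simp add: algebra_simps)
      then show ?thesis by (simp add: q_def flip: mult.assoc)
    qed
    then have "- m2 * exp (- m2 * y) * u y + u' y * exp (- m2 * y) = exp ((m1 - m2) * y) * q y" by (simp add: algebra_simps)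
    with d show ?thesis by (simp only:)
  qed
  define c where "c = \<bar>q k\<bar> + \<bar>q (- k)\<bar>"
  define A where "A = \<bar>z k\<bar> + \<bar>z (- k)\<bar>"
  let ?\<delta> = "m1 - m2"
  have zb: "z y \<le> A + c * (exp (?\<delta> * \<bar>y\<bar>) * \<bar>y\<bar>)" if y: "\<bar>y\<bar> \<ge> k" for y
  proof (cases "y \<ge> 0")
    case True
    then have ky: "k \<le> y" using y by simp
    have "z y - z k \<le> c * exp (?\<delta> * y) * (y - k)"
    proof (cases "k = y")
      case False
      then have "k < y" using ky by simp
      then obtain x where x: "k < x" "x < y" "z y - z k = (y - k) * (exp (?\<delta> * x) * q x)"
        using MVT2[OF \<open>k < y\<close>, of z "\<lambda>x. exp (?\<delta> * x) * q x"] zd by auto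
      have "exp (?\<delta> * x) * q x \<le> exp (?\<delta> * y) * c"
      proof -
        have "q x \<le> c" using q_right[of x] x by (simp add: c_def)
        then have "exp (?\<delta> * x) * q x \<le> exp (?\<delta> * x) * c" by (intro mult_left_mono) auto
        also have "\<dots> \<le> exp (?\<delta> * y) * c" using x m12 by (intro mult_right_mono) (auto simp: c_def mult_left_mono)
        finally show ?thesis .
      qed
      then have "(y - k) * (exp (?\<delta> * x) * q x) \<le> (y - k) * (exp (?\<delta> * y) * c)" using ky by (intro mult_left_mono) auto
      then show ?thesis using x(3) by (simp add: mult_ac)
    qed simp
    also have "\<dots> \<le> c * exp (?\<delta> * y) * y" using k by (intro mult_left_mono) (auto simp: c_def)
    finally show ?thesis using True by (simp add: A_def mult.assoc)
  next
    case False
    then have ky: "y \<le> - k" using y by simp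
    have "z y - z (- k) \<le> c * (- k - y)"
    proof (cases "y = - k")
      case False
      then have "y < - k" using ky by simp
      then obtain x where x: "y < x" "x < - k" "z (- k) - z y = (- k - y) * (exp (?\<delta> * x) * q x)" 
        using MVT2[OF \<open>y < - k\<close>, of z "\<lambda>x. exp (?\<delta> * x) * q x"] zd by auto
      have "- c \<le> exp (?\<delta> * x) * q x"
      proof -
        have e1: "exp (?\<delta> * x) \<le> 1" using x k m12 by (simp add: mult_nonneg_nonpos)
        have "- c \<le> q x" using q_left[of x] x by (simp add: c_def)
        then have "exp (?\<delta> * x) * - c \<le> exp (?\<delta> * x) * q x" by (intro mult_left_mono) auto
        moreover have "1 * c \<ge> exp (?\<delta> * x) * c" using e1 by (intro mult_right_mono) (auto simp: c_def)
        ultimately show ?thesis by simp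
      qed
      then have "(- k - y) * - c \<le> (- k - y) * (exp (?\<delta> * x) * q x)" using ky by (intro mult_left_mono) auto
      then show ?thesis using x(3) by (simp add: algebra_simps)
    qed simp
    also have "\<dots> \<le> c * (exp (?\<delta> * \<bar>y\<bar>) * \<bar>y\<bar>)"
    proof (rule mult_left_mono)
      have "1 \<le> exp (?\<delta> * \<bar>y\<bar>)" using m12 by simp
      then have "1 * \<bar>y\<bar> \<le> exp (?\<delta> * \<bar>y\<bar>) * \<bar>y\<bar>" by (intro mult_right_mono) auto
      moreover have "\<bar>y\<bar> = - y" using False by simp
      ultimately show "- k - y \<le> exp (?\<delta> * \<bar>y\<bar>) * \<bar>y\<bar>" using k by linarith
    qed (simp add: c_def)
    finally show ?thesis by (simp add: A_def)
  qed
  have nn: "A \<ge> 0" "c \<ge> 0" by (auto simp: A_def c_def)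
  show ?thesis
  \<comment> \<open>\<open>\<bar>m2\<bar>\<close> undoes the weight in \<open>z\<close>,
    \<open>?\<delta>\<close> comes from the derivative of \<open>z\<close>, and \<open>1\<close>
    absorbs the linear factor through \<open>\<bar>y\<bar> \<le> exp \<bar>y\<bar>\<close>.\<close>
  proof (rule that[of "A + c" "\<bar>m2\<bar> + ?\<delta> + 1"])
    show "A + c \<ge> 0" "\<bar>m2\<bar> + ?\<delta> + 1 \<ge> 0" using nn m12 by auto
    fix y assume y: "\<bar>y\<bar> \<ge> k"
    have ey: "\<bar>y\<bar> \<le> exp \<bar>y\<bar>" using exp_ge_add_one_self[of "\<bar>y\<bar>"] by linarith
    have "exp (?\<delta> * \<bar>y\<bar>) * \<bar>y\<bar> \<le> exp (?\<delta> * \<bar>y\<bar>) * exp \<bar>y\<bar>" using ey by (intro mult_left_mono) auto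
    then have 1: "c * (exp (?\<delta> * \<bar>y\<bar>) * \<bar>y\<bar>) \<le> c * (exp (?\<delta> * \<bar>y\<bar>) * exp \<bar>y\<bar>)" by (rule mult_left_mono[OF _ nn(2)])
    have e1: "1 \<le> exp (?\<delta> * \<bar>y\<bar>) * exp \<bar>y\<bar>" using m12 by (simp flip: exp_add)
    have "z y \<le> A + c * (exp (?\<delta> * \<bar>y\<bar>) * exp \<bar>y\<bar>)" using zb[OF y] 1 by linarith
    also have "\<dots> \<le> (A + c) * (exp (?\<delta> * \<bar>y\<bar>) * exp \<bar>y\<bar>)"
      using mult_left_mono[OF e1 nn(1)] by (simp add: algebra_simps)
    finally have zz: "z y \<le> (A + c) * (exp (?\<delta> * \<bar>y\<bar>) * exp \<bar>y\<bar>)" .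
    have "u y = exp (m2 * y) * z y" by (simp add: z_def flip: mult.assoc exp_add)
    also have "\<dots> \<le> exp (m2 * y) * ((A + c) * (exp (?\<delta> * \<bar>y\<bar>) * exp \<bar>y\<bar>))" using zz by (intro mult_left_mono) auto
    also have "\<dots> \<le> exp (\<bar>m2\<bar> * \<bar>y\<bar>) * ((A + c) * (exp (?\<delta> * \<bar>y\<bar>) * exp \<bar>y\<bar>))"
      using nn abs_ge_self[of "m2 * y"] by (intro mult_right_mono) (auto simp: abs_mult)
    also have "\<dots> = (A + c) * exp ((\<bar>m2\<bar> + ?\<delta> + 1) * \<bar>y\<bar>)"
      by (simp add: algebra_simps flip: exp_add)
    finally show "u y \<le> (A + c) * exp ((\<bar>m2\<bar> + ?\<delta> + 1) * \<bar>y\<bar>)" .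
  qed
qed

lemma ennreal_add_le: "0 \<le> b \<Longrightarrow> ennreal (a + b) \<le> ennreal a + ennreal b"
  by (cases "0 \<le> a") (auto simp: ennreal_leI ennreal_neg)

text \<open>\<open>ennreal\<close> truncates negative values to zero, so the integral on the right
  is that of the positive part. This allows a signed stopped value to be estimated pointwise by
  nonnegative terms.\<close>

lemma ennreal_integral_le:
  fixes X :: "'b \<Rightarrow> real"
  assumes X: "integrable M X" shows "ennreal (integral\<^sup>L M X) \<le> (\<integral>\<^sup>+\<omega>. ennreal (X \<omega>) \<partial>M)"
proof -
  have i: "integrable M (\<lambda>\<omega>. max 0 (X \<omega>))" using X by simp
  have "integral\<^sup>L M X \<le> (LINT \<omega>|M. max 0 (X \<omega>))" by (rule integral_mono[OF X i]) simp
  then have "ennreal (integral\<^sup>L M X) \<le> ennreal (LINT \<omega>|M. max 0 (X \<omega>))" by (rule ennreal_leI)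
  also have "\<dots> = (\<integral>\<^sup>+\<omega>. ennreal (max 0 (X \<omega>)) \<partial>M)" by (rule nn_integral_eq_integral[OF i, symmetric]) simp
  also have "\<dots> = (\<integral>\<^sup>+\<omega>. ennreal (X \<omega>) \<partial>M)" by simp
  finally show ?thesis .
qed

context drifted_brownian
begin

text \<open>\<open>escape_probability\<close> is used with \<open>c = \<beta> + 1\<close>: one unit
  more than the growth rate leaves a factor \<open>exp (- N)\<close> to spare.\<close>

lemma escape_negligible:
  fixes \<beta> K e T :: real and k :: nat
  assumes T: "0 < T" and b: "0 \<le> \<beta>" and K: "0 \<le> K" and e: "0 < e"
  obtains N :: nat where "k \<le> N" "K * exp (\<beta> * N) * prob {\<omega>\<in>space M. hit (outside N) \<omega> \<le> ennreal T} \<le> e"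
proof -
  define A where "A = exp ((\<sigma>\<^sup>2 * (\<beta> + 1)\<^sup>2 / 2 + \<bar>\<mu>\<bar> * (\<beta> + 1)) * T)"
  obtain N1 :: nat where N1: "K * (2 * A) / e \<le> N1" using real_arch_simple by blast
  define N where "N = max k N1"
  let ?p = "prob {\<omega>\<in>space M. hit (outside N) \<omega> \<le> ennreal T}"
  have "?p * (exp ((\<beta> + 1) * N) / 2) \<le> ?p * cosh ((\<beta> + 1) * N)"
    by (intro mult_left_mono) (auto simp: cosh_def)
  also have "\<dots> \<le> A" unfolding A_def by (rule escape_probability) (use b T in auto)
  finally have "?p * (exp ((\<beta> + 1) * N) / 2) \<le> A" .
  moreover have "exp ((\<beta> + 1) * N) = exp (\<beta> * N) * exp N" unfolding exp_add[symmetric] by (simp add: algebra_simps)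
  ultimately have p: "?p * exp (\<beta> * N) * exp N \<le> 2 * A" by simp
  have "(K * exp (\<beta> * N) * ?p) * exp N = K * (?p * exp (\<beta> * N) * exp N)" by (simp add: mult_ac)
  also have "\<dots> \<le> K * (2 * A)" using p K by (rule mult_left_mono)
  also have "\<dots> \<le> e * N1" using N1 e by (simp add: field_simps)
  also have "\<dots> \<le> e * exp N"
  proof (rule mult_left_mono)
    have "real N1 \<le> real N" by (simp add: N_def)
    then show "real N1 \<le> exp (real N)" using exp_ge_add_one_self[of "real N"] by linarith
  qed (use e in simp)
  finally have "K * exp (\<beta> * N) * ?p \<le> e" by simp
  then show ?thesis by (intro that[of N]) (auto simp: N_def)
qed

lemma nn_occ_loc_mono:
  assumes "m \<le> n" shows "nn_occ r (loc \<tau> m) \<phi> \<le> nn_occ r (loc \<tau> n) \<phi>"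
  unfolding nn_occ_def
proof (rule nn_integral_mono)
  fix z :: "'a \<times> real" assume "z \<in> space (M \<Otimes>\<^sub>M lborel)"
  then have om: "fst z \<in> space M" by (auto simp: space_pair_measure)
  have "snd z < loc \<tau> n (fst z)" if "0 \<le> snd z" "snd z < loc \<tau> m (fst z)"
    using that(2) assms unfolding less_loc_iff[OF om that(1)] by fastforce
  then show "ennreal (occ_kernel r (loc \<tau> m) \<phi> z) \<le> ennreal (occ_kernel r (loc \<tau> n) \<phi> z)"
    by (auto simp: occ_kernel_def indicator_def)
qed

end

section \<open>The zero set, the transversality quantity and the lower bound\<close>

context log_hjb
begin

definition Z :: "real set" where "Z = {y. f y = 0}"

lemma closed_Z: "closed Z"
  unfolding Z_def by (intro closed_Collect_eq f_cont(1) continuous_on_const)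

text \<open>The transversality expression of the theorem with \<open>hit Z\<close> in place of its
  exit time; the two times agree when \<open>f 0 > 0\<close>.\<close>

definition survival :: "real \<Rightarrow> ennreal" where
  "survival t = ennreal (exp (- r * t)) * (\<integral>\<^sup>+\<omega>. ennreal (f (Y t \<omega>)) * indicator {\<omega>. ennreal t < hit Z \<omega>} \<omega> \<partial>M)"

lemma hit_event: "closed C \<Longrightarrow> 0 \<le> t \<Longrightarrow> {\<omega>\<in>space M. hit C \<omega> \<le> ennreal t} \<in> sets M"
  using hit_stopping_time[of C] filtration_subset[of t] unfolding is_stopping_time_def by blast

lemma survival_integrand_measurable:
  assumes t: "0 \<le> t" shows "(\<lambda>\<omega>. ennreal (f (Y t \<omega>)) * indicator {\<omega>. ennreal t < hit Z \<omega>} \<omega>) \<in> borel_measurable M"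
proof -
  note [measurable] = Y_measurable[OF t] meas(1)
  have e: "space M - {\<omega>\<in>space M. hit Z \<omega> \<le> ennreal t} \<in> sets M" using hit_event[OF closed_Z t] by blast
  have "(\<lambda>\<omega>. ennreal (f (Y t \<omega>)) * indicator (space M - {\<omega>\<in>space M. hit Z \<omega> \<le> ennreal t}) \<omega>) \<in> borel_measurable M"
    using e by measurable
  then show ?thesis by (rule measurable_cong[THEN iffD1, rotated]) (auto simp: indicator_def not_le)
qed

lemma survival_alt:
  assumes t: "0 \<le> t"
  shows "survival t = (\<integral>\<^sup>+\<omega>. ennreal (exp (- r * t) * f (Y t \<omega>) * indicator {\<omega>. ennreal t < hit Z \<omega>} \<omega>) \<partial>M)"
  unfolding survival_def nn_integral_cmult[OF survival_integrand_measurable[OF t], symmetric]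
  by (intro nn_integral_cong) (auto simp: indicator_def ennreal_mult f_nonneg)

text \<open>The inequality is Dynkin's formula for \<open>u = f - D\<close>. The part of
  \<open>Pm\<close> outside \<open>{-m..m}\<close> is carried by \<open>D\<close>, which may be
  dropped at the end as \<open>D \<ge> 0\<close> and costs nothing at the start as
  \<open>D 0 = 0\<close>; the inside part remains on the left. The bound \<open>N\<close> is chosen
  last, since the growth constants of \<open>u\<close> depend on \<open>m\<close>.\<close>

lemma lower_bound_step:
  fixes m :: nat
  assumes disc: "0 \<le> \<mu>\<^sup>2 + 2 * \<sigma>\<^sup>2 * r" and m: "1 \<le> m" and e: "0 < e"
  shows "ennreal (f 0) + nn_occ r (loc (hit Z) m) Pm \<le> survival m + ennreal e + flow r (hit Z) Pp"
proof -
  define \<Delta> where "\<Delta> = sqrt (\<mu>\<^sup>2 + 2 * \<sigma>\<^sup>2 * r)"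
  define m1 where "m1 = (- \<mu> + \<Delta>) / \<sigma>\<^sup>2"
  define m2 where "m2 = (- \<mu> - \<Delta>) / \<sigma>\<^sup>2"
  have s2: "\<sigma>\<^sup>2 > 0" using sigma by simp
  have D2: "\<Delta>\<^sup>2 = \<mu>\<^sup>2 + 2 * \<sigma>\<^sup>2 * r" "\<Delta> \<ge> 0" using disc by (auto simp: \<Delta>_def)
  have m12: "m2 \<le> m1" using D2(2) s2 by (auto simp: m1_def m2_def intro!: divide_right_mono)
  have m_sum: "\<sigma>\<^sup>2 / 2 * (m1 + m2) = - \<mu>" using sigma by (simp add: m1_def m2_def field_simps)
  have "m1 * m2 = (\<mu>\<^sup>2 - \<Delta>\<^sup>2) / (\<sigma>\<^sup>2 * \<sigma>\<^sup>2)" by (simp add: m1_def m2_def power2_eq_square algebra_simps)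
  moreover have "\<sigma>\<^sup>2 / 2 * ((\<mu>\<^sup>2 - (\<mu>\<^sup>2 + 2 * \<sigma>\<^sup>2 * r)) / (\<sigma>\<^sup>2 * \<sigma>\<^sup>2)) = - r" using s2 by simp
  ultimately have m_prod: "\<sigma>\<^sup>2 / 2 * (m1 * m2) = - r" unfolding D2 by (simp only:)
  define I where "I y = (indicator {y. \<bar>y\<bar> > real m} y :: real)" for y
  have Im [measurable]: "I \<in> borel_measurable borel" unfolding I_def[abs_def] by measurable
  have I01: "0 \<le> I y" "I y \<le> 1" for y by (auto simp: I_def indicator_def)
  note [measurable] = meas
  \<comment> \<open>the sum and product of the roots are chosen so that \<open>L = \<sigma>\<^sup>2 / 2 (d/dy - m1)(d/dy - m2)\<close>\<close>
  define \<rho>s where "\<rho>s y = 2 / \<sigma>\<^sup>2 * (Pm y * I y)" for y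
  have PmI_int: "set_integrable lborel {a..b} (\<lambda>y. Pm y * I y)" for a b
  proof (rule set_integrable_bound[OF PP_int(2)[of a b]])
    show "AE y in lborel. y \<in> {a..b} \<longrightarrow> norm (Pm y * I y) \<le> norm (Pm y)"
      by (auto simp: I_def indicator_def)
  qed (auto simp: set_borel_measurable_def)
  have \<rho>s_m: "\<rho>s \<in> borel_measurable borel" unfolding \<rho>s_def[abs_def] by measurable
  have \<rho>s_int: "set_integrable lborel {a..b} \<rho>s" for a b
    unfolding \<rho>s_def[abs_def] by (intro set_integrable_mult_right PmI_int)
  have \<rho>s_nn: "0 \<le> \<rho>s y" for y using I01 s2 by (simp add: \<rho>s_def)
  obtain D D' where D: "D 0 = 0" "\<And>y. 0 \<le> D y" "\<And>y. (D has_real_derivative D' y) (at y)"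
    "has_density D' (\<lambda>y. (m1 + m2) * D' y - m1 * m2 * D y + \<rho>s y)"
    by (rule nonneg_source_solution[OF \<rho>s_m \<rho>s_int \<rho>s_nn, of m1 m2]) blast
  define u where "u y = f y - D y" for y
  define u' where "u' y = f' y + -1 * D' y" for y
  define h where "h y = g y + -1 * ((m1 + m2) * D' y - m1 * m2 * D y + \<rho>s y)" for y
  have u1: "(u has_real_derivative u' y) (at y)" for y
    unfolding u_def[abs_def] u'_def using DERIV_diff[OF f' D(3)] by simp
  have u2: "has_density u' h" unfolding u'_def[abs_def] h_def[abs_def]
    by (rule has_density_add[OF g has_density_cmult[OF D(4)]])
  define Lu where "Lu y = \<sigma>\<^sup>2 / 2 * h y + \<mu> * u' y - r * u y" for y
  have Lu: "Lu y = Lf y - Pm y * I y" for y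
  proof -
    have "Lu y = Lf y - (\<sigma>\<^sup>2 / 2 * (m1 + m2)) * D' y + (\<sigma>\<^sup>2 / 2 * (m1 * m2)) * D y - \<sigma>\<^sup>2 / 2 * \<rho>s y - \<mu> * D' y + r * D y"
      by (simp add: Lu_def h_def u'_def u_def algebra_simps)
    also have "\<dots> = Lf y - \<sigma>\<^sup>2 / 2 * \<rho>s y" unfolding m_sum m_prod by simp
    also have "\<sigma>\<^sup>2 / 2 * \<rho>s y = Pm y * I y" using s2 by (simp add: \<rho>s_def)
    finally show ?thesis .
  qed
  have Lu_m: "Lu \<in> borel_measurable borel" unfolding Lu[abs_def] by measurable
  have Lu_int: "set_integrable lborel {a..b} Lu" for a b unfolding Lu[abs_def]
    by (rule set_integral_diff(1)[OF Lf_int PmI_int])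
  have sub: "AE y in lborel. \<bar>y\<bar> > real m \<longrightarrow> h y - (m1 + m2) * u' y + m1 * m2 * u y \<le> 0"
    using Lf_le
  proof eventually_elim
    case (elim y)
    show ?case
    proof
      assume "\<bar>y\<bar> > real m"
      then have "Lu y \<le> 0" using elim by (auto simp: Lu I_def max_def)
      moreover have "Lu y = \<sigma>\<^sup>2 / 2 * (h y - (m1 + m2) * u' y + m1 * m2 * u y)"
      proof -
        have "\<sigma>\<^sup>2 / 2 * (h y - (m1 + m2) * u' y + m1 * m2 * u y)
            = \<sigma>\<^sup>2 / 2 * h y - (\<sigma>\<^sup>2 / 2 * (m1 + m2)) * u' y + (\<sigma>\<^sup>2 / 2 * (m1 * m2)) * u y" by (simp add: algebra_simps)
        then show ?thesis unfolding m_sum m_prod by (simp add: Lu_def)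
      qed
      ultimately show "h y - (m1 + m2) * u' y + m1 * m2 * u y \<le> 0" using s2 by (simp add: mult_le_0_iff)
    qed
  qed
  obtain C \<beta> where C: "C \<ge> 0" "\<beta> \<ge> 0" "\<And>y. \<bar>y\<bar> \<ge> real m \<Longrightarrow> u y \<le> C * exp (\<beta> * \<bar>y\<bar>)"
    using subsolution_growth[OF u1 u2 sub _ m12] by auto
  have T: "real m > 0" "real m \<ge> 0" using m by auto
  \<comment> \<open>On the boundary of the large interval the value of \<open>u\<close>, together
    with a bound for the discount up to time \<open>m\<close>, is at most
    \<open>K * exp (\<beta> * N)\<close>.\<close>
  define K where "K = exp (\<bar>r\<bar> * m) * C"
  have K: "K \<ge> 0" using C by (simp add: K_def)
  obtain N :: nat where N: "m \<le> N" "K * exp (\<beta> * N) * prob {\<omega>\<in>space M. hit (outside N) \<omega> \<le> ennreal m} \<le> e"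
    using escape_negligible[OF T(1) C(2) K e] by blast
  let ?\<tau> = "hit Z"
  let ?O = "outside (real N)"
  let ?\<rho> = "stop_before ?\<tau> ?O (real m)"
  note tau = hit_stopping_time[OF closed_Z]
  have N0: "real N \<ge> 0" by simp
  have st: "stops ?\<rho> (real m) (real N)" by (rule stop_before_stops[OF tau closed_outside outside_compl T(2)])
  define E where "E = {\<omega>\<in>space M. hit ?O \<omega> \<le> ennreal m}"
  have E: "E \<in> sets M" unfolding E_def by (rule hit_event[OF closed_outside T(2)])
  let ?X = "\<lambda>\<omega>. exp (- r * ?\<rho> \<omega>) * u (Y (?\<rho> \<omega>) \<omega>)"
  let ?B = "\<lambda>\<omega>. exp (- r * real m) * f (Y (real m) \<omega>) * indicator {\<omega>. ennreal (real m) < hit Z \<omega>} \<omega>"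
  have Bnn: "0 \<le> ?B \<omega>" for \<omega> by (simp add: f_nonneg)
  have X_le: "?X \<omega> \<le> K * exp (\<beta> * N) * indicator E \<omega> + ?B \<omega>" if om: "\<omega> \<in> space M" for \<omega>
  proof -
    have Ann: "0 \<le> K * exp (\<beta> * N) * indicator E \<omega>" using K by simp
    \<comment> \<open>Leaving the large interval, reaching \<open>Z\<close> and the horizon
      \<open>m\<close> compete for being first. The three outcomes contribute the small error, at
      most zero, and the survival term.\<close>
    have "hit ?O \<omega> \<le> ennreal m \<and> hit ?O \<omega> \<le> ?\<tau> \<omega> \<or> ?\<tau> \<omega> \<le> ennreal m \<and> ?\<tau> \<omega> \<le> hit ?O \<omega>
        \<or> ennreal m < ?\<tau> \<omega> \<and> ennreal m < hit ?O \<omega>"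
      by (meson le_cases not_le order_trans)
    then show ?thesis
    proof (elim disjE conjE)
      assume a: "hit ?O \<omega> \<le> ennreal m" "hit ?O \<omega> \<le> ?\<tau> \<omega>"
      have "Y (?\<rho> \<omega>) \<omega> \<in> ?O" by (rule stop_before_hit[where \<tau>="hit Z", OF closed_outside om T(2) a])
      then have Yabs: "\<bar>Y (?\<rho> \<omega>) \<omega>\<bar> = real N" using stops_value_bound[OF st N0 om] by (auto simp: outside_def)
      then have "u (Y (?\<rho> \<omega>) \<omega>) \<le> C * exp (\<beta> * N)" using C(3)[of "Y (?\<rho> \<omega>) \<omega>"] N(1) by simp
      then have "?X \<omega> \<le> exp (- r * ?\<rho> \<omega>) * (C * exp (\<beta> * N))" by (intro mult_left_mono) auto
      also have "\<dots> \<le> exp (\<bar>r\<bar> * m) * (C * exp (\<beta> * N))"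
        using stop_before_bounds[OF T(2)] C(1) by (intro mult_right_mono discount_bound) auto
      finally show ?thesis using a om Bnn[of \<omega>] by (simp add: K_def E_def mult.assoc)
    next
      assume a: "?\<tau> \<omega> \<le> ennreal m" "?\<tau> \<omega> \<le> hit ?O \<omega>"
      have "?\<rho> \<omega> = stop_before (hit ?O) Z m \<omega>" by (simp add: stop_before_def min.commute)
      then have "Y (?\<rho> \<omega>) \<omega> \<in> Z" using stop_before_hit[where \<tau>="hit ?O", OF closed_Z om T(2) a] by simp
      then have "u (Y (?\<rho> \<omega>) \<omega>) \<le> 0" using D(2) by (simp add: u_def Z_def)
      then have "?X \<omega> \<le> 0" by (intro mult_nonneg_nonpos) auto
      then show ?thesis using Ann Bnn[of \<omega>] by linarith
    next
      assume a: "ennreal m < ?\<tau> \<omega>" "ennreal m < hit ?O \<omega>"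
      then have "?\<rho> \<omega> = m" by (simp add: stop_before_def min_absorb2 less_imp_le)
      moreover have "u (Y m \<omega>) \<le> f (Y m \<omega>)" using D(2) by (simp add: u_def)
      ultimately have "?X \<omega> \<le> ?B \<omega>" using a(1) by simp
      then show ?thesis using Ann by linarith
    qed
  qed
  have cu: "continuous_on UNIV u" using DERIV_continuous_on[of UNIV u u'] u1 by simp
  have Xint: "integrable M ?X" by (rule stopped_integrable[OF st N0 cu])
  have Dyn: "expectation ?X = f 0 + occ r ?\<rho> Lu"
    using Dynkin_density[OF st T(1) N0 u1 u2] D(1) by (simp add: u_def Lu_def[abs_def])
  have Bm: "(\<lambda>\<omega>. ennreal (?B \<omega>)) \<in> borel_measurable M"
  proof -
    have "(\<lambda>\<omega>. ennreal (exp (- r * m)) * (ennreal (f (Y m \<omega>)) * indicator {\<omega>. ennreal m < hit Z \<omega>} \<omega>)) \<in> borel_measurable M"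
      using survival_integrand_measurable[OF T(2)] by measurable
    then show ?thesis by (rule measurable_cong[THEN iffD1, rotated]) (auto simp: indicator_def ennreal_mult f_nonneg)
  qed
  have "ennreal (expectation ?X) \<le> (\<integral>\<^sup>+\<omega>. ennreal (?X \<omega>) \<partial>M)" by (rule ennreal_integral_le[OF Xint])
  also have "\<dots> \<le> (\<integral>\<^sup>+\<omega>. ennreal (K * exp (\<beta> * N)) * indicator E \<omega> + ennreal (?B \<omega>) \<partial>M)"
  proof (rule nn_integral_mono)
    fix \<omega> assume "\<omega> \<in> space M"
    then have "ennreal (?X \<omega>) \<le> ennreal (K * exp (\<beta> * N) * indicator E \<omega> + ?B \<omega>)" by (intro ennreal_leI X_le)
    also have "\<dots> \<le> ennreal (K * exp (\<beta> * N) * indicator E \<omega>) + ennreal (?B \<omega>)" by (rule ennreal_add_le[OF Bnn])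
    finally show "ennreal (?X \<omega>) \<le> ennreal (K * exp (\<beta> * N)) * indicator E \<omega> + ennreal (?B \<omega>)"
      by (cases "\<omega> \<in> E") simp_all
  qed
  also have "\<dots> = (\<integral>\<^sup>+\<omega>. ennreal (K * exp (\<beta> * N)) * indicator E \<omega> \<partial>M) + survival m"
    unfolding survival_alt[OF T(2)] by (rule nn_integral_add) (use E Bm in auto)
  also have "(\<integral>\<^sup>+\<omega>. ennreal (K * exp (\<beta> * N)) * indicator E \<omega> \<partial>M) = ennreal (K * exp (\<beta> * N) * prob E)"
    using E K by (simp add: nn_integral_cmult_indicator emeasure_eq_measure ennreal_mult')
  also have "\<dots> \<le> ennreal e" using N(2) by (intro ennreal_leI) (simp add: E_def)
  finally have 1: "ennreal (f 0 + occ r ?\<rho> Lu) \<le> ennreal e + survival m" unfolding Dyn by (simp add: add_right_mono)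
  \<comment> \<open>The part of \<open>Pm\<close> that \<open>D\<close> does not carry. Off the
    zeros of \<open>f\<close> one has \<open>Lu = - P - Pm * I\<close> almost everywhere, so
    \<open>Q = Lu + Pp\<close> there.\<close>
  define Q where "Q y = Pm y * (1 - I y)" for y
  have Qm: "Q \<in> borel_measurable borel" unfolding Q_def[abs_def] by measurable
  have Q_int: "set_integrable lborel {a..b} Q" for a b
  proof -
    have "set_integrable lborel {a..b} (\<lambda>y. Pm y - Pm y * I y)" by (rule set_integral_diff(1)[OF PP_int(2) PmI_int])
    then show ?thesis by (simp add: Q_def[abs_def] algebra_simps)
  qed
  have Qnn: "0 \<le> Q y" for y using I01 by (simp add: Q_def)
  have "occ r ?\<rho> Q \<le> occ r ?\<rho> (\<lambda>y. Lu y + Pp y)"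
  proof (rule occ_mono[OF st T(2) Qm borel_measurable_add[OF Lu_m meas(5)] Q_int set_integral_add(1)[OF Lu_int PP_int(1)],
        where G="\<lambda>y. f y \<noteq> 0"])
    show "AE y in lborel. f y \<noteq> 0 \<longrightarrow> Q y \<le> Lu y + Pp y"
      using Lf_eq by eventually_elim (auto simp: Lu Q_def max_def algebra_simps)
    fix \<omega> s assume s: "\<omega> \<in> space M" "0 \<le> s" "s < ?\<rho> \<omega>"
    then have "ennreal s < hit Z \<omega>" using less_stop_before_iff[OF s(2) T(2)] by blast
    then show "f (Y s \<omega>) \<noteq> 0" using hit_greater_iff[OF closed_Z s(2,1)] s(2) by (auto simp: Z_def)
  qed
  also have "\<dots> = occ r ?\<rho> Lu + occ r ?\<rho> Pp"
    by (rule occ_add[OF occ_integrable(1)[OF st Lu_m T(2) Lu_int] occ_integrable(1)[OF st meas(5) T(2) PP_int(1)]])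
  finally have Qle: "occ r ?\<rho> Q \<le> occ r ?\<rho> Lu + occ r ?\<rho> Pp" .
  note nnQ = nn_occ_eq_occ[OF st Qm T(2) Q_int Qnn, of r]
  note nnP = nn_occ_eq_occ[OF st meas(5) T(2) PP_int(1) max.cobounded2, of r]
  \<comment> \<open>Before \<open>loc (hit Z) m\<close> the path stays within
    \<open>{-m..m}\<close>, where \<open>Q = Pm\<close>, and the larger interval has not been left
    either.\<close>
  have 2: "nn_occ r (loc ?\<tau> m) Pm \<le> nn_occ r ?\<rho> Q" unfolding nn_occ_def
  proof (rule nn_integral_mono)
    fix z :: "'a \<times> real" assume "z \<in> space (M \<Otimes>\<^sub>M lborel)"
    then have om: "fst z \<in> space M" by (auto simp: space_pair_measure)
    have "snd z < ?\<rho> (fst z) \<and> \<bar>Y (snd z) (fst z)\<bar> < m" if s: "0 \<le> snd z" "snd z < loc ?\<tau> m (fst z)"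
    proof -
      have a: "ennreal (snd z) < ?\<tau> (fst z)" "\<And>v. 0 \<le> v \<Longrightarrow> v \<le> snd z \<Longrightarrow> \<bar>Y v (fst z)\<bar> < m" "snd z < m"
        using s(2) unfolding less_loc_iff[OF om s(1)] by auto
      have "ennreal (snd z) < hit ?O (fst z)"
        unfolding hit_greater_iff[OF closed_outside s(1) om] using a(2) N(1) by (fastforce simp: outside_def)
      then show ?thesis using a s(1) less_stop_before_iff[OF s(1) T(2)] by blast
    qed
    then show "ennreal (occ_kernel r (loc ?\<tau> m) Pm z) \<le> ennreal (occ_kernel r ?\<rho> Q z)"
      by (auto simp: occ_kernel_def indicator_def Q_def I_def)
  qed
  have "ennreal (f 0) + nn_occ r (loc ?\<tau> m) Pm \<le> ennreal (f 0) + ennreal (occ r ?\<rho> Q)"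
    using 2 unfolding nnQ(1) by (rule add_left_mono)
  also have "\<dots> = ennreal (f 0 + occ r ?\<rho> Q)" using nnQ(2) f_nonneg by simp
  also have "\<dots> \<le> ennreal ((f 0 + occ r ?\<rho> Lu) + occ r ?\<rho> Pp)" using Qle by (intro ennreal_leI) simp
  also have "\<dots> \<le> ennreal (f 0 + occ r ?\<rho> Lu) + ennreal (occ r ?\<rho> Pp)" by (rule ennreal_add_le[OF nnP(2)])
  also have "\<dots> \<le> (ennreal e + survival m) + flow r ?\<tau> Pp"
    using 1 nn_occ_le_flow[OF tau closed_outside outside_compl T(2) meas(5), where N="real N" and r=r]
    unfolding nnP(1) by (rule add_mono)
  finally show ?thesis by (simp add: add.commute)
qed

text \<open>The loss up to level \<open>n\<close> increases with \<open>n\<close>, so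
  \<open>n\<close> can stay fixed while the level in \<open>lower_bound_step\<close> tends to
  infinity and the survival term vanishes; only then is the supremum over \<open>n\<close>
  taken.\<close>

lemma lower_bound_real_roots:
  assumes disc: "0 \<le> \<mu>\<^sup>2 + 2 * \<sigma>\<^sup>2 * r" and tr: "(survival \<longlongrightarrow> 0) at_top"
  shows "ennreal (f 0) + flow r (hit Z) Pm \<le> flow r (hit Z) Pp"
proof -
  have "ennreal (f 0) + nn_occ r (loc (hit Z) n) Pm \<le> flow r (hit Z) Pp" for n
  proof (rule ennreal_le_epsilon)
    fix e :: real assume e: "0 < e"
    have "((\<lambda>k. survival (real k)) \<longlongrightarrow> 0) sequentially" by (rule filterlim_compose[OF tr filterlim_real_sequentially])
    then have "eventually (\<lambda>k. survival (real k) < ennreal (e / 2)) sequentially"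
      using e by (intro order_tendstoD(2)) (auto simp: ennreal_zero_less_divide)
    moreover have "eventually (\<lambda>k. max 1 n \<le> k) sequentially" by (rule eventually_ge_at_top)
    ultimately have "eventually (\<lambda>k. survival (real k) < ennreal (e / 2) \<and> max 1 n \<le> k) sequentially" by (rule eventually_conj)
    then obtain k where k: "survival (real k) < ennreal (e / 2)" "max 1 n \<le> k"
      unfolding eventually_sequentially by blast
    have "ennreal (f 0) + nn_occ r (loc (hit Z) n) Pm \<le> ennreal (f 0) + nn_occ r (loc (hit Z) k) Pm"
      using k by (intro add_left_mono nn_occ_loc_mono) simp
    also have "\<dots> \<le> survival k + ennreal (e / 2) + flow r (hit Z) Pp"
      by (rule lower_bound_step[OF disc]) (use k e in auto)
    also have "\<dots> \<le> ennreal (e / 2) + ennreal (e / 2) + flow r (hit Z) Pp" using k by (intro add_right_mono) auto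
    also have "ennreal (e / 2) + ennreal (e / 2) = ennreal e" using e by (simp flip: ennreal_plus)
    finally show "ennreal (f 0) + nn_occ r (loc (hit Z) n) Pm \<le> flow r (hit Z) Pp + ennreal e" by (simp add: add.commute)
  qed
  then have "(SUP n. ennreal (f 0) + nn_occ r (loc (hit Z) n) Pm) \<le> flow r (hit Z) Pp" by (rule SUP_least)
  then show ?thesis
    unfolding flow_SUP[OF hit_stopping_time[OF closed_Z] meas(6) max.cobounded2]
    by (simp add: ennreal_SUP_add_right)
qed

end

section \<open>Complex characteristic roots\<close>

text \<open>Applied at a zero of \<open>f \<ge> 0\<close>. A second derivative at the single point
  suffices: were it negative, \<open>f'\<close> would be negative just to the right and
  \<open>f\<close> would fall below its minimum.\<close>

lemma second_derivative_at_minimum: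
  fixes f f' :: "real \<Rightarrow> real"
  assumes f': "\<And>z. (f has_real_derivative f' z) (at z)" and g: "(f' has_real_derivative c) (at y)"
    and min: "\<And>z. f y \<le> f z"
  shows "f' y = 0" "0 \<le> c"
proof -
  show z: "f' y = 0" by (rule DERIV_local_min[OF f', of 1]) (use min in auto)
  show "0 \<le> c"
  proof (rule ccontr)
    assume "\<not> 0 \<le> c"
    then obtain d where d: "0 < d" "\<And>h. 0 < h \<Longrightarrow> h < d \<Longrightarrow> f' (y + h) < f' y"
      using DERIV_neg_dec_right[OF g] by auto
    have "y < y + d / 2" using d by simp
    from MVT2[OF this, of f f'] f' obtain x where x: "y < x" "x < y + d / 2" "f (y + d / 2) - f y = (y + d / 2 - y) * f' x" by auto
    have "f' x < 0" using d(2)[of "x - y"] x z by simp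
    then have "f (y + d / 2) - f y < 0" unfolding x(3) using d by (intro mult_pos_neg) auto
    then show False using min[of "y + d / 2"] by simp
  qed
qed

text \<open>The phase is \<open>arctan (q / p)\<close>; \<open>p > 0\<close> keeps it strictly
  between \<open>- (pi / 2)\<close> and \<open>pi / 2\<close>, so that \<open>z = 0\<close> lies
  where the shifted cosine is positive.\<close>

lemma ex_cos_amplitude:
  fixes p q :: real assumes p: "0 < p"
  obtains R \<theta> where "0 < R" "- (pi / 2) < \<theta>" "\<theta> < pi / 2" "\<And>z. p * cos z + q * sin z = R * cos (z - \<theta>)"
proof
  let ?t = "arctan (q / p)"
  show "- (pi / 2) < ?t" "?t < pi / 2" using arctan_bounded[of "q / p"] by auto
  have c: "cos ?t > 0" by (rule cos_gt_zero_pi) (use arctan_bounded[of "q / p"] in auto)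
  show "0 < p / cos ?t" using p c by simp
  have "sin ?t = q / p * cos ?t" using tan_arctan[of "q / p"] c by (simp add: tan_def field_simps)
  then show "p * cos z + q * sin z = p / cos ?t * cos (z - ?t)" for z
    using c p by (simp add: cos_diff field_simps)
qed

context log_hjb
begin

text \<open>With \<open>\<delta> = - r - \<mu>\<^sup>2 / (2\<sigma>\<^sup>2) > 0\<close> the discounted density carries a factor \<open>e\<^sup>\<delta>\<^sup>s / sqrt s \<ge> sqrt (2\<delta>)\<close>, so it is bounded below uniformly in time.\<close>

lemma weighted_density_bound:
  assumes disc: "\<mu>\<^sup>2 + 2 * \<sigma>\<^sup>2 * r < 0" and s: "1 \<le> s"
  shows "sqrt (2 * (- r - \<mu>\<^sup>2 / (2 * \<sigma>\<^sup>2))) * exp (\<mu> / \<sigma>\<^sup>2 * y - y\<^sup>2 / (2 * \<sigma>\<^sup>2)) / sqrt (2 * pi * \<sigma>\<^sup>2)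
    \<le> exp (- r * s) * normal_density (\<mu> * s) (\<bar>\<sigma>\<bar> * sqrt s) y"
proof -
  have s2: "\<sigma>\<^sup>2 > 0" using sigma by simp
  define \<delta> where "\<delta> = - r - \<mu>\<^sup>2 / (2 * \<sigma>\<^sup>2)"
  have dl: "\<delta> > 0" unfolding \<delta>_def using disc s2 by (simp add: field_simps)
  have "sqrt (2 * \<delta>) * sqrt s \<le> exp (\<delta> * s)"
  proof -
    have "2 * \<delta> * s \<le> exp (2 * \<delta> * s)" using exp_ge_add_one_self[of "2 * \<delta> * s"] by linarith
    then have "sqrt (2 * \<delta> * s) \<le> sqrt (exp (2 * \<delta> * s))" by simp
    also have "exp (2 * \<delta> * s) = (exp (\<delta> * s))\<^sup>2" by (simp add: power2_eq_square flip: exp_add)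
    finally show ?thesis by (simp add: real_sqrt_mult)
  qed
  then have 1: "sqrt (2 * \<delta>) \<le> exp (\<delta> * s) / sqrt s" using s by (simp add: field_simps)
  have "y\<^sup>2 / (2 * \<sigma>\<^sup>2 * s) \<le> y\<^sup>2 / (2 * \<sigma>\<^sup>2)" using s s2 by (intro divide_left_mono) (auto simp: mult_le_cancel_left1)
  then have 2: "exp (\<mu> / \<sigma>\<^sup>2 * y - y\<^sup>2 / (2 * \<sigma>\<^sup>2)) \<le> exp (\<mu> / \<sigma>\<^sup>2 * y - y\<^sup>2 / (2 * \<sigma>\<^sup>2 * s))" by simp
  have "sqrt (2 * \<delta>) * exp (\<mu> / \<sigma>\<^sup>2 * y - y\<^sup>2 / (2 * \<sigma>\<^sup>2)) \<le> exp (\<delta> * s) / sqrt s * exp (\<mu> / \<sigma>\<^sup>2 * y - y\<^sup>2 / (2 * \<sigma>\<^sup>2 * s))"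
    by (rule mult_mono[OF 1 2]) (use s in auto)
  then have "sqrt (2 * \<delta>) * exp (\<mu> / \<sigma>\<^sup>2 * y - y\<^sup>2 / (2 * \<sigma>\<^sup>2)) / sqrt (2 * pi * \<sigma>\<^sup>2)
      \<le> exp (\<delta> * s) / sqrt s * exp (\<mu> / \<sigma>\<^sup>2 * y - y\<^sup>2 / (2 * \<sigma>\<^sup>2 * s)) / sqrt (2 * pi * \<sigma>\<^sup>2)"
    by (rule divide_right_mono) simp
  also have "\<dots> = exp (\<delta> * s + (\<mu> / \<sigma>\<^sup>2 * y - y\<^sup>2 / (2 * \<sigma>\<^sup>2 * s))) / (sqrt s * sqrt (2 * pi * \<sigma>\<^sup>2))"
    by (simp add: exp_add)
  also have "\<delta> * s + (\<mu> / \<sigma>\<^sup>2 * y - y\<^sup>2 / (2 * \<sigma>\<^sup>2 * s)) = - r * s + - (y - \<mu> * s)\<^sup>2 / (2 * (\<bar>\<sigma>\<bar> * sqrt s)\<^sup>2)"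
    unfolding \<delta>_def power_mult_distrib power2_abs using s sigma by (simp add: field_simps power2_eq_square)
  also have "sqrt s * sqrt (2 * pi * \<sigma>\<^sup>2) = sqrt (2 * pi * (\<bar>\<sigma>\<bar> * sqrt s)\<^sup>2)"
    using s by (simp add: power_mult_distrib real_sqrt_mult mult_ac)
  also have "exp (- r * s + - (y - \<mu> * s)\<^sup>2 / (2 * (\<bar>\<sigma>\<bar> * sqrt s)\<^sup>2)) / sqrt (2 * pi * (\<bar>\<sigma>\<bar> * sqrt s)\<^sup>2)
      = exp (- r * s) * normal_density (\<mu> * s) (\<bar>\<sigma>\<bar> * sqrt s) y"
    unfolding normal_density_def exp_add by simp
  finally show ?thesis unfolding \<delta>_def .
qed

text \<open>By the uniform lower bound on the discounted density, the expected discounted gain per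
  unit time is at least the fixed integral \<open>?K\<close> from time \<open>1\<close> on. Over an
  infinite horizon the total is finite only if \<open>?K = 0\<close>, and the weight
  \<open>\<kappa>\<close> is positive.\<close>

lemma nonpositive_if_complex_roots:
  assumes disc: "\<mu>\<^sup>2 + 2 * \<sigma>\<^sup>2 * r < 0" and fin: "flow r (\<lambda>_. \<infinity>) Pp < \<infinity>"
  shows "AE y in lborel. P y \<le> 0"
proof -
  note [measurable] = meas Y_max_measurable
  define \<kappa> where "\<kappa> y = sqrt (2 * (- r - \<mu>\<^sup>2 / (2 * \<sigma>\<^sup>2))) * exp (\<mu> / \<sigma>\<^sup>2 * y - y\<^sup>2 / (2 * \<sigma>\<^sup>2)) / sqrt (2 * pi * \<sigma>\<^sup>2)" for y
  have kpos: "\<kappa> y > 0" for y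
  proof -
    have "0 < - r - \<mu>\<^sup>2 / (2 * \<sigma>\<^sup>2)" using disc sigma by (simp add: field_simps)
    then show ?thesis unfolding \<kappa>_def using sigma
      by (intro divide_pos_pos mult_pos_pos real_sqrt_gt_zero exp_gt_zero) simp_all
  qed
  have [measurable]: "\<kappa> \<in> borel_measurable borel" unfolding \<kappa>_def[abs_def] by measurable
  let ?K = "\<integral>\<^sup>+y. ennreal (\<kappa> y * Pp y) \<partial>lborel"
  have slice: "?K \<le> (\<integral>\<^sup>+\<omega>. ennreal (exp (- r * s) * Pp (Y s \<omega>)) \<partial>M)" if s: "1 \<le> s" for s
  proof -
    have "?K \<le> (\<integral>\<^sup>+y. ennreal (normal_density (\<mu> * s) (\<bar>\<sigma>\<bar> * sqrt s) y) * ennreal (exp (- r * s) * Pp y) \<partial>lborel)"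
    proof (rule nn_integral_mono)
      fix y
      have "\<kappa> y * Pp y \<le> (exp (- r * s) * normal_density (\<mu> * s) (\<bar>\<sigma>\<bar> * sqrt s) y) * Pp y"
        unfolding \<kappa>_def by (rule mult_right_mono[OF weighted_density_bound[OF disc s]]) simp
      then show "ennreal (\<kappa> y * Pp y) \<le> ennreal (normal_density (\<mu> * s) (\<bar>\<sigma>\<bar> * sqrt s) y) * ennreal (exp (- r * s) * Pp y)"
        by (simp add: ennreal_leI mult_ac flip: ennreal_mult)
    qed
    also have "\<dots> = (\<integral>\<^sup>+\<omega>. ennreal (exp (- r * s) * Pp (Y s \<omega>)) \<partial>M)"
      by (rule distributed_nn_integral[OF Y_distributed]) (use s in auto)
    finally show ?thesis .
  qed
  let ?k = "\<lambda>\<omega> s. ennreal (exp (- r * s) * Pp (Y (max 0 s) \<omega>)) * indicator {1::real..} s"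
  have km: "(\<lambda>(\<omega>, s). ?k \<omega> s) \<in> borel_measurable (M \<Otimes>\<^sub>M lborel)"
    unfolding case_prod_beta by measurable
  have "?K * \<infinity> = (\<integral>\<^sup>+s. ?K * indicator {1::real..} s \<partial>lborel)"
  proof -
    have "emeasure lborel {1::real..} = \<infinity>"
    proof -
      have "of_nat n \<le> emeasure lborel {1::real..}" for n
      proof -
        have "ennreal (real n) = emeasure lborel {1..1 + real n}" by simp
        also have "\<dots> \<le> emeasure lborel {1::real..}" by (rule emeasure_mono) auto
        finally show ?thesis by (simp add: ennreal_of_nat_eq_real_of_nat)
      qed
      then have "(SUP n. of_nat n :: ennreal) \<le> emeasure lborel {1::real..}" by (rule SUP_least)
      then show ?thesis by (simp add: ennreal_SUP_of_nat_eq_top top_unique)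
    qed
    then show ?thesis by (subst nn_integral_cmult_indicator) simp_all
  qed
  also have "\<dots> \<le> (\<integral>\<^sup>+s. (\<integral>\<^sup>+\<omega>. ?k \<omega> s \<partial>M) \<partial>lborel)"
  proof (rule nn_integral_mono)
    show "?K * indicator {1::real..} s \<le> (\<integral>\<^sup>+\<omega>. ?k \<omega> s \<partial>M)" for s :: real
      using slice[of s] by (cases "1 \<le> s") auto
  qed
  also have "\<dots> = (\<integral>\<^sup>+\<omega>. (\<integral>\<^sup>+s. ?k \<omega> s \<partial>lborel) \<partial>M)" by (rule paths.Fubini'[OF km])
  also have "\<dots> \<le> flow r (\<lambda>_. \<infinity>) Pp" unfolding flow_def
    by (intro nn_integral_mono) (auto simp: indicator_def ennreal_less_top)
  finally have "?K * \<infinity> < \<infinity>" using fin by (rule order_le_less_trans)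
  then have "?K = 0" by (auto simp: ennreal_mult_top split: if_splits)
  then have "AE y in lborel. ennreal (\<kappa> y * Pp y) = 0" by (subst (asm) nn_integral_0_iff_AE) measurable
  then show ?thesis
  proof eventually_elim
    case (elim y)
    then have "\<kappa> y * Pp y \<le> 0" by (simp add: ennreal_eq_0_iff)
    then show ?case using kpos[of y] by (simp add: mult_le_0_iff)
  qed
qed

lemma vanishes_if_complex_roots:
  assumes disc: "\<mu>\<^sup>2 + 2 * \<sigma>\<^sup>2 * r < 0" and fin: "flow r (\<lambda>_. \<infinity>) Pp < \<infinity>"
    and tr: "(survival \<longlongrightarrow> 0) at_top"
  shows "f 0 = 0"
proof (rule ccontr)
  assume "f 0 \<noteq> 0"
  then have f0: "0 < f 0" using f_nonneg[of 0] by simp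
  have s2: "\<sigma>\<^sup>2 > 0" using sigma by simp
  \<comment> \<open>Off the zeros of \<open>f\<close> this is \<open>Lf = - P\<close>. On them
    \<open>f\<close> is minimal, so \<open>f' = 0\<close> and \<open>g \<ge> 0\<close>.\<close>
  have Lf_nonneg: "AE y in lborel. 0 \<le> Lf y"
    using Lf_eq nonpositive_if_complex_roots[OF disc fin] g_deriv
  proof eventually_elim
    case (elim y)
    show ?case
    proof (cases "f y = 0")
      case True
      then have "f' y = 0" "0 \<le> g y" using second_derivative_at_minimum[OF f' elim(3)] f_nonneg by auto
      then show ?thesis using True by simp
    qed (use elim in simp)
  qed
  \<comment> \<open>\<open>a\<close> and \<open>w\<close> are the real and imaginary parts of the
    characteristic roots; \<open>e1\<close> and \<open>e2\<close> below express their sum and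
    product.\<close>
  define a where "a = - \<mu> / \<sigma>\<^sup>2"
  define w where "w = sqrt (- \<mu>\<^sup>2 - 2 * \<sigma>\<^sup>2 * r) / \<sigma>\<^sup>2"
  have w: "w > 0" using disc s2 by (simp add: w_def)
  have w2: "w\<^sup>2 = (- \<mu>\<^sup>2 - 2 * \<sigma>\<^sup>2 * r) / (\<sigma>\<^sup>2)\<^sup>2" using disc by (simp add: w_def power_divide)
  have e1: "\<sigma>\<^sup>2 / 2 * (2 * a) = - \<mu>" using s2 by (simp add: a_def)
  have e2: "\<sigma>\<^sup>2 / 2 * (a\<^sup>2 + w\<^sup>2) = - r" 
  proof -
    have S: "S / 2 * (- 2 * S * r / S\<^sup>2) = - r" if "S \<noteq> 0" for S using that by (simp add: power2_eq_square)
    have "a\<^sup>2 + w\<^sup>2 = - 2 * \<sigma>\<^sup>2 * r / (\<sigma>\<^sup>2)\<^sup>2"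
      unfolding w2 a_def power_divide add_divide_distrib[symmetric] by simp
    then show ?thesis using S[of "\<sigma>\<^sup>2"] s2 by (simp only:)
  qed
  \<comment> \<open>With this coefficient the harmonic function \<open>k\<close> has the same value
    and slope at \<open>0\<close> as \<open>f\<close>.\<close>
  define b where "b = (f' 0 - a * f 0) / w"
  have wb: "w * b = f' 0 - a * f 0" using w by (simp add: b_def)
  obtain R \<theta> where R: "0 < R" "- (pi / 2) < \<theta>" "\<theta> < pi / 2"
    "\<And>z. f 0 * cos z + b * sin z = R * cos (z - \<theta>)"
    using ex_cos_amplitude[OF f0] by blast
  define k where "k y = exp (a * y) * (f 0 * cos (w * y) + b * sin (w * y))" for y
  \<comment> \<open>\<open>f - k\<close> has zero data at \<open>0\<close> and the nonnegative
    source \<open>Lf\<close>. The factor \<open>sin (w * (y - z))\<close> of the kernel that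
    represents it keeps its sign for \<open>z\<close> between \<open>0\<close> and \<open>y\<close>
    as long as \<open>\<bar>w * y\<bar> \<le> pi\<close>, hence the bound on
    \<open>y\<close>.\<close>
  have k_le: "k y \<le> f y" if y: "\<bar>y\<bar> \<le> pi / w" for y
  proof -
    define \<phi> where "\<phi> z = exp (- a * z) * sin (w * (y - z))" for z
    define \<phi>' where "\<phi>' z = - a * \<phi> z - w * (exp (- a * z) * cos (w * (y - z)))" for z
    define \<psi> where "\<psi> z = exp (- a * z) * (w * cos (w * (y - z)) - a * sin (w * (y - z)))" for z
    have d\<phi>: "(\<phi> has_real_derivative \<phi>' z) (at z)" for z
      unfolding \<phi>_def[abs_def] \<phi>'_def by (auto intro!: derivative_eq_intros simp: algebra_simps)
    have d\<psi>: "(\<psi> has_real_derivative (a\<^sup>2 + w\<^sup>2) * \<phi> z) (at z)" for z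
      unfolding \<psi>_def[abs_def] \<phi>_def by (auto intro!: derivative_eq_intros simp: algebra_simps power2_eq_square)
    have c: "continuous_on UNIV \<phi>'" "continuous_on UNIV (\<lambda>z. (a\<^sup>2 + w\<^sup>2) * \<phi> z)"
      unfolding \<phi>'_def \<phi>_def by (intro continuous_intros)+
    \<comment> \<open>\<open>\<phi>\<close> solves the adjoint equation and vanishes at \<open>y\<close>, so the density of \<open>H\<close> is a multiple of \<open>\<phi> Lf\<close>\<close>
    define H where "H z = \<phi> z * f' z + \<psi> z * f z" for z
    have "has_density H (\<lambda>z. (\<phi>' z * f' z + \<phi> z * g z) + ((a\<^sup>2 + w\<^sup>2) * \<phi> z * f z + \<psi> z * f' z))"
      unfolding H_def[abs_def]
      by (intro has_density_add has_density_mult_C1[OF d\<phi> c(1) g] has_density_mult_C1[OF d\<psi> c(2) has_density_C1[OF f' f_cont(2)]])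
    moreover have "(\<phi>' z * f' z + \<phi> z * g z) + ((a\<^sup>2 + w\<^sup>2) * \<phi> z * f z + \<psi> z * f' z) = 2 / \<sigma>\<^sup>2 * (\<phi> z * Lf z)" for z
    proof -
      have "\<phi>' z + \<psi> z = - (2 * a) * \<phi> z" by (simp add: \<phi>'_def \<psi>_def \<phi>_def algebra_simps)
      then have "(\<phi>' z * f' z + \<phi> z * g z) + ((a\<^sup>2 + w\<^sup>2) * \<phi> z * f z + \<psi> z * f' z)
          = \<phi> z * (g z - (2 * a) * f' z + (a\<^sup>2 + w\<^sup>2) * f z)" by algebra
      also have "\<dots> = 2 / \<sigma>\<^sup>2 * (\<phi> z * (\<sigma>\<^sup>2 / 2 * g z - (\<sigma>\<^sup>2 / 2 * (2 * a)) * f' z + (\<sigma>\<^sup>2 / 2 * (a\<^sup>2 + w\<^sup>2)) * f z))"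
        using s2 by (simp add: field_simps)
      finally show ?thesis unfolding e1 e2 by simp
    qed
    ultimately have Hd: "has_density H (\<lambda>z. 2 / \<sigma>\<^sup>2 * (\<phi> z * Lf z))" by simp
    have nHd: "has_density (\<lambda>z. -1 * H z) (\<lambda>z. -1 * (2 / \<sigma>\<^sup>2 * (\<phi> z * Lf z)))" by (rule has_density_cmult[OF Hd])
    have wy: "\<bar>w * y\<bar> \<le> pi" using y w by (simp add: abs_mult field_simps)
    have "H 0 \<le> H y"
    proof (cases "0 \<le> y")
      case True
      have "AE z in lborel. 0 < z \<and> z < y \<longrightarrow> 0 \<le> 2 / \<sigma>\<^sup>2 * (\<phi> z * Lf z)"
        using Lf_nonneg
      proof eventually_elim
        case (elim z)
        have "0 \<le> \<phi> z" if z: "0 < z" "z < y"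
        proof -
          have "0 \<le> w * (y - z)" "w * (y - z) \<le> w * y" using w z by auto
          then show ?thesis using wy by (auto simp: \<phi>_def intro!: mult_nonneg_nonneg sin_ge_zero)
        qed
        then show ?case using elim s2 by simp
      qed
      from has_density_mono[OF Hd this order_refl True order_refl] show ?thesis .
    next
      case False
      then have y0: "y \<le> 0" by simp
      have "AE z in lborel. y < z \<and> z < 0 \<longrightarrow> 0 \<le> -1 * (2 / \<sigma>\<^sup>2 * (\<phi> z * Lf z))"
        using Lf_nonneg
      proof eventually_elim
        case (elim z)
        have "\<phi> z \<le> 0" if z: "y < z" "z < 0"
        proof -
          have "0 \<le> w * (z - y)" "w * (z - y) \<le> - (w * y)" using w z by (auto simp: algebra_simps mult_nonneg_nonpos)
          then have "0 \<le> sin (w * (z - y))" using wy by (intro sin_ge_zero) auto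
          moreover have "sin (w * (y - z)) = - sin (w * (z - y))" unfolding sin_minus[symmetric] by (simp add: algebra_simps)
          ultimately show ?thesis by (auto simp: \<phi>_def intro!: mult_nonneg_nonpos)
        qed
        then have "y < z \<and> z < 0 \<longrightarrow> \<phi> z * Lf z \<le> 0" using elim by (auto intro!: mult_nonpos_nonneg)
        then show ?case using s2 by (auto simp: divide_le_0_iff)
      qed
      from has_density_mono[OF nHd this order_refl y0 order_refl] show ?thesis by simp
    qed
    also have "H y = w * (exp (- a * y) * f y)" by (simp add: H_def \<phi>_def \<psi>_def)
    also have "H 0 = w * (exp (- a * y) * k y)"
    proof -
      have "w * (exp (- a * y) * k y) = (exp (- a * y) * exp (a * y)) * (f 0 * (w * cos (w * y)) + (w * b) * sin (w * y))"
        by (simp add: k_def algebra_simps)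
      also have "exp (- a * y) * exp (a * y) = 1" by (simp flip: exp_add)
      also have "1 * (f 0 * (w * cos (w * y)) + (w * b) * sin (w * y)) = H 0"
        unfolding wb by (simp add: H_def \<phi>_def \<psi>_def algebra_simps)
      finally show ?thesis by simp
    qed
    finally show ?thesis using w by simp
  qed
  have kR: "k y = exp (a * y) * (R * cos (w * y - \<theta>))" for y unfolding k_def R(4) ..
  \<comment> \<open>The interval around \<open>0\<close> on which the cosine factor of
    \<open>k\<close> is positive. It lies within the range of \<open>k_le\<close> because
    \<open>\<bar>\<theta>\<bar> < pi / 2\<close>.\<close>
  define J where "J = {(\<theta> - pi / 2) / w <..< (\<theta> + pi / 2) / w}"
  have J_pos: "0 < k y" if y: "y \<in> J" for y
  proof -
    have "- (pi / 2) < w * y - \<theta>" "w * y - \<theta> < pi / 2" using y w by (auto simp: J_def field_simps)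
    then show ?thesis using R(1) cos_gt_zero_pi by (simp add: kR)
  qed
  have J_sub: "J \<subseteq> {- (pi / w)..pi / w}"
  proof
    fix y assume "y \<in> J"
    then have "- (pi / 2) < w * y - \<theta>" "w * y - \<theta> < pi / 2" using w by (auto simp: J_def field_simps)
    then have "- pi \<le> w * y" "w * y \<le> pi" using R(2,3) by linarith+
    then show "y \<in> {- (pi / w)..pi / w}" using w by (auto simp: field_simps)
  qed
  have k0: "k 0 = f 0" by (simp add: k_def)
  \<comment> \<open>The discounted \<open>k (Y)\<close> has constant mean up to the exit from
    \<open>J\<close>, and \<open>k\<close> vanishes at the exit points. So \<open>f 0\<close> is the
    mean over paths still in \<open>J\<close> at time \<open>t\<close>; on those
    \<open>f \<ge> k > 0\<close>, hence \<open>Z\<close> has not been hit.\<close>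
  have bound: "ennreal (f 0) \<le> survival t" if t: "0 < t" for t
  proof -
    let ?\<rho> = "stop_before (\<lambda>_. \<infinity>) (- J) t"
    have cJ: "closed (- J)" unfolding J_def by (intro closed_Compl open_greaterThanLessThan)
    have t0: "0 \<le> t" and N: "0 \<le> pi / w" using t w by auto
    have st: "stops ?\<rho> t (pi / w)" by (rule stop_before_stops[OF never_stopping_time cJ _ t0]) (use J_sub in simp)
    define k1 where "k1 y = a * k y + exp (a * y) * (w * (b * cos (w * y) - f 0 * sin (w * y)))" for y
    define k2 where "k2 y = 2 * a * k1 y - (a\<^sup>2 + w\<^sup>2) * k y" for y
    have d1: "(k has_real_derivative k1 y) (at y)" for y
      unfolding k_def[abs_def] k1_def by (auto intro!: derivative_eq_intros simp: algebra_simps)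
    have d2: "(k1 has_real_derivative k2 y) (at y)" for y
    proof -
      have d: "(k1 has_real_derivative a * k1 y + (a * (exp (a * y) * (w * (b * cos (w * y) - f 0 * sin (w * y)))) - w\<^sup>2 * k y)) (at y)"
        unfolding k1_def[abs_def]
        by (rule derivative_eq_intros d1 refl | simp add: k_def k1_def algebra_simps power2_eq_square)+
      have eq: "a * (exp (a * y) * (w * (b * cos (w * y) - f 0 * sin (w * y)))) = a * k1 y - a\<^sup>2 * k y"
        by (simp add: k1_def algebra_simps power2_eq_square)
      have "a * k1 y + (a * k1 y - a\<^sup>2 * k y - w\<^sup>2 * k y) = k2 y" by (simp add: k2_def algebra_simps)
      with d show ?thesis unfolding eq by (simp only:)
    qed
    have ck: "continuous_on UNIV k" "continuous_on UNIV k1"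
      using DERIV_continuous_on[of UNIV k k1] DERIV_continuous_on[of UNIV k1 k2] d1 d2 by simp_all
    have c2: "continuous_on UNIV k2" unfolding k2_def[abs_def] by (intro continuous_intros ck)
    have "\<sigma>\<^sup>2 / 2 * k2 y + \<mu> * k1 y - r * k y = 0" for y
    proof -
      have "\<sigma>\<^sup>2 / 2 * k2 y = (\<sigma>\<^sup>2 / 2 * (2 * a)) * k1 y - (\<sigma>\<^sup>2 / 2 * (a\<^sup>2 + w\<^sup>2)) * k y" by (simp add: k2_def algebra_simps)
      then show ?thesis unfolding e1 e2 by linarith
    qed
    moreover have "occ r ?\<rho> (\<lambda>y. 0) = 0" by (simp add: occ_def occ_kernel_def)
    ultimately have Dyn: "expectation (\<lambda>\<omega>. exp (- r * ?\<rho> \<omega>) * k (Y (?\<rho> \<omega>) \<omega>)) = f 0"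
      using occ_C2[OF st t N d1 d2 c2, of r] k0 by simp
    have "ennreal (f 0) \<le> (\<integral>\<^sup>+\<omega>. ennreal (exp (- r * ?\<rho> \<omega>) * k (Y (?\<rho> \<omega>) \<omega>)) \<partial>M)"
      using ennreal_integral_le[OF stopped_integrable[OF st N ck(1), of r]] unfolding Dyn .
    also have "\<dots> \<le> survival t" unfolding survival_alt[OF t0]
    proof (rule nn_integral_mono, rule ennreal_leI)
      fix \<omega> assume om: "\<omega> \<in> space M"
      show "exp (- r * ?\<rho> \<omega>) * k (Y (?\<rho> \<omega>) \<omega>) \<le> exp (- r * t) * f (Y t \<omega>) * indicator {\<omega>. ennreal t < hit Z \<omega>} \<omega>"
      proof (cases "hit (- J) \<omega> \<le> ennreal t")
        case True
        let ?cJ = "{(\<theta> - pi / 2) / w .. (\<theta> + pi / 2) / w}"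
        have out: "Y (?\<rho> \<omega>) \<omega> \<in> - J" by (rule stop_before_hit[OF cJ om t0 True]) simp
        have "Y (?\<rho> \<omega>) \<omega> \<in> ?cJ"
        proof (rule stopped_in_closed[OF _ _ om])
          show "0 \<in> ?cJ" using R(2,3) w by (auto simp: field_simps)
          show "0 \<le> ?\<rho> \<omega>" by (rule stop_before_bounds[OF t0])
          fix s assume s: "0 \<le> s" "s < ?\<rho> \<omega>"
          then have "Y s \<omega> \<notin> - J" using less_stop_before_iff[OF s(1) t0] hit_greater_iff[OF cJ s(1) om] by auto
          then show "Y s \<omega> \<in> ?cJ" by (auto simp: J_def)
        qed simp
        with out have "Y (?\<rho> \<omega>) \<omega> = (\<theta> - pi / 2) / w \<or> Y (?\<rho> \<omega>) \<omega> = (\<theta> + pi / 2) / w" by (auto simp: J_def)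
        then have "w * Y (?\<rho> \<omega>) \<omega> - \<theta> = - (pi / 2) \<or> w * Y (?\<rho> \<omega>) \<omega> - \<theta> = pi / 2" using w by auto
        then have "cos (w * Y (?\<rho> \<omega>) \<omega> - \<theta>) = 0" by (elim disjE) (simp_all only: cos_minus cos_pi_half)
        then have "k (Y (?\<rho> \<omega>) \<omega>) = 0" unfolding kR by simp
        then show ?thesis by (simp add: f_nonneg)
      next
        case False
        then have lt: "ennreal t < hit (- J) \<omega>" by simp
        then have rt: "?\<rho> \<omega> = t" using t0 by (simp add: stop_before_def min_absorb2 less_imp_le)
        have inJ: "Y s \<omega> \<in> J" if "0 \<le> s" "s \<le> t" for s using lt that unfolding hit_greater_iff[OF cJ t0 om] by auto
        have "Y s \<omega> \<notin> Z" if "s \<in> {0..t}" for s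
        proof -
          have "Y s \<omega> \<in> J" using that inJ by simp
          then have "0 < k (Y s \<omega>)" "k (Y s \<omega>) \<le> f (Y s \<omega>)" using J_pos k_le J_sub by (auto simp: abs_le_iff)
          then show ?thesis by (simp add: Z_def)
        qed
        then have "ennreal t < hit Z \<omega>" unfolding hit_greater_iff[OF closed_Z t0 om] by blast
        moreover have "k (Y t \<omega>) \<le> f (Y t \<omega>)" using k_le J_sub inJ[OF t0 order_refl] by (auto simp: abs_le_iff)
        ultimately show ?thesis unfolding rt by simp
      qed
    qed
    finally show ?thesis .
  qed
  have "ennreal (f 0) \<le> 0"
    by (rule tendsto_lowerbound[OF tr]) (auto intro!: eventually_mono[OF eventually_gt_at_top[of 0]] bound)
  then show False using f0 by simp
qed

text \<open>\<open>f 0 > 0\<close> excludes complex roots by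
  \<open>vanishes_if_complex_roots\<close>; the two bounds then meet.\<close>

lemma attained_value:
  assumes fin: "flow r (\<lambda>_. \<infinity>) Pp < \<infinity>" and tr: "(survival \<longlongrightarrow> 0) at_top" and f0: "0 < f 0"
  shows "flow r (hit Z) Pp = ennreal (f 0) + flow r (hit Z) Pm"
proof (rule antisym)
  show "flow r (hit Z) Pp \<le> ennreal (f 0) + flow r (hit Z) Pm" by (rule upper_bound[OF hit_stopping_time[OF closed_Z]])
  have "0 \<le> \<mu>\<^sup>2 + 2 * \<sigma>\<^sup>2 * r" using vanishes_if_complex_roots[OF _ fin tr] f0 by (cases "0 \<le> \<mu>\<^sup>2 + 2 * \<sigma>\<^sup>2 * r") auto
  then show "ennreal (f 0) + flow r (hit Z) Pm \<le> flow r (hit Z) Pp" by (rule lower_bound_real_roots[OF _ tr])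
qed

end

section \<open>The stopping problem for geometric Brownian motion\<close>

lemma (in drifted_brownian) flow_cong_AE:
  assumes "AE \<omega> in M. \<tau> \<omega> = \<tau>' \<omega>" shows "flow r \<tau> \<phi> = flow r \<tau>' \<phi>"
  unfolding flow_def by (rule nn_integral_cong_AE) (use assms in eventually_elim, simp)

lemma (in drifted_brownian) flow_mono: "flow r \<tau> \<phi> \<le> flow r (\<lambda>_. \<infinity>) \<phi>"
  unfolding flow_def by (intro nn_integral_mono mult_left_mono) (auto simp: indicator_def ennreal_less_top)

text \<open>Finiteness of \<open>a\<close> rules out the form infinity minus infinity; if
  \<open>b\<close> is infinite the difference is minus infinity.\<close>

lemma enn2ereal_diff_le:
  assumes "a \<le> ennreal c + b" "a < \<infinity>" "0 \<le> c" shows "enn2ereal a - enn2ereal b \<le> ereal c"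
proof (cases b)
  case (real q)
  obtain p where p: "a = ennreal p" "0 \<le> p" using assms(2) by (cases a) auto
  have "ennreal p \<le> ennreal (c + q)" using assms(1,3) real p by simp
  then have "p \<le> c + q" using assms(3) real by (subst (asm) ennreal_le_iff) auto
  then show ?thesis using p real by (simp add: enn2ereal_ennreal)
next
  case top
  then show ?thesis using assms(2) by (cases a) (auto simp: enn2ereal_ennreal)
qed

lemma enn2ereal_diff_eq:
  assumes "a = ennreal c + b" "a < \<infinity>" "0 \<le> c" shows "enn2ereal a - enn2ereal b = ereal c"
proof (cases b)
  case (real q)
  then have "a = ennreal (c + q)" using assms by simp
  then show ?thesis using assms(3) real by (simp add: enn2ereal_ennreal del: ennreal_plus)
qed (use assms in simp)

text \<open>The chain rule read backwards, through \<open>y = ln (z / x)\<close>: the HJB relation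
  is available only where \<open>deriv v\<close> is known to be differentiable, and this has to be
  inferred from differentiability in the variable \<open>y\<close>.\<close>

lemma derivative_of_exp_scale:
  fixes w :: "real \<Rightarrow> real"
  assumes x: "0 < x" and d: "((\<lambda>y. x * exp y * w (x * exp y)) has_real_derivative d) (at y)"
  shows "(w has_real_derivative (d - x * exp y * w (x * exp y)) / (x * exp y)\<^sup>2) (at (x * exp y))"
proof -
  let ?z = "x * exp y" and ?h = "\<lambda>y. x * exp y * w (x * exp y)"
  have z: "0 < ?z" using x by simp
  have lnz: "ln (?z / x) = y" using x by simp
  have l: "((\<lambda>s. ln (s / x)) has_real_derivative 1 / ?z) (at ?z)"
    using x by (auto intro!: derivative_eq_intros)
  have "((\<lambda>s. ?h (ln (s / x))) has_real_derivative d * (1 / ?z)) (at ?z)"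
    by (rule DERIV_chain2[OF _ l]) (use d in \<open>simp only: lnz\<close>)
  from DERIV_divide[OF this DERIV_ident] z
  have "((\<lambda>s. ?h (ln (s / x)) / s) has_real_derivative (d * (1 / ?z) * ?z - ?h (ln (?z / x)) * 1) / (?z * ?z)) (at ?z)"
    by simp
  moreover have "(d * (1 / ?z) * ?z - ?h (ln (?z / x)) * 1) / (?z * ?z) = (d - ?h y) / ?z\<^sup>2"
    unfolding lnz using z by (simp add: power2_eq_square)
  ultimately have "((\<lambda>s. ?h (ln (s / x)) / s) has_real_derivative (d - ?h y) / ?z\<^sup>2) (at ?z)" by (simp only:)
  then show ?thesis
    by (rule has_field_derivative_transform_within_open[where S="{0<..}"]) (use x in auto)
qed

section \<open>Transfer of the value and of the exit time to the original problem\<close>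

locale hjb_solution =
  fixes M :: "'a measure" and W :: "real \<Rightarrow> 'a \<Rightarrow> real"
    and r \<alpha> \<sigma> :: real and Prof v :: "real \<Rightarrow> real"
  assumes BM: "std_brownian_motion M W"
    and complete: "complete_space_measure M"
    and sigma_nz: "\<sigma> \<noteq> 0"
    and A3_meas: "Prof \<in> borel_measurable (restrict_space borel {0<..})"
    and A3_locint: "\<And>a b. 0 < a \<Longrightarrow> set_integrable lborel {a..b} Prof"
    and A2: "\<And>x. 0 < x \<Longrightarrow> disc_nn M W r \<alpha> \<sigma> (\<lambda>y. max (Prof y) 0) x (\<lambda>_. \<infinity>) < \<infinity>"
    and v_nonneg: "\<And>x. 0 < x \<Longrightarrow> 0 \<le> v x"
    and v_C1: "v C1_differentiable_on {0<..}"
    and v'_AC: "\<And>a b. 0 < a \<Longrightarrow> abs_continuous_on {a..b} (deriv v)"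
    and HJB: "AE x in lborel. 0 < x \<longrightarrow> deriv v differentiable (at x) \<longrightarrow>
               min (- (- r * v x + \<alpha> * x * deriv v x + \<sigma>\<^sup>2 / 2 * x\<^sup>2 * deriv (deriv v) x) - Prof x) (v x) = 0"
    and transv: "\<And>x. 0 < x \<Longrightarrow>
       ((\<lambda>t. ennreal (exp (- r * t)) *
          (\<integral>\<^sup>+ \<omega>. ennreal (v (gbm \<alpha> \<sigma> W x t \<omega>)) *
               indicator {\<omega>. ennreal t < Inf {ennreal s | s. 0 < s \<and> v (gbm \<alpha> \<sigma> W x s \<omega>) = 0}} \<omega> \<partial>M))
        \<longlongrightarrow> 0) at_top"
begin

sublocale drifted_brownian M W "\<alpha> - \<sigma>\<^sup>2 / 2" \<sigma>
  by unfold_locales (rule BM sigma_nz)+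

lemma gbm_eq: "gbm \<alpha> \<sigma> W x s \<omega> = x * exp (Y s \<omega>)"
  by (simp add: gbm_def Y_def)

lemma disc_nn_eq_flow: "disc_nn M W r \<alpha> \<sigma> \<phi> x \<tau> = flow r \<tau> (\<lambda>y. \<phi> (x * exp y))"
  by (simp only: disc_nn_def flow_def gbm_eq)

lemma v_deriv: "0 < z \<Longrightarrow> (v has_real_derivative deriv v z) (at z)" "continuous_on {0<..} (deriv v)"
proof -
  obtain D where D: "\<And>z. 0 < z \<Longrightarrow> (v has_real_derivative D z) (at z)" "continuous_on {0<..} D"
    using v_C1 unfolding C1_differentiable_on_def has_real_derivative_iff_has_vector_derivative by auto
  have eq: "deriv v z = D z" if "0 < z" for z by (rule DERIV_imp_deriv[OF D(1)[OF that]])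
  show "0 < z \<Longrightarrow> (v has_real_derivative deriv v z) (at z)" using D(1) eq by simp
  show "continuous_on {0<..} (deriv v)" using D(2) by (rule continuous_on_cong[THEN iffD2, rotated -1]) (auto simp: eq)
qed

lemma ex_log_hjb:
  assumes x: "0 < x"
  obtains g where "log_hjb M W (\<alpha> - \<sigma>\<^sup>2 / 2) \<sigma> r (\<lambda>y. v (x * exp y)) (\<lambda>y. x * exp y * deriv v (x * exp y)) g (\<lambda>y. Prof (x * exp y))"
proof -
  define f where "f y = v (x * exp y)" for y
  define f' where "f' y = x * exp y * deriv v (x * exp y)" for y
  define P where "P y = Prof (x * exp y)" for y
  let ?\<mu> = "\<alpha> - \<sigma>\<^sup>2 / 2"
  have s2: "\<sigma>\<^sup>2 > 0" using sigma_nz by simp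
  have df: "(f has_real_derivative f' y) (at y)" for y
  proof -
    have "(f has_real_derivative deriv v (x * exp y) * (x * exp y)) (at y)"
      unfolding f_def[abs_def] by (rule DERIV_chain2[OF v_deriv(1)]) (use x in \<open>auto intro!: derivative_eq_intros\<close>)
    then show ?thesis by (simp add: f'_def mult_ac)
  qed
  have cf: "continuous_on UNIV f" using DERIV_continuous_on[of UNIV f f'] df by simp
  have "continuous_on UNIV (\<lambda>y. deriv v (x * exp y))"
    by (rule continuous_on_compose2[OF v_deriv(2)]) (use x in \<open>auto intro!: continuous_intros\<close>)
  then have cf': "continuous_on UNIV f'" unfolding f'_def[abs_def] by (intro continuous_intros)
  have Pm: "P \<in> borel_measurable borel" unfolding P_def[abs_def] by (rule measurable_exp_scale[OF x A3_meas])
  have Pi: "set_integrable lborel {a..b} P" for a b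
    unfolding P_def[abs_def] by (rule set_integrable_exp_scale[OF x A3_meas A3_locint])
  \<comment> \<open>Stated for every possible derivative \<open>d\<close>, because the existence of
    one comes only later from \<open>has_density_abs_continuous\<close>, which in turn takes its
    bound \<open>G\<close> from this relation. The drift changes from \<open>\<alpha>\<close> to
    \<open>?\<mu>\<close> because \<open>?z\<^sup>2 * deriv (deriv v) ?z = d - f' y\<close>.\<close>
  have local: "AE y in lborel. \<forall>d. (f' has_real_derivative d) (at y) \<longrightarrow>
      min (- (\<sigma>\<^sup>2 / 2 * d + ?\<mu> * f' y - r * f y) - P y) (f y) = 0"
    using AE_exp_scale[OF x HJB]
  proof eventually_elim
    case (elim y)
    let ?z = "x * exp y"
    have z: "0 < ?z" using x by simp
    show ?case
    proof (intro allI impI)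
      fix d assume d: "(f' has_real_derivative d) (at y)"
      have dd: "(deriv v has_real_derivative (d - f' y) / ?z\<^sup>2) (at ?z)"
        unfolding f'_def by (rule derivative_of_exp_scale[OF x]) (use d in \<open>simp only: f'_def[abs_def]\<close>)
      then have "deriv v differentiable (at ?z)" by (auto simp: real_differentiable_def)
      from elim[rule_format, OF this]
      have "min (- (- r * f y + \<alpha> * f' y + \<sigma>\<^sup>2 / 2 * (?z\<^sup>2 * deriv (deriv v) ?z)) - P y) (f y) = 0"
        by (simp add: f_def f'_def P_def mult.assoc)
      also have "?z\<^sup>2 * deriv (deriv v) ?z = d - f' y" using x by (simp add: DERIV_imp_deriv[OF dd])
      also have "- (- r * f y + \<alpha> * f' y + \<sigma>\<^sup>2 / 2 * (d - f' y)) - P y = - (\<sigma>\<^sup>2 / 2 * d + ?\<mu> * f' y - r * f y) - P y"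
        by (simp add: field_simps)
      finally show "min (- (\<sigma>\<^sup>2 / 2 * d + ?\<mu> * f' y - r * f y) - P y) (f y) = 0" .
    qed
  qed
  \<comment> \<open>The inequality \<open>- Lf - P \<ge> 0\<close> solved for the second
    derivative.\<close>
  define G where "G y = 2 / \<sigma>\<^sup>2 * ((r * f y - ?\<mu> * f' y) - P y)" for y
  have Gi: "set_integrable lborel {a..b} G" for a b
    unfolding G_def[abs_def]
    by (intro set_integrable_mult_right set_integral_diff(1)[OF _ Pi] borel_integrable_atLeastAtMost'
        continuous_intros continuous_on_subset[OF cf] continuous_on_subset[OF cf']) auto
  have le: "AE y in lborel. f' differentiable (at y) \<longrightarrow> deriv f' y \<le> G y"
    using local
  proof eventually_elim
    case (elim y)
    show ?case
    proof
      assume "f' differentiable (at y)"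
      then obtain d where d: "(f' has_real_derivative d) (at y)" by (auto simp: real_differentiable_def)
      then have "\<sigma>\<^sup>2 / 2 * d + ?\<mu> * f' y - r * f y \<le> - P y" using elim by (fastforce simp: min_def split: if_splits)
      then have "\<sigma>\<^sup>2 / 2 * d \<le> (r * f y - ?\<mu> * f' y) - P y" by linarith
      then have "d \<le> G y" unfolding G_def using s2 by (simp add: field_simps)
      then show "deriv f' y \<le> G y" using DERIV_imp_deriv[OF d] by simp
    qed
  qed
  have ac: "abs_continuous_on {a..b} f'" for a b
    unfolding f'_def[abs_def] by (rule abs_continuous_on_exp_scale[OF x v'_AC])
  obtain g where g: "has_density f' g" "AE y in lborel. (f' has_real_derivative g y) (at y)"
    using has_density_abs_continuous[OF ac Gi le] by blast
  have "AE y in lborel. min (- (\<sigma>\<^sup>2 / 2 * g y + ?\<mu> * f' y - r * f y) - P y) (f y) = 0"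
    using local g(2) by eventually_elim blast
  moreover have "0 \<le> f y" for y using v_nonneg x by (simp add: f_def)
  ultimately have "log_hjb M W ?\<mu> \<sigma> r f f' g P"
    using df g Pm Pi by unfold_locales auto
  then show ?thesis by (intro that[of g]) (simp add: f_def[abs_def] f'_def[abs_def] P_def[abs_def])
qed

abbreviation exit_time :: "real \<Rightarrow> 'a \<Rightarrow> ennreal" where
  "exit_time x \<omega> \<equiv> Inf {ennreal s | s. 0 < s \<and> v (gbm \<alpha> \<sigma> W x s \<omega>) = 0}"

text \<open>The exit time only looks at \<open>s > 0\<close>; started on the stopping boundary, \<open>Y\<close> returns to \<open>0\<close> immediately.\<close>

lemma exit_time_zero:
  assumes "v x = 0" shows "AE \<omega> in M. exit_time x \<omega> = 0"
  using return_immediately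
proof eventually_elim
  case (elim \<omega>)
  have le: "exit_time x \<omega> \<le> 0 + ennreal e" if e: "0 < e" for e
  proof -
    obtain n :: nat where n: "1 / Suc n < e" using nat_approx_posE[OF e] by blast
    obtain s where s: "0 < s" "s < 1 / Suc n" "Y s \<omega> = 0" using elim by blast
    have "exit_time x \<omega> \<le> ennreal s" by (rule Inf_lower) (use s assms in \<open>auto simp: gbm_eq\<close>)
    also have "\<dots> \<le> ennreal e" using s n by (intro ennreal_leI) simp
    finally show ?thesis by simp
  qed
  have "exit_time x \<omega> \<le> 0" by (rule ennreal_le_epsilon) (rule le)
  then show ?case by simp
qed

text \<open>Completeness makes the exceptional sets measurable, and the filtration contains all null
  sets, so every event \<open>\<tau> \<le> t\<close> with \<open>t \<ge> 0\<close> is the complement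
  of a null set in \<open>F t\<close>.\<close>

lemma stopping_time_if_AE_zero:
  assumes "AE \<omega> in M. \<tau> \<omega> = 0" shows "is_stopping_time M W \<tau>"
  unfolding is_stopping_time_def
proof (intro allI impI)
  fix t :: real assume t: "0 \<le> t"
  obtain N where N: "{\<omega>\<in>space M. \<tau> \<omega> \<noteq> 0} \<subseteq> N" "N \<in> null_sets M"
    using assms by (auto simp: eventually_ae_filter)
  let ?A = "{\<omega>\<in>space M. \<not> \<tau> \<omega> \<le> ennreal t}"
  have sub: "?A \<subseteq> N" using N(1) by auto
  then have "?A \<in> sets M" using complete N(2) unfolding complete_space_measure_def by blast
  then have "?A \<in> null_sets M" by (rule null_sets_subset[OF N(2) _ sub])
  then have "space (F t) - ?A \<in> sets (F t)" by (intro sets.compl_sets null_sets_filtration)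
  moreover have "space (F t) - ?A = {\<omega>\<in>space M. \<tau> \<omega> \<le> ennreal t}" by auto
  ultimately show "{\<omega>\<in>space M. \<tau> \<omega> \<le> ennreal t} \<in> sets (F t)" by simp
qed

lemma profit_finite:
  assumes "0 < x" shows "flow r \<tau> (\<lambda>y. max (Prof (x * exp y)) 0) < \<infinity>"
  by (rule order_le_less_trans[OF flow_mono]) (use A2[OF assms] in \<open>simp only: disc_nn_eq_flow\<close>)

lemma payoff_le:
  assumes x: "0 < x" and tau: "is_stopping_time M W \<tau>"
  shows "payoff M W r \<alpha> \<sigma> Prof x \<tau> \<le> ereal (v x)"
proof -
  obtain g where "log_hjb M W (\<alpha> - \<sigma>\<^sup>2 / 2) \<sigma> r (\<lambda>y. v (x * exp y)) (\<lambda>y. x * exp y * deriv v (x * exp y)) g (\<lambda>y. Prof (x * exp y))"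
    by (rule ex_log_hjb[OF x])
  from log_hjb.upper_bound[OF this tau] show ?thesis
    unfolding payoff_def disc_nn_eq_flow by (intro enn2ereal_diff_le profit_finite x v_nonneg) simp
qed

text \<open>If \<open>v x = 0\<close>, the exit time is almost surely \<open>0\<close> and the
  payoff vanishes. Otherwise the path starts outside \<open>Z\<close>, so the infimum over
  \<open>s > 0\<close> coincides with \<open>hit Z\<close> and \<open>attained_value\<close>
  applies.\<close>

lemma exit_time_optimal:
  assumes x: "0 < x"
  shows "is_stopping_time M W (exit_time x) \<and> payoff M W r \<alpha> \<sigma> Prof x (exit_time x) = ereal (v x)"
proof (cases "v x = 0")
  case True
  note z = exit_time_zero[OF True]
  have "flow r (exit_time x) \<phi> = 0" for \<phi>
  proof -
    have "flow r (exit_time x) \<phi> = flow r (\<lambda>_. 0) \<phi>" by (rule flow_cong_AE[OF z])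
    also have "\<dots> = 0" by (simp add: flow_def)
    finally show ?thesis .
  qed
  then show ?thesis using stopping_time_if_AE_zero[OF z] True by (simp add: payoff_def disc_nn_eq_flow)
next
  case False
  then have v0: "0 < v x" using v_nonneg[OF x] by simp
  obtain g where lh: "log_hjb M W (\<alpha> - \<sigma>\<^sup>2 / 2) \<sigma> r (\<lambda>y. v (x * exp y)) (\<lambda>y. x * exp y * deriv v (x * exp y)) g (\<lambda>y. Prof (x * exp y))"
    by (rule ex_log_hjb[OF x])
  then interpret L: log_hjb M W "\<alpha> - \<sigma>\<^sup>2 / 2" \<sigma> r "\<lambda>y. v (x * exp y)" "\<lambda>y. x * exp y * deriv v (x * exp y)" g "\<lambda>y. Prof (x * exp y)" .
  have eq: "exit_time x \<omega> = hit L.Z \<omega>" if om: "\<omega> \<in> space M" for \<omega>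
  proof -
    have "0 < s \<and> v (gbm \<alpha> \<sigma> W x s \<omega>) = 0 \<longleftrightarrow> 0 \<le> s \<and> Y s \<omega> \<in> L.Z" for s
      using v0 Y_0[OF om] by (cases "s = 0") (auto simp: gbm_eq L.Z_def)
    then show ?thesis by (simp add: hit_def)
  qed
  have sv: "L.survival = (\<lambda>t. ennreal (exp (- r * t)) *
      (\<integral>\<^sup>+ \<omega>. ennreal (v (gbm \<alpha> \<sigma> W x t \<omega>)) * indicator {\<omega>. ennreal t < exit_time x \<omega>} \<omega> \<partial>M))"
  proof
    fix t
    show "L.survival t = ennreal (exp (- r * t)) *
        (\<integral>\<^sup>+ \<omega>. ennreal (v (gbm \<alpha> \<sigma> W x t \<omega>)) * indicator {\<omega>. ennreal t < exit_time x \<omega>} \<omega> \<partial>M)"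
      unfolding L.survival_def
    proof (intro arg_cong2[where f="(*)"] refl nn_integral_cong)
      fix \<omega> assume om: "\<omega> \<in> space M"
      show "indicator {\<omega>. ennreal t < hit L.Z \<omega>} \<omega> = (indicator {\<omega>. ennreal t < exit_time x \<omega>} \<omega> :: ennreal)"
        unfolding indicator_def mem_Collect_eq eq[OF om] by (rule refl)
    qed (simp add: gbm_eq)
  qed
  have tr: "(L.survival \<longlongrightarrow> 0) at_top" unfolding sv by (rule transv[OF x])
  have "is_stopping_time M W (exit_time x) \<longleftrightarrow> is_stopping_time M W (hit L.Z)"
    unfolding is_stopping_time_def by (simp add: eq cong: conj_cong)
  then have st: "is_stopping_time M W (exit_time x)" using hit_stopping_time[OF L.closed_Z] by simp
  have "AE \<omega> in M. exit_time x \<omega> = hit L.Z \<omega>" by (rule AE_I2) (rule eq)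
  note fl = flow_cong_AE[OF this]
  have "flow r (hit L.Z) (\<lambda>y. max (Prof (x * exp y)) 0) = ennreal (v x) + flow r (hit L.Z) (\<lambda>y. max (- Prof (x * exp y)) 0)"
    using L.attained_value[OF profit_finite[OF x] tr] v0 by simp
  then have "payoff M W r \<alpha> \<sigma> Prof x (exit_time x) = ereal (v x)"
    unfolding payoff_def disc_nn_eq_flow fl by (rule enn2ereal_diff_eq[OF _ profit_finite[OF x] v_nonneg[OF x]])
  then show ?thesis using st by blast
qed

lemma value_fun_eq:
  assumes x: "0 < x" shows "value_fun M W r \<alpha> \<sigma> Prof x = ereal (v x)"
  unfolding value_fun_def
proof (rule antisym)
  show "(SUP \<tau>\<in>{\<tau>. is_stopping_time M W \<tau>}. payoff M W r \<alpha> \<sigma> Prof x \<tau>) \<le> ereal (v x)"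
    by (rule SUP_least) (simp add: payoff_le[OF x])
  show "ereal (v x) \<le> (SUP \<tau>\<in>{\<tau>. is_stopping_time M W \<tau>}. payoff M W r \<alpha> \<sigma> Prof x \<tau>)"
    using exit_time_optimal[OF x] by (intro SUP_upper2[of "exit_time x"]) auto
qed

end

theorem theorem1:
  fixes M :: "'a measure" and W :: "real \<Rightarrow> 'a \<Rightarrow> real"
    and r \<alpha> \<sigma> :: real and Prof v :: "real \<Rightarrow> real"
  assumes BM: "std_brownian_motion M W"
    and complete: "complete_space_measure M"
    and sigma_nz: "\<sigma> \<noteq> 0"
    and A3_meas: "Prof \<in> borel_measurable (restrict_space borel {0<..})"
    and A3_locint: "\<And>a b. 0 < a \<Longrightarrow> set_integrable lborel {a..b} Prof"
    and A2: "\<And>x. 0 < x \<Longrightarrow> disc_nn M W r \<alpha> \<sigma> (\<lambda>y. max (Prof y) 0) x (\<lambda>_. \<infinity>) < \<infinity>"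
    and v_nonneg: "\<And>x. 0 < x \<Longrightarrow> 0 \<le> v x"
    and v_C1: "v C1_differentiable_on {0<..}"
    and v'_AC: "\<And>a b. 0 < a \<Longrightarrow> abs_continuous_on {a..b} (deriv v)"
    and HJB: "AE x in lborel. 0 < x \<longrightarrow> deriv v differentiable (at x) \<longrightarrow>
               min (- (- r * v x + \<alpha> * x * deriv v x + \<sigma>\<^sup>2 / 2 * x\<^sup>2 * deriv (deriv v) x) - Prof x) (v x) = 0"
    and transv: "\<And>x. 0 < x \<Longrightarrow>
       ((\<lambda>t. ennreal (exp (- r * t)) *
          (\<integral>\<^sup>+ \<omega>. ennreal (v (gbm \<alpha> \<sigma> W x t \<omega>)) *
               indicator {\<omega>. ennreal t < Inf {ennreal s | s. 0 < s \<and> v (gbm \<alpha> \<sigma> W x s \<omega>) = 0}} \<omega> \<partial>M))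
        \<longlongrightarrow> 0) at_top"
  shows "(\<forall>x>0. value_fun M W r \<alpha> \<sigma> Prof x = ereal (v x))
       \<and> (\<forall>x>0. is_stopping_time M W (\<lambda>\<omega>. Inf {ennreal s | s. 0 < s \<and> v (gbm \<alpha> \<sigma> W x s \<omega>) = 0})
               \<and> payoff M W r \<alpha> \<sigma> Prof x (\<lambda>\<omega>. Inf {ennreal s | s. 0 < s \<and> v (gbm \<alpha> \<sigma> W x s \<omega>) = 0})
                   = value_fun M W r \<alpha> \<sigma> Prof x)
       \<and> (\<forall>x>0. \<forall>\<omega>. Inf {ennreal s | s. 0 < s \<and> v (gbm \<alpha> \<sigma> W x s \<omega>) = 0}
                   = Inf {ennreal s | s. 0 < s \<and> value_fun M W r \<alpha> \<sigma> Prof (gbm \<alpha> \<sigma> W x s \<omega>) = 0})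
       \<and> {x. 0 < x \<and> value_fun M W r \<alpha> \<sigma> Prof x = 0} = {x. 0 < x \<and> v x = 0}
       \<and> {x. 0 < x \<and> value_fun M W r \<alpha> \<sigma> Prof x > 0} = {x. 0 < x \<and> v x > 0}
       \<and> {x. 0 < x \<and> value_fun M W r \<alpha> \<sigma> Prof x = 0} \<union> {x. 0 < x \<and> value_fun M W r \<alpha> \<sigma> Prof x > 0} = {0<..}"
proof -
  interpret hjb_solution M W r \<alpha> \<sigma> Prof v
    by (rule hjb_solution.intro[OF BM complete sigma_nz A3_meas A3_locint A2 v_nonneg v_C1 v'_AC HJB transv])
  \<comment> \<open>\<open>gbm\<close> stays positive, so \<open>value_fun\<close> may be replaced
    by \<open>v\<close> along the whole path; this gives the description of the exit time through
    the value function.\<close>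
  have pos: "0 < gbm \<alpha> \<sigma> W x s \<omega>" if "0 < x" for x s \<omega> using that by (simp add: gbm_eq)
  show ?thesis
  proof (intro conjI allI impI)
    fix x :: real assume x: "x > 0"
    show "value_fun M W r \<alpha> \<sigma> Prof x = ereal (v x)" by (rule value_fun_eq[OF x])
    show "is_stopping_time M W (exit_time x)" using exit_time_optimal[OF x] by blast
    show "payoff M W r \<alpha> \<sigma> Prof x (exit_time x) = value_fun M W r \<alpha> \<sigma> Prof x"
      using exit_time_optimal[OF x] value_fun_eq[OF x] by simp
    show "exit_time x \<omega> = Inf {ennreal s | s. 0 < s \<and> value_fun M W r \<alpha> \<sigma> Prof (gbm \<alpha> \<sigma> W x s \<omega>) = 0}" for \<omega>
      by (simp add: value_fun_eq[OF pos[OF x]])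
  next
    show "{x. 0 < x \<and> value_fun M W r \<alpha> \<sigma> Prof x = 0} = {x. 0 < x \<and> v x = 0}"
      "{x. 0 < x \<and> value_fun M W r \<alpha> \<sigma> Prof x > 0} = {x. 0 < x \<and> v x > 0}"
      by (auto simp: value_fun_eq)
    show "{x. 0 < x \<and> value_fun M W r \<alpha> \<sigma> Prof x = 0} \<union> {x. 0 < x \<and> value_fun M W r \<alpha> \<sigma> Prof x > 0} = {0<..}"
      using v_nonneg by (auto simp: value_fun_eq) (metis less_eq_real_def)
  qed
qed

end
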